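(* (Mixed reciprocity relation.) For the scattering of plane waves $E^i(\cdot,d,q)$ and of electric dipoles $E^i(\cdot;z,p)$ from the obstacle $\Omega_2$ (in the two-layered medium described in the context) one has $$4\pi\, q\cdot E^\infty(-d;z_0,p)=p\cdot E^s(z_0,d,q),\qquad z_0\in\Omega_0,$$ $$4\pi\, q\cdot E^\infty(-d;z_1,p)=\lambda_E\lambda_H\, p\cdot F(z_1,d,q),\qquad z_1\in\Omega_1,$$ for all incident directions $d\in S^2$ and all polarizations $p,q\in\mathbb{R}^3$.
   Context: Geometry. $0<\alpha<1$ is fixed. $\Omega_2\subset\mathbb{R}^3$ is an open bounded region (the impenetrable obstacle) with $C^2$ boundary $S_1$. The set $\mathbb{R}^3\setminus\overline{\Omega_2}$ is divided by a closed $C^{2,\alpha}$ surface $S_0$ into two connected domains: the unbounded domain $\Omega_0$ (with boundary $S_0$) and the bounded domain $\Omega_1$ (with boundary $S_0\cup S_1$). $S_1=\overline{\Gamma}_1\cup\overline{\Gamma}_2$ with $\Gamma_1,\Gamma_2$ disjoint relatively open subsets of $S_1$ (either may be empty). $\nu$ is the unit normal, directed into the exterior of each closed surface $S_0$, $S_1$. $S^2$ is the unit sphere; $a\cdot b$ is the bilinear scalar product on $\mathbb{C}^3$. Parameters. $\omega>0$; $\epsilon_0,\mu_0,\epsilon_1,\mu_1>0$; $\sigma_0=0$, $\sigma_1\ge 0$; $k_j^2=(\epsilon_j+i\sigma_j/\omega)\mu_j\omega^2$ with $\Re k_j>0$, $\Im k_j\ge0$ ($j=0,1$); $\lambda_E=\sqrt{\epsilon_0/(\epsilon_1+i\sigma_1/\omega)}$,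 $\lambda_H=\sqrt{\mu_0/\mu_1}$ (square roots with positive real part, so $\lambda_E\lambda_H=k_0/k_1$); $\lambda>0$ is a constant. Problem (BVP). Given tangential data $T_1,T_2$ on $S_0$, $T_3$ on $\Gamma_1$, $T_4$ on $\Gamma_2$, find $E,H\in C^1(\Omega_0)\cap C(\overline{\Omega_0})$ and $F,G\in C^1(\Omega_1)\cap C(\overline{\Omega_1})$ with $$\mathrm{curl}\,E-ik_0H=0,\quad \mathrm{curl}\,H+ik_0E=0\ \text{ in }\Omega_0,\qquad \mathrm{curl}\,F-ik_1G=0,\quad \mathrm{curl}\,G+ik_1F=0\ \text{ in }\Omega_1,$$ $$\lim_{|x|\to\infty}(H\times x-|x|E)=0\ \text{ uniformly in all directions } x/|x|,$$ $$\nu\times E-\lambda_E\,\nu\times F=T_1,\quad \nu\times H-\lambda_H\,\nu\times G=T_2\ \text{ on }S_0,$$ $$\nu\times F=T_3\ \text{ on }\Gamma_1,\qquad \nu\times G-\frac{\lambda}{k_1}(\nu\times F)\times\nu=T_4\ \text{ on }\Gamma_2.$$ This problem is taken to be uniquely solvable for the data below. The electric far field pattern $E^\infty$ of a solution is defined on $S^2$ by $E(x)=\frac{e^{ik_0|x|}}{|x|}\{E^\infty(\hat x)+O(1/|x|)\}$ as $|x|\to\infty$, uniformly in $\hat x=x/|x|$. Plane waves. $E^i(x,d,q)=\frac{i}{k_0}\mathrm{curl}\,\mathrm{curl}\,(q e^{ik_0x\cdot d})=ik_0(d\times q)\times d\,e^{ik_0x\cdot d}$, $H^i(x,d,q)=\mathrm{curl}\,(q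 e^{ik_0x\cdot d})=ik_0\,d\times q\,e^{ik_0x\cdot d}$. The scattered fields $E^s(\cdot,d,q),H^s(\cdot,d,q)$ in $\Omega_0$ and the fields $F(\cdot,d,q),G(\cdot,d,q)$ in $\Omega_1$ are the solution $(E,H,F,G)$ of (BVP) with $T_1=-\nu\times E^i(\cdot,d,q)$, $T_2=-\nu\times H^i(\cdot,d,q)$, $T_3=0$, $T_4=0$. Electric dipoles. $\Phi_j(x,y)=\frac{e^{ik_j|x-y|}}{4\pi|x-y|}$. For $z_j\in\Omega_j$ ($j=0,1$) and $p\in\mathbb{R}^3$, $E^i(x;z_j,p)=\frac{i}{k_j}\mathrm{curl}\,\mathrm{curl}\,(p\,\Phi_j(x,z_j))$, $H^i(x;z_j,p)=\mathrm{curl}\,(p\,\Phi_j(x,z_j))$, $x\ne z_j$. If $z_0\in\Omega_0$, then $E^\infty(\cdot;z_0,p)$ is the electric far field pattern of the solution of (BVP) with $T_1=-\nu\times E^i(\cdot;z_0,p)$, $T_2=-\nu\times H^i(\cdot;z_0,p)$, $T_3=0$, $T_4=0$. If $z_1\in\Omega_1$, then $E^\infty(\cdot;z_1,p)$ is the electric far field pattern of the solution of (BVP) with $T_1=\lambda_E\,\nu\times E^i(\cdot;z_1,p)$, $T_2=\lambda_H\,\nu\times H^i(\cdot;z_1,p)$, $T_3=-\nu\times E^i(\cdot;z_1,p)$, $T_4=-\nu\times H^i(\cdot;z_1,p)+\frac{\lambda}{k_1}(\nu\times E^i(\cdot;z_1,p))\times\nu$. *)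

theory Defs
  imports "HOL-Analysis.Analysis" "HOL-Library.Landau_Symbols"
begin

section \<open>Complex vector algebra and differential operators\<close>

type_synonym vfield = "real^3 \<Rightarrow> complex^3"

text \<open>The library's inner product on \<^typ>\<open>complex^3\<close> is the real Euclidean one, and its cross product
  lives on \<^typ>\<open>real^3\<close> only; here both operations are the complex bilinear ones.\<close>

definition bilinear_dot :: "complex^3 \<Rightarrow> complex^3 \<Rightarrow> complex" (infixl "\<bullet>\<^sub>c" 70) where
  "a \<bullet>\<^sub>c b = (\<Sum>i\<in>UNIV. a$i * b$i)"

definition cross :: "complex^3 \<Rightarrow> complex^3 \<Rightarrow> complex^3" (infixr "\<times>\<^sub>c" 74) where
  "a \<times>\<^sub>c b = vector [a$2 * b$3 - a$3 * b$2, a$3 * b$1 - a$1 * b$3, a$1 * b$2 - a$2 * b$1]"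

definition cvec :: "real^3 \<Rightarrow> complex^3" where
  "cvec v = (\<chi> i. complex_of_real (v$i))"

definition partial :: "3 \<Rightarrow> (real^3 \<Rightarrow> 'b::real_normed_vector) \<Rightarrow> real^3 \<Rightarrow> 'b" where
  "partial j f x = frechet_derivative f (at x) (axis j 1)"

definition curl :: "vfield \<Rightarrow> vfield" where
  "curl E x = vector [partial 2 E x $ 3 - partial 3 E x $ 2,
                      partial 3 E x $ 1 - partial 1 E x $ 3,
                      partial 1 E x $ 2 - partial 2 E x $ 1]"

definition grad :: "(real^3 \<Rightarrow> real) \<Rightarrow> real^3 \<Rightarrow> real^3" where
  "grad \<rho> x = (\<chi> j. partial j \<rho> x)"


section \<open>Smoothness classes, surfaces and normals\<close>

text \<open>Both classes are meant for open \<open>U\<close>.\<close>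

primrec C_k_on :: "nat \<Rightarrow> (real^3) set \<Rightarrow> (real^3 \<Rightarrow> 'b::real_normed_vector) \<Rightarrow> bool" where
  "C_k_on 0 U f \<longleftrightarrow> continuous_on U f"
| "C_k_on (Suc k) U f \<longleftrightarrow> f differentiable_on U \<and> (\<forall>j. C_k_on k U (partial j f))"

text \<open>\<open>C\<^bsup>k,\<alpha>\<^esup>\<close>: all partial derivatives of order \<open>k\<close> are Hoelder continuous on \<open>U\<close> with exponent \<open>\<alpha>\<close>.\<close>

primrec C_k_holder_on ::
  "nat \<Rightarrow> real \<Rightarrow> (real^3) set \<Rightarrow> (real^3 \<Rightarrow> 'b::real_normed_vector) \<Rightarrow> bool" where
  "C_k_holder_on 0 \<alpha> U f \<longleftrightarrow> (\<exists>C. \<forall>x\<in>U. \<forall>y\<in>U. norm (f x - f y) \<le> C * dist x y powr \<alpha>)"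
| "C_k_holder_on (Suc k) \<alpha> U f \<longleftrightarrow>
     f differentiable_on U \<and> (\<forall>j. C_k_holder_on k \<alpha> U (partial j f))"

definition closed_C2_holder_surface :: "real \<Rightarrow> (real^3) set \<Rightarrow> bool" where
  "closed_C2_holder_surface \<alpha> S \<longleftrightarrow>
     compact S \<and>
     (\<forall>x\<in>S. \<exists>U \<rho>. open U \<and> x \<in> U \<and> C_k_holder_on 2 \<alpha> U \<rho> \<and>
        (\<forall>y\<in>U. grad \<rho> y \<noteq> 0) \<and> S \<inter> U = {y\<in>U. \<rho> y = (0::real)})"

text \<open>\<open>\<rho>\<close> describes the set \<open>D\<close> near \<open>x\<close> as \<open>\<rho> < 0\<close>; so \<open>D\<close> lies locally on one side of its frontier,
  and the gradient of \<open>\<rho>\<close> points out of \<open>D\<close>.\<close>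

definition local_defining_function ::
  "(real^3) set \<Rightarrow> real^3 \<Rightarrow> (real^3) set \<Rightarrow> (real^3 \<Rightarrow> real) \<Rightarrow> bool" where
  "local_defining_function D x U \<rho> \<longleftrightarrow>
     open U \<and> x \<in> U \<and> (\<forall>y\<in>U. grad \<rho> y \<noteq> 0) \<and>
     D \<inter> U = {y\<in>U. \<rho> y < 0} \<and> frontier D \<inter> U = {y\<in>U. \<rho> y = 0}"

definition has_C2_boundary :: "(real^3) set \<Rightarrow> bool" where
  "has_C2_boundary D \<longleftrightarrow>
     (\<forall>x\<in>frontier D. \<exists>U \<rho>. C_k_on 2 U \<rho> \<and> local_defining_function D x U \<rho>)"

definition outward_unit_normal :: "(real^3) set \<Rightarrow> real^3 \<Rightarrow> real^3 \<Rightarrow> bool" where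
  "outward_unit_normal D x n \<longleftrightarrow>
     (\<exists>U \<rho>. C_k_on 1 U \<rho> \<and> local_defining_function D x U \<rho> \<and>
        n = (1 / norm (grad \<rho> x)) *\<^sub>R grad \<rho> x)"


section \<open>The two-layered medium\<close>

record layered_medium =
  \<Omega>\<^sub>0 :: "(real^3) set"
  \<Omega>\<^sub>1 :: "(real^3) set"
  \<Omega>\<^sub>2 :: "(real^3) set"
  S\<^sub>0 :: "(real^3) set"
  S\<^sub>1 :: "(real^3) set"
  \<Gamma>\<^sub>1 :: "(real^3) set"
  \<Gamma>\<^sub>2 :: "(real^3) set"
  \<nu> :: "real^3 \<Rightarrow> real^3"
  \<omega> :: real
  \<epsilon>\<^sub>0 :: real
  \<mu>\<^sub>0 :: real
  \<epsilon>\<^sub>1 :: real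
  \<mu>\<^sub>1 :: real
  \<sigma>\<^sub>1 :: real
  impedance :: real   \<comment> \<open>the constant \<open>\<lambda>\<close> of the boundary condition on \<open>\<Gamma>\<^sub>2\<close>\<close>

text \<open>The exterior of the closed surface \<open>S\<^sub>0\<close> is \<open>\<Omega>\<^sub>0\<close>, so that \<open>\<nu>\<close> on \<open>S\<^sub>0\<close> is the outward normal
  of the enclosed region \<open>- closure \<Omega>\<^sub>0\<close>; on \<open>S\<^sub>1\<close> it points out of the obstacle \<open>\<Omega>\<^sub>2\<close> into \<open>\<Omega>\<^sub>1\<close>.\<close>

definition admissible_medium :: "real \<Rightarrow> layered_medium \<Rightarrow> bool" where
  "admissible_medium \<alpha> M \<longleftrightarrow>
     open (\<Omega>\<^sub>2 M) \<and> bounded (\<Omega>\<^sub>2 M) \<and> \<Omega>\<^sub>2 M \<noteq> {} \<and>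
     has_C2_boundary (\<Omega>\<^sub>2 M) \<and> frontier (\<Omega>\<^sub>2 M) = S\<^sub>1 M \<and>
     closed_C2_holder_surface \<alpha> (S\<^sub>0 M) \<and>
     open (\<Omega>\<^sub>0 M) \<and> connected (\<Omega>\<^sub>0 M) \<and> \<not> bounded (\<Omega>\<^sub>0 M) \<and> frontier (\<Omega>\<^sub>0 M) = S\<^sub>0 M \<and>
     open (\<Omega>\<^sub>1 M) \<and> connected (\<Omega>\<^sub>1 M) \<and> bounded (\<Omega>\<^sub>1 M) \<and> \<Omega>\<^sub>1 M \<noteq> {} \<and>
     frontier (\<Omega>\<^sub>1 M) = S\<^sub>0 M \<union> S\<^sub>1 M \<and>
     \<Omega>\<^sub>0 M \<inter> \<Omega>\<^sub>1 M = {} \<and> \<Omega>\<^sub>0 M \<union> S\<^sub>0 M \<union> \<Omega>\<^sub>1 M = UNIV - closure (\<Omega>\<^sub>2 M) \<and>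
     openin (top_of_set (S\<^sub>1 M)) (\<Gamma>\<^sub>1 M) \<and> openin (top_of_set (S\<^sub>1 M)) (\<Gamma>\<^sub>2 M) \<and>
     \<Gamma>\<^sub>1 M \<inter> \<Gamma>\<^sub>2 M = {} \<and> S\<^sub>1 M = closure (\<Gamma>\<^sub>1 M) \<union> closure (\<Gamma>\<^sub>2 M) \<and>
     (\<forall>x\<in>S\<^sub>0 M. outward_unit_normal (- closure (\<Omega>\<^sub>0 M)) x (\<nu> M x)) \<and>
     (\<forall>x\<in>S\<^sub>1 M. outward_unit_normal (\<Omega>\<^sub>2 M) x (\<nu> M x)) \<and>
     \<omega> M > 0 \<and> \<epsilon>\<^sub>0 M > 0 \<and> \<mu>\<^sub>0 M > 0 \<and> \<epsilon>\<^sub>1 M > 0 \<and> \<mu>\<^sub>1 M > 0 \<and> \<sigma>\<^sub>1 M \<ge> 0 \<and> impedance M > 0"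

text \<open>Wave numbers and transmission constants. The principal root \<^const>\<open>csqrt\<close> is the root
  with positive real part here, see the lemmas below.\<close>

definition wavenumber :: "real \<Rightarrow> real \<Rightarrow> real \<Rightarrow> real \<Rightarrow> complex" where
  "wavenumber w \<epsilon> \<mu> \<sigma> =
     csqrt ((of_real \<epsilon> + \<i> * of_real \<sigma> / of_real w) * of_real \<mu> * (of_real w)\<^sup>2)"

definition k\<^sub>0 :: "layered_medium \<Rightarrow> complex" where
  "k\<^sub>0 M = wavenumber (\<omega> M) (\<epsilon>\<^sub>0 M) (\<mu>\<^sub>0 M) 0"

definition k\<^sub>1 :: "layered_medium \<Rightarrow> complex" where
  "k\<^sub>1 M = wavenumber (\<omega> M) (\<epsilon>\<^sub>1 M) (\<mu>\<^sub>1 M) (\<sigma>\<^sub>1 M)"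

definition lambda_E :: "layered_medium \<Rightarrow> complex" where
  "lambda_E M = csqrt (of_real (\<epsilon>\<^sub>0 M) /
     (of_real (\<epsilon>\<^sub>1 M) + \<i> * of_real (\<sigma>\<^sub>1 M) / of_real (\<omega> M)))"

definition lambda_H :: "layered_medium \<Rightarrow> complex" where
  "lambda_H M = of_real (sqrt (\<mu>\<^sub>0 M / \<mu>\<^sub>1 M))"

lemma Re_csqrt_pos: "Re z > 0 \<Longrightarrow> Re (csqrt z) > 0"
  by (auto intro: add_nonneg_pos)

lemma wavenumber_characterization:
  assumes "w > 0" "\<epsilon> > 0" "\<mu> > 0" "\<sigma> \<ge> 0"
  shows "(wavenumber w \<epsilon> \<mu> \<sigma>)\<^sup>2 = (of_real \<epsilon> + \<i> * of_real \<sigma> / of_real w) * of_real \<mu> * (of_real w)\<^sup>2"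
    and "Re (wavenumber w \<epsilon> \<mu> \<sigma>) > 0" and "Im (wavenumber w \<epsilon> \<mu> \<sigma>) \<ge> 0"
proof -
  define z where "z = (of_real \<epsilon> + \<i> * of_real \<sigma> / of_real w) * of_real \<mu> * (of_real w)\<^sup>2"
  have z: "z = Complex (\<epsilon> * \<mu> * w\<^sup>2) (\<sigma> / w * \<mu> * w\<^sup>2)"
    by (simp add: z_def complex_eq_iff power2_eq_square)
  have "Re z > 0" "Im z \<ge> 0"
    using assms by (simp_all add: z)
  then show "Re (wavenumber w \<epsilon> \<mu> \<sigma>) > 0"
    using Re_csqrt_pos by (simp add: wavenumber_def z_def del: csqrt.simps)
  show "Im (wavenumber w \<epsilon> \<mu> \<sigma>) \<ge> 0"
    unfolding wavenumber_def z_def[symmetric] using \<open>Im z \<ge> 0\<close> complex_Re_le_cmod[of z]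
    by (auto simp: sgn_real_def)
  show "(wavenumber w \<epsilon> \<mu> \<sigma>)\<^sup>2 = (of_real \<epsilon> + \<i> * of_real \<sigma> / of_real w) * of_real \<mu> * (of_real w)\<^sup>2"
    by (simp add: wavenumber_def)
qed

lemma lambda_E_characterization:
  assumes "\<omega> M > 0" "\<epsilon>\<^sub>0 M > 0" "\<epsilon>\<^sub>1 M > 0"
  shows "(lambda_E M)\<^sup>2 = of_real (\<epsilon>\<^sub>0 M) / (of_real (\<epsilon>\<^sub>1 M) + \<i> * of_real (\<sigma>\<^sub>1 M) / of_real (\<omega> M))"
    and "Re (lambda_E M) > 0"
proof -
  show "(lambda_E M)\<^sup>2 = of_real (\<epsilon>\<^sub>0 M) / (of_real (\<epsilon>\<^sub>1 M) + \<i> * of_real (\<sigma>\<^sub>1 M) / of_real (\<omega> M))"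
    by (simp add: lambda_E_def)
  have "Re (of_real (\<epsilon>\<^sub>0 M) / (of_real (\<epsilon>\<^sub>1 M) + \<i> * of_real (\<sigma>\<^sub>1 M) / of_real (\<omega> M))) > 0"
    using assms by (simp add: Re_divide add_pos_nonneg)
  then show "Re (lambda_E M) > 0"
    unfolding lambda_E_def by (rule Re_csqrt_pos)
qed


section \<open>The boundary value problem\<close>

definition maxwell_in :: "complex \<Rightarrow> (real^3) set \<Rightarrow> vfield \<Rightarrow> vfield \<Rightarrow> bool" where
  "maxwell_in k U E H \<longleftrightarrow>
     C_k_on 1 U E \<and> C_k_on 1 U H \<and> continuous_on (closure U) E \<and> continuous_on (closure U) H \<and>
     (\<forall>x\<in>U. curl E x - (\<i> * k) *s H x = 0 \<and> curl H x + (\<i> * k) *s E x = 0)"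

text \<open>A limit along \<^const>\<open>at_infinity\<close> is uniform in the direction of \<open>x\<close>.\<close>

definition silver_mueller :: "vfield \<Rightarrow> vfield \<Rightarrow> bool" where
  "silver_mueller E H \<longleftrightarrow> ((\<lambda>x. H x \<times>\<^sub>c cvec x - norm x *\<^sub>R E x) \<longlongrightarrow> 0) at_infinity"

definition tangential_trace :: "layered_medium \<Rightarrow> vfield \<Rightarrow> vfield" where
  "tangential_trace M E x = cvec (\<nu> M x) \<times>\<^sub>c E x"

definition impedance_trace :: "layered_medium \<Rightarrow> vfield \<Rightarrow> vfield \<Rightarrow> vfield" where
  "impedance_trace M F G x =
     tangential_trace M G x - (of_real (impedance M) / k\<^sub>1 M) *s (tangential_trace M F x \<times>\<^sub>c cvec (\<nu> M x))"

text \<open>The boundary data \<open>(T\<^sub>1, T\<^sub>2, T\<^sub>3, T\<^sub>4)\<close>, used on \<open>S\<^sub>0\<close>, \<open>S\<^sub>0\<close>, \<open>\<Gamma>\<^sub>1\<close> and \<open>\<Gamma>\<^sub>2\<close>, respectively.\<close>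

type_synonym bvp_data = "vfield \<times> vfield \<times> vfield \<times> vfield"

text \<open>Only the values of \<open>E, H\<close> on the closure of \<open>\<Omega>\<^sub>0\<close> and of \<open>F, G\<close> on the closure of \<open>\<Omega>\<^sub>1\<close> matter.\<close>

fun bvp_solution ::
  "layered_medium \<Rightarrow> bvp_data \<Rightarrow> vfield \<Rightarrow> vfield \<Rightarrow> vfield \<Rightarrow> vfield \<Rightarrow> bool" where
  "bvp_solution M (T\<^sub>1, T\<^sub>2, T\<^sub>3, T\<^sub>4) E H F G \<longleftrightarrow>
     maxwell_in (k\<^sub>0 M) (\<Omega>\<^sub>0 M) E H \<and> maxwell_in (k\<^sub>1 M) (\<Omega>\<^sub>1 M) F G \<and> silver_mueller E H \<and>
     (\<forall>x\<in>S\<^sub>0 M. tangential_trace M E x - lambda_E M *s tangential_trace M F x = T\<^sub>1 x \<and>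
                tangential_trace M H x - lambda_H M *s tangential_trace M G x = T\<^sub>2 x) \<and>
     (\<forall>x\<in>\<Gamma>\<^sub>1 M. tangential_trace M F x = T\<^sub>3 x) \<and>
     (\<forall>x\<in>\<Gamma>\<^sub>2 M. impedance_trace M F G x = T\<^sub>4 x)"

definition uniquely_solvable :: "layered_medium \<Rightarrow> bvp_data \<Rightarrow> bool" where
  "uniquely_solvable M T \<longleftrightarrow>
     (\<exists>E H F G. bvp_solution M T E H F G) \<and>
     (\<forall>E H F G E' H' F' G'. bvp_solution M T E H F G \<and> bvp_solution M T E' H' F' G' \<longrightarrow>
        (\<forall>x\<in>\<Omega>\<^sub>0 M. E x = E' x \<and> H x = H' x) \<and> (\<forall>x\<in>\<Omega>\<^sub>1 M. F x = F' x \<and> G x = G' x))"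

text \<open>\<open>E(x) = e\<^bsup>ik|x|\<^esup> / |x| \<cdot> (E\<^sup>\<infinity>(x / |x|) + O(1 / |x|))\<close>, with remainder \<open>r\<close>; only the values
  of \<open>E\<^sup>\<infinity>\<close> on the unit sphere matter.\<close>

definition far_field_pattern :: "complex \<Rightarrow> vfield \<Rightarrow> vfield \<Rightarrow> bool" where
  "far_field_pattern k E Einf \<longleftrightarrow>
     (\<exists>r. (\<forall>\<^sub>F x in at_infinity.
            E x = (exp (\<i> * k * of_real (norm x)) / of_real (norm x)) *s
                    (Einf (x /\<^sub>R norm x) + r x)) \<and>
          (\<lambda>x. norm (r x)) \<in> O[at_infinity](\<lambda>x. 1 / norm x))"


section \<open>Incident fields and the associated boundary data\<close>

definition plane_wave_E :: "complex \<Rightarrow> real^3 \<Rightarrow> real^3 \<Rightarrow> vfield" where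
  "plane_wave_E k d q x =
     (\<i> / k) *s curl (curl (\<lambda>y. exp (\<i> * k * of_real (y \<bullet> d)) *s cvec q)) x"

definition plane_wave_H :: "complex \<Rightarrow> real^3 \<Rightarrow> real^3 \<Rightarrow> vfield" where
  "plane_wave_H k d q = curl (\<lambda>y. exp (\<i> * k * of_real (y \<bullet> d)) *s cvec q)"

definition fundamental_solution :: "complex \<Rightarrow> real^3 \<Rightarrow> real^3 \<Rightarrow> complex" where
  "fundamental_solution k x y =
     exp (\<i> * k * of_real (norm (x - y))) / (4 * of_real pi * of_real (norm (x - y)))"

definition dipole_E :: "complex \<Rightarrow> real^3 \<Rightarrow> real^3 \<Rightarrow> vfield" where
  "dipole_E k z p x = (\<i> / k) *s curl (curl (\<lambda>y. fundamental_solution k y z *s cvec p)) x"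

definition dipole_H :: "complex \<Rightarrow> real^3 \<Rightarrow> real^3 \<Rightarrow> vfield" where
  "dipole_H k z p = curl (\<lambda>y. fundamental_solution k y z *s cvec p)"

definition plane_wave_data :: "layered_medium \<Rightarrow> real^3 \<Rightarrow> real^3 \<Rightarrow> bvp_data" where
  "plane_wave_data M d q =
     (\<lambda>x. - tangential_trace M (plane_wave_E (k\<^sub>0 M) d q) x,
      \<lambda>x. - tangential_trace M (plane_wave_H (k\<^sub>0 M) d q) x,
      \<lambda>x. 0,
      \<lambda>x. 0)"

definition dipole_data_0 :: "layered_medium \<Rightarrow> real^3 \<Rightarrow> real^3 \<Rightarrow> bvp_data" where
  "dipole_data_0 M z p =
     (\<lambda>x. - tangential_trace M (dipole_E (k\<^sub>0 M) z p) x,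
      \<lambda>x. - tangential_trace M (dipole_H (k\<^sub>0 M) z p) x,
      \<lambda>x. 0,
      \<lambda>x. 0)"

definition dipole_data_1 :: "layered_medium \<Rightarrow> real^3 \<Rightarrow> real^3 \<Rightarrow> bvp_data" where
  "dipole_data_1 M z p =
     (\<lambda>x. lambda_E M *s tangential_trace M (dipole_E (k\<^sub>1 M) z p) x,
      \<lambda>x. lambda_H M *s tangential_trace M (dipole_H (k\<^sub>1 M) z p) x,
      \<lambda>x. - tangential_trace M (dipole_E (k\<^sub>1 M) z p) x,
      \<lambda>x. - tangential_trace M (dipole_H (k\<^sub>1 M) z p) x +
            (of_real (impedance M) / k\<^sub>1 M) *s
              (tangential_trace M (dipole_E (k\<^sub>1 M) z p) x \<times>\<^sub>c cvec (\<nu> M x)))"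

end

theory Submission
  imports Defs
begin


text \<open>The left and right sides of both identities are fluxes. Let \<open>(E1, H1)\<close>, \<open>(F1, G1)\<close> be the total fields of
  the plane wave in \<open>\<Omega>\<^sub>0\<close> and \<open>\<Omega>\<^sub>1\<close>, and \<open>(E2, H2)\<close>, \<open>(F2, G2)\<close> those of the dipole. In each layer both solve the same Maxwell
  system, so \<open>E1 \<times> H2 - E2 \<times> H1\<close> and \<open>F1 \<times> G2 - F2 \<times> G1\<close> are divergence free. By the transmission conditions the
  normal component of the first equals \<open>\<lambda>\<^sub>E \<lambda>\<^sub>H\<close> times that of the second on \<open>S\<^sub>0\<close>, and by the boundary
  conditions the latter vanishes on \<open>S\<^sub>1\<close>. Hence the flux through a large sphere equals the flux through a small sphere around the
  dipole, with the factor \<open>\<lambda>\<^sub>E \<lambda>\<^sub>H\<close> if the dipole lies in \<open>\<Omega>\<^sub>1\<close>.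

  Around its position \<open>z\<close> a dipole reads off the other field: the flux is a universal constant times
  \<open>p \<bullet> E1(z)\<close> or \<open>p \<bullet> F1(z)\<close> (lemma \<open>source_flux\<close>). On a large sphere the pairing of two radiating fields vanishes by
  the Silver-Mueller condition (\<open>radiating_flux_vanishes\<close>), and the pairing of the incident plane wave with
  the radiated field of the dipole remains. A plane wave in direction \<open>d\<close> is the limit of rescaled dipoles at \<open>- t d\<close>. Reading off
  the radiated field at \<open>- t d\<close> turns this pairing into the same universal constant times
  \<open>4 \<pi> q \<bullet> E\<^sup>\<infinity>(- d)\<close> (\<open>far_field_flux\<close>). The constant cancels. If the dipole
  lies in \<open>\<Omega>\<^sub>0\<close>, the free-space pairing of plane wave and dipole removes the incident part of \<open>E1(z)\<close>.

  Surface integrals are avoided: the flux of \<open>V\<close> is the integral of \<open>\<nabla>\<phi> \<bullet> V\<close> with a cutoff \<open>\<phi>\<close>, and the divergence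
  theorem becomes the statement that this integral vanishes for compactly supported \<open>\<phi>\<close>
  (\<open>weak_div_free\<close>). Surfaces enter only through their defining functions, in \<open>weak_div_free_interface\<close>: a field that is
  divergence free on both sides, continuous up to the surface from each side, and has matching normal components is weakly divergence
  free across the surface.\<close>

section \<open>Gradients and integration by parts\<close>

text \<open>A \<open>C\<^sup>1\<close> function is handled together with the family \<open>D\<close> of its partial derivatives, so that products, compositions
  and cutoffs come with explicit derivatives; \<open>U\<close> is meant to be open.\<close>

definition has_grad ::
  "(real^3) set \<Rightarrow> (real^3 \<Rightarrow> 'a::real_normed_vector) \<Rightarrow> (3 \<Rightarrow> real^3 \<Rightarrow> 'a) \<Rightarrow> bool" where
  "has_grad U f D \<longleftrightarrow>
     (\<forall>x\<in>U. (f has_derivative (\<lambda>h. \<Sum>j\<in>UNIV. h$j *\<^sub>R D j x)) (at x)) \<and> (\<forall>j. continuous_on U (D j))"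

lemma has_grad_derivative:
  "has_grad U f D \<Longrightarrow> x \<in> U \<Longrightarrow> (f has_derivative (\<lambda>h. \<Sum>j\<in>UNIV. h$j *\<^sub>R D j x)) (at x)"
  by (simp add: has_grad_def)

lemma has_grad_continuous_deriv: "has_grad U f D \<Longrightarrow> continuous_on U (D j)"
  by (simp add: has_grad_def)

lemma has_grad_continuous: "has_grad U f D \<Longrightarrow> continuous_on U f"
  unfolding has_grad_def
  by (meson continuous_at_imp_continuous_on has_derivative_continuous)

lemma has_gradI:
  assumes "\<And>x. x \<in> U \<Longrightarrow> (f has_derivative f' x) (at x)"
    and "\<And>x h. x \<in> U \<Longrightarrow> f' x h = (\<Sum>j\<in>UNIV. h$j *\<^sub>R D j x)"
    and "\<And>j. continuous_on U (D j)"
  shows "has_grad U f D"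
proof -
  have "f' x = (\<lambda>h. \<Sum>j\<in>UNIV. h$j *\<^sub>R D j x)" if "x \<in> U" for x
    using assms(2)[OF that] by auto
  with assms(1,3) show ?thesis by (auto simp: has_grad_def)
qed

lemma has_grad_partial:
  assumes "has_grad U f D" "x \<in> U"
  shows "partial j f x = D j x"
proof -
  have "frechet_derivative f (at x) = (\<lambda>h. \<Sum>j\<in>UNIV. h$j *\<^sub>R D j x)"
    using frechet_derivative_at[OF has_grad_derivative[OF assms]] by simp
  then show ?thesis
    by (simp add: partial_def axis_def if_distrib[where f="\<lambda>r. r *\<^sub>R _"] cong: if_cong)
qed

lemma linear_sum_axis:
  fixes f :: "real^3 \<Rightarrow> 'a::real_normed_vector"
  assumes "linear f"
  shows "f h = (\<Sum>j\<in>UNIV. h$j *\<^sub>R f (axis j 1))"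
proof -
  interpret linear f by fact
  have "h = (\<Sum>j\<in>UNIV. h$j *\<^sub>R axis j 1)"
    by (simp add: vec_eq_iff axis_def if_distrib cong: if_cong)
  then have "f h = f (\<Sum>j\<in>UNIV. h$j *\<^sub>R axis j 1)" by simp
  then show ?thesis by (simp add: sum scale)
qed

lemma C1_has_grad:
  assumes "open U" "C_k_on 1 U f"
  shows "has_grad U f (\<lambda>j. partial j f)"
proof (rule has_gradI)
  fix x assume "x \<in> U"
  then have d: "f differentiable at x"
    using assms by (simp add: differentiable_on_eq_differentiable_at)
  then show "(f has_derivative frechet_derivative f (at x)) (at x)"
    by (simp add: frechet_derivative_works)
  show "frechet_derivative f (at x) h = (\<Sum>j\<in>UNIV. h$j *\<^sub>R partial j f x)" for h
    unfolding partial_def by (rule linear_sum_axis) (rule linear_frechet_derivative[OF d])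
next
  show "continuous_on U (partial j f)" for j using assms by simp
qed

lemma has_grad_subset: "has_grad U f D \<Longrightarrow> W \<subseteq> U \<Longrightarrow> has_grad W f D"
  unfolding has_grad_def by (meson continuous_on_subset subsetD)

lemma has_grad_cong:
  assumes "open U" "has_grad U f D" "\<And>x. x \<in> U \<Longrightarrow> f x = g x" "\<And>j x. x \<in> U \<Longrightarrow> D j x = D' j x"
  shows "has_grad U g D'"
proof (rule has_gradI)
  fix x assume x: "x \<in> U"
  show "(g has_derivative (\<lambda>h. \<Sum>j\<in>UNIV. h$j *\<^sub>R D j x)) (at x)"
    using has_derivative_transform_within_open[OF has_grad_derivative[OF assms(2) x] assms(1) x] assms(3)
    by simp
  show "(\<Sum>j\<in>UNIV. h$j *\<^sub>R D j x) = (\<Sum>j\<in>UNIV. h$j *\<^sub>R D' j x)" for h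
    using assms(4)[OF x] by simp
next
  show "continuous_on U (D' j)" for j
    using has_grad_continuous_deriv[OF assms(2)] assms(4) by (metis continuous_on_cong)
qed

lemma has_grad_Un:
  assumes "open U" "open W" "has_grad U f D" "has_grad W f D"
  shows "has_grad (U \<union> W) f D"
  using assms unfolding has_grad_def by (auto intro: continuous_on_open_Un)

lemma has_grad_const: "has_grad U (\<lambda>x. c) (\<lambda>j x. 0)"
  by (rule has_gradI[where f'="\<lambda>x h. 0"]) auto

lemma has_grad_add:
  assumes "has_grad U f D" "has_grad U g E"
  shows "has_grad U (\<lambda>x. f x + g x) (\<lambda>j x. D j x + E j x)"
  by (rule has_gradI, rule has_derivative_add)
     (use assms in \<open>auto simp: has_grad_def sum.distrib scaleR_add_right intro!: continuous_intros\<close>)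

lemma has_grad_diff:
  assumes "has_grad U f D" "has_grad U g E"
  shows "has_grad U (\<lambda>x. f x - g x) (\<lambda>j x. D j x - E j x)"
  by (rule has_gradI, rule has_derivative_diff)
     (use assms in \<open>auto simp: has_grad_def sum_subtractf scaleR_diff_right intro!: continuous_intros\<close>)

lemma has_grad_sum:
  assumes "\<And>i. i \<in> I \<Longrightarrow> has_grad U (f i) (D i)"
  shows "has_grad U (\<lambda>x. \<Sum>i\<in>I. f i x) (\<lambda>j x. \<Sum>i\<in>I. D i j x)"
  using assms
  by (induction I rule: infinite_finite_induct) (auto intro: has_grad_const has_grad_add)

lemma has_grad_bilinear:
  assumes "bounded_bilinear b" "has_grad U f D" "has_grad U g E"
  shows "has_grad U (\<lambda>x. b (f x) (g x)) (\<lambda>j x. b (D j x) (g x) + b (f x) (E j x))"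
proof -
  interpret bounded_bilinear b by fact
  show ?thesis
  proof (rule has_gradI)
    fix x assume "x \<in> U"
    then show "((\<lambda>x. b (f x) (g x)) has_derivative
       (\<lambda>h. b (f x) (\<Sum>j\<in>UNIV. h$j *\<^sub>R E j x) + b (\<Sum>j\<in>UNIV. h$j *\<^sub>R D j x) (g x))) (at x)"
      using assms by (intro FDERIV) (auto simp: has_grad_def)
    show "b (f x) (\<Sum>j\<in>UNIV. h$j *\<^sub>R E j x) + b (\<Sum>j\<in>UNIV. h$j *\<^sub>R D j x) (g x) =
       (\<Sum>j\<in>UNIV. h$j *\<^sub>R (b (D j x) (g x) + b (f x) (E j x)))" for h
      by (simp add: sum_left sum_right scaleR_left scaleR_right scaleR_add_right sum.distrib)
  next
    show "continuous_on U (\<lambda>x. b (D j x) (g x) + b (f x) (E j x))" for j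
      using assms(2,3)
      by (intro continuous_on_add continuous_on)
         (auto dest: has_grad_continuous has_grad_continuous_deriv)
  qed
qed

lemma has_grad_mult:
  fixes f g :: "real^3 \<Rightarrow> 'a::real_normed_algebra"
  assumes "has_grad U f D" "has_grad U g E"
  shows "has_grad U (\<lambda>x. f x * g x) (\<lambda>j x. D j x * g x + f x * E j x)"
  using has_grad_bilinear[OF bounded_bilinear_mult assms] .

lemma has_grad_linear:
  assumes "bounded_linear l" "has_grad U f D"
  shows "has_grad U (\<lambda>x. l (f x)) (\<lambda>j x. l (D j x))"
proof -
  interpret bounded_linear l by fact
  show ?thesis
    by (rule has_gradI, rule has_derivative)
       (use assms in \<open>auto simp: has_grad_def sum scaleR intro!: continuous_on\<close>)
qed

lemma has_grad_cmult:
  fixes f :: "real^3 \<Rightarrow> 'a::real_normed_algebra"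
  shows "has_grad U f D \<Longrightarrow> has_grad U (\<lambda>x. c * f x) (\<lambda>j x. c * D j x)"
  by (rule has_grad_linear[OF bounded_linear_mult_right])

lemma has_grad_of_real:
  "has_grad U f D \<Longrightarrow> has_grad U (\<lambda>x. of_real (f x) :: complex) (\<lambda>j x. of_real (D j x))"
  by (rule has_grad_linear[OF bounded_linear_of_real])

lemma has_grad_component:
  "has_grad U (f :: real^3 \<Rightarrow> complex^3) D \<Longrightarrow> has_grad U (\<lambda>x. f x $ i) (\<lambda>j x. D j x $ i)"
  by (rule has_grad_linear[OF bounded_linear_vec_nth])

lemma has_grad_coord: "has_grad U (\<lambda>x. x $ i) (\<lambda>j x. if j = i then 1 else 0)"
  by (rule has_gradI[where f'="\<lambda>x h. h $ i"])
     (auto intro: bounded_linear_imp_has_derivative bounded_linear_vec_nth simp: if_distrib cong: if_cong)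

lemma has_grad_compose:
  fixes f :: "real^3 \<Rightarrow> real" and g :: "real \<Rightarrow> 'a::real_normed_vector"
  assumes f: "has_grad U f D" and U: "f ` U \<subseteq> S"
    and g: "\<And>s. s \<in> S \<Longrightarrow> (g has_vector_derivative g' s) (at s)" and c: "continuous_on S g'"
  shows "has_grad U (\<lambda>x. g (f x)) (\<lambda>j x. D j x *\<^sub>R g' (f x))"
proof (rule has_gradI)
  fix x assume x: "x \<in> U"
  have "(g has_derivative (\<lambda>t. t *\<^sub>R g' (f x))) (at (f x))"
    using g U x unfolding has_vector_derivative_def by auto
  from has_derivative_compose[OF has_grad_derivative[OF f x] this]
  show "((\<lambda>x. g (f x)) has_derivative (\<lambda>h. (\<Sum>j\<in>UNIV. h$j *\<^sub>R D j x) *\<^sub>R g' (f x))) (at x)" .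
  show "(\<Sum>j\<in>UNIV. h$j *\<^sub>R D j x) *\<^sub>R g' (f x) = (\<Sum>j\<in>UNIV. h$j *\<^sub>R (D j x *\<^sub>R g' (f x)))" for h
    by (simp add: scaleR_sum_left)
next
  show "continuous_on U (\<lambda>x. D j x *\<^sub>R g' (f x))" for j
    using has_grad_continuous_deriv[OF f] has_grad_continuous[OF f] c U
    by (intro continuous_intros) (auto intro: continuous_on_compose2)
qed

lemma norm_sq_sum: "(norm (x :: real^3))\<^sup>2 = (\<Sum>i\<in>UNIV. x$i * x$i)"
  by (metis dot_square_norm inner_vec_def inner_real_def)

lemma has_grad_dist_sq: "has_grad U (\<lambda>x. (norm (x - z))\<^sup>2) (\<lambda>j x. 2 * (x - z)$j)"
proof (rule has_gradI)
  fix x :: "real^3"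
  show "((\<lambda>x. (norm (x - z))\<^sup>2) has_derivative (\<lambda>h. 2 * ((x - z) \<bullet> h))) (at x)"
    unfolding dot_square_norm[symmetric]
    by (auto intro!: derivative_eq_intros simp: inner_commute)
  show "2 * ((x - z) \<bullet> h) = (\<Sum>j\<in>UNIV. h$j *\<^sub>R (2 * (x - z)$j))" for h
    by (simp add: inner_vec_def sum_distrib_left mult_ac)
qed (auto intro!: continuous_intros)

text \<open>Extension by zero: \<open>U\<close> and the complement of \<open>K\<close> are open and cover the space.\<close>

lemma has_grad_glue:
  assumes "open U" "has_grad U f D" "closed K" "K \<subseteq> U"
    and "\<And>x. x \<notin> K \<Longrightarrow> f x = 0" "\<And>x j. x \<notin> K \<Longrightarrow> D j x = 0"
  shows "has_grad UNIV f D"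
proof -
  have "has_grad (- K) f D"
    by (rule has_grad_cong[OF _ has_grad_const[of _ 0]]) (use assms in auto)
  with assms have "has_grad (U \<union> - K) f D" by (intro has_grad_Un) auto
  moreover have "U \<union> - K = UNIV" using assms by auto
  ultimately show ?thesis by simp
qed

lemma has_grad_zero_deriv:
  assumes "has_grad U f D" "open W" "W \<subseteq> U" "\<And>x. x \<in> W \<Longrightarrow> f x = c" "x \<in> W"
  shows "D j x = 0"
proof -
  have "has_grad W (\<lambda>x. c) D"
  proof (rule has_grad_cong[OF assms(2)])
    show "has_grad W f D" using assms has_grad_subset by blast
  qed (use assms in auto)
  from has_grad_partial[OF this assms(5)] has_grad_partial[OF has_grad_const[of W c] assms(5)]
  show ?thesis by simp
qed

lemma integrable_compact_support:
  fixes f :: "real^3 \<Rightarrow> 'a::{banach, second_countable_topology}"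
  assumes "continuous_on K f" "compact K" "\<And>x. x \<notin> K \<Longrightarrow> f x = 0"
  shows "integrable lborel f"
proof -
  have "integrable lborel (\<lambda>x. indicator K x *\<^sub>R f x)"
    by (rule borel_integrable_compact) (use assms in auto)
  moreover have "(\<lambda>x. indicator K x *\<^sub>R f x) = f"
    using assms by (auto simp: indicator_def)
  ultimately show ?thesis by simp
qed

lemma lborel_integral_translate:
  fixes f :: "real^3 \<Rightarrow> 'a::{banach, second_countable_topology}"
  assumes "f \<in> borel_measurable borel"
  shows "integral\<^sup>L lborel (\<lambda>x. f (a + x)) = integral\<^sup>L lborel f"
proof -
  have "integral\<^sup>L lborel f = integral\<^sup>L (distr lborel borel ((+) a)) f"
    by (simp add: lborel_distr_plus)
  also have "\<dots> = integral\<^sup>L lborel (\<lambda>x. f (a + x))"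
    using assms by (subst integral_distr) auto
  finally show ?thesis by simp
qed

text \<open>Every integration by parts below comes down to this. By translation invariance the difference quotients
  of \<open>f\<close> have integral zero, and the compact support together with the bounded derivative
  dominates them by an integrable function.\<close>

lemma integral_partial_eq_0:
  fixes f :: "real^3 \<Rightarrow> complex"
  assumes f: "has_grad UNIV f D" and K: "compact K" "\<And>x. x \<notin> K \<Longrightarrow> f x = 0"
  shows "integral\<^sup>L lborel (D j) = 0"
proof -
  have D0: "D i x = 0" if "x \<notin> K" for i x
    by (rule has_grad_zero_deriv[OF f, of "- K"]) (use K that in \<open>auto simp: compact_imp_closed\<close>)
  have cf: "continuous_on UNIV f" by (rule has_grad_continuous[OF f])
  have cD: "continuous_on UNIV (D i)" for i by (rule has_grad_continuous_deriv[OF f])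
  obtain R where R: "\<And>x. x \<in> K \<Longrightarrow> norm x \<le> R"
    using compact_imp_bounded[OF K(1)] by (auto simp: bounded_iff)
  have "\<exists>b. \<forall>x. norm (D i x) \<le> b" for i
  proof -
    have "bounded (D i ` K)"
      by (rule compact_imp_bounded, rule compact_continuous_image[OF _ K(1)])
         (use cD continuous_on_subset in blast)
    then obtain b where "\<And>x. x \<in> K \<Longrightarrow> norm (D i x) \<le> b" by (auto simp: bounded_iff)
    then have "norm (D i x) \<le> max b 0" for x
      using D0 by (cases "x \<in> K") (auto intro: le_max_iff_disj[THEN iffD2])
    then show ?thesis by blast
  qed
  then obtain b where b: "\<And>i x. norm (D i x) \<le> b i" by metis
  define B where "B = (\<Sum>i\<in>UNIV. b i)"
  have lip: "norm (f x - f y) \<le> B * norm (x - y)" for x y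
  proof (rule differentiable_bound[of UNIV f "\<lambda>x h. \<Sum>j\<in>UNIV. h$j *\<^sub>R D j x"])
    show "(f has_derivative (\<lambda>h. \<Sum>j\<in>UNIV. h$j *\<^sub>R D j x)) (at x within UNIV)" for x
      using has_grad_derivative[OF f] by simp
    show "onorm (\<lambda>h. \<Sum>j\<in>UNIV. h$j *\<^sub>R D j x) \<le> B" for x
    proof (rule onorm_le)
      fix h :: "real^3"
      have "norm (\<Sum>j\<in>UNIV. h$j *\<^sub>R D j x) \<le> (\<Sum>j\<in>UNIV. norm h * b j)"
        by (rule sum_norm_le)
           (auto intro!: mult_mono b simp: component_le_norm_cart)
      then show "norm (\<Sum>j\<in>UNIV. h$j *\<^sub>R D j x) \<le> B * norm h"
        by (simp add: B_def sum_distrib_left mult.commute)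
    qed
  qed auto
  define e where "e = (axis j 1 :: real^3)"
  define t where "t n = inverse (real (Suc n))" for n
  have t: "0 < t n" "t n \<le> 1" for n by (auto simp: t_def field_simps)
  have t0: "t \<longlonglongrightarrow> 0" unfolding t_def by (rule LIMSEQ_inverse_real_of_nat)
  define g where "g n x = (1 / t n) *\<^sub>R (f (t n *\<^sub>R e + x) - f x)" for n x
  have ne: "norm e = 1" by (simp add: e_def)
  have fm: "f \<in> borel_measurable borel" using cf by (rule borel_measurable_continuous_onI)
  have intf: "integrable lborel f"
    by (rule integrable_compact_support[OF _ K]) (use cf continuous_on_subset in auto)
  have intft: "integrable lborel (\<lambda>x. f (a + x))" for a
  proof (rule integrable_compact_support)
    show "compact ((\<lambda>x. x - a) ` K)" by (intro compact_continuous_image K continuous_intros)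
    show "continuous_on ((\<lambda>x. x - a) ` K) (\<lambda>x. f (a + x))"
      by (rule continuous_on_compose2[OF cf]) (auto intro!: continuous_intros)
    fix x assume "x \<notin> (\<lambda>x. x - a) ` K"
    then have "a + x \<notin> K" by (auto simp: image_iff)
    then show "f (a + x) = 0" by (rule K(2))
  qed
  have g0: "integral\<^sup>L lborel (g n) = 0" for n
    unfolding g_def using intf intft fm by (simp add: lborel_integral_translate)
  have "(\<lambda>n. integral\<^sup>L lborel (g n)) \<longlonglongrightarrow> integral\<^sup>L lborel (D j)"
  proof (rule integral_dominated_convergence[where w="\<lambda>x. indicator (cball 0 (R+1)) x *\<^sub>R B"])
    show "D j \<in> borel_measurable lborel" using cD borel_measurable_continuous_onI by auto
    show "g n \<in> borel_measurable lborel" for n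
    proof -
      have "continuous_on UNIV (\<lambda>x. f (t n *\<^sub>R e + x))"
        by (rule continuous_on_compose2[OF cf]) (auto intro!: continuous_intros)
      then have "continuous_on UNIV (g n)"
        unfolding g_def[abs_def] using cf by (intro continuous_intros)
      then show ?thesis using borel_measurable_continuous_onI by auto
    qed
    show "integrable lborel (\<lambda>x. indicator (cball 0 (R+1)) x *\<^sub>R B :: real)" 
      by (rule borel_integrable_compact) auto
    show "AE x in lborel. (\<lambda>n. g n x) \<longlonglongrightarrow> D j x"
    proof (rule AE_I2)
      fix x :: "real^3"
      have "(f has_derivative (\<lambda>h. \<Sum>j\<in>UNIV. h$j *\<^sub>R D j x)) (at x)"
        by (rule has_grad_derivative[OF f]) simp
      then have "((\<lambda>y. f (y *\<^sub>R e + x)) has_derivative (\<lambda>y. \<Sum>j\<in>UNIV. (y *\<^sub>R e)$j *\<^sub>R D j x)) (at 0)"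
        by (intro has_derivative_compose[where f="\<lambda>y. y *\<^sub>R e + x" and g = f])
           (auto intro!: derivative_eq_intros)
      also have "(\<lambda>y. \<Sum>j\<in>UNIV. (y *\<^sub>R e)$j *\<^sub>R D j x) = (\<lambda>y. y *\<^sub>R D j x)"
        by (simp add: e_def axis_def if_distrib[where f="\<lambda>r. (_ * r) *\<^sub>R _"] cong: if_cong)
      finally have "((\<lambda>y. f (y *\<^sub>R e + x)) has_vector_derivative D j x) (at 0)"
        by (simp add: has_vector_derivative_def)
      then have "((\<lambda>y. norm (f (y *\<^sub>R e + x) - f x - y *\<^sub>R D j x) / norm y) \<longlongrightarrow> 0) (at 0)"
        unfolding has_vector_derivative_def has_derivative_at by simp
      then have "((\<lambda>y. norm ((1/y) *\<^sub>R (f (y *\<^sub>R e + x) - f x) - D j x)) \<longlongrightarrow> 0) (at 0)"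
      proof (rule Lim_transform_eventually)
        have "norm ((1/y) *\<^sub>R (f (y *\<^sub>R e + x) - f x) - D j x) =
            norm (f (y *\<^sub>R e + x) - f x - y *\<^sub>R D j x) / norm y" if "y \<noteq> 0" for y
        proof -
          have "(1/y) *\<^sub>R (f (y *\<^sub>R e + x) - f x) - D j x = (1/y) *\<^sub>R (f (y *\<^sub>R e + x) - f x - y *\<^sub>R D j x)"
            using that by (simp add: scaleR_diff_right)
          then show ?thesis by (simp add: divide_inverse)
        qed
        then show "\<forall>\<^sub>F y in at 0. norm (f (y *\<^sub>R e + x) - f x - y *\<^sub>R D j x) / norm y =
            norm ((1/y) *\<^sub>R (f (y *\<^sub>R e + x) - f x) - D j x)"
          by (auto simp: eventually_at_filter intro!: always_eventually)
      qed
      then have "((\<lambda>y. (1/y) *\<^sub>R (f (y *\<^sub>R e + x) - f x)) \<longlongrightarrow> D j x) (at 0)"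
        using Lim_null tendsto_norm_zero_iff by blast
      then show "(\<lambda>n. g n x) \<longlonglongrightarrow> D j x"
        unfolding g_def
        by (rule filterlim_compose)
           (use t(1)[THEN less_imp_neq] t0 in \<open>auto simp: filterlim_at intro!: always_eventually\<close>)
    qed
    show "AE x in lborel. norm (g n x) \<le> indicator (cball 0 (R+1)) x *\<^sub>R B" for n
    proof (rule AE_I2)
      fix x :: "real^3"
      show "norm (g n x) \<le> indicator (cball 0 (R+1)) x *\<^sub>R B"
      proof (cases "x \<in> cball 0 (R+1)")
        case True
        have "norm (f (t n *\<^sub>R e + x) - f x) \<le> B * norm (t n *\<^sub>R e)"
          using lip[of "t n *\<^sub>R e + x" x] by simp
        then have "norm (g n x) \<le> B"
          using t[of n] ne by (simp add: g_def pos_divide_le_eq mult.commute)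
        then show ?thesis using True by simp
      next
        case False
        have "norm x \<le> norm (t n *\<^sub>R e + x) + norm (t n *\<^sub>R e)"
          by (metis add.commute add_diff_cancel_right' norm_triangle_ineq4)
        then have "norm (t n *\<^sub>R e + x) > R" "norm x > R"
          using False t[of n] ne by (auto simp: dist_norm)
        then have "t n *\<^sub>R e + x \<notin> K" "x \<notin> K" using R by force+
        then show ?thesis using K(2) False by (simp add: g_def)
      qed
    qed
  qed
  then show ?thesis using g0 by (simp add: LIMSEQ_const_iff)
qed


section \<open>Weakly divergence free fields\<close>

text \<open>The gradient \<open>D\<close> is a parameter because fluxes depend on the test function only through it.\<close>

definition test_fun :: "(real^3) set \<Rightarrow> (real^3 \<Rightarrow> complex) \<Rightarrow> (3 \<Rightarrow> real^3 \<Rightarrow> complex) \<Rightarrow> bool" where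
  "test_fun A \<phi> D \<longleftrightarrow> has_grad UNIV \<phi> D \<and> (\<exists>K. compact K \<and> K \<subseteq> A \<and> (\<forall>x. x \<notin> K \<longrightarrow> \<phi> x = 0))"

lemma test_funE:
  assumes "test_fun A \<phi> D"
  obtains K where "compact K" "K \<subseteq> A" "\<And>x. x \<notin> K \<Longrightarrow> \<phi> x = 0" "\<And>x j. x \<notin> K \<Longrightarrow> D j x = 0"
    "has_grad UNIV \<phi> D"
proof -
  from assms obtain K where K: "compact K" "K \<subseteq> A" "\<And>x. x \<notin> K \<Longrightarrow> \<phi> x = 0" and g: "has_grad UNIV \<phi> D"
    by (auto simp: test_fun_def)
  have "D j x = 0" if "x \<notin> K" for x j
    by (rule has_grad_zero_deriv[OF g, of "- K"]) (use K that in \<open>auto simp: compact_imp_closed\<close>)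
  with K g that show ?thesis by blast
qed

lemma test_fun_mono: "test_fun A \<phi> D \<Longrightarrow> A \<subseteq> B \<Longrightarrow> test_fun B \<phi> D"
  unfolding test_fun_def by blast

lemma test_fun_mult_right:
  assumes "test_fun A \<phi> D" "open A" "has_grad A f E"
  shows "test_fun A (\<lambda>x. \<phi> x * f x) (\<lambda>j x. D j x * f x + \<phi> x * E j x)"
proof -
  obtain K where K: "compact K" "K \<subseteq> A" "\<And>x. x \<notin> K \<Longrightarrow> \<phi> x = 0" "\<And>x j. x \<notin> K \<Longrightarrow> D j x = 0"
    and g: "has_grad UNIV \<phi> D"
    using test_funE[OF assms(1)] by metis
  have "has_grad UNIV (\<lambda>x. \<phi> x * f x) (\<lambda>j x. D j x * f x + \<phi> x * E j x)"
    by (rule has_grad_glue[OF assms(2) has_grad_mult[OF has_grad_subset[OF g] assms(3)], of K])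
       (use K compact_imp_closed in auto)
  with K show ?thesis unfolding test_fun_def by auto
qed

lemma test_fun_integrable:
  assumes "test_fun A \<phi> D" "continuous_on A (f :: real^3 \<Rightarrow> complex)"
  shows "integrable lborel (\<lambda>x. D j x * f x)" "integrable lborel (\<lambda>x. \<phi> x * f x)"
proof -
  obtain K where K: "compact K" "K \<subseteq> A" "\<And>x. x \<notin> K \<Longrightarrow> \<phi> x = 0" "\<And>x j. x \<notin> K \<Longrightarrow> D j x = 0"
    and g: "has_grad UNIV \<phi> D"
    using test_funE[OF assms(1)] by metis
  have c: "continuous_on K (D j)" "continuous_on K \<phi>" "continuous_on K f"
    using g assms(2) K(2) has_grad_continuous has_grad_continuous_deriv continuous_on_subset by blast+
  show "integrable lborel (\<lambda>x. D j x * f x)" "integrable lborel (\<lambda>x. \<phi> x * f x)"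
    using K c by (auto intro!: integrable_compact_support[of K] continuous_intros)
qed

lemma integral_by_parts:
  assumes \<phi>: "test_fun U \<phi> D" and "open U" and f: "has_grad U f E"
  shows "integral\<^sup>L lborel (\<lambda>x. D j x * f x) = - integral\<^sup>L lborel (\<lambda>x. \<phi> x * E j x)"
proof -
  have t: "test_fun U (\<lambda>x. \<phi> x * f x) (\<lambda>j x. D j x * f x + \<phi> x * E j x)"
    by (rule test_fun_mult_right[OF assms])
  then have "integral\<^sup>L lborel (\<lambda>x. D j x * f x + \<phi> x * E j x) = 0"
    by (elim test_funE) (rule integral_partial_eq_0[where D="\<lambda>j x. D j x * f x + \<phi> x * E j x"])
  then show ?thesis
    using test_fun_integrable[OF \<phi>] has_grad_continuous[OF f] has_grad_continuous_deriv[OF f]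
    by (simp add: add_eq_0_iff2)
qed

lemma integral_grad_dot:
  assumes \<phi>: "test_fun U \<phi> D" and "open U" and V: "\<And>i. has_grad U (\<lambda>x. V x $ i) (DV i)"
  shows "integrable lborel (\<lambda>x. \<Sum>i\<in>UNIV. D i x * (V x :: complex^3) $ i)" (is ?A)
    and "integral\<^sup>L lborel (\<lambda>x. \<Sum>i\<in>UNIV. D i x * V x $ i) =
          - integral\<^sup>L lborel (\<lambda>x. \<phi> x * (\<Sum>i\<in>UNIV. DV i i x))" (is ?B)
proof -
  have i1: "integrable lborel (\<lambda>x. D i x * V x $ i)" and i2: "integrable lborel (\<lambda>x. \<phi> x * DV i i x)" for i
    using test_fun_integrable[OF \<phi>] has_grad_continuous[OF V] has_grad_continuous_deriv[OF V] by auto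
  then show ?A by simp
  show ?B
    using i1 i2 integral_by_parts[OF \<phi> assms(2) V]
    by (simp add: sum_distrib_left sum_negf)
qed


text \<open>\<open>div V = 0\<close> in the weak sense. The test function carries the derivative, so
  the notion also makes sense for a field that jumps across a surface. Integrability is part of the notion so that the integrals can
  be added when a test function is split.\<close>

definition weak_div_free :: "(real^3) set \<Rightarrow> vfield \<Rightarrow> bool" where
  "weak_div_free A V \<longleftrightarrow> (\<forall>\<phi> D. test_fun A \<phi> D \<longrightarrow>
     integrable lborel (\<lambda>x. \<Sum>i\<in>UNIV. D i x * V x $ i) \<and>
     integral\<^sup>L lborel (\<lambda>x. \<Sum>i\<in>UNIV. D i x * V x $ i) = 0)"

lemma weak_div_freeI:
  assumes "open U" "\<And>i. has_grad U (\<lambda>x. V x $ i) (DV i)" "\<And>x. x \<in> U \<Longrightarrow> (\<Sum>i\<in>UNIV. DV i i x) = 0"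
  shows "weak_div_free U V"
  unfolding weak_div_free_def
proof (intro allI impI)
  fix \<phi> D assume \<phi>: "test_fun U \<phi> D"
  have "\<phi> x * (\<Sum>i\<in>UNIV. DV i i x) = 0" for x
    using assms(3) test_funE[OF \<phi>] by (metis mult_eq_0_iff subsetD)
  then have "(\<lambda>x. \<phi> x * (\<Sum>i\<in>UNIV. DV i i x)) = (\<lambda>x. 0)" by blast
  then show "integrable lborel (\<lambda>x. \<Sum>i\<in>UNIV. D i x * V x $ i) \<and>
     integral\<^sup>L lborel (\<lambda>x. \<Sum>i\<in>UNIV. D i x * V x $ i) = 0"
    using integral_grad_dot[OF \<phi> assms(1,2)] by simp
qed

lemma weak_div_free_mono: "weak_div_free A V \<Longrightarrow> B \<subseteq> A \<Longrightarrow> weak_div_free B V"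
  unfolding weak_div_free_def using test_fun_mono by blast

lemma weak_div_free_cong:
  assumes "weak_div_free A V" "\<And>x. x \<in> A \<Longrightarrow> V x = W x"
  shows "weak_div_free A W"
  unfolding weak_div_free_def
proof (intro allI impI)
  fix \<phi> D assume \<phi>: "test_fun A \<phi> D"
  have "(\<lambda>x. \<Sum>i\<in>UNIV. D i x * W x $ i) = (\<lambda>x. \<Sum>i\<in>UNIV. D i x * V x $ i)"
  proof
    fix x show "(\<Sum>i\<in>UNIV. D i x * W x $ i) = (\<Sum>i\<in>UNIV. D i x * V x $ i)"
    proof (cases "x \<in> A")
      case False
      then have "D i x = 0" for i using test_funE[OF \<phi>] by (metis subsetD)
      then show ?thesis by simp
    qed (use assms(2) in simp)
  qed
  with assms(1) \<phi> show "integrable lborel (\<lambda>x. \<Sum>i\<in>UNIV. D i x * W x $ i) \<and>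
     integral\<^sup>L lborel (\<lambda>x. \<Sum>i\<in>UNIV. D i x * W x $ i) = 0"
    by (auto simp: weak_div_free_def)
qed

text \<open>The square of the positive part is a \<open>C\<^sup>1\<close> function that vanishes on a half line; all cutoffs are built from it.\<close>

lemma pos_square_deriv:
  "((\<lambda>t. (max 0 t)\<^sup>2) has_real_derivative 2 * max 0 t) (at (t::real))"
proof -
  consider "t > 0" | "t < 0" | "t = 0" by linarith
  then show ?thesis
  proof cases
    case 1
    have "((\<lambda>t. t\<^sup>2) has_real_derivative 2 * t) (at t)" by (auto intro!: derivative_eq_intros)
    then have "((\<lambda>t. (max 0 t)\<^sup>2) has_real_derivative 2 * t) (at t)"
      by (rule has_field_derivative_transform_within_open[where S="{0<..}"]) (use 1 in auto)
    with 1 show ?thesis by simp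
  next
    case 2
    have "((\<lambda>t. 0) has_real_derivative 0) (at t)" by simp
    then have "((\<lambda>t. (max 0 t)\<^sup>2) has_real_derivative 0) (at t)"
      by (rule has_field_derivative_transform_within_open[where S="{..<0}"]) (use 2 in auto)
    with 2 show ?thesis by simp
  next
    case 3
    have "((\<lambda>h. max 0 h) \<longlongrightarrow> max 0 0) (at (0::real))" by (intro tendsto_intros)
    moreover have "\<forall>\<^sub>F h in at (0::real). max 0 h = (max 0 h)\<^sup>2 / h"
      by (auto simp: eventually_at_filter max_def power2_eq_square intro!: always_eventually)
    ultimately have "((\<lambda>h. (max 0 h)\<^sup>2 / h) \<longlongrightarrow> 0) (at (0::real))"
      using Lim_transform_eventually by fastforce
    with 3 show ?thesis by (simp add: DERIV_def)
  qed
qed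

text \<open>A \<open>C\<^sup>1\<close> step that decreases from \<open>1\<close> for \<open>s \<le> a\<close> to \<open>0\<close> for \<open>s \<ge> b\<close>; \<open>cut'\<close> is its derivative.\<close>

definition cut :: "real \<Rightarrow> real \<Rightarrow> real \<Rightarrow> real" where
  "cut a b s = (max 0 (b - s))\<^sup>2 / ((max 0 (b - s))\<^sup>2 + (max 0 (s - a))\<^sup>2)"

definition cut' :: "real \<Rightarrow> real \<Rightarrow> real \<Rightarrow> real" where
  "cut' a b s = - 2 * max 0 (b - s) * max 0 (s - a) * (max 0 (b - s) + max 0 (s - a)) /
     ((max 0 (b - s))\<^sup>2 + (max 0 (s - a))\<^sup>2)\<^sup>2"

lemma cut_denominator:
  assumes "a < b" shows "(max 0 (b - s))\<^sup>2 + (max 0 (s - a))\<^sup>2 > (0::real)"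
proof -
  have "max 0 (b - s) > 0 \<or> max 0 (s - a) > 0" using assms by linarith
  then show ?thesis by (auto intro: add_pos_nonneg add_nonneg_pos)
qed

lemma cut_deriv:
  assumes "a < b" shows "(cut a b has_real_derivative cut' a b s) (at s)"
proof -
  let ?p = "max 0 (b - s)" and ?q = "max 0 (s - a)"
  have 1: "((\<lambda>s. (max 0 (b - s))\<^sup>2) has_real_derivative 2 * ?p * (0 - 1)) (at s)"
    by (rule DERIV_chain2[OF pos_square_deriv]) (auto intro!: derivative_eq_intros)
  have 2: "((\<lambda>s. (max 0 (s - a))\<^sup>2) has_real_derivative 2 * ?q * (1 - 0)) (at s)"
    by (rule DERIV_chain2[OF pos_square_deriv]) (auto intro!: derivative_eq_intros)
  have n: "?p\<^sup>2 + ?q\<^sup>2 \<noteq> 0" using cut_denominator[OF assms, of s] by (metis less_irrefl)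
  have "((\<lambda>s. (max 0 (b - s))\<^sup>2 / ((max 0 (b - s))\<^sup>2 + (max 0 (s - a))\<^sup>2)) has_real_derivative
     (2 * ?p * (0 - 1) * (?p\<^sup>2 + ?q\<^sup>2) - ?p\<^sup>2 * (2 * ?p * (0 - 1) + 2 * ?q * (1 - 0))) /
       ((?p\<^sup>2 + ?q\<^sup>2) * (?p\<^sup>2 + ?q\<^sup>2))) (at s)"
    by (rule DERIV_divide[OF 1 DERIV_add[OF 1 2] n])
  moreover have "2 * p * (0 - 1) * (p\<^sup>2 + q\<^sup>2) - p\<^sup>2 * (2 * p * (0 - 1) + 2 * q * (1 - 0)) =
     - 2 * p * q * (p + q)" for p q :: real
    by algebra
  ultimately show ?thesis
    unfolding cut_def[abs_def] cut'_def by (simp add: power2_eq_square)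
qed

lemma cut_values:
  assumes "a < b"
  shows "s \<le> a \<Longrightarrow> cut a b s = 1" "b \<le> s \<Longrightarrow> cut a b s = 0"
    "0 \<le> cut a b s" "cut a b s \<le> 1" "s \<le> a \<or> b \<le> s \<Longrightarrow> cut' a b s = 0" "cut' a b s \<le> 0"
proof -
  show "s \<le> a \<Longrightarrow> cut a b s = 1" "b \<le> s \<Longrightarrow> cut a b s = 0" "s \<le> a \<or> b \<le> s \<Longrightarrow> cut' a b s = 0"
    using assms by (auto simp: cut_def cut'_def max_def)
  show "0 \<le> cut a b s" "cut a b s \<le> 1"
    using cut_denominator[OF assms, of s] by (auto simp: cut_def)
  show "cut' a b s \<le> 0" unfolding cut'_def
    by (intro divide_nonpos_nonneg mult_nonpos_nonneg) auto
qed

lemma continuous_cut': "a < b \<Longrightarrow> continuous_on S (cut' a b)"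
  unfolding cut'_def[abs_def]
proof (intro continuous_intros ballI)
  fix s assume "a < b"
  then show "((max 0 (b - s))\<^sup>2 + (max 0 (s - a))\<^sup>2)\<^sup>2 \<noteq> 0"
    using cut_denominator[of a b s] by (metis less_irrefl power_not_zero)
qed

text \<open>Cutoffs depend on the squared distance, which is differentiable at the centre as well.\<close>

definition bump :: "real^3 \<Rightarrow> real \<Rightarrow> real \<Rightarrow> real^3 \<Rightarrow> complex" where
  "bump z a b x = of_real (cut a b ((norm (x - z))\<^sup>2))"

definition dbump :: "real^3 \<Rightarrow> real \<Rightarrow> real \<Rightarrow> 3 \<Rightarrow> real^3 \<Rightarrow> complex" where
  "dbump z a b j x = of_real (2 * (x - z)$j * cut' a b ((norm (x - z))\<^sup>2))"

lemma has_grad_bump: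
  assumes "a < b" shows "has_grad UNIV (bump z a b) (dbump z a b)"
proof -
  have "has_grad UNIV (\<lambda>x. cut a b ((norm (x - z))\<^sup>2)) (\<lambda>j x. (2 * (x - z)$j) *\<^sub>R cut' a b ((norm (x - z))\<^sup>2))"
    by (rule has_grad_compose[OF has_grad_dist_sq, of _ _ UNIV])
       (use cut_deriv[OF assms] continuous_cut'[OF assms] in
         \<open>auto simp: has_real_derivative_iff_has_vector_derivative\<close>)
  from has_grad_of_real[OF this] show ?thesis
    unfolding bump_def[abs_def] dbump_def[abs_def] by simp
qed

lemma test_fun_bump:
  assumes "a < b" "cball z r \<subseteq> A" "b \<le> r\<^sup>2" "0 \<le> r"
  shows "test_fun A (bump z a b) (dbump z a b)"
  unfolding test_fun_def
proof (intro conjI exI[of _ "cball z r"] allI impI)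
  fix x assume "x \<notin> cball z r"
  then have "norm (x - z) > r" by (simp add: dist_norm norm_minus_commute)
  then have "(norm (x - z))\<^sup>2 \<ge> b" using assms(3,4) by (smt (verit) power_mono)
  then show "bump z a b x = 0" using cut_values[OF assms(1)] by (simp add: bump_def)
qed (use assms has_grad_bump in auto)

text \<open>A partition of unity without divisions: with a bump \<open>\<beta>\<close> around one centre, \<open>\<phi> = \<beta> \<phi> + \<phi> (1 - \<beta>)\<close>. The first
  part is supported in a good ball, and the second one vanishes on the inner ball. After the finitely many balls that
  cover the support nothing is left.\<close>

lemma weak_div_free_local:
  assumes loc: "\<And>x. x \<in> A \<Longrightarrow> \<exists>r>0. weak_div_free (ball x r) V"
  shows "weak_div_free A V"
proof -
  define Z where "Z D \<longleftrightarrow> integrable lborel (\<lambda>x. \<Sum>i\<in>UNIV. D i x * V x $ i) \<and>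
     integral\<^sup>L lborel (\<lambda>x. \<Sum>i\<in>UNIV. D i x * V x $ i) = 0" for D :: "3 \<Rightarrow> real^3 \<Rightarrow> complex"
  obtain r where r: "\<And>x. x \<in> A \<Longrightarrow> r x > 0" "\<And>x. x \<in> A \<Longrightarrow> weak_div_free (ball x (r x)) V"
    using loc by metis
  have main: "Z D" if "finite I" "I \<subseteq> A" "test_fun A \<phi> D" "\<And>x. x \<notin> (\<Union>i\<in>I. cball i (r i / 3)) \<Longrightarrow> \<phi> x = 0"
    for I \<phi> D
    using that
  proof (induction I arbitrary: \<phi> D rule: finite_induct)
    case empty
    have "D j x = 0" for j x
    proof (rule has_grad_zero_deriv[of UNIV \<phi> D UNIV])
      show "has_grad UNIV \<phi> D" using empty(2) unfolding test_fun_def by blast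
    qed (use empty in auto)
    then show ?case by (simp add: Z_def)
  next
    case (insert i I)
    define a b where "a = (r i / 3)\<^sup>2" and "b = (r i / 2)\<^sup>2"
    have ri: "r i > 0" using r insert by auto
    have ab: "a < b" unfolding a_def b_def using ri by (intro power_strict_mono) auto
    let ?\<beta> = "bump i a b" and ?D = "dbump i a b"
    note \<beta> = has_grad_bump[OF ab, of i]
    have t1: "test_fun A (\<lambda>x. \<phi> x * (1 - ?\<beta> x)) (\<lambda>j x. D j x * (1 - ?\<beta> x) + \<phi> x * (0 - ?D j x))" (is "test_fun A _ ?D1")
    proof -
      obtain K where K: "compact K" "K \<subseteq> A" "\<And>x. x \<notin> K \<Longrightarrow> \<phi> x = 0" and g: "has_grad UNIV \<phi> D"
        using insert.prems(2) by (auto simp: test_fun_def)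
      show ?thesis unfolding test_fun_def
        using has_grad_mult[OF g has_grad_diff[OF has_grad_const[of UNIV 1] \<beta>]] K by auto
    qed
    have "Z ?D1"
    proof (rule insert.IH[OF _ t1])
      fix x assume x: "x \<notin> (\<Union>i\<in>I. cball i (r i / 3))"
      show "\<phi> x * (1 - ?\<beta> x) = 0"
      proof (cases "x \<in> cball i (r i / 3)")
        case True
        then have "(norm (x - i))\<^sup>2 \<le> a" unfolding a_def
          by (intro power_mono) (auto simp: dist_norm norm_minus_commute)
        then show ?thesis using cut_values[OF ab] by (simp add: bump_def)
      next
        case False
        then show ?thesis using x insert.prems(3)[of x] by auto
      qed
    qed (use insert in auto)
    have t2: "test_fun (ball i (r i)) (\<lambda>x. ?\<beta> x * \<phi> x) (\<lambda>j x. ?D j x * \<phi> x + ?\<beta> x * D j x)" (is "test_fun _ _ ?D2")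
    proof (rule test_fun_mult_right)
      show "test_fun (ball i (r i)) ?\<beta> ?D"
        by (rule test_fun_bump[OF ab, of _ "r i / 2"]) (use ri in \<open>auto simp: b_def dist_norm\<close>)
      show "has_grad (ball i (r i)) \<phi> D"
        using insert.prems(2) has_grad_subset[of UNIV \<phi> D] by (simp add: test_fun_def)
    qed simp
    have "Z ?D2" unfolding Z_def
      using r(2)[of i] t2 insert.prems by (auto simp: weak_div_free_def)
    have "(\<lambda>x. \<Sum>i\<in>UNIV. D i x * V x $ i) =
       (\<lambda>x. (\<Sum>i\<in>UNIV. ?D1 i x * V x $ i) + (\<Sum>i\<in>UNIV. ?D2 i x * V x $ i))"
      by (simp add: sum.distrib[symmetric] algebra_simps)
    with \<open>Z ?D1\<close> \<open>Z ?D2\<close> show ?case unfolding Z_def by simp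
  qed
  show ?thesis unfolding weak_div_free_def
  proof (intro allI impI)
    fix \<phi> D assume \<phi>: "test_fun A \<phi> D"
    obtain K where K: "compact K" "K \<subseteq> A" "\<And>x. x \<notin> K \<Longrightarrow> \<phi> x = 0"
      using test_funE[OF \<phi>] by metis
    have "K \<subseteq> (\<Union>x\<in>K. ball x (r x / 3))" using K r by force
    from compactE_image[OF K(1) _ this] obtain I where I: "I \<subseteq> K" "finite I" "K \<subseteq> (\<Union>x\<in>I. ball x (r x / 3))"
      by auto
    have "Z D"
    proof (rule main[OF I(2) _ \<phi>])
      fix x assume "x \<notin> (\<Union>i\<in>I. cball i (r i / 3))"
      then have "x \<notin> K" using I(3) by (force simp: mem_ball)
      then show "\<phi> x = 0" by (rule K(3))
    qed (use I K in auto)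
    then show "integrable lborel (\<lambda>x. \<Sum>i\<in>UNIV. D i x * V x $ i) \<and>
     integral\<^sup>L lborel (\<lambda>x. \<Sum>i\<in>UNIV. D i x * V x $ i) = 0" by (simp add: Z_def)
  qed
qed


section \<open>Divergence free fields across a surface\<close>

lemma real_polynomial_has_grad:
  fixes p :: "real^3 \<Rightarrow> real"
  assumes "real_polynomial_function p"
  shows "\<exists>D. has_grad UNIV p D"
  using assms
proof induction
  case (linear f)
  have "has_grad UNIV f (\<lambda>j x. f (axis j 1))"
  proof (rule has_gradI)
    show "(f has_derivative f) (at x)" for x by (rule bounded_linear_imp_has_derivative[OF linear])
    show "f h = (\<Sum>j\<in>UNIV. h$j *\<^sub>R f (axis j 1))" for h
      by (rule linear_sum_axis[OF bounded_linear.linear[OF linear]])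
  qed simp
  then show ?case by blast
qed (blast intro: has_grad_const has_grad_add has_grad_mult)+

lemma polynomial_has_grad:
  fixes p :: "real^3 \<Rightarrow> complex"
  assumes "polynomial_function p"
  shows "\<exists>D. has_grad UNIV p D"
proof -
  have "real_polynomial_function (\<lambda>x. Re (p x))" "real_polynomial_function (\<lambda>x. Im (p x))"
    using assms bounded_linear_Re bounded_linear_Im by (auto simp: polynomial_function_def o_def)
  then obtain A B where "has_grad UNIV (\<lambda>x. Re (p x)) A" "has_grad UNIV (\<lambda>x. Im (p x)) B"
    using real_polynomial_has_grad by blast
  from has_grad_add[OF has_grad_of_real[OF this(1)] has_grad_cmult[OF has_grad_of_real[OF this(2)], of \<i>]]
  show ?thesis by (auto simp: complex_eq[symmetric])
qed

lemma compact_in_ball: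
  fixes x :: "real^3"
  assumes "compact K" "K \<subseteq> ball x r" "0 < r"
  obtains r1 where "0 < r1" "r1 < r" "K \<subseteq> cball x r1"
proof (cases "K = {}")
  case True then show ?thesis using that[of "r/2"] assms(3) by auto
next
  case False
  have "continuous_on K (\<lambda>y. dist x y)" by (intro continuous_intros)
  from continuous_attains_sup[OF assms(1) False this]
  obtain y where y: "y \<in> K" "\<forall>z\<in>K. dist x z \<le> dist x y" by auto
  have "dist x y < r" using y(1) assms(2) by auto
  moreover have "K \<subseteq> cball x (max (dist x y) (r/2))" using y(2) by force
  ultimately show ?thesis using that[of "max (dist x y) (r/2)"] assms(3) by simp
qed

text \<open>The factor \<open>g'(\<rho>) D\<^sub>j\<rho>\<close> may concentrate near a level set of \<open>\<rho>\<close>. As it is the derivative of \<open>g(\<rho>)\<close>,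
  integration by parts leaves a bound in terms of \<open>sup |g|\<close> alone. This replaces estimates of the area of level sets.\<close>

lemma level_set_integral_bound:
  assumes \<psi>: "test_fun U \<psi> D" and U: "open U" and \<rho>: "has_grad U \<rho> D\<rho>"
    and g: "\<And>t. (g has_real_derivative g' t) (at t)" "continuous_on UNIV g'" "\<And>t. \<bar>g t\<bar> \<le> B"
  shows "norm (integral\<^sup>L lborel (\<lambda>x. \<psi> x * of_real (D\<rho> j x * g' (\<rho> x)))) \<le> B * integral\<^sup>L lborel (\<lambda>x. norm (D j x))"
proof -
  have gr: "has_grad U (\<lambda>x. of_real (g (\<rho> x)) :: complex) (\<lambda>j x. of_real (D\<rho> j x * g' (\<rho> x)))"
    using has_grad_of_real[OF has_grad_compose[OF \<rho>, of UNIV g g']] g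
    by (simp add: has_real_derivative_iff_has_vector_derivative)
  have "integrable lborel (\<lambda>x. D j x * 1)" by (rule test_fun_integrable[OF \<psi>]) auto
  then have i: "integrable lborel (\<lambda>x. norm (D j x))" by simp
  have "norm (integral\<^sup>L lborel (\<lambda>x. \<psi> x * of_real (D\<rho> j x * g' (\<rho> x)))) =
      norm (integral\<^sup>L lborel (\<lambda>x. D j x * of_real (g (\<rho> x))))"
    using integral_by_parts[OF \<psi> U gr, of j] by simp
  also have "\<dots> \<le> integral\<^sup>L lborel (\<lambda>x. norm (D j x) * B)"
  proof (rule Bochner_Integration.integral_norm_bound_integral)
    show "integrable lborel (\<lambda>x. D j x * of_real (g (\<rho> x)))"
      by (rule test_fun_integrable[OF \<psi> has_grad_continuous[OF gr]])
    show "integrable lborel (\<lambda>x. norm (D j x) * B)" using i by simp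
    show "norm (D j x * of_real (g (\<rho> x))) \<le> norm (D j x) * B" for x
      using g(3) by (simp add: norm_mult mult_left_mono)
  qed
  finally show ?thesis by (simp add: mult.commute)
qed

text \<open>An even function that vanishes for \<open>|t| \<le> \<epsilon>\<close> and equals \<open>1\<close> for \<open>|t| \<ge> 2 \<epsilon>\<close>; \<open>away \<epsilon> (\<rho> x)\<close> cuts out a
  neighbourhood of the surface \<open>\<rho> = 0\<close>.\<close>

definition away :: "real \<Rightarrow> real \<Rightarrow> real" where
  "away \<epsilon> t = (1 - cut \<epsilon> (2*\<epsilon>) t) + (1 - cut \<epsilon> (2*\<epsilon>) (-t))"

definition away' :: "real \<Rightarrow> real \<Rightarrow> real" where
  "away' \<epsilon> t = cut' \<epsilon> (2*\<epsilon>) (-t) - cut' \<epsilon> (2*\<epsilon>) t"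

lemma away_deriv:
  assumes "\<epsilon> > 0"
  shows "(away \<epsilon> has_real_derivative away' \<epsilon> t) (at t)"
proof -
  have e: "\<epsilon> < 2*\<epsilon>" using assms by simp
  have m: "((\<lambda>t. cut \<epsilon> (2*\<epsilon>) (-t)) has_real_derivative cut' \<epsilon> (2*\<epsilon>) (-t) * (-1)) (at t)"
    by (rule DERIV_chain2[OF cut_deriv[OF e]]) (auto intro!: derivative_eq_intros)
  show ?thesis unfolding away_def[abs_def] away'_def
    by (rule derivative_eq_intros cut_deriv[OF e] m | simp)+
qed

text \<open>The last bound has the derivative of \<open>5 \<epsilon> arctan (t / \<epsilon>)\<close> on its right side, so that
  the bound on level sets above makes the integral of \<open>1 - away \<epsilon> \<circ> \<rho>\<close> of order \<open>\<epsilon>\<close>.\<close>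

lemma away_values:
  assumes "\<epsilon> > 0"
  shows "\<bar>t\<bar> \<le> \<epsilon> \<Longrightarrow> away \<epsilon> t = 0" "\<bar>t\<bar> \<ge> 2 * \<epsilon> \<Longrightarrow> away \<epsilon> t = 1" "\<bar>away \<epsilon> t\<bar> \<le> 1"
    "\<bar>t\<bar> \<le> \<epsilon> \<Longrightarrow> away' \<epsilon> t = 0" "\<bar>1 - away \<epsilon> t\<bar> \<le> 5 / (1 + (t/\<epsilon>)\<^sup>2)"
proof -
  have e: "\<epsilon> < 2*\<epsilon>" using assms by simp
  note c = cut_values[OF e]
  show z: "\<bar>t\<bar> \<le> \<epsilon> \<Longrightarrow> away \<epsilon> t = 0" for t using c(1)[of t] c(1)[of "-t"] by (auto simp: away_def)
  show one: "\<bar>t\<bar> \<ge> 2 * \<epsilon> \<Longrightarrow> away \<epsilon> t = 1" for t 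
    using assms c(1)[of t] c(1)[of "-t"] c(2)[of t] c(2)[of "-t"] by (cases "t \<ge> 0") (auto simp: away_def)
  show "\<bar>t\<bar> \<le> \<epsilon> \<Longrightarrow> away' \<epsilon> t = 0" using c(5)[of t] c(5)[of "-t"] by (auto simp: away'_def abs_le_iff)
  have r: "0 \<le> away \<epsilon> t \<and> away \<epsilon> t \<le> 1"
    using assms c(1)[of t] c(1)[of "-t"] c(3,4)[of t] c(3,4)[of "-t"] by (cases "t \<ge> 0") (auto simp: away_def)
  then show "\<bar>away \<epsilon> t\<bar> \<le> 1" by simp
  show "\<bar>1 - away \<epsilon> t\<bar> \<le> 5 / (1 + (t/\<epsilon>)\<^sup>2)"
  proof (cases "\<bar>t\<bar> \<ge> 2 * \<epsilon>")
    case True then show ?thesis using one by simp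
  next
    case False
    then have "\<bar>t/\<epsilon>\<bar> \<le> 2" using assms by (simp add: field_simps)
    then have "(t/\<epsilon>)\<^sup>2 \<le> 2\<^sup>2" by (metis abs_le_square_iff abs_numeral)
    moreover have "0 < 1 + (t/\<epsilon>)\<^sup>2" by (simp add: add_pos_nonneg)
    ultimately have "1 \<le> 5 / (1 + (t/\<epsilon>)\<^sup>2)" by (simp add: pos_le_divide_eq del: power_divide)
    then show ?thesis using r by linarith
  qed
qed

text \<open>The odd counterpart of \<open>away\<close>: it is bounded by \<open>1\<close>, and its derivative dominates \<open>|away'|\<close>.\<close>

definition sgn_approx :: "real \<Rightarrow> real \<Rightarrow> real" where
  "sgn_approx \<epsilon> t = cut \<epsilon> (2*\<epsilon>) (-t) - cut \<epsilon> (2*\<epsilon>) t"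

definition sgn_approx' :: "real \<Rightarrow> real \<Rightarrow> real" where
  "sgn_approx' \<epsilon> t = - cut' \<epsilon> (2*\<epsilon>) (-t) - cut' \<epsilon> (2*\<epsilon>) t"

lemma sgn_approx:
  assumes "\<epsilon> > 0"
  shows "(sgn_approx \<epsilon> has_real_derivative sgn_approx' \<epsilon> t) (at t)" "\<bar>sgn_approx \<epsilon> t\<bar> \<le> 1"
    "\<bar>away' \<epsilon> t\<bar> \<le> sgn_approx' \<epsilon> t" "continuous_on S (sgn_approx' \<epsilon>)" "continuous_on S (away' \<epsilon>)"
proof -
  have e: "\<epsilon> < 2*\<epsilon>" using assms by simp
  note c = cut_values[OF e]
  have m: "((\<lambda>t. cut \<epsilon> (2*\<epsilon>) (-t)) has_real_derivative cut' \<epsilon> (2*\<epsilon>) (-t) * (-1)) (at t)"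
    by (rule DERIV_chain2[OF cut_deriv[OF e]]) (auto intro!: derivative_eq_intros)
  show "(sgn_approx \<epsilon> has_real_derivative sgn_approx' \<epsilon> t) (at t)"
    unfolding sgn_approx_def[abs_def] sgn_approx'_def
    by (rule derivative_eq_intros cut_deriv[OF e] m | simp)+
  show "\<bar>sgn_approx \<epsilon> t\<bar> \<le> 1" using c(3,4)[of t] c(3,4)[of "-t"] by (auto simp: sgn_approx_def)
  show "\<bar>away' \<epsilon> t\<bar> \<le> sgn_approx' \<epsilon> t" using c(6)[of t] c(6)[of "-t"] by (auto simp: away'_def sgn_approx'_def)
  have "continuous_on S (\<lambda>t. cut' \<epsilon> (2*\<epsilon>) (-t))"
    by (rule continuous_on_compose2[OF continuous_cut'[OF e, of UNIV]]) (auto intro!: continuous_intros)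
  then show "continuous_on S (sgn_approx' \<epsilon>)" "continuous_on S (away' \<epsilon>)"
    unfolding sgn_approx'_def[abs_def] away'_def[abs_def]
    by (auto intro!: continuous_intros continuous_cut'[OF e])
qed

text \<open>If \<open>d\<close> keeps the sign \<open>s\<close>, then so does the integrand \<open>z d g\<close>, and the integral of its modulus is the modulus of its integral.\<close>

lemma signed_norm:
  fixes s d g :: real and z :: complex
  assumes "\<bar>s\<bar> = 1" "\<bar>d\<bar> = s * d" "g \<ge> 0" "z = of_real (norm z)"
  shows "z * of_real (d * g) = of_real s * of_real (norm (z * of_real (d * g)))"
proof -
  have ss: "s * s = 1" using assms(1) by (metis abs_mult_self_eq mult_1)
  have "norm (z * of_real (d * g)) = norm z * (s * d) * g"
    using assms(2,3) by (simp add: norm_mult abs_mult)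
  then have "s * norm (z * of_real (d * g)) = norm z * (d * g)"
  proof -
    have "s * (norm z * (s * d) * g) = (s * s) * (norm z * (d * g))" by algebra
    then show ?thesis using ss \<open>norm (z * _) = _\<close> by simp
  qed
  then have "of_real s * of_real (norm (z * of_real (d * g))) = complex_of_real (norm z) * of_real (d * g)"
    by (metis of_real_mult)
  then show ?thesis using assms(4) by simp
qed

text \<open>The divergence theorem across the surface \<open>\<rho> = 0\<close>. A test function \<open>\<phi>\<close> is multiplied by \<open>away \<epsilon> \<circ> \<rho>\<close>; the product
  has its support off the surface, where \<open>V\<close> is weakly divergence free. The product rule gives two integrals.
  The one with \<open>away \<epsilon> (\<rho>) (\<nabla>\<phi> \<bullet> V)\<close> tends to the integral in question. The other one is the integral of
  \<open>away' \<epsilon> (\<rho>) G\<close> with \<open>G = \<phi> (\<nabla>\<rho> \<bullet> V)\<close>, and \<open>G\<close> extends continuously across the surface because the normal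
  components match. With \<open>h = G / D\<^sub>j\<rho>\<close> it is the integral of \<open>h D\<^sub>j (away \<epsilon> \<circ> \<rho>)\<close>. Here \<open>away\<close> is even, so
  \<open>away \<epsilon> \<circ> \<rho>\<close> tends to \<open>1\<close> on both sides; hence the integral tends to that of \<open>- D\<^sub>jh\<close>, which is zero, if \<open>h\<close> is
  differentiable, and a continuous \<open>h\<close> is approximated uniformly by polynomials.

  The value \<open>V = 0\<close> on the surface makes \<open>away \<epsilon> (\<rho>) V\<close> converge to \<open>V\<close> at every point.\<close>

lemma weak_div_free_interface:
  assumes U: "open U" "x0 \<in> U" and \<rho>: "has_grad U \<rho> D\<rho>" and j: "D\<rho> j x0 \<noteq> (0::real)"
    and Vp: "continuous_on {x\<in>U. \<rho> x \<ge> 0} Vp" and Vm: "continuous_on {x\<in>U. \<rho> x \<le> 0} Vm"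
    and pos: "\<And>x. x \<in> U \<Longrightarrow> \<rho> x > 0 \<Longrightarrow> V x = Vp x"
    and neg: "\<And>x. x \<in> U \<Longrightarrow> \<rho> x < 0 \<Longrightarrow> V x = Vm x"
    and zero: "\<And>x. x \<in> U \<Longrightarrow> \<rho> x = 0 \<Longrightarrow> V x = 0"
    and off: "weak_div_free {x\<in>U. \<rho> x \<noteq> 0} V"
    and match: "\<And>x. x \<in> U \<Longrightarrow> \<rho> x = 0 \<Longrightarrow>
       (\<Sum>i\<in>UNIV. of_real (D\<rho> i x) * Vp x $ i) = (\<Sum>i\<in>UNIV. of_real (D\<rho> i x) * Vm x $ i)"
  shows "\<exists>r>0. weak_div_free (ball x0 r) V"
proof -
  define s where "s = sgn (D\<rho> j x0)"
  have s: "\<bar>s\<bar> = 1" "s * D\<rho> j x0 > 0" using j by (auto simp: s_def sgn_real_def)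
  have cj: "continuous_on U (\<lambda>x. s * D\<rho> j x)"
    using has_grad_continuous_deriv[OF \<rho>] by (intro continuous_intros)
  define c where "c = s * D\<rho> j x0 / 2"
  have c: "c > 0" using s by (simp add: c_def)
  have "open (U \<inter> (\<lambda>x. s * D\<rho> j x) -` {c<..})"
    using cj U by (intro continuous_open_preimage) auto
  moreover have "x0 \<in> U \<inter> (\<lambda>x. s * D\<rho> j x) -` {c<..}" using U s by (simp add: c_def)
  ultimately obtain r where r: "r > 0" "ball x0 r \<subseteq> U \<inter> (\<lambda>x. s * D\<rho> j x) -` {c<..}"
    by (meson openE)
  define B where "B = ball x0 r"
  have B: "open B" "B \<subseteq> U" "\<And>x. x \<in> B \<Longrightarrow> s * D\<rho> j x > c"
    using r by (auto simp: B_def)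
  have abs_j: "\<bar>D\<rho> j x\<bar> = s * D\<rho> j x" if "x \<in> B" for x
  proof -
    have "\<bar>D\<rho> j x\<bar> = \<bar>s * D\<rho> j x\<bar>" using s(1) by (simp add: abs_mult)
    then show ?thesis using B(3)[OF that] c by simp
  qed
  note \<rho>B = has_grad_subset[OF \<rho> B(2)]
  have c\<rho>: "continuous_on U \<rho>" by (rule has_grad_continuous[OF \<rho>])
  define N where "N x = (if \<rho> x \<le> 0 then \<Sum>i\<in>UNIV. of_real (D\<rho> i x) * Vm x $ i
     else \<Sum>i\<in>UNIV. of_real (D\<rho> i x) * Vp x $ i)" for x
  have cN: "continuous_on U N"
    unfolding N_def
  proof (rule continuous_on_cases_le)
    show "continuous_on {x \<in> U. \<rho> x \<le> 0} (\<lambda>x. \<Sum>i\<in>UNIV. of_real (D\<rho> i x) * Vm x $ i)"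
      using Vm has_grad_continuous_deriv[OF \<rho>]
      by (intro continuous_intros) (auto intro: continuous_on_subset)
    show "continuous_on {x \<in> U. 0 \<le> \<rho> x} (\<lambda>x. \<Sum>i\<in>UNIV. of_real (D\<rho> i x) * Vp x $ i)"
      using Vp has_grad_continuous_deriv[OF \<rho>]
      by (intro continuous_intros) (auto intro: continuous_on_subset)
  qed (use c\<rho> match in auto)
  have "weak_div_free B V" unfolding weak_div_free_def
  proof (intro allI impI)
    fix \<phi> D assume \<phi>: "test_fun B \<phi> D"
    obtain K where K: "compact K" "K \<subseteq> B" "\<And>x. x \<notin> K \<Longrightarrow> \<phi> x = 0" "\<And>x j. x \<notin> K \<Longrightarrow> D j x = 0"
      and g\<phi>: "has_grad UNIV \<phi> D"
      using test_funE[OF \<phi>] by metis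
    obtain r1 where r1: "0 < r1" "r1 < r" "K \<subseteq> cball x0 r1"
      using compact_in_ball[OF K(1) _ r(1)] K(2) B_def by metis
    define r2 where "r2 = (r1 + r) / 2"
    define r3 where "r3 = (r2 + r) / 2"
    have r23: "r1 < r2" "r2 < r3" "r3 < r" using r1 by (auto simp: r2_def r3_def)
    define \<psi> where "\<psi> = bump x0 (r1\<^sup>2) (r2\<^sup>2)"
    define D\<psi> where "D\<psi> = dbump x0 (r1\<^sup>2) (r2\<^sup>2)"
    define \<zeta> where "\<zeta> = bump x0 (r2\<^sup>2) (r3\<^sup>2)"
    define D\<zeta> where "D\<zeta> = dbump x0 (r2\<^sup>2) (r3\<^sup>2)"
    have sq: "r1\<^sup>2 < r2\<^sup>2" "r2\<^sup>2 < r3\<^sup>2" using r23 r1 by (auto intro!: power_strict_mono)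
    have \<psi>: "test_fun B \<psi> D\<psi>" unfolding \<psi>_def D\<psi>_def
      by (rule test_fun_bump[OF sq(1), of _ r2]) (use r23 r1 in \<open>auto simp: B_def\<close>)
    have \<zeta>: "test_fun B \<zeta> D\<zeta>" unfolding \<zeta>_def D\<zeta>_def
      by (rule test_fun_bump[OF sq(2), of _ r3]) (use r23 r1 in \<open>auto simp: B_def\<close>)
    have \<psi>1: "\<psi> x = 1" if "x \<in> K" for x
    proof -
      have "norm (x - x0) \<le> r1" using that r1(3) by (auto simp: dist_norm norm_minus_commute)
      then have "(norm (x - x0))\<^sup>2 \<le> r1\<^sup>2" by (intro power_mono) auto
      then show ?thesis using cut_values[OF sq(1)] by (simp add: \<psi>_def bump_def)
    qed
    have \<psi>0: "\<psi> x = 0" if "x \<notin> cball x0 r2" for x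
    proof -
      have "norm (x - x0) \<ge> r2" using that by (auto simp: dist_norm norm_minus_commute)
      then have "(norm (x - x0))\<^sup>2 \<ge> r2\<^sup>2" using r1 r23 by (intro power_mono) auto
      then show ?thesis using cut_values[OF sq(1)] by (simp add: \<psi>_def bump_def)
    qed
    have \<zeta>1: "\<zeta> x = 1" if "x \<in> cball x0 r2" for x
    proof -
      have "norm (x - x0) \<le> r2" using that by (auto simp: dist_norm norm_minus_commute)
      then have "(norm (x - x0))\<^sup>2 \<le> r2\<^sup>2" by (intro power_mono) auto
      then show ?thesis using cut_values[OF sq(2)] by (simp add: \<zeta>_def bump_def)
    qed
    have \<psi>r: "\<psi> x = of_real (norm (\<psi> x))" "norm (\<psi> x) \<le> 1" for x
      using cut_values[OF sq(1)] by (auto simp: \<psi>_def bump_def)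
    have \<zeta>r: "\<zeta> x = of_real (norm (\<zeta> x))" for x
      using cut_values[OF sq(2)] by (auto simp: \<zeta>_def bump_def)
    define h where "h x = \<phi> x * N x / of_real (D\<rho> j x)" for x
    have cB: "continuous_on B N" "continuous_on B (D\<rho> i)" "continuous_on B \<phi>" for i
      using cN has_grad_continuous_deriv[OF \<rho>] has_grad_continuous[OF g\<phi>] B(2)
      by (auto intro: continuous_on_subset)
    have "D\<rho> j x \<noteq> 0" if "x \<in> B" for x using B(3)[OF that] c by auto
    then have ch: "continuous_on B h" unfolding h_def
      using cB by (intro continuous_intros) auto
    define I where "I \<epsilon> = integral\<^sup>L lborel (\<lambda>x. \<phi> x * (of_real (away' \<epsilon> (\<rho> x)) * N x))" for \<epsilon>
    have grad_away: "has_grad B (\<lambda>x. of_real (away \<epsilon> (\<rho> x)) :: complex) (\<lambda>j x. of_real (D\<rho> j x * away' \<epsilon> (\<rho> x)))"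
      if "\<epsilon> > 0" for \<epsilon>
      using has_grad_of_real[OF has_grad_compose[OF \<rho>B, of UNIV "away \<epsilon>" "away' \<epsilon>"]] away_deriv[OF that] sgn_approx(5)[OF that]
      by (simp add: has_real_derivative_iff_has_vector_derivative)
    have cont_away': "continuous_on B (\<lambda>x. of_real (away' \<epsilon> (\<rho> x)) :: complex)" if "\<epsilon> > 0" for \<epsilon>
      using sgn_approx(5)[OF that, of UNIV] has_grad_continuous[OF \<rho>B]
      by (intro continuous_intros) (auto intro: continuous_on_compose2)
    \<comment> \<open>The polynomial \<open>P\<close> replaces \<open>h\<close>; the error \<open>\<delta>\<close> is multiplied by an integral of \<open>|away'|\<close> that stays bounded.\<close>
    have I0: "\<forall>\<^sub>F n in sequentially. norm (I (inverse (real (Suc n)))) < e" if e: "e > 0" for e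
    proof -
      define C where "C = integral\<^sup>L lborel (\<lambda>x. norm (D\<psi> j x))"
      have C: "C \<ge> 0" by (simp add: C_def)
      define \<delta> where "\<delta> = e / (2 * (C + 1))"
      have \<delta>: "\<delta> > 0" using e C by (simp add: \<delta>_def)
      have "\<exists>g. polynomial_function g \<and> (\<forall>x \<in> cball x0 r2. norm (h x - g x) < \<delta>)"
        by (rule Stone_Weierstrass_polynomial_function[OF compact_cball _ \<delta>])
           (rule continuous_on_subset[OF ch], use r23 in \<open>auto simp: B_def\<close>)
      then obtain P where P: "polynomial_function P" "\<And>x. x \<in> cball x0 r2 \<Longrightarrow> norm (h x - P x) < \<delta>" by blast
      obtain DP where DP: "has_grad UNIV P DP" using polynomial_has_grad[OF P(1)] by blast
      define \<Psi> where "\<Psi> x = \<psi> x * P x" for x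
      define D\<Psi> where "D\<Psi> j x = D\<psi> j x * P x + \<psi> x * DP j x" for j x
      have \<Psi>: "test_fun B \<Psi> D\<Psi>"
        unfolding \<Psi>_def[abs_def] D\<Psi>_def[abs_def]
        by (rule test_fun_mult_right[OF \<psi> B(1) has_grad_subset[OF DP]]) simp
      have D\<Psi>0: "D\<Psi> i x = 0" if "x \<notin> cball x0 r2" for i x
        by (rule has_grad_zero_deriv[of UNIV \<Psi> D\<Psi> "- cball x0 r2"])
           (use \<Psi> \<psi>0 that in \<open>auto simp: test_fun_def \<Psi>_def\<close>)
      have "bounded (D\<Psi> j ` cball x0 r2)"
        using \<Psi> by (intro compact_imp_bounded compact_continuous_image)
           (auto simp: test_fun_def has_grad_def intro: continuous_on_subset)
      then obtain M0 where M0: "\<And>x. x \<in> cball x0 r2 \<Longrightarrow> norm (D\<Psi> j x) \<le> M0"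
        unfolding bounded_iff by blast
      define M where "M = max M0 0"
      have M: "norm (D\<Psi> j x) \<le> M * norm (\<zeta> x)" "M \<ge> 0" for x
        using M0[of x] \<zeta>1[of x] D\<Psi>0[of x j] by (cases "x \<in> cball x0 r2"; auto simp: M_def)+
      define C2 where "C2 = integral\<^sup>L lborel (\<lambda>x. norm (D\<zeta> j x))"
      have C2: "C2 \<ge> 0" by (simp add: C2_def)
      have bound: "norm (I \<epsilon>) \<le> \<delta> * C + M * (5 * \<epsilon> / c) * (pi/2 * C2)" if \<epsilon>: "\<epsilon> > 0" for \<epsilon>
      proof -
        define A where "A x = of_real (D\<rho> j x * away' \<epsilon> (\<rho> x)) * (h x - P x)" for x
        have cA: "continuous_on B A" unfolding A_def
          using cont_away'[OF \<epsilon>] cB ch has_grad_continuous[OF DP] 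
          by (simp, intro continuous_intros) (auto intro: continuous_on_subset)
        have split: "\<phi> x * (of_real (away' \<epsilon> (\<rho> x)) * N x) = \<psi> x * A x + \<Psi> x * of_real (D\<rho> j x * away' \<epsilon> (\<rho> x))" for x
        proof (cases "x \<in> K")
          case True
          then have "D\<rho> j x \<noteq> 0" using B(3)[of x] K(2) c by force
          then show ?thesis using \<psi>1[OF True] by (simp add: A_def h_def \<Psi>_def field_simps)
        next
          case False
          then show ?thesis using K(3) by (simp add: A_def h_def \<Psi>_def algebra_simps)
        qed
        have int1: "integrable lborel (\<lambda>x. \<psi> x * A x)" by (rule test_fun_integrable[OF \<psi> cA])
        have int2: "integrable lborel (\<lambda>x. \<Psi> x * of_real (D\<rho> j x * away' \<epsilon> (\<rho> x)))"
          by (rule test_fun_integrable[OF \<Psi> has_grad_continuous_deriv[OF grad_away[OF \<epsilon>]]])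
        have I_eq: "I \<epsilon> = integral\<^sup>L lborel (\<lambda>x. \<psi> x * A x) + integral\<^sup>L lborel (\<lambda>x. \<Psi> x * of_real (D\<rho> j x * away' \<epsilon> (\<rho> x)))"
          unfolding I_def split using int1 int2 by simp
        \<comment> \<open>\<open>|away'|\<close> is dominated by the derivative of the odd function \<open>sgn_approx\<close>, and \<open>D\<rho> j\<close> keeps its sign on \<open>B\<close>.\<close>
        let ?S = "\<lambda>x. \<psi> x * of_real (D\<rho> j x * sgn_approx' \<epsilon> (\<rho> x))"
        have cS: "continuous_on B (\<lambda>x. of_real (D\<rho> j x * sgn_approx' \<epsilon> (\<rho> x)) :: complex)"
          using sgn_approx(4)[OF \<epsilon>, of UNIV] has_grad_continuous[OF \<rho>B] cB
          by (intro continuous_intros) (auto intro: continuous_on_compose2)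
        have intS: "integrable lborel ?S" by (rule test_fun_integrable[OF \<psi> cS])
        have S_abs: "?S x = of_real s * of_real (norm (?S x))" for x
        proof (cases "x \<in> B")
          case True
          have "sgn_approx' \<epsilon> (\<rho> x) \<ge> 0" using sgn_approx(3)[OF \<epsilon>] abs_ge_zero order_trans by blast
          from signed_norm[OF s(1) abs_j[OF True] this \<psi>r(1)] show ?thesis .
        next
          case False
          then have "\<psi> x = 0" using \<psi>0 r23 by (auto simp: B_def)
          then show ?thesis by simp
        qed
        have "norm (integral\<^sup>L lborel (\<lambda>x. \<psi> x * A x)) \<le> integral\<^sup>L lborel (\<lambda>x. \<delta> * norm (?S x))"
        proof (rule Bochner_Integration.integral_norm_bound_integral[OF int1])
          show "integrable lborel (\<lambda>x. \<delta> * norm (?S x))" using intS by (intro integrable_mult_right integrable_norm)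
          fix x
          show "norm (\<psi> x * A x) \<le> \<delta> * norm (?S x)"
          proof (cases "x \<in> cball x0 r2")
            case True
            have "norm (A x) \<le> (\<bar>D\<rho> j x\<bar> * sgn_approx' \<epsilon> (\<rho> x)) * \<delta>"
            proof -
              have "\<bar>D\<rho> j x\<bar> * \<bar>away' \<epsilon> (\<rho> x)\<bar> \<le> \<bar>D\<rho> j x\<bar> * sgn_approx' \<epsilon> (\<rho> x)"
                using sgn_approx(3)[OF \<epsilon>] by (rule mult_left_mono) simp
              then have "norm (complex_of_real (D\<rho> j x * away' \<epsilon> (\<rho> x))) \<le> \<bar>D\<rho> j x\<bar> * sgn_approx' \<epsilon> (\<rho> x)"
                by (simp only: norm_of_real abs_mult)
              from mult_mono[OF this less_imp_le[OF P(2)[OF True]] order_trans[OF norm_ge_zero this] norm_ge_zero]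
              show ?thesis unfolding A_def by (simp only: norm_mult)
            qed
            moreover have "0 \<le> sgn_approx' \<epsilon> (\<rho> x)" using sgn_approx(3)[OF \<epsilon>] abs_ge_zero order_trans by blast
            moreover have "norm (?S x) = norm (\<psi> x) * (\<bar>D\<rho> j x\<bar> * sgn_approx' \<epsilon> (\<rho> x))"
              using calculation(2) by (simp add: norm_mult abs_mult)
            moreover have "norm (\<psi> x * A x) \<le> norm (\<psi> x) * (\<bar>D\<rho> j x\<bar> * sgn_approx' \<epsilon> (\<rho> x) * \<delta>)"
              unfolding norm_mult by (rule mult_left_mono[OF calculation(1)]) simp
            ultimately show ?thesis by (simp only: mult_ac)
          next
            case False
            then show ?thesis using \<psi>0 by simp
          qed
        qed
        also have "\<dots> = \<delta> * integral\<^sup>L lborel (\<lambda>x. norm (?S x))" by simp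
        also have "integral\<^sup>L lborel (\<lambda>x. norm (?S x)) = norm (integral\<^sup>L lborel ?S)"
        proof -
          have "integral\<^sup>L lborel ?S = integral\<^sup>L lborel (\<lambda>x. of_real s * of_real (norm (?S x)))"
            using S_abs by (rule Bochner_Integration.integral_cong[OF refl])
          also have "\<dots> = of_real s * of_real (integral\<^sup>L lborel (\<lambda>x. norm (?S x)))"
            by (simp del: norm_mult of_real_mult)
          finally show ?thesis using s(1) by (simp add: norm_mult)
        qed
        also have "\<dots> \<le> 1 * C" unfolding C_def
          by (rule level_set_integral_bound[OF \<psi> B(1) \<rho>B, of "sgn_approx \<epsilon>"])
             (use sgn_approx[OF \<epsilon>] in auto)
        finally have part1: "norm (integral\<^sup>L lborel (\<lambda>x. \<psi> x * A x)) \<le> \<delta> * C" using \<delta> by simp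
        \<comment> \<open>After integration by parts only \<open>1 - away\<close> remains, which the derivative of \<open>5 \<epsilon> arctan (t / \<epsilon>)\<close> dominates.\<close>
        define atn where "atn t = \<epsilon> * arctan (t / \<epsilon>)" for t
        define atn' where "atn' t = 1 / (1 + (t/\<epsilon>)\<^sup>2)" for t
        have dpos: "1 + (t/\<epsilon>)\<^sup>2 > 0" for t :: real by (simp add: add_pos_nonneg)
        have at1: "(atn has_real_derivative atn' t) (at t)" for t
        proof -
          have "((\<lambda>t. t / \<epsilon>) has_real_derivative 1 / \<epsilon>) (at t)"
            using \<epsilon> by (auto intro!: derivative_eq_intros)
          from DERIV_cmult[OF DERIV_chain2[OF DERIV_arctan this], of \<epsilon>]
          show ?thesis unfolding atn_def[abs_def] atn'_def using \<epsilon> by (simp add: inverse_eq_divide)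
        qed
        have at2: "continuous_on UNIV atn'"
          unfolding atn'_def[abs_def] using dpos \<epsilon> by (intro continuous_intros) (metis less_irrefl)+
        have at3: "\<bar>atn t\<bar> \<le> \<epsilon> * (pi/2)" for t
        proof -
          have "\<bar>arctan (t/\<epsilon>)\<bar> \<le> pi/2" using arctan_bounded[of "t/\<epsilon>"] by linarith
          then show ?thesis using \<epsilon> mult_left_mono[of "\<bar>arctan (t/\<epsilon>)\<bar>" "pi/2" \<epsilon>] by (simp add: atn_def abs_mult)
        qed
        have at4: "atn' t \<ge> 0" for t using dpos[of t] by (simp add: atn'_def)
        let ?T = "\<lambda>x. \<zeta> x * of_real (D\<rho> j x * atn' (\<rho> x))"
        have cT: "continuous_on B (\<lambda>x. of_real (D\<rho> j x * atn' (\<rho> x)) :: complex)"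
          using at2 has_grad_continuous[OF \<rho>B] cB
          by (intro continuous_intros) (auto intro: continuous_on_compose2)
        have intT: "integrable lborel ?T" by (rule test_fun_integrable[OF \<zeta> cT])
        have \<zeta>0: "\<zeta> x = 0" if "x \<notin> B" for x
        proof -
          have "norm (x - x0) \<ge> r3" using that r23 by (auto simp: B_def dist_norm norm_minus_commute)
          then have "(norm (x - x0))\<^sup>2 \<ge> r3\<^sup>2" using r1 r23 by (intro power_mono) auto
          then show ?thesis using cut_values[OF sq(2)] by (simp add: \<zeta>_def bump_def)
        qed
        have T_abs: "?T x = of_real s * of_real (norm (?T x))" for x
        proof (cases "x \<in> B")
          case True
          from signed_norm[OF s(1) abs_j[OF True] at4 \<zeta>r] show ?thesis .
        qed (use \<zeta>0 in simp)
        have e2: "integral\<^sup>L lborel (\<lambda>x. \<Psi> x * of_real (D\<rho> j x * away' \<epsilon> (\<rho> x))) =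
            integral\<^sup>L lborel (\<lambda>x. D\<Psi> j x * (1 - of_real (away \<epsilon> (\<rho> x))))"
        proof -
          have "integrable lborel (\<lambda>x. D\<Psi> j x * 1)" "integrable lborel (\<lambda>x. D\<Psi> j x * of_real (away \<epsilon> (\<rho> x)))"
            by (rule test_fun_integrable[OF \<Psi>], simp)
               (rule test_fun_integrable[OF \<Psi> has_grad_continuous[OF grad_away[OF \<epsilon>]]])
          moreover have "integral\<^sup>L lborel (D\<Psi> j) = 0"
            using \<Psi> by (elim test_funE) (rule integral_partial_eq_0)
          ultimately show ?thesis
            using integral_by_parts[OF \<Psi> B(1) grad_away[OF \<epsilon>], of j] by (simp add: right_diff_distrib)
        qed
        have "norm (integral\<^sup>L lborel (\<lambda>x. D\<Psi> j x * (1 - of_real (away \<epsilon> (\<rho> x)))))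
            \<le> integral\<^sup>L lborel (\<lambda>x. (5 * M / c) * norm (?T x))"
        proof (rule Bochner_Integration.integral_norm_bound_integral)
          show "integrable lborel (\<lambda>x. D\<Psi> j x * (1 - of_real (away \<epsilon> (\<rho> x))))"
            by (rule test_fun_integrable[OF \<Psi>])
               (use has_grad_continuous[OF grad_away[OF \<epsilon>]] in \<open>auto intro!: continuous_intros\<close>)
          show "integrable lborel (\<lambda>x. (5 * M / c) * norm (?T x))"
            using intT by (intro integrable_mult_right integrable_norm)
          fix x
          show "norm (D\<Psi> j x * (1 - of_real (away \<epsilon> (\<rho> x)))) \<le> (5 * M / c) * norm (?T x)"
          proof (cases "x \<in> B")
            case True
            have a: "norm (1 - complex_of_real (away \<epsilon> (\<rho> x))) \<le> 5 * atn' (\<rho> x)"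
            proof -
              have "norm (complex_of_real (1 - away \<epsilon> (\<rho> x))) \<le> 5 * atn' (\<rho> x)"
                using away_values(5)[OF \<epsilon>, of "\<rho> x"] unfolding norm_of_real atn'_def by simp
              then show ?thesis by simp
            qed
            have b: "1 \<le> \<bar>D\<rho> j x\<bar> / c" using B(3)[OF True] abs_j[OF True] c by simp
            have "norm (D\<Psi> j x * (1 - of_real (away \<epsilon> (\<rho> x)))) \<le> (M * norm (\<zeta> x)) * (5 * atn' (\<rho> x))"
              unfolding norm_mult using M a by (intro mult_mono) auto
            also have "\<dots> \<le> (M * norm (\<zeta> x)) * (5 * atn' (\<rho> x)) * (\<bar>D\<rho> j x\<bar> / c)"
              using mult_left_mono[OF b, of "(M * norm (\<zeta> x)) * (5 * atn' (\<rho> x))"] M(2) at4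
              by (simp only: mult_1_right mult_nonneg_nonneg norm_ge_zero zero_le_numeral)
            also have "\<dots> = (5 * M / c) * norm (?T x)"
              using at4 by (simp add: norm_mult abs_mult)
            finally show ?thesis .
          next
            case False
            then have "D\<Psi> j x = 0" using D\<Psi>0 r23 by (auto simp: B_def)
            then show ?thesis using M(2) c by simp
          qed
        qed
        also have "\<dots> = (5 * M / c) * integral\<^sup>L lborel (\<lambda>x. norm (?T x))" by simp
        also have "integral\<^sup>L lborel (\<lambda>x. norm (?T x)) = norm (integral\<^sup>L lborel ?T)"
        proof -
          have "integral\<^sup>L lborel ?T = integral\<^sup>L lborel (\<lambda>x. of_real s * of_real (norm (?T x)))"
            using T_abs by (rule Bochner_Integration.integral_cong[OF refl])
          also have "\<dots> = of_real s * of_real (integral\<^sup>L lborel (\<lambda>x. norm (?T x)))"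
            by (simp del: norm_mult of_real_mult)
          finally show ?thesis using s(1) by (simp add: norm_mult)
        qed
        also have "(5 * M / c) * \<dots> \<le> (5 * M / c) * (\<epsilon> * (pi/2) * C2)" 
          unfolding C2_def
          by (intro mult_left_mono level_set_integral_bound[OF \<zeta> B(1) \<rho>B, of atn] at1 at2 at3) (use M c in auto)
        finally have part2: "norm (integral\<^sup>L lborel (\<lambda>x. D\<Psi> j x * (1 - of_real (away \<epsilon> (\<rho> x)))))
            \<le> (5 * M / c) * (\<epsilon> * (pi/2) * C2)" .
        have "norm (I \<epsilon>) \<le> \<delta> * C + (5 * M / c) * (\<epsilon> * (pi/2) * C2)"
          unfolding I_eq e2 by (rule norm_triangle_le[OF add_mono[OF part1 part2]])
        then show ?thesis by (simp add: mult_ac)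
      qed
      have "(\<lambda>n. \<delta> * C + M * (5 * inverse (real (Suc n)) / c) * (pi/2 * C2)) \<longlonglongrightarrow> \<delta> * C + M * (5 * 0 / c) * (pi/2 * C2)"
        using c by (intro tendsto_intros LIMSEQ_inverse_real_of_nat) auto
      moreover have "\<delta> * C + M * (5 * 0 / c) * (pi/2 * C2) < e"
        using e C by (simp add: \<delta>_def field_simps add_nonneg_pos)
      ultimately have "\<forall>\<^sub>F n in sequentially. \<delta> * C + M * (5 * inverse (real (Suc n)) / c) * (pi/2 * C2) < e"
        by (rule order_tendstoD)
      then show ?thesis
      proof eventually_elim
        case (elim n)
        have "inverse (real (Suc n)) > 0" by simp
        from bound[OF this] elim show ?case by linarith
      qed
    qed
    \<comment> \<open>The product rule for \<open>\<phi> (away \<circ> \<rho>)\<close>, which is a test function off the surface.\<close>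
    define X where "X x = (\<Sum>i\<in>UNIV. D i x * V x $ i)" for x
    define Y where "Y n x = of_real (away (inverse (real (Suc n))) (\<rho> x)) * X x" for n x
    have Y: "integrable lborel (Y n)" "integral\<^sup>L lborel (Y n) = - I (inverse (real (Suc n)))" for n
    proof -
      define \<epsilon> where "\<epsilon> = inverse (real (Suc n))"
      have \<epsilon>: "\<epsilon> > 0" by (simp add: \<epsilon>_def)
      let ?a = "\<lambda>x. complex_of_real (away \<epsilon> (\<rho> x))"
      let ?D = "\<lambda>j x. D j x * ?a x + \<phi> x * of_real (D\<rho> j x * away' \<epsilon> (\<rho> x))"
      have "test_fun B (\<lambda>x. \<phi> x * ?a x) ?D" by (rule test_fun_mult_right[OF \<phi> B(1) grad_away[OF \<epsilon>]])
      then have "has_grad UNIV (\<lambda>x. \<phi> x * ?a x) ?D" by (simp add: test_fun_def)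
      moreover have "closed (K \<inter> \<rho> -` {t. \<bar>t\<bar> \<ge> \<epsilon>})"
        using c\<rho> K(1,2) B(2) compact_imp_closed
        by (intro continuous_closed_preimage closed_Collect_le continuous_intros) (auto intro: continuous_on_subset)
      then have "compact (K \<inter> \<rho> -` {t. \<bar>t\<bar> \<ge> \<epsilon>})"
        using compact_Int_closed[OF K(1)] by (metis inf.left_idem)
      moreover have "K \<inter> \<rho> -` {t. \<bar>t\<bar> \<ge> \<epsilon>} \<subseteq> {x\<in>U. \<rho> x \<noteq> 0}" using K(2) B(2) \<epsilon> by auto
      moreover have "\<phi> x * ?a x = 0" if "x \<notin> K \<inter> \<rho> -` {t. \<bar>t\<bar> \<ge> \<epsilon>}" for x
        using that K(3)[of x] away_values(1)[OF \<epsilon>, of "\<rho> x"] by auto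
      ultimately have "test_fun {x\<in>U. \<rho> x \<noteq> 0} (\<lambda>x. \<phi> x * ?a x) ?D" unfolding test_fun_def by blast
      then have t: "integrable lborel (\<lambda>x. \<Sum>i\<in>UNIV. ?D i x * V x $ i)"
         "integral\<^sup>L lborel (\<lambda>x. \<Sum>i\<in>UNIV. ?D i x * V x $ i) = 0"
        using off unfolding weak_div_free_def by blast+
      have eq: "(\<Sum>i\<in>UNIV. ?D i x * V x $ i) = Y n x + \<phi> x * (of_real (away' \<epsilon> (\<rho> x)) * N x)" for x
      proof -
        have "\<phi> x * (of_real (away' \<epsilon> (\<rho> x)) * N x) = \<phi> x * (of_real (away' \<epsilon> (\<rho> x)) * (\<Sum>i\<in>UNIV. of_real (D\<rho> i x) * V x $ i))"
        proof (cases "x \<in> B \<and> \<rho> x \<noteq> 0")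
          case True
          then have "x \<in> U" using B(2) by auto
          then have "N x = (\<Sum>i\<in>UNIV. of_real (D\<rho> i x) * V x $ i)"
            using True pos[of x] neg[of x] by (cases "\<rho> x" "0::real" rule: linorder_cases) (auto simp: N_def)
          then show ?thesis by simp
        next
          case False
          then show ?thesis using K(2) K(3)[of x] away_values(4)[OF \<epsilon>, of "\<rho> x"] \<epsilon> by auto
        qed
        then show ?thesis unfolding Y_def \<epsilon>_def[symmetric]
          by (simp add: X_def sum_distrib_left sum_distrib_right sum.distrib[symmetric] algebra_simps)
      qed
      have i2: "integrable lborel (\<lambda>x. \<phi> x * (of_real (away' \<epsilon> (\<rho> x)) * N x))"
        by (rule test_fun_integrable[OF \<phi>]) (intro continuous_intros cont_away' \<epsilon> cB)
      have Yeq: "Y n = (\<lambda>x. (\<Sum>i\<in>UNIV. ?D i x * V x $ i) - \<phi> x * (of_real (away' \<epsilon> (\<rho> x)) * N x))"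
        using eq by (simp add: fun_eq_iff)
      show "integrable lborel (Y n)" unfolding Yeq by (rule Bochner_Integration.integrable_diff[OF t(1) i2])
      show "integral\<^sup>L lborel (Y n) = - I (inverse (real (Suc n)))"
        using Bochner_Integration.integral_diff[OF t(1) i2] t(2)
        unfolding Yeq I_def \<epsilon>_def[symmetric] by simp
    qed
    have side: "\<exists>b. \<forall>x\<in>K \<inter> \<rho> -` S. norm (\<Sum>i\<in>UNIV. D i x * W x $ i) \<le> b"
      if W: "continuous_on {x\<in>U. \<rho> x \<in> S} W" and "closed S" for W :: vfield and S
    proof -
      have "closed (K \<inter> \<rho> -` S)"
        using c\<rho> K(1,2) B(2) compact_imp_closed that(2)
        by (intro continuous_closed_preimage) (auto intro: continuous_on_subset)
      then have "compact (K \<inter> \<rho> -` S)"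
        using compact_Int_closed[OF K(1)] by (metis inf.left_idem)
      moreover have "continuous_on (K \<inter> \<rho> -` S) (\<lambda>x. \<Sum>i\<in>UNIV. D i x * W x $ i)"
        using continuous_on_subset[OF W, of "K \<inter> \<rho> -` S"] K(2) B(2)
          continuous_on_subset[OF has_grad_continuous_deriv[OF g\<phi>]]
        by (intro continuous_intros) auto
      ultimately have "bounded ((\<lambda>x. \<Sum>i\<in>UNIV. D i x * W x $ i) ` (K \<inter> \<rho> -` S))"
        by (intro compact_imp_bounded compact_continuous_image)
      then show ?thesis by (simp add: bounded_iff)
    qed
    obtain bp where bp: "\<forall>x\<in>K \<inter> \<rho> -` {0..}. norm (\<Sum>i\<in>UNIV. D i x * Vp x $ i) \<le> bp"
      using side[of "{0..}" Vp] Vp by auto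
    obtain bm where bm: "\<forall>x\<in>K \<inter> \<rho> -` {..0}. norm (\<Sum>i\<in>UNIV. D i x * Vm x $ i) \<le> bm"
      using side[of "{..0}" Vm] Vm by auto
    define b where "b = max 0 (max bp bm)"
    have b: "norm (X x) \<le> indicator K x *\<^sub>R b" for x
    proof (cases "x \<in> K")
      case True
      then have "x \<in> U" using K(2) B(2) by auto
      then show ?thesis
        using True bp bm pos[of x] neg[of x] zero[of x]
        by (cases "\<rho> x" "0::real" rule: linorder_cases) (auto simp: X_def b_def le_max_iff_disj)
    qed (use K in \<open>simp add: X_def\<close>)
    have lim: "(\<lambda>n. Y n x) \<longlonglongrightarrow> X x" for x
    proof (cases "x \<in> B \<and> \<rho> x \<noteq> 0")
      case True
      have "\<forall>\<^sub>F n in sequentially. inverse (real (Suc n)) < \<bar>\<rho> x\<bar> / 2"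
        using True by (intro order_tendstoD(2)[OF LIMSEQ_inverse_real_of_nat]) auto
      then have "\<forall>\<^sub>F n in sequentially. Y n x = X x"
      proof eventually_elim
        case (elim n)
        then show ?case using away_values(2)[of "inverse (real (Suc n))" "\<rho> x"] by (simp add: Y_def)
      qed
      then show ?thesis by (rule tendsto_eventually)
    next
      case False
      then have "X x = 0" using K(2) K(4)[of x] zero[of x] B(2) by (cases "x \<in> K") (auto simp: X_def)
      then show ?thesis by (simp add: Y_def)
    qed
    have mX: "X \<in> borel_measurable lborel"
      by (rule borel_measurable_LIMSEQ_metric[where f=Y]) (use Y(1) lim in auto)
    have intb: "integrable lborel (\<lambda>x. indicator K x *\<^sub>R b)" by (rule borel_integrable_compact[OF K(1)]) auto
    have YX: "norm (Y n x) \<le> norm (X x)" for n x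
      using away_values(3)[of "inverse (real (Suc n))"] by (simp add: Y_def norm_mult mult_left_le_one_le)
    have "integrable lborel X"
      by (rule Bochner_Integration.integrable_bound[OF intb mX]) (use b in \<open>auto intro: order_trans[OF _ abs_ge_self]\<close>)
    moreover have "(\<lambda>n. integral\<^sup>L lborel (Y n)) \<longlonglongrightarrow> integral\<^sup>L lborel X"
      by (rule integral_dominated_convergence[OF mX _ intb])
         (use Y(1) lim order_trans[OF YX b] in auto)
    moreover have "(\<lambda>n. integral\<^sup>L lborel (Y n)) \<longlonglongrightarrow> 0"
      unfolding Y(2) using I0 by (auto simp: tendsto_iff dist_norm)
    ultimately show "integrable lborel (\<lambda>x. \<Sum>i\<in>UNIV. D i x * V x $ i) \<and>
       integral\<^sup>L lborel (\<lambda>x. \<Sum>i\<in>UNIV. D i x * V x $ i) = 0"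
      unfolding X_def[abs_def] using LIMSEQ_unique by blast
  qed
  then show ?thesis using r(1) B_def by blast
qed


section \<open>Maxwell fields and transmission conditions\<close>

lemma bilinear_dot_3: "a \<bullet>\<^sub>c b = a$1 * b$1 + a$2 * b$2 + a$3 * b$3"
  by (simp add: bilinear_dot_def sum_3)

lemma cross_nth [simp]:
  "(a \<times>\<^sub>c b)$1 = a$2 * b$3 - a$3 * b$2"
  "(a \<times>\<^sub>c b)$2 = a$3 * b$1 - a$1 * b$3"
  "(a \<times>\<^sub>c b)$3 = a$1 * b$2 - a$2 * b$1"
  by (simp_all add: cross_def vector_3)

lemma vec3_eqI: "(a::'a^3)$1 = b$1 \<Longrightarrow> a$2 = b$2 \<Longrightarrow> a$3 = b$3 \<Longrightarrow> a = b"
  by (simp add: vec_eq_iff forall_3)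

text \<open>The curl in terms of component gradients: \<open>D i j\<close> stands for the derivative of the \<open>i\<close>-th component in direction \<open>j\<close>.\<close>

definition rot :: "(3 \<Rightarrow> 3 \<Rightarrow> real^3 \<Rightarrow> complex) \<Rightarrow> real^3 \<Rightarrow> complex^3" where
  "rot D x = vector [D 3 2 x - D 2 3 x, D 1 3 x - D 3 1 x, D 2 1 x - D 1 2 x]"

lemma rot_nth [simp]:
  "rot D x $ 1 = D 3 2 x - D 2 3 x" "rot D x $ 2 = D 1 3 x - D 3 1 x" "rot D x $ 3 = D 2 1 x - D 1 2 x"
  by (simp_all add: rot_def vector_3)

lemma has_grad_vec:
  fixes E :: vfield
  assumes "\<And>i. has_grad U (\<lambda>x. E x $ i) (D i)"
  shows "has_grad U E (\<lambda>j x. \<chi> i. D i j x)"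
proof -
  have bl: "bounded_linear (\<lambda>c::complex. axis i c :: complex^3)" for i
    by (rule linear_conv_bounded_linear[THEN iffD1], rule linearI) (auto simp: axis_def vec_eq_iff)
  have "has_grad U (\<lambda>x. \<Sum>i\<in>UNIV. axis i (E x $ i)) (\<lambda>j x. \<Sum>i\<in>UNIV. axis i (D i j x))"
    by (rule has_grad_sum) (rule has_grad_linear[OF bl assms])
  moreover have "(\<Sum>i\<in>UNIV. axis i (c i)) = (\<chi> i. c i)" for c :: "3 \<Rightarrow> complex"
    by (simp add: vec_eq_iff axis_def)
  ultimately show ?thesis by simp
qed

lemma curl_eq_rot:
  assumes "\<And>i. has_grad U (\<lambda>x. E x $ i) (D i)" "x \<in> U"
  shows "curl E x = rot D x"
  using has_grad_partial[OF has_grad_vec[OF assms(1)] assms(2)]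
  by (simp add: curl_def rot_def)

lemma has_grad_cross:
  assumes "\<And>i. has_grad U (\<lambda>x. A x $ i) (DA i)" "\<And>i. has_grad U (\<lambda>x. B x $ i) (DB i)"
  shows "has_grad U (\<lambda>x. (A x \<times>\<^sub>c B x) $ i)
     (\<lambda>j x. ((\<chi> m. DA m j x) \<times>\<^sub>c B x + A x \<times>\<^sub>c (\<chi> m. DB m j x)) $ i)"
proof -
  have *: "has_grad U (\<lambda>x. A x $ a * B x $ b - A x $ b * B x $ a)
     (\<lambda>j x. (DA a j x * B x $ b - DA b j x * B x $ a) + (A x $ a * DB b j x - A x $ b * DB a j x))" for a b
    using has_grad_diff[OF has_grad_mult[OF assms, of a b] has_grad_mult[OF assms, of b a]]
    by (simp add: algebra_simps)
  consider "i = 1" | "i = 2" | "i = 3" using exhaust_3 by blast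
  then show ?thesis by cases (use *[of 2 3] *[of 3 1] *[of 1 2] in simp_all)
qed

text \<open>The flux density of Lorentz reciprocity.\<close>

definition flux_field :: "vfield \<Rightarrow> vfield \<Rightarrow> vfield \<Rightarrow> vfield \<Rightarrow> vfield" where
  "flux_field E H E' H' x = E x \<times>\<^sub>c H' x - E' x \<times>\<^sub>c H x"

text \<open>Twice the identity \<open>div (A \<times> B) = curl A \<bullet> B - A \<bullet> curl B\<close>.\<close>

lemma flux_field_grad:
  assumes "\<And>i. has_grad U (\<lambda>x. E x $ i) (DE i)" "\<And>i. has_grad U (\<lambda>x. H x $ i) (DH i)"
    "\<And>i. has_grad U (\<lambda>x. E' x $ i) (DE' i)" "\<And>i. has_grad U (\<lambda>x. H' x $ i) (DH' i)"
  obtains DV where "\<And>i. has_grad U (\<lambda>x. flux_field E H E' H' x $ i) (DV i)"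
    "\<And>x. (\<Sum>i\<in>UNIV. DV i i x) = rot DE x \<bullet>\<^sub>c H' x - E x \<bullet>\<^sub>c rot DH' x - rot DE' x \<bullet>\<^sub>c H x + E' x \<bullet>\<^sub>c rot DH x"
proof -
  let ?DV = "\<lambda>i j x. ((\<chi> m. DE m j x) \<times>\<^sub>c H' x + E x \<times>\<^sub>c (\<chi> m. DH' m j x)) $ i
     - ((\<chi> m. DE' m j x) \<times>\<^sub>c H x + E' x \<times>\<^sub>c (\<chi> m. DH m j x)) $ i"
  have "has_grad U (\<lambda>x. flux_field E H E' H' x $ i) (?DV i)" for i
    unfolding flux_field_def vector_minus_component
    by (rule has_grad_diff[OF has_grad_cross[OF assms(1,4)] has_grad_cross[OF assms(3,2)]])
  moreover have "(\<Sum>i\<in>UNIV. ?DV i i x) = rot DE x \<bullet>\<^sub>c H' x - E x \<bullet>\<^sub>c rot DH' x - rot DE' x \<bullet>\<^sub>c H x + E' x \<bullet>\<^sub>c rot DH x" for x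
    by (simp add: sum_3 bilinear_dot_3 algebra_simps)
  ultimately show ?thesis by (rule that)
qed

text \<open>The Maxwell system without boundary behaviour; component gradients are exhibited because divergences of cross
  products are computed from them.\<close>

definition maxwell_C1 :: "complex \<Rightarrow> (real^3) set \<Rightarrow> vfield \<Rightarrow> vfield \<Rightarrow> bool" where
  "maxwell_C1 k U E H \<longleftrightarrow> open U \<and> (\<exists>DE DH. (\<forall>i. has_grad U (\<lambda>x. E x $ i) (DE i)) \<and>
     (\<forall>i. has_grad U (\<lambda>x. H x $ i) (DH i)) \<and>
     (\<forall>x\<in>U. rot DE x = (\<i> * k) *s H x \<and> rot DH x = - (\<i> * k) *s E x))"

lemma maxwell_C1E:
  assumes "maxwell_C1 k U E H"
  obtains DE DH where "open U" "\<And>i. has_grad U (\<lambda>x. E x $ i) (DE i)" "\<And>i. has_grad U (\<lambda>x. H x $ i) (DH i)"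
    "\<And>x. x \<in> U \<Longrightarrow> rot DE x = (\<i> * k) *s H x" "\<And>x. x \<in> U \<Longrightarrow> rot DH x = - (\<i> * k) *s E x"
  using assms unfolding maxwell_C1_def by blast

lemma maxwell_C1I:
  assumes "open U" "\<And>i. has_grad U (\<lambda>x. E x $ i) (DE i)" "\<And>i. has_grad U (\<lambda>x. H x $ i) (DH i)"
    "\<And>x. x \<in> U \<Longrightarrow> rot DE x = (\<i> * k) *s H x" "\<And>x. x \<in> U \<Longrightarrow> rot DH x = - (\<i> * k) *s E x"
  shows "maxwell_C1 k U E H"
  using assms unfolding maxwell_C1_def by blast

lemma maxwell_in_C1:
  assumes "maxwell_in k U E H" "open U"
  shows "maxwell_C1 k U E H"
proof (rule maxwell_C1I)
  have gE: "has_grad U E (\<lambda>j. partial j E)" and gH: "has_grad U H (\<lambda>j. partial j H)"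
    using C1_has_grad[OF assms(2)] assms(1) unfolding maxwell_in_def by blast+
  show "has_grad U (\<lambda>x. E x $ i) (\<lambda>j x. partial j E x $ i)" for i by (rule has_grad_component[OF gE])
  show "has_grad U (\<lambda>x. H x $ i) (\<lambda>j x. partial j H x $ i)" for i by (rule has_grad_component[OF gH])
  fix x assume "x \<in> U"
  then have "curl E x - (\<i> * k) *s H x = 0" "curl H x + (\<i> * k) *s E x = 0"
    using assms(1) unfolding maxwell_in_def by blast+
  moreover have "rot (\<lambda>i j x. partial j E x $ i) x = curl E x" "rot (\<lambda>i j x. partial j H x $ i) x = curl H x"
    by (simp_all add: curl_def rot_def)
  ultimately show "rot (\<lambda>i j x. partial j E x $ i) x = (\<i> * k) *s H x"
    "rot (\<lambda>i j x. partial j H x $ i) x = - (\<i> * k) *s E x"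
    by (simp_all add: eq_neg_iff_add_eq_0 vector_sneg_minus1[symmetric] vec_eq_iff)
qed fact

lemma maxwell_C1_subset: "maxwell_C1 k U E H \<Longrightarrow> open W \<Longrightarrow> W \<subseteq> U \<Longrightarrow> maxwell_C1 k W E H"
  unfolding maxwell_C1_def by (meson has_grad_subset subsetD)

lemma maxwell_C1_add:
  assumes "maxwell_C1 k U E H" "maxwell_C1 k U E' H'"
  shows "maxwell_C1 k U (\<lambda>x. E x + E' x) (\<lambda>x. H x + H' x)"
proof -
  obtain DE DH where 1: "open U" "\<And>i. has_grad U (\<lambda>x. E x $ i) (DE i)" "\<And>i. has_grad U (\<lambda>x. H x $ i) (DH i)"
    "\<And>x. x \<in> U \<Longrightarrow> rot DE x = (\<i> * k) *s H x" "\<And>x. x \<in> U \<Longrightarrow> rot DH x = - (\<i> * k) *s E x"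
    using maxwell_C1E[OF assms(1)] by metis
  obtain DE' DH' where 2: "\<And>i. has_grad U (\<lambda>x. E' x $ i) (DE' i)" "\<And>i. has_grad U (\<lambda>x. H' x $ i) (DH' i)"
    "\<And>x. x \<in> U \<Longrightarrow> rot DE' x = (\<i> * k) *s H' x" "\<And>x. x \<in> U \<Longrightarrow> rot DH' x = - (\<i> * k) *s E' x"
    using maxwell_C1E[OF assms(2)] by metis
  have r: "rot (\<lambda>i j x. A i j x + B i j x) x = rot A x + rot B x" for A B x
    by (rule vec3_eqI) simp_all
  show ?thesis
  proof (rule maxwell_C1I[OF 1(1)])
    show "has_grad U (\<lambda>x. (E x + E' x) $ i) (\<lambda>j x. DE i j x + DE' i j x)"
      "has_grad U (\<lambda>x. (H x + H' x) $ i) (\<lambda>j x. DH i j x + DH' i j x)" for i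
      using has_grad_add[OF 1(2) 2(1)] has_grad_add[OF 1(3) 2(2)] by simp_all
    show "rot (\<lambda>i j x. DE i j x + DE' i j x) x = (\<i> * k) *s (H x + H' x)"
      "rot (\<lambda>i j x. DH i j x + DH' i j x) x = - (\<i> * k) *s (E x + E' x)" if "x \<in> U" for x
      using 1(4,5)[OF that] 2(3,4)[OF that] by (simp_all only: r vector_add_ldistrib)
  qed
qed

lemma maxwell_C1_cong:
  assumes "maxwell_C1 k U E H" "\<And>x. x \<in> U \<Longrightarrow> E x = E' x" "\<And>x. x \<in> U \<Longrightarrow> H x = H' x"
  shows "maxwell_C1 k U E' H'"
proof -
  obtain DE DH where 1: "open U" "\<And>i. has_grad U (\<lambda>x. E x $ i) (DE i)" "\<And>i. has_grad U (\<lambda>x. H x $ i) (DH i)"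
    "\<And>x. x \<in> U \<Longrightarrow> rot DE x = (\<i> * k) *s H x" "\<And>x. x \<in> U \<Longrightarrow> rot DH x = - (\<i> * k) *s E x"
    using maxwell_C1E[OF assms(1)] by metis
  show ?thesis
    by (rule maxwell_C1I[OF 1(1), of _ DE _ DH])
       (use 1 assms has_grad_cong[OF 1(1) 1(2)] has_grad_cong[OF 1(1) 1(3)] in auto)
qed

lemma maxwell_continuous:
  assumes "maxwell_C1 k U E H"
  shows "continuous_on U E" "continuous_on U H"
proof -
  obtain DE DH where 1: "\<And>i. has_grad U (\<lambda>x. E x $ i) (DE i)" "\<And>i. has_grad U (\<lambda>x. H x $ i) (DH i)"
    using assms by (rule maxwell_C1E) (rule that; assumption)
  show "continuous_on U E" by (rule has_grad_continuous[OF has_grad_vec[OF 1(1)]])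
  show "continuous_on U H" by (rule has_grad_continuous[OF has_grad_vec[OF 1(2)]])
qed

text \<open>Both pairs have the same wave number, so the four curl terms of the divergence cancel in pairs.\<close>

lemma flux_field_div_free:
  assumes "maxwell_C1 k U E H" "maxwell_C1 k U E' H'"
  shows "weak_div_free U (flux_field E H E' H')"
proof -
  obtain DE DH where 1: "open U" "\<And>i. has_grad U (\<lambda>x. E x $ i) (DE i)" "\<And>i. has_grad U (\<lambda>x. H x $ i) (DH i)"
    "\<And>x. x \<in> U \<Longrightarrow> rot DE x = (\<i> * k) *s H x" "\<And>x. x \<in> U \<Longrightarrow> rot DH x = - (\<i> * k) *s E x"
    using maxwell_C1E[OF assms(1)] by metis
  obtain DE' DH' where 2: "\<And>i. has_grad U (\<lambda>x. E' x $ i) (DE' i)" "\<And>i. has_grad U (\<lambda>x. H' x $ i) (DH' i)"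
    "\<And>x. x \<in> U \<Longrightarrow> rot DE' x = (\<i> * k) *s H' x" "\<And>x. x \<in> U \<Longrightarrow> rot DH' x = - (\<i> * k) *s E' x"
    using maxwell_C1E[OF assms(2)] by metis
  obtain DV where DV: "\<And>i. has_grad U (\<lambda>x. flux_field E H E' H' x $ i) (DV i)"
    "\<And>x. (\<Sum>i\<in>UNIV. DV i i x) = rot DE x \<bullet>\<^sub>c H' x - E x \<bullet>\<^sub>c rot DH' x - rot DE' x \<bullet>\<^sub>c H x + E' x \<bullet>\<^sub>c rot DH x"
    by (rule flux_field_grad[OF 1(2,3) 2(1,2)]) (rule that; assumption)
  show ?thesis
    by (rule weak_div_freeI[OF 1(1) DV(1)])
       (simp add: DV(2) 1(4,5) 2(3,4) bilinear_dot_3 algebra_simps)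
qed

lemma continuous_on_cross:
  assumes "continuous_on U A" "continuous_on U B"
  shows "continuous_on U (\<lambda>x. A x \<times>\<^sub>c B x)"
proof -
  have "continuous_on U (\<lambda>x. \<chi> i. (A x \<times>\<^sub>c B x) $ i)"
  proof (rule continuous_on_vec_lambda)
    fix i :: 3
    consider "i = 1" | "i = 2" | "i = 3" using exhaust_3 by blast
    then show "continuous_on U (\<lambda>x. (A x \<times>\<^sub>c B x) $ i)"
      by cases (simp_all add: assms continuous_on_diff continuous_on_mult continuous_on_component)
  qed
  then show ?thesis by simp
qed

lemma continuous_on_flux_field:
  "continuous_on U E \<Longrightarrow> continuous_on U H \<Longrightarrow> continuous_on U E' \<Longrightarrow> continuous_on U H' \<Longrightarrow>
   continuous_on U (flux_field E H E' H')"
  unfolding flux_field_def[abs_def] by (intro continuous_on_diff continuous_on_cross)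

text \<open>In a normal component \<open>n \<bullet> (E \<times> H)\<close> each factor enters only through its tangential trace, so the two
  factors can be exchanged for \<open>a F\<close> and \<open>b G\<close> one after the other.\<close>

lemma transmission_normal:
  assumes "n \<times>\<^sub>c E1 = a *s (n \<times>\<^sub>c F1)" "n \<times>\<^sub>c H1 = b *s (n \<times>\<^sub>c G1)"
    "n \<times>\<^sub>c E2 = a *s (n \<times>\<^sub>c F2)" "n \<times>\<^sub>c H2 = b *s (n \<times>\<^sub>c G2)"
  shows "n \<bullet>\<^sub>c (E1 \<times>\<^sub>c H2 - E2 \<times>\<^sub>c H1) = n \<bullet>\<^sub>c ((a * b) *s (F1 \<times>\<^sub>c G2 - F2 \<times>\<^sub>c G1))"
proof -
  have l: "n \<bullet>\<^sub>c (A \<times>\<^sub>c B) = (n \<times>\<^sub>c A) \<bullet>\<^sub>c B" and r: "n \<bullet>\<^sub>c (A \<times>\<^sub>c B) = - (A \<bullet>\<^sub>c (n \<times>\<^sub>c B))" for A B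
    by (simp_all add: bilinear_dot_3 algebra_simps)
  have d: "n \<bullet>\<^sub>c (A - B) = n \<bullet>\<^sub>c A - n \<bullet>\<^sub>c B" and s1: "(c *s A) \<bullet>\<^sub>c B = c * (A \<bullet>\<^sub>c B)" and s2: "A \<bullet>\<^sub>c (c *s B) = c * (A \<bullet>\<^sub>c B)" for A B c
    by (simp_all add: bilinear_dot_3 algebra_simps)
  have "n \<bullet>\<^sub>c (E \<times>\<^sub>c H) = a * b * (n \<bullet>\<^sub>c (F \<times>\<^sub>c G))"
    if "n \<times>\<^sub>c E = a *s (n \<times>\<^sub>c F)" "n \<times>\<^sub>c H = b *s (n \<times>\<^sub>c G)" for E H F G
  proof -
    have "n \<bullet>\<^sub>c (E \<times>\<^sub>c H) = a * (n \<bullet>\<^sub>c (F \<times>\<^sub>c H))" using that(1) by (simp add: l s1)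
    also have "n \<bullet>\<^sub>c (F \<times>\<^sub>c H) = b * (n \<bullet>\<^sub>c (F \<times>\<^sub>c G))" using that(2) by (simp add: r s2)
    finally show ?thesis by simp
  qed
  from this[OF assms(1) assms(4)] this[OF assms(3) assms(2)] show ?thesis by (simp add: d s2 right_diff_distrib)
qed

lemma conductor_normal:
  assumes "n \<times>\<^sub>c F1 = 0" "n \<times>\<^sub>c F2 = 0"
  shows "n \<bullet>\<^sub>c (F1 \<times>\<^sub>c G2 - F2 \<times>\<^sub>c G1) = 0"
proof -
  have "n \<bullet>\<^sub>c (F1 \<times>\<^sub>c G2 - F2 \<times>\<^sub>c G1) = (n \<times>\<^sub>c F1) \<bullet>\<^sub>c G2 - (n \<times>\<^sub>c F2) \<bullet>\<^sub>c G1"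
    by (simp add: bilinear_dot_3 algebra_simps)
  then show ?thesis using assms by (simp add: bilinear_dot_3)
qed

text \<open>The impedance condition turns \<open>n \<bullet> (F1 \<times> G2)\<close> into \<open>- c (n \<times> F1) \<bullet> (n \<times> F2)\<close>, which is symmetric in the two fields.\<close>

lemma impedance_normal:
  assumes "n \<times>\<^sub>c G1 = c *s ((n \<times>\<^sub>c F1) \<times>\<^sub>c n)" "n \<times>\<^sub>c G2 = c *s ((n \<times>\<^sub>c F2) \<times>\<^sub>c n)"
  shows "n \<bullet>\<^sub>c (F1 \<times>\<^sub>c G2 - F2 \<times>\<^sub>c G1) = 0"
proof -
  have "n \<bullet>\<^sub>c (F1 \<times>\<^sub>c G2 - F2 \<times>\<^sub>c G1) = F2 \<bullet>\<^sub>c (n \<times>\<^sub>c G1) - F1 \<bullet>\<^sub>c (n \<times>\<^sub>c G2)"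
    by (simp add: bilinear_dot_3 algebra_simps)
  also have "\<dots> = 0" unfolding assms by (simp add: bilinear_dot_3) algebra
  finally show ?thesis .
qed

lemma grad_inner:
  assumes "has_grad U \<rho> D" "x \<in> U"
  shows "(\<rho> has_derivative (\<lambda>h. (\<chi> j. D j x) \<bullet> h)) (at x)"
  using has_grad_derivative[OF assms] by (simp add: inner_vec_def mult.commute)

text \<open>Moving from \<open>y\<close> in a direction \<open>v\<close> with \<open>a \<bullet> v < 0\<close> makes \<open>f\<close> negative, hence \<open>g\<close> too, which gives \<open>b \<bullet> v \<le> 0\<close>.
  So one open half space is contained in the closed half space of \<open>b\<close>, and \<open>b\<close> has no component orthogonal to \<open>a\<close>.\<close>

lemma defining_function_gradients_parallel:
  fixes a b :: "real^3"
  assumes f: "(f has_derivative (\<lambda>h. a \<bullet> h)) (at y)" and g: "(g has_derivative (\<lambda>h. b \<bullet> h)) (at y)"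
    and fg: "f y = 0" "g y = (0::real)" and W: "open W" "y \<in> W" and imp: "\<And>x. x \<in> W \<Longrightarrow> f x < 0 \<Longrightarrow> g x < 0"
    and a: "a \<noteq> 0"
  shows "\<exists>c. b = c *\<^sub>R a"
proof -
  have dir: "((\<lambda>t. F (y + t *\<^sub>R v)) has_real_derivative (u \<bullet> v)) (at 0)"
    if "(F has_derivative (\<lambda>h. u \<bullet> h)) (at y)" for F u v
  proof -
    have "((\<lambda>t. F (y + t *\<^sub>R v)) has_derivative (\<lambda>t. u \<bullet> (t *\<^sub>R v))) (at 0)"
      by (rule has_derivative_compose[where f="\<lambda>t. y + t *\<^sub>R v" and g=F])
         (use that in \<open>auto intro!: derivative_eq_intros\<close>)
    then show ?thesis by (simp add: has_field_derivative_def mult.commute[of "u \<bullet> v"] fun_eq_iff[symmetric] mult_commute_abs)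
  qed
  have key: "b \<bullet> v \<le> 0" if v: "a \<bullet> v < 0" for v
  proof (rule ccontr)
    assume "\<not> b \<bullet> v \<le> 0"
    then obtain d1 where d1: "d1 > 0" "\<And>h. 0 < h \<Longrightarrow> h < d1 \<Longrightarrow> g (y + h *\<^sub>R v) > 0"
      using DERIV_pos_inc_right[OF dir[OF g, of v]] fg by auto
    obtain d2 where d2: "d2 > 0" "\<And>h. 0 < h \<Longrightarrow> h < d2 \<Longrightarrow> f (y + h *\<^sub>R v) < 0"
      using DERIV_neg_dec_right[OF dir[OF f, of v] v] fg by auto
    have "((\<lambda>t. y + t *\<^sub>R v) \<longlongrightarrow> y + 0 *\<^sub>R v) (at_right 0)" by (intro tendsto_intros)
    then have "\<forall>\<^sub>F t in at_right 0. y + t *\<^sub>R v \<in> W" using W topological_tendstoD by fastforce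
    moreover have "\<forall>\<^sub>F t in at_right (0::real). 0 < t \<and> t < min d1 d2"
      unfolding eventually_at_right_field using d1(1) d2(1) by (intro exI[of _ "min d1 d2"]) auto
    ultimately have "\<forall>\<^sub>F t in at_right (0::real). False"
    proof eventually_elim
      case (elim t)
      then show ?case using d1(2)[of t] d2(2)[of t] imp[of "y + t *\<^sub>R v"] by force
    qed
    then show False by (simp add: eventually_False)
  qed
  define c where "c = (a \<bullet> b) / (a \<bullet> a)"
  define w where "w = b - c *\<^sub>R a"
  have aa: "a \<bullet> a > 0" using a by simp
  have aw: "a \<bullet> w = 0" using a by (simp add: w_def c_def inner_diff_right)
  have bw: "b \<bullet> w = w \<bullet> w" 
    using aw by (simp add: w_def inner_diff_left inner_diff_right inner_commute)
  have "w \<bullet> w \<le> e" if "e > 0" for e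
  proof -
    define t where "t = e / (\<bar>a \<bullet> b\<bar> + 1)"
    have t: "t > 0" using that by (simp add: t_def add_nonneg_pos)
    have "a \<bullet> (w - t *\<^sub>R a) < 0" using aw t aa by (simp add: inner_diff_right)
    from key[OF this] have "w \<bullet> w \<le> t * (a \<bullet> b)" using bw by (simp add: inner_diff_right inner_commute)
    also have "\<dots> \<le> t * (\<bar>a \<bullet> b\<bar> + 1)" using t by (intro mult_left_mono) auto
    also have "\<dots> = e" by (simp add: t_def)
    finally show ?thesis .
  qed
  then have "w \<bullet> w \<le> 0" using field_le_epsilon[of "w \<bullet> w" 0] by auto
  then have "w = 0" by (metis inner_ge_zero inner_eq_zero_iff order_antisym)
  then show ?thesis by (auto simp: w_def)
qed

text \<open>The normal at \<open>y\<close> belongs to some defining function, \<open>\<rho>\<close> is one around a different point \<open>x\<close>; their gradients at \<open>y\<close> are parallel.\<close>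

lemma normal_component_transfer:
  assumes out: "outward_unit_normal A y n" and fr: "y \<in> frontier A"
    and loc: "local_defining_function A x U \<rho>" "y \<in> U" and \<rho>: "C_k_on 1 U \<rho>"
    and W: "cvec n \<bullet>\<^sub>c w = 0"
  shows "(\<Sum>i\<in>UNIV. of_real (partial i \<rho> y) * w $ i) = 0"
proof -
  obtain U' \<rho>' where U': "C_k_on 1 U' \<rho>'" "local_defining_function A y U' \<rho>'"
    and n: "n = (1 / norm (grad \<rho>' y)) *\<^sub>R grad \<rho>' y"
    using out unfolding outward_unit_normal_def by blast
  have o: "open U" "open U'" "y \<in> U'" using loc(1) U'(2) by (auto simp: local_defining_function_def)
  have g: "grad \<rho>' y \<noteq> 0" using U'(2) o by (auto simp: local_defining_function_def)
  have d: "(\<rho>' has_derivative (\<lambda>h. grad \<rho>' y \<bullet> h)) (at y)" "(\<rho> has_derivative (\<lambda>h. grad \<rho> y \<bullet> h)) (at y)"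
    using grad_inner[OF C1_has_grad[OF o(2) U'(1)] o(3)] grad_inner[OF C1_has_grad[OF o(1) \<rho>] loc(2)]
    by (simp_all add: grad_def)
  have "\<rho>' y = 0" "\<rho> y = 0" using fr loc U'(2) o by (auto simp: local_defining_function_def)
  moreover have "\<rho> x < 0" if "x \<in> U \<inter> U'" "\<rho>' x < 0" for x
    using that loc(1) U'(2) unfolding local_defining_function_def by blast
  ultimately obtain c where c: "grad \<rho> y = c *\<^sub>R grad \<rho>' y"
    using defining_function_gradients_parallel[OF d, of "U \<inter> U'"] o g loc(2) by blast
  have "grad \<rho> y = (c * norm (grad \<rho>' y)) *\<^sub>R n" using g by (simp add: c n)
  then have "partial i \<rho> y = (c * norm (grad \<rho>' y)) * n $ i" for i
    unfolding grad_def by (metis vec_lambda_beta vector_scaleR_component real_scaleR_def)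
  then have "(\<Sum>i\<in>UNIV. of_real (partial i \<rho> y) * w $ i) = of_real (c * norm (grad \<rho>' y)) * (cvec n \<bullet>\<^sub>c w)"
    by (simp add: bilinear_dot_def cvec_def sum_distrib_left mult_ac)
  then show ?thesis using W by simp
qed

lemma weak_div_free_0: "weak_div_free A (\<lambda>x. 0)"
  by (simp add: weak_div_free_def)

text \<open>Near a point of \<open>S\<^sub>0\<close> the set \<open>\<rho> < 0\<close> is \<open>\<Omega>\<^sub>1\<close> and \<open>\<rho> > 0\<close> is \<open>\<Omega>\<^sub>0\<close>; near \<open>S\<^sub>1\<close> they are \<open>\<Omega>\<^sub>2\<close>, where
  the field is continued by zero, and \<open>\<Omega>\<^sub>1\<close>. On \<open>S\<^sub>1\<close> the normal component is known to vanish on \<open>\<Gamma>\<^sub>1\<close> and \<open>\<Gamma>\<^sub>2\<close> only;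
  their union is dense in \<open>S\<^sub>1\<close>, and the component along the gradient of \<open>\<rho>\<close> is continuous up to the surface.\<close>

lemma transmission_div_free:
  assumes adm: "admissible_medium \<alpha> M" and z: "z \<notin> S\<^sub>0 M" "z \<notin> S\<^sub>1 M"
    and c0: "continuous_on (closure (\<Omega>\<^sub>0 M) - {z}) W0" and c1: "continuous_on (closure (\<Omega>\<^sub>1 M) - {z}) W1"
    and d0: "weak_div_free (\<Omega>\<^sub>0 M - {z}) W0" and d1: "weak_div_free (\<Omega>\<^sub>1 M - {z}) W1"
    and n0: "\<And>x. x \<in> S\<^sub>0 M \<Longrightarrow> cvec (\<nu> M x) \<bullet>\<^sub>c W0 x = cvec (\<nu> M x) \<bullet>\<^sub>c W1 x"
    and n1: "\<And>x. x \<in> \<Gamma>\<^sub>1 M \<union> \<Gamma>\<^sub>2 M \<Longrightarrow> cvec (\<nu> M x) \<bullet>\<^sub>c W1 x = 0"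
  shows "weak_div_free (- {z}) (\<lambda>x. if x \<in> \<Omega>\<^sub>0 M then W0 x else if x \<in> \<Omega>\<^sub>1 M then W1 x else 0)"
proof -
  note adm' = adm[unfolded admissible_medium_def]
  let ?V = "\<lambda>x. if x \<in> \<Omega>\<^sub>0 M then W0 x else if x \<in> \<Omega>\<^sub>1 M then W1 x else 0"
  have o: "open (\<Omega>\<^sub>0 M)" "open (\<Omega>\<^sub>1 M)" "open (\<Omega>\<^sub>2 M)" and dj: "\<Omega>\<^sub>0 M \<inter> \<Omega>\<^sub>1 M = {}"
    and fr: "frontier (\<Omega>\<^sub>0 M) = S\<^sub>0 M" "frontier (\<Omega>\<^sub>1 M) = S\<^sub>0 M \<union> S\<^sub>1 M" "frontier (\<Omega>\<^sub>2 M) = S\<^sub>1 M"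
    and un: "\<Omega>\<^sub>0 M \<union> S\<^sub>0 M \<union> \<Omega>\<^sub>1 M = UNIV - closure (\<Omega>\<^sub>2 M)"
    and \<nu>0': "\<forall>x\<in>S\<^sub>0 M. outward_unit_normal (- closure (\<Omega>\<^sub>0 M)) x (\<nu> M x)"
    and \<nu>1': "\<forall>x\<in>S\<^sub>1 M. outward_unit_normal (\<Omega>\<^sub>2 M) x (\<nu> M x)"
    and S1: "S\<^sub>1 M = closure (\<Gamma>\<^sub>1 M) \<union> closure (\<Gamma>\<^sub>2 M)"
    by - (insert adm', (elim conjE, assumption)+)
  note \<nu>0 = bspec[OF \<nu>0'] and \<nu>1 = bspec[OF \<nu>1']
  have cl: "closure (\<Omega>\<^sub>0 M) = \<Omega>\<^sub>0 M \<union> S\<^sub>0 M" "closure (\<Omega>\<^sub>1 M) = \<Omega>\<^sub>1 M \<union> S\<^sub>0 M \<union> S\<^sub>1 M"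
    "closure (\<Omega>\<^sub>2 M) = \<Omega>\<^sub>2 M \<union> S\<^sub>1 M"
    using fr by (simp_all add: closure_Un_frontier Un_assoc)
  have fdj: "\<Omega>\<^sub>0 M \<inter> S\<^sub>0 M = {}" "\<Omega>\<^sub>1 M \<inter> (S\<^sub>0 M \<union> S\<^sub>1 M) = {}" "\<Omega>\<^sub>2 M \<inter> S\<^sub>1 M = {}"
    using o fr by (auto simp: frontier_def interior_open)
  have S0fr: "frontier (- closure (\<Omega>\<^sub>0 M)) = S\<^sub>0 M"
  proof -
    have "frontier (- closure (\<Omega>\<^sub>0 M)) = closure (- closure (\<Omega>\<^sub>0 M)) \<inter> closure (\<Omega>\<^sub>0 M)"
      by (simp add: frontier_closures)
    moreover have "\<Omega>\<^sub>1 M \<subseteq> - closure (\<Omega>\<^sub>0 M)" using cl(1) dj fdj by blast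
    then have "S\<^sub>0 M \<subseteq> closure (- closure (\<Omega>\<^sub>0 M))" using closure_mono cl(2) by blast
    moreover have "\<Omega>\<^sub>0 M \<inter> closure (- closure (\<Omega>\<^sub>0 M)) = {}"
      using open_Int_closure_eq_empty[OF o(1)] closure_subset[of "\<Omega>\<^sub>0 M"] by blast
    ultimately show ?thesis using cl(1) by blast
  qed
  have op: "\<exists>r>0. weak_div_free (ball x r) ?V" if A: "open A" "x \<in> A" "weak_div_free A W" "\<And>y. y \<in> A \<Longrightarrow> W y = ?V y" for A W x
  proof -
    obtain r where "r > 0" "ball x r \<subseteq> A" using A(1,2) by (meson openE)
    then show ?thesis using weak_div_free_cong[OF weak_div_free_mono[OF that(3)], of "ball x r" ?V] that(4) by blast
  qed
  have o01: "open (\<Omega>\<^sub>0 M - {z})" "open (\<Omega>\<^sub>1 M - {z})" using o by auto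
  have d01: "weak_div_free ((\<Omega>\<^sub>0 M - {z}) \<union> (\<Omega>\<^sub>1 M - {z})) ?V"
  proof (rule weak_div_free_local, elim UnE)
    show "\<exists>r>0. weak_div_free (ball y r) ?V" if "y \<in> \<Omega>\<^sub>0 M - {z}" for y
      by (rule op[OF o01(1) that d0]) simp
    show "\<exists>r>0. weak_div_free (ball y r) ?V" if "y \<in> \<Omega>\<^sub>1 M - {z}" for y
      by (rule op[OF o01(2) that d1]) (use dj in auto)
  qed
  show ?thesis
  proof (rule weak_div_free_local)
    fix x assume "x \<in> - {z}"
    then have xz: "x \<noteq> z" by simp
    consider "x \<in> \<Omega>\<^sub>0 M \<union> \<Omega>\<^sub>1 M" | "x \<in> \<Omega>\<^sub>2 M" | "x \<in> S\<^sub>0 M" | "x \<in> S\<^sub>1 M"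
      using un cl(3) by blast
    then show "\<exists>r>0. weak_div_free (ball x r) ?V"
    proof cases
      case 1
      show ?thesis by (rule op[OF open_Un[OF o01] _ d01]) (use 1 xz in auto)
    next
      case 2
      show ?thesis by (rule op[OF o(3) _ weak_div_free_0]) (use 2 un cl(3) in auto)
    next
      case 3
      obtain U \<rho> where \<rho>: "C_k_on 1 U \<rho>" and loc: "local_defining_function (- closure (\<Omega>\<^sub>0 M)) x U \<rho>"
        using \<nu>0[OF 3] unfolding outward_unit_normal_def by blast
      have U: "open U" "x \<in> U" "grad \<rho> x \<noteq> 0" and neg: "- closure (\<Omega>\<^sub>0 M) \<inter> U = {y\<in>U. \<rho> y < 0}"
        and lev: "S\<^sub>0 M \<inter> U = {y\<in>U. \<rho> y = 0}"
        using loc S0fr unfolding local_defining_function_def by auto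
      obtain j where j: "partial j \<rho> x \<noteq> 0" using U(3) by (auto simp: grad_def vec_eq_iff)
      let ?U = "U - {z} - closure (\<Omega>\<^sub>2 M)"
      have oU: "open ?U" using U(1) by (intro open_Diff) auto
      have xU: "x \<in> ?U" using U xz 3 un by blast
      have m: "y \<in> \<Omega>\<^sub>0 M" if "y \<in> ?U" "\<rho> y > 0" for y
        using that un neg lev cl(1) by (force simp: set_eq_iff)
      have p: "y \<in> \<Omega>\<^sub>1 M" if "y \<in> ?U" "\<rho> y < 0" for y
        using that un neg lev cl(1) by (force simp: set_eq_iff)
      have s: "y \<in> S\<^sub>0 M" if "y \<in> ?U" "\<rho> y = 0" for y using that lev by blast
      show ?thesis
      proof (rule weak_div_free_interface[OF oU xU has_grad_subset[OF C1_has_grad[OF U(1) \<rho>]] j, of W0 W1])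
        have "{y \<in> ?U. \<rho> y \<ge> 0} \<subseteq> closure (\<Omega>\<^sub>0 M) - {z}" using m s cl(1) by (force simp: order_le_less)
        then show "continuous_on {y \<in> ?U. \<rho> y \<ge> 0} W0" by (rule continuous_on_subset[OF c0])
        have "{y \<in> ?U. \<rho> y \<le> 0} \<subseteq> closure (\<Omega>\<^sub>1 M) - {z}" using p s cl(2) by (force simp: order_le_less)
        then show "continuous_on {y \<in> ?U. \<rho> y \<le> 0} W1" by (rule continuous_on_subset[OF c1])
        show "?V y = W0 y" if "y \<in> ?U" "\<rho> y > 0" for y using m[OF that] by simp
        show "?V y = W1 y" if "y \<in> ?U" "\<rho> y < 0" for y using p[OF that] dj by auto
        show "?V y = 0" if "y \<in> ?U" "\<rho> y = 0" for y using s[OF that] fdj by auto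
        show "weak_div_free {y \<in> ?U. \<rho> y \<noteq> 0} ?V"
        proof (rule weak_div_free_mono[OF d01], rule subsetI)
          fix y assume y: "y \<in> {y \<in> ?U. \<rho> y \<noteq> 0}"
          then show "y \<in> (\<Omega>\<^sub>0 M - {z}) \<union> (\<Omega>\<^sub>1 M - {z})"
            using m[of y] p[of y] by (cases "\<rho> y" "0::real" rule: linorder_cases) auto
        qed
        show "(\<Sum>i\<in>UNIV. of_real (partial i \<rho> y) * W0 y $ i) = (\<Sum>i\<in>UNIV. of_real (partial i \<rho> y) * W1 y $ i)"
          if "y \<in> ?U" "\<rho> y = 0" for y
        proof -
          have "(\<Sum>i\<in>UNIV. of_real (partial i \<rho> y) * (W0 y - W1 y) $ i) = 0"
            by (rule normal_component_transfer[OF \<nu>0 _ loc _ \<rho>])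
               (use s[OF that] that n0 S0fr in \<open>auto simp: bilinear_dot_3 algebra_simps\<close>)
          then show ?thesis by (simp add: algebra_simps sum_subtractf)
        qed
      qed blast
    next
      case 4
      obtain U \<rho> where \<rho>: "C_k_on 1 U \<rho>" and loc: "local_defining_function (\<Omega>\<^sub>2 M) x U \<rho>"
        using \<nu>1[OF 4] unfolding outward_unit_normal_def by blast
      have U: "open U" "x \<in> U" "grad \<rho> x \<noteq> 0" and neg: "\<Omega>\<^sub>2 M \<inter> U = {y\<in>U. \<rho> y < 0}"
        and lev: "S\<^sub>1 M \<inter> U = {y\<in>U. \<rho> y = 0}"
        using loc fr(3) unfolding local_defining_function_def by auto
      obtain j where j: "partial j \<rho> x \<noteq> 0" using U(3) by (auto simp: grad_def vec_eq_iff)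
      let ?U = "U - {z} - closure (\<Omega>\<^sub>0 M)"
      have oU: "open ?U" using U(1) by (intro open_Diff) auto
      have xU: "x \<in> ?U" using U xz 4 un cl by blast
      have m: "y \<in> \<Omega>\<^sub>1 M" if "y \<in> ?U" "\<rho> y > 0" for y
      proof -
        have "y \<notin> \<Omega>\<^sub>2 M" "y \<notin> S\<^sub>1 M" using that neg lev by (force simp: set_eq_iff)+
        then show ?thesis using that(1) un cl by blast
      qed
      have p: "y \<in> \<Omega>\<^sub>2 M" if "y \<in> ?U" "\<rho> y < 0" for y using that neg by blast
      have s: "y \<in> S\<^sub>1 M" if "y \<in> ?U" "\<rho> y = 0" for y using that lev by blast
      have \<Omega>2: "?V y = 0" if "y \<in> \<Omega>\<^sub>2 M" for y using that un cl(3) by auto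
      note g\<rho> = has_grad_subset[OF C1_has_grad[OF U(1) \<rho>], of ?U]
      have sub: "{y \<in> ?U. \<rho> y \<ge> 0} \<subseteq> closure (\<Omega>\<^sub>1 M) - {z}" using m s cl(2) by (force simp: order_le_less)
      define f where "f y = (\<Sum>i\<in>UNIV. of_real (partial i \<rho> y) * W1 y $ i)" for y
      have f0: "f y = 0" if "y \<in> ?U" "y \<in> \<Gamma>\<^sub>1 M \<union> \<Gamma>\<^sub>2 M" for y
      proof -
        have "y \<in> S\<^sub>1 M" using S1 that(2) closure_subset by blast
        then show ?thesis unfolding f_def
          using normal_component_transfer[OF \<nu>1 _ loc _ \<rho> n1[OF that(2)]] that(1) fr(3) by blast
      qed
      have "continuous_on {y \<in> ?U. \<rho> y \<ge> 0} (partial i \<rho>)" for i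
        by (rule continuous_on_subset[OF has_grad_continuous_deriv[OF C1_has_grad[OF U(1) \<rho>]]]) auto
      then have cf: "continuous_on {y \<in> ?U. \<rho> y \<ge> 0} f" unfolding f_def
        using continuous_on_subset[OF c1 sub] by (intro continuous_intros)
      have f1: "f y = 0" if y: "y \<in> ?U" "\<rho> y = 0" for y
      proof (rule ccontr)
        assume "f y \<noteq> 0"
        have "openin (top_of_set {y \<in> ?U. \<rho> y \<ge> 0}) ({y \<in> ?U. \<rho> y \<ge> 0} \<inter> f -` (- {0}))"
          by (rule continuous_openin_preimage_gen[OF cf]) auto
        then obtain T where T: "open T" "{y \<in> ?U. \<rho> y \<ge> 0} \<inter> f -` (- {0}) = {y \<in> ?U. \<rho> y \<ge> 0} \<inter> T"
          by (auto simp: openin_open)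
        then have "y \<in> T \<inter> ?U" using y \<open>f y \<noteq> 0\<close> by force
        moreover have "open (T \<inter> ?U)" using T(1) oU by blast
        moreover have "y \<in> closure (\<Gamma>\<^sub>1 M \<union> \<Gamma>\<^sub>2 M)" using s[OF y] S1 by simp
        ultimately obtain g where g: "g \<in> \<Gamma>\<^sub>1 M \<union> \<Gamma>\<^sub>2 M" "g \<in> T \<inter> ?U"
          by (meson closure_iff_nhds_not_empty disjoint_iff subset_refl)
        have "g \<in> S\<^sub>1 M" using S1 g(1) closure_subset by blast
        then have "\<rho> g = 0" using g(2) lev by blast
        then have "f g \<noteq> 0" using g(2) T(2) by force
        then show False using f0 g by blast
      qed
      show ?thesis
      proof (rule weak_div_free_interface[OF oU xU g\<rho> j, of W1 "\<lambda>x. 0"])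
        show "continuous_on {y \<in> ?U. \<rho> y \<ge> 0} W1" by (rule continuous_on_subset[OF c1 sub])
        show "continuous_on {y \<in> ?U. \<rho> y \<le> 0} (\<lambda>x. 0)" by simp
        show "?V y = W1 y" if "y \<in> ?U" "\<rho> y > 0" for y using m[OF that] dj by auto
        show "?V y = 0" if "y \<in> ?U" "\<rho> y < 0" for y using \<Omega>2 p[OF that] .
        show "?V y = 0" if "y \<in> ?U" "\<rho> y = 0" for y using s[OF that] fdj un cl(3) by auto
        have "weak_div_free ((\<Omega>\<^sub>0 M - {z}) \<union> (\<Omega>\<^sub>1 M - {z}) \<union> \<Omega>\<^sub>2 M) ?V"
        proof (rule weak_div_free_local)
          fix y assume "y \<in> (\<Omega>\<^sub>0 M - {z}) \<union> (\<Omega>\<^sub>1 M - {z}) \<union> \<Omega>\<^sub>2 M"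
          then show "\<exists>r>0. weak_div_free (ball y r) ?V"
            using op[OF open_Un[OF o01] _ d01, of y] op[OF o(3) _ weak_div_free_0, of y] \<Omega>2 by auto
        qed
        then show "weak_div_free {y \<in> ?U. \<rho> y \<noteq> 0} ?V"
        proof (rule weak_div_free_mono, intro subsetI)
          fix y assume y: "y \<in> {y \<in> ?U. \<rho> y \<noteq> 0}"
          then show "y \<in> (\<Omega>\<^sub>0 M - {z}) \<union> (\<Omega>\<^sub>1 M - {z}) \<union> \<Omega>\<^sub>2 M"
            using m[of y] p[of y] by (cases "\<rho> y" "0::real" rule: linorder_cases) auto
        qed
        show "(\<Sum>i\<in>UNIV. of_real (partial i \<rho> y) * W1 y $ i) = (\<Sum>i\<in>UNIV. of_real (partial i \<rho> y) * 0 $ i)"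
          if "y \<in> ?U" "\<rho> y = 0" for y
          using f1[OF that] by (simp add: f_def)
      qed blast
    qed
  qed
qed


section \<open>Dipole fields\<close>

lemma three_neq [simp]: "(1::3) \<noteq> 2" "(1::3) \<noteq> 3" "(2::3) \<noteq> 3" "(2::3) \<noteq> 1" "(3::3) \<noteq> 1" "(3::3) \<noteq> 2"
  by simp_all

text \<open>For a profile \<open>F\<close> of the squared distance with derivatives \<open>F1\<close>, \<open>F2\<close> these are the magnetic field
  \<open>curl (F p)\<close> and the electric field \<open>(i/k) curl curl (F p)\<close>.\<close>

definition radial_H :: "(real \<Rightarrow> complex) \<Rightarrow> real^3 \<Rightarrow> real^3 \<Rightarrow> vfield" where
  "radial_H F1 z p x = (2 * F1 ((norm (x - z))\<^sup>2)) *s (cvec (x - z) \<times>\<^sub>c cvec p)"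

definition radial_E :: "complex \<Rightarrow> (real \<Rightarrow> complex) \<Rightarrow> (real \<Rightarrow> complex) \<Rightarrow> real^3 \<Rightarrow> real^3 \<Rightarrow> vfield" where
  "radial_E k F1 F2 z p x = (\<i> / k) *s
     ((4 * F2 ((norm (x - z))\<^sup>2) * (cvec (x - z) \<bullet>\<^sub>c cvec p)) *s cvec (x - z)
      - (4 * of_real ((norm (x - z))\<^sup>2) * F2 ((norm (x - z))\<^sup>2) + 4 * F1 ((norm (x - z))\<^sup>2)) *s cvec p)"

lemma cvec_nth [simp]: "cvec v $ i = of_real (v $ i)"
  by (simp add: cvec_def)

lemma has_grad_offset:
  "has_grad U (\<lambda>x. complex_of_real ((x - z)$i)) (\<lambda>j x. if j = i then 1 else 0)"
proof -
  have "has_grad U (\<lambda>x. x$i - z$i) (\<lambda>j x. (if j = i then 1 else 0) - 0)"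
    by (rule has_grad_diff[OF has_grad_coord has_grad_const])
  then have "has_grad U (\<lambda>x. (x - z)$i) (\<lambda>j x. if j = i then 1 else 0)" by simp
  from has_grad_of_real[OF this]
  have "has_grad U (\<lambda>x. complex_of_real ((x - z)$i)) (\<lambda>j x. complex_of_real (if j = i then 1 else 0))" .
  moreover have "(\<lambda>j (x::real^3). complex_of_real (if j = i then 1 else 0)) = (\<lambda>j x. if j = i then 1 else 0)"
    by (auto simp: fun_eq_iff)
  ultimately show ?thesis by simp
qed

lemma has_grad_radial:
  assumes "\<And>s. s \<in> S \<Longrightarrow> (F has_vector_derivative F' s) (at s)" "continuous_on S F'"
    "\<And>x. x \<in> U \<Longrightarrow> (norm (x - z))\<^sup>2 \<in> S"
  shows "has_grad U (\<lambda>x. F ((norm (x - z))\<^sup>2)) (\<lambda>j x. of_real (2 * (x - z)$j) * (F' ((norm (x - z))\<^sup>2) :: complex))"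
  using has_grad_compose[OF has_grad_dist_sq, of z U S F F'] assms
  by (auto simp: image_subset_iff scaleR_conv_of_real)

text \<open>The equation for \<open>curl H\<close> holds for every profile. In the other one the defect is
  \<open>- (i/k) grad (\<Delta>F + k\<^sup>2 F) \<times> p\<close>: in terms of \<open>s = |x - z|\<^sup>2\<close> one has \<open>\<Delta>F + k\<^sup>2 F = 4 s F'' + 6 F' + k\<^sup>2 F\<close>, and
  the bracket is the derivative of this function of \<open>s\<close>.\<close>

lemma radial_fields:
  assumes F1: "\<And>s. s \<in> S \<Longrightarrow> (F1 has_vector_derivative F2 s) (at s)"
    and F2: "\<And>s. s \<in> S \<Longrightarrow> (F2 has_vector_derivative F3 s) (at s)"
    and F3: "continuous_on S F3" and U: "\<And>x. x \<in> U \<Longrightarrow> (norm (x - z))\<^sup>2 \<in> S" and k: "k \<noteq> 0"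
  obtains DE DH where "\<And>i. has_grad U (\<lambda>x. radial_E k F1 F2 z p x $ i) (DE i)"
    "\<And>i. has_grad U (\<lambda>x. radial_H F1 z p x $ i) (DH i)"
    "\<And>x. rot DH x = - (\<i> * k) *s radial_E k F1 F2 z p x"
    "\<And>x. rot DE x = (\<i> * k) *s radial_H F1 z p x - ((\<i> / k) * 2 *
       (4 * of_real ((norm (x - z))\<^sup>2) * F3 ((norm (x - z))\<^sup>2) + 10 * F2 ((norm (x - z))\<^sup>2)
         + k\<^sup>2 * F1 ((norm (x - z))\<^sup>2))) *s (cvec (x - z) \<times>\<^sub>c cvec p)"
proof -
  have cF2: "continuous_on S F2"
    using F2 by (meson continuous_at_imp_continuous_on has_vector_derivative_continuous)
  let ?s = "\<lambda>x. (norm (x - z))\<^sup>2"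
  let ?X = "\<lambda>x i. complex_of_real ((x - z)$i)"
  let ?P = "\<lambda>i. complex_of_real (p$i)"
  let ?dl = "\<lambda>i j. if j = i then 1 else (0::complex)"
  let ?dot = "\<lambda>x. \<Sum>i\<in>UNIV. ?X x i * ?P i"
  note g1 = has_grad_radial[OF F1 cF2 U, of U]
  note g2 = has_grad_radial[OF F2 F3 U, of U]
  have gs: "has_grad U (\<lambda>x. complex_of_real (?s x)) (\<lambda>j x. of_real (2 * (x - z)$j))"
    by (rule has_grad_of_real[OF has_grad_dist_sq])
  have gdot: "has_grad U ?dot (\<lambda>j x. ?P j)"
  proof -
    have "has_grad U ?dot (\<lambda>j x. \<Sum>i\<in>UNIV. ?dl i j * ?P i + ?X x i * 0)"
      by (rule has_grad_sum, rule has_grad_mult[OF has_grad_offset has_grad_const])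
    then show ?thesis by (simp add: if_distrib[where f="\<lambda>c. c * _"] cong: if_cong)
  qed
  define DH where "DH i j x = 2 * ((of_real (2 * (x - z)$j) * F2 (?s x)) * (cvec (x - z) \<times>\<^sub>c cvec p) $ i
     + F1 (?s x) * ((\<chi> m. ?dl m j) \<times>\<^sub>c cvec p) $ i)" for i j x
  have gH: "has_grad U (\<lambda>x. radial_H F1 z p x $ i) (DH i)" for i
  proof -
    have "has_grad U (\<lambda>x. (cvec (x - z) \<times>\<^sub>c cvec p) $ i)
       (\<lambda>j x. ((\<chi> m. ?dl m j) \<times>\<^sub>c cvec p + cvec (x - z) \<times>\<^sub>c (\<chi> m. 0)) $ i)"
      by (rule has_grad_cross) (simp_all add: has_grad_offset[simplified] has_grad_const)
    moreover have "A \<times>\<^sub>c (\<chi> m. 0) = 0" for A by (rule vec3_eqI) simp_all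
    ultimately have "has_grad U (\<lambda>x. (cvec (x - z) \<times>\<^sub>c cvec p) $ i) (\<lambda>j x. ((\<chi> m. ?dl m j) \<times>\<^sub>c cvec p) $ i)"
      by (simp only: add_0_right)
    from has_grad_cmult[OF has_grad_mult[OF g1 this], of 2]
    show ?thesis unfolding DH_def[abs_def] radial_H_def by (simp add: mult.assoc)
  qed
  define DE where "DE i j x = (\<i>/k) * ((4 * ((of_real (2 * (x - z)$j) * F3 (?s x)) * ?dot x + F2 (?s x) * ?P j)) * ?X x i
      + 4 * (F2 (?s x) * ?dot x) * ?dl i j
      - (4 * (of_real (2 * (x - z)$j) * F2 (?s x) + of_real (?s x) * (of_real (2 * (x - z)$j) * F3 (?s x)))
         + 4 * (of_real (2 * (x - z)$j) * F2 (?s x))) * ?P i)" for i j x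
  have gE: "has_grad U (\<lambda>x. radial_E k F1 F2 z p x $ i) (DE i)" for i
  proof -
    have "has_grad U (\<lambda>x. (\<i>/k) * ((4 * (F2 (?s x) * ?dot x)) * ?X x i - (4 * (of_real (?s x) * F2 (?s x)) + 4 * F1 (?s x)) * ?P i))
       (\<lambda>j x. (\<i>/k) * (((4 * ((of_real (2 * (x - z)$j) * F3 (?s x)) * ?dot x + F2 (?s x) * ?P j)) * ?X x i
         + (4 * (F2 (?s x) * ?dot x)) * ?dl i j)
        - ((4 * (of_real (2 * (x - z)$j) * F2 (?s x) + of_real (?s x) * (of_real (2 * (x - z)$j) * F3 (?s x)))
         + 4 * (of_real (2 * (x - z)$j) * F2 (?s x))) * ?P i + (4 * (of_real (?s x) * F2 (?s x)) + 4 * F1 (?s x)) * 0)))"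
      by (intro has_grad_cmult has_grad_diff has_grad_mult has_grad_add g1 g2 gs gdot has_grad_offset has_grad_const)
    moreover have "(\<lambda>x. (\<i>/k) * ((4 * (F2 (?s x) * ?dot x)) * ?X x i - (4 * (of_real (?s x) * F2 (?s x)) + 4 * F1 (?s x)) * ?P i))
       = (\<lambda>x. radial_E k F1 F2 z p x $ i)"
      by (simp only: radial_E_def vector_smult_component vector_minus_component cvec_nth bilinear_dot_def mult.assoc)
    moreover have "(\<lambda>j x. (\<i>/k) * (((4 * ((of_real (2 * (x - z)$j) * F3 (?s x)) * ?dot x + F2 (?s x) * ?P j)) * ?X x i
         + (4 * (F2 (?s x) * ?dot x)) * ?dl i j)
        - ((4 * (of_real (2 * (x - z)$j) * F2 (?s x) + of_real (?s x) * (of_real (2 * (x - z)$j) * F3 (?s x)))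
         + 4 * (of_real (2 * (x - z)$j) * F2 (?s x))) * ?P i + (4 * (of_real (?s x) * F2 (?s x)) + 4 * F1 (?s x)) * 0))) = DE i"
      unfolding DE_def[abs_def] by (simp only: mult_zero_right add_0_right)
    ultimately show ?thesis by (simp only:)
  qed
  have "complex_of_real (?s x) = ?X x 1 * ?X x 1 + ?X x 2 * ?X x 2 + ?X x 3 * ?X x 3" for x
    unfolding norm_sq_sum sum_3 by simp
  then have sq: "(complex_of_real (norm (x - z)))\<^sup>2 = ?X x 1 * ?X x 1 + ?X x 2 * ?X x 2 + ?X x 3 * ?X x 3" for x
    by (simp only: of_real_power)
  have kk: "- (\<i> * k) * ((\<i> / k) * c) = c" for c using k by simp
  have 1: "rot DH x = - (\<i> * k) *s radial_E k F1 F2 z p x" for x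
  proof -
    have "- (\<i> * k) *s radial_E k F1 F2 z p x = 
     ((4 * F2 (?s x) * (cvec (x - z) \<bullet>\<^sub>c cvec p)) *s cvec (x - z)
      - (4 * of_real (?s x) * F2 (?s x) + 4 * F1 (?s x)) *s cvec p)"
      unfolding radial_E_def vector_smult_assoc using k by simp
    also have "\<dots> = rot DH x"
      by (rule vec3_eqI) (simp_all add: DH_def sq bilinear_dot_3 algebra_simps)
    finally show ?thesis by simp
  qed
  have 2: "rot DE x = (\<i> * k) *s radial_H F1 z p x - ((\<i> / k) * 2 *
       (4 * of_real (?s x) * F3 (?s x) + 10 * F2 (?s x) + k\<^sup>2 * F1 (?s x))) *s (cvec (x - z) \<times>\<^sub>c cvec p)" for x
  proof -
    have ik: "(\<i> / k) * k\<^sup>2 = \<i> * k" using k by (simp add: power2_eq_square)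
    have "((\<i> / k) * 2 * (4 * of_real (?s x) * F3 (?s x) + 10 * F2 (?s x) + k\<^sup>2 * F1 (?s x)))
       = (\<i> / k) * (8 * of_real (?s x) * F3 (?s x) + 20 * F2 (?s x)) + 2 * \<i> * k * F1 (?s x)"
      unfolding ik[symmetric, THEN arg_cong[where f="\<lambda>c. 2 * c * F1 (?s x)"], simplified mult.assoc] 
      using k by (simp add: field_simps power2_eq_square)
    then have "(\<i> * k) *s radial_H F1 z p x - ((\<i> / k) * 2 *
       (4 * of_real (?s x) * F3 (?s x) + 10 * F2 (?s x) + k\<^sup>2 * F1 (?s x))) *s (cvec (x - z) \<times>\<^sub>c cvec p)
       = (- (\<i>/k)) *s ((8 * of_real (?s x) * F3 (?s x) + 20 * F2 (?s x)) *s (cvec (x - z) \<times>\<^sub>c cvec p))"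
      unfolding radial_H_def by (simp only:) (simp add: vec_eq_iff algebra_simps)
    also have "\<dots> = rot DE x"
    proof -
      define c where "c = \<i>/k"
      show ?thesis
        by (rule vec3_eqI) (simp_all add: DE_def c_def[symmetric] sum_3 sq algebra_simps)
    qed
    finally show ?thesis by simp
  qed
  show ?thesis by (rule that[OF gE gH 1 2])
qed

text \<open>The fundamental solution at distance \<open>w\<close>, and its first three derivatives with respect to \<open>s = w\<^sup>2\<close>, that is, under
  \<open>(1 / (2 w)) d/dw\<close>.\<close>

definition src0 :: "complex \<Rightarrow> complex \<Rightarrow> complex" where
  "src0 k w = exp (\<i> * k * w) * inverse w / (4 * of_real pi)"
definition src1 :: "complex \<Rightarrow> complex \<Rightarrow> complex" where
  "src1 k w = exp (\<i> * k * w) * (\<i> * k * inverse w ^ 2 - inverse w ^ 3) / (8 * of_real pi)"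
definition src2 :: "complex \<Rightarrow> complex \<Rightarrow> complex" where
  "src2 k w = exp (\<i> * k * w) * ((\<i> * k)\<^sup>2 * inverse w ^ 3 - 3 * (\<i> * k) * inverse w ^ 4 + 3 * inverse w ^ 5) / (16 * of_real pi)"
definition src3 :: "complex \<Rightarrow> complex \<Rightarrow> complex" where
  "src3 k w = exp (\<i> * k * w) * ((\<i> * k) ^ 3 * inverse w ^ 4 - 6 * (\<i> * k)\<^sup>2 * inverse w ^ 5
     + 15 * (\<i> * k) * inverse w ^ 6 - 15 * inverse w ^ 7) / (32 * of_real pi)"

lemma exp_inverse_power_deriv:
  fixes c w :: complex
  assumes "w \<noteq> 0"
  shows "((\<lambda>w. exp (c * w) * inverse w ^ n) has_field_derivative
     exp (c * w) * (c * inverse w ^ n - of_nat n * inverse w ^ Suc n)) (at w)"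
proof -
  have 1: "((\<lambda>w. exp (c * w)) has_field_derivative exp (c * w) * c) (at w)"
    by (auto intro!: derivative_eq_intros)
  have 2: "((\<lambda>w. inverse w ^ n) has_field_derivative of_nat n * (- (inverse w ^ 2)) * inverse w ^ (n - 1)) (at w)"
    using DERIV_power[OF DERIV_inverse[OF assms], of n] by (simp add: numeral_2_eq_2 mult_ac)
  have 3: "of_nat n * (- (inverse w ^ 2)) * inverse w ^ (n - 1) = - of_nat n * inverse w ^ Suc n"
    by (cases n) (simp_all add: power2_eq_square algebra_simps)
  from DERIV_mult[OF 1 2] show ?thesis unfolding 3 by (simp add: algebra_simps)
qed

lemma src_deriv:
  assumes w: "w \<noteq> 0"
  shows "(src0 k has_field_derivative 2 * w * src1 k w) (at w)"
    "(src1 k has_field_derivative 2 * w * src2 k w) (at w)"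
    "(src2 k has_field_derivative 2 * w * src3 k w) (at w)"
proof -
  define c where "c = \<i> * k"
  define u where "u = inverse w"
  have wu: "w * u ^ Suc n = u ^ n" for n using w by (simp add: u_def)
  note d = exp_inverse_power_deriv[OF w, of c, folded u_def]
  have pw: "w * u ^ 2 = u" "w * u ^ 3 = u ^ 2" "w * u ^ 4 = u ^ 3" "w * u ^ 5 = u ^ 4" "w * u ^ 6 = u ^ 5" "w * u ^ 7 = u ^ 6"
    using wu[of 1] wu[of 2] wu[of 3] wu[of 4] wu[of 5] wu[of 6] by (simp_all add: eval_nat_numeral)
  have e1: "w * src1 k w = exp (c * w) * (c * u - u ^ 2) / (8 * of_real pi)"
  proof -
    have "w * src1 k w = exp (c * w) * (c * (w * u ^ 2) - w * u ^ 3) / (8 * of_real pi)"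
      unfolding src1_def c_def[symmetric] u_def[symmetric] by (simp add: algebra_simps)
    then show ?thesis unfolding pw .
  qed
  have e2: "w * src2 k w = exp (c * w) * (c\<^sup>2 * u ^ 2 - 3 * c * u ^ 3 + 3 * u ^ 4) / (16 * of_real pi)"
  proof -
    have "w * src2 k w = exp (c * w) * (c\<^sup>2 * (w * u ^ 3) - 3 * c * (w * u ^ 4) + 3 * (w * u ^ 5)) / (16 * of_real pi)"
      unfolding src2_def c_def[symmetric] u_def[symmetric] by (simp add: algebra_simps)
    then show ?thesis unfolding pw .
  qed
  have e3: "w * src3 k w = exp (c * w) * (c ^ 3 * u ^ 3 - 6 * c\<^sup>2 * u ^ 4 + 15 * c * u ^ 5 - 15 * u ^ 6) / (32 * of_real pi)"
  proof -
    have "w * src3 k w = exp (c * w) * (c ^ 3 * (w * u ^ 4) - 6 * c\<^sup>2 * (w * u ^ 5) + 15 * c * (w * u ^ 6) - 15 * (w * u ^ 7)) / (32 * of_real pi)"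
      unfolding src3_def c_def[symmetric] u_def[symmetric] by (simp add: algebra_simps)
    then show ?thesis unfolding pw .
  qed
  have "((\<lambda>w. exp (c * w) * inverse w ^ 1 / (4 * of_real pi)) has_field_derivative
     exp (c * w) * (c * u ^ 1 - of_nat 1 * u ^ Suc 1) / (4 * of_real pi)) (at w)"
    by (intro DERIV_cdivide d)
  moreover have "exp (c * w) * (c * u ^ 1 - of_nat 1 * u ^ Suc 1) / (4 * of_real pi) = 2 * w * src1 k w"
    unfolding mult.assoc e1 by (simp add: field_simps eval_nat_numeral)
  ultimately show "(src0 k has_field_derivative 2 * w * src1 k w) (at w)"
    unfolding src0_def[abs_def] c_def by simp
  have "((\<lambda>w. (c * (exp (c * w) * inverse w ^ 2) - exp (c * w) * inverse w ^ 3) / (8 * of_real pi)) has_field_derivative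
     (c * (exp (c * w) * (c * u ^ 2 - of_nat 2 * u ^ Suc 2)) - exp (c * w) * (c * u ^ 3 - of_nat 3 * u ^ Suc 3)) / (8 * of_real pi)) (at w)"
    by (intro DERIV_cdivide DERIV_diff DERIV_cmult d)
  moreover have "(c * (exp (c * w) * (c * u ^ 2 - of_nat 2 * u ^ Suc 2)) - exp (c * w) * (c * u ^ 3 - of_nat 3 * u ^ Suc 3)) / (8 * of_real pi)
     = 2 * w * src2 k w"
    unfolding mult.assoc e2 by (simp add: field_simps eval_nat_numeral)
  moreover have "(\<lambda>w. (c * (exp (c * w) * inverse w ^ 2) - exp (c * w) * inverse w ^ 3) / (8 * of_real pi)) = src1 k"
    by (simp add: src1_def c_def fun_eq_iff algebra_simps)
  ultimately show "(src1 k has_field_derivative 2 * w * src2 k w) (at w)" by simp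
  have "((\<lambda>w. (c\<^sup>2 * (exp (c * w) * inverse w ^ 3) - 3 * c * (exp (c * w) * inverse w ^ 4) + 3 * (exp (c * w) * inverse w ^ 5)) / (16 * of_real pi)) has_field_derivative
     (c\<^sup>2 * (exp (c * w) * (c * u ^ 3 - of_nat 3 * u ^ Suc 3)) - 3 * c * (exp (c * w) * (c * u ^ 4 - of_nat 4 * u ^ Suc 4))
       + 3 * (exp (c * w) * (c * u ^ 5 - of_nat 5 * u ^ Suc 5))) / (16 * of_real pi)) (at w)"
    by (intro DERIV_cdivide DERIV_diff DERIV_add DERIV_cmult d)
  moreover have "(c\<^sup>2 * (exp (c * w) * (c * u ^ 3 - of_nat 3 * u ^ Suc 3)) - 3 * c * (exp (c * w) * (c * u ^ 4 - of_nat 4 * u ^ Suc 4))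
       + 3 * (exp (c * w) * (c * u ^ 5 - of_nat 5 * u ^ Suc 5))) / (16 * of_real pi) = 2 * w * src3 k w"
    unfolding mult.assoc e3 by (simp add: field_simps eval_nat_numeral)
  moreover have "(\<lambda>w. (c\<^sup>2 * (exp (c * w) * inverse w ^ 3) - 3 * c * (exp (c * w) * inverse w ^ 4) + 3 * (exp (c * w) * inverse w ^ 5)) / (16 * of_real pi)) = src2 k"
    by (simp add: src2_def c_def fun_eq_iff algebra_simps)
  ultimately show "(src2 k has_field_derivative 2 * w * src3 k w) (at w)" by simp
qed

text \<open>The \<open>s\<close>-derivative of the Helmholtz equation \<open>4 s F'' + 6 F' + k\<^sup>2 F = 0\<close>.\<close>

lemma src_ode:
  assumes w: "w \<noteq> 0"
  shows "4 * w\<^sup>2 * src3 k w + 10 * src2 k w + k\<^sup>2 * src1 k w = 0"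
proof -
  define c where "c = \<i> * k"
  define u where "u = inverse w"
  have wu: "w\<^sup>2 * u ^ Suc (Suc n) = u ^ n" for n using w by (simp add: u_def power2_eq_square field_simps)
  have k: "k\<^sup>2 = - c\<^sup>2" by (simp add: c_def power_mult_distrib)
  have e: "w\<^sup>2 * src3 k w = exp (c * w) * (c ^ 3 * u\<^sup>2 - 6 * c\<^sup>2 * u ^ 3 + 15 * c * u ^ 4 - 15 * u ^ 5) / (32 * of_real pi)"
  proof -
    have "w\<^sup>2 * src3 k w = exp (c * w) * (c ^ 3 * (w\<^sup>2 * u ^ 4) - 6 * c\<^sup>2 * (w\<^sup>2 * u ^ 5) + 15 * c * (w\<^sup>2 * u ^ 6) - 15 * (w\<^sup>2 * u ^ 7)) / (32 * of_real pi)"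
      unfolding src3_def c_def[symmetric] u_def[symmetric] by (simp add: algebra_simps)
    moreover have "w\<^sup>2 * u ^ 4 = u\<^sup>2" "w\<^sup>2 * u ^ 5 = u ^ 3" "w\<^sup>2 * u ^ 6 = u ^ 4" "w\<^sup>2 * u ^ 7 = u ^ 5"
      using wu[of 2] wu[of 3] wu[of 4] wu[of 5] by (simp_all add: eval_nat_numeral)
    ultimately show ?thesis by (simp only:)
  qed
  show ?thesis
    unfolding mult.assoc e unfolding src2_def src1_def c_def[symmetric] u_def[symmetric] k
    by (simp add: field_simps power2_eq_square power3_eq_cube)
qed

lemma sqrt_compose_deriv:
  assumes "(f has_field_derivative 2 * of_real (sqrt s) * d) (at (complex_of_real (sqrt s)))" "s > 0"
  shows "((\<lambda>s. f (of_real (sqrt s))) has_vector_derivative d) (at s)"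
proof -
  have "((\<lambda>s. complex_of_real (sqrt s)) has_vector_derivative of_real (inverse (sqrt s) / 2)) (at s)"
  proof -
    have "(sqrt has_real_derivative inverse (sqrt s) / 2) (at s)" by (rule DERIV_real_sqrt[OF assms(2)])
    then show ?thesis by (rule has_vector_derivative_of_real)
  qed
  from field_vector_diff_chain_at[OF this assms(1)]
  have "((\<lambda>s. f (of_real (sqrt s))) has_vector_derivative
     of_real (inverse (sqrt s) / 2) * (2 * of_real (sqrt s) * d)) (at s)" by (simp only: o_def)
  moreover have "complex_of_real (inverse (sqrt s) / 2) * (2 * of_real (sqrt s) * d) = d"
    using assms(2) by simp
  ultimately show ?thesis by (simp only:)
qed

lemma src_radial_deriv:
  assumes "s > 0"
  shows "((\<lambda>s. src0 k (of_real (sqrt s))) has_vector_derivative src1 k (of_real (sqrt s))) (at s)"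
    "((\<lambda>s. src1 k (of_real (sqrt s))) has_vector_derivative src2 k (of_real (sqrt s))) (at s)"
    "((\<lambda>s. src2 k (of_real (sqrt s))) has_vector_derivative src3 k (of_real (sqrt s))) (at s)"
  using assms by (auto intro!: sqrt_compose_deriv src_deriv)

lemma continuous_src3: "continuous_on {0<..} (\<lambda>s. src3 k (of_real (sqrt s)))"
  unfolding src3_def by (intro continuous_intros) auto

lemma dipole_radial:
  assumes k: "k \<noteq> 0" and x: "x \<noteq> z"
  shows "dipole_H k z p x = radial_H (\<lambda>s. src1 k (of_real (sqrt s))) z p x" (is ?H)
    and "dipole_E k z p x = radial_E k (\<lambda>s. src1 k (of_real (sqrt s))) (\<lambda>s. src2 k (of_real (sqrt s))) z p x" (is ?E)
proof -
  let ?U = "- {z}"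
  have U: "(norm (x - z))\<^sup>2 \<in> {0<..}" if "x \<in> ?U" for x using that by simp
  let ?F = "\<lambda>n. (\<lambda>s. (if n = 0 then src0 else if n = 1 then src1 else src2) k (complex_of_real (sqrt s)))"
  have c1: "continuous_on {0<..} (\<lambda>s. src1 k (complex_of_real (sqrt s)))"
    using src_radial_deriv(2) by (meson continuous_at_imp_continuous_on greaterThan_iff has_vector_derivative_continuous)
  have g: "has_grad ?U (\<lambda>x. (fundamental_solution k x z *s cvec p) $ i)
      (\<lambda>j x. of_real (2 * (x - z)$j) * src1 k (of_real (sqrt ((norm (x - z))\<^sup>2))) * of_real (p$i))" for i
  proof -
    have "has_grad ?U (\<lambda>x. src0 k (of_real (sqrt ((norm (x - z))\<^sup>2))))
       (\<lambda>j x. of_real (2 * (x - z)$j) * src1 k (of_real (sqrt ((norm (x - z))\<^sup>2))))"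
      by (rule has_grad_radial[OF src_radial_deriv(1) c1]) auto
    from has_grad_mult[OF this has_grad_const[of _ "complex_of_real (p$i)"]]
    have "has_grad ?U (\<lambda>x. src0 k (of_real (sqrt ((norm (x - z))\<^sup>2))) * complex_of_real (p$i))
      (\<lambda>j x. of_real (2 * (x - z)$j) * src1 k (of_real (sqrt ((norm (x - z))\<^sup>2))) * of_real (p$i))" by simp
    moreover have "(\<lambda>x. src0 k (of_real (sqrt ((norm (x - z))\<^sup>2)))) = (\<lambda>x. fundamental_solution k x z)"
    proof -
      have "a * inverse w / b = a / (b * w)" for a b w :: complex
        by (cases "w = 0"; cases "b = 0") (auto simp: field_simps)
      then show ?thesis unfolding fundamental_solution_def src0_def by simp
    qed
    then have "(\<lambda>x. src0 k (of_real (sqrt ((norm (x - z))\<^sup>2))) * complex_of_real (p$i)) =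
       (\<lambda>x. (fundamental_solution k x z *s cvec p) $ i)"
      unfolding vector_smult_component cvec_nth by metis
    ultimately show ?thesis by (simp only:)
  qed
  have H: "dipole_H k z p x = radial_H (\<lambda>s. src1 k (of_real (sqrt s))) z p x" if "x \<in> ?U" for x
    unfolding dipole_H_def curl_eq_rot[OF g that] radial_H_def
    by (rule vec3_eqI) (simp_all add: algebra_simps)
  from H x show ?H by simp
  obtain DE DH where R: "\<And>i. has_grad ?U (\<lambda>x. radial_H (\<lambda>s. src1 k (of_real (sqrt s))) z p x $ i) (DH i)"
    "\<And>x. rot DH x = - (\<i> * k) *s radial_E k (\<lambda>s. src1 k (of_real (sqrt s))) (\<lambda>s. src2 k (of_real (sqrt s))) z p x"
  proof (rule radial_fields[OF _ _ continuous_src3 U k, where p=p])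
    show "((\<lambda>s. src1 k (of_real (sqrt s))) has_vector_derivative src2 k (of_real (sqrt s))) (at s)"
      "((\<lambda>s. src2 k (of_real (sqrt s))) has_vector_derivative src3 k (of_real (sqrt s))) (at s)" if "s \<in> {0<..}" for s
      using src_radial_deriv(2,3) that by auto
  qed (use that in blast)+
  have "has_grad ?U (\<lambda>x. dipole_H k z p x $ i) (DH i)" for i
    by (rule has_grad_cong[OF _ R(1)]) (use H in auto)
  from curl_eq_rot[OF this, of x] x
  have "dipole_E k z p x = (\<i> / k) *s rot DH x" by (simp add: dipole_E_def dipole_H_def)
  then show ?E unfolding R(2) vector_smult_assoc using k by simp
qed

lemma dipole_maxwell:
  assumes k: "k \<noteq> 0" shows "maxwell_C1 k (- {z}) (dipole_E k z p) (dipole_H k z p)"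
proof -
  let ?F1 = "\<lambda>s. src1 k (of_real (sqrt s))" and ?F2 = "\<lambda>s. src2 k (of_real (sqrt s))"
  let ?F3 = "\<lambda>s. src3 k (of_real (sqrt s))"
  have U: "(norm (x - z))\<^sup>2 \<in> {0<..}" if "x \<in> - {z}" for x using that by simp
  have d: "\<And>s. s \<in> {0<..} \<Longrightarrow> (?F1 has_vector_derivative ?F2 s) (at s)"
    "\<And>s. s \<in> {0<..} \<Longrightarrow> (?F2 has_vector_derivative ?F3 s) (at s)"
    using src_radial_deriv(2,3) by auto
  have "maxwell_C1 k (- {z}) (radial_E k ?F1 ?F2 z p) (radial_H ?F1 z p)"
  proof (rule radial_fields[OF d continuous_src3 U k, where p=p])
    fix DE DH assume R: "\<And>i. has_grad (- {z}) (\<lambda>x. radial_E k ?F1 ?F2 z p x $ i) (DE i)"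
      "\<And>i. has_grad (- {z}) (\<lambda>x. radial_H ?F1 z p x $ i) (DH i)"
      "\<And>x. rot DH x = - (\<i> * k) *s radial_E k ?F1 ?F2 z p x"
      "\<And>x. rot DE x = (\<i> * k) *s radial_H ?F1 z p x - ((\<i> / k) * 2 *
       (4 * of_real ((norm (x - z))\<^sup>2) * ?F3 ((norm (x - z))\<^sup>2) + 10 * ?F2 ((norm (x - z))\<^sup>2)
         + k\<^sup>2 * ?F1 ((norm (x - z))\<^sup>2))) *s (cvec (x - z) \<times>\<^sub>c cvec p)"
    have ode: "4 * of_real ((norm (x - z))\<^sup>2) * ?F3 ((norm (x - z))\<^sup>2) + 10 * ?F2 ((norm (x - z))\<^sup>2)
         + k\<^sup>2 * ?F1 ((norm (x - z))\<^sup>2) = 0" if "x \<in> - {z}" for x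
      using src_ode[of "of_real (norm (x - z))" k] that by simp
    show ?thesis
      by (rule maxwell_C1I[OF _ R(1,2) _ R(3)]) (use R(4) ode in auto)
  qed auto
  then show ?thesis by (rule maxwell_C1_cong) (use dipole_radial[OF k] in auto)
qed


section \<open>The flux around a dipole\<close>

lemma has_vector_derivative_piecewise:
  fixes T g :: "real \<Rightarrow> complex"
  assumes T: "\<And>s. (T has_vector_derivative T' s) (at s)"
    and g: "\<And>s. s \<ge> a \<Longrightarrow> (g has_vector_derivative g' s) (at s)"
    and eq: "T a = g a" "T' a = g' a"
  shows "((\<lambda>s. if s \<le> a then T s else g s) has_vector_derivative (if s \<le> a then T' s else g' s)) (at s)"
proof -
  have "((\<lambda>s. if s \<in> {..a} then T s else g s) has_vector_derivative
     (if s \<in> {..a} then T' s else g' s)) (at s within UNIV)"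
  proof (rule has_vector_derivative_If_within_closures[where T="{a<..}"])
    show "(T has_vector_derivative T' s) (at s within {..a} \<union> (closure {..a} \<inter> closure {a<..}))"
      by (rule has_vector_derivative_at_within[OF T])
    show "(g has_vector_derivative g' s) (at s within {a<..} \<union> (closure {..a} \<inter> closure {a<..}))"
      if "s \<in> {a<..} \<union> (closure {..a} \<inter> closure {a<..})"
      by (rule has_vector_derivative_at_within[OF g]) (use that in auto)
  qed (use eq in auto)
  then show ?thesis by simp
qed

text \<open>A dipole without its singularity: for \<open>s \<le> a\<close> the first derivative of the profile is replaced by its second order Taylor
  polynomial at \<open>a\<close>. The fields outside the ball \<open>|x - z|\<^sup>2 \<le> a\<close> do not change, and two further continuous derivatives,
  \<open>moll2\<close> and \<open>moll3\<close>, are what is needed for \<open>C\<^sup>1\<close> fields.\<close>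

definition moll1 :: "complex \<Rightarrow> real \<Rightarrow> real \<Rightarrow> complex" where
  "moll1 k a s = (if s \<le> a then src1 k (of_real (sqrt a)) + src2 k (of_real (sqrt a)) * of_real (s - a)
     + src3 k (of_real (sqrt a)) * (of_real (s - a))\<^sup>2 / 2 else src1 k (of_real (sqrt s)))"
definition moll2 :: "complex \<Rightarrow> real \<Rightarrow> real \<Rightarrow> complex" where
  "moll2 k a s = (if s \<le> a then src2 k (of_real (sqrt a)) + src3 k (of_real (sqrt a)) * of_real (s - a)
     else src2 k (of_real (sqrt s)))"
definition moll3 :: "complex \<Rightarrow> real \<Rightarrow> real \<Rightarrow> complex" where
  "moll3 k a s = (if s \<le> a then src3 k (of_real (sqrt a)) else src3 k (of_real (sqrt s)))"

text \<open>The function \<open>4 s F'' + 6 F' + k\<^sup>2 F\<close> of the modified profile, simplified with the Helmholtz equation and its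
  derivative at \<open>a\<close>. It vanishes for \<open>s \<ge> a\<close> and acts as a smeared point source.\<close>

definition kern :: "complex \<Rightarrow> real \<Rightarrow> real \<Rightarrow> complex" where
  "kern k a s = (if s \<le> a then (7 * src3 k (of_real (sqrt a)) + k\<^sup>2 * src2 k (of_real (sqrt a)) / 2) * (of_real (s - a))\<^sup>2
      + k\<^sup>2 * src3 k (of_real (sqrt a)) / 6 * (of_real (s - a)) ^ 3 else 0)"

definition kern' :: "complex \<Rightarrow> real \<Rightarrow> real \<Rightarrow> complex" where
  "kern' k a s = 4 * of_real s * moll3 k a s + 10 * moll2 k a s + k\<^sup>2 * moll1 k a s"

lemma poly_derivs:
  "((\<lambda>s. complex_of_real (s - a)) has_vector_derivative 1) (at s)"
  "((\<lambda>s. (complex_of_real (s - a))\<^sup>2) has_vector_derivative 2 * of_real (s - a)) (at s)"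
  "((\<lambda>s. (complex_of_real (s - a)) ^ 3) has_vector_derivative 3 * (of_real (s - a))\<^sup>2) (at s)"
proof -
  have "((\<lambda>s. (s - a)) has_real_derivative 1) (at s)"
    "((\<lambda>s. (s - a)\<^sup>2) has_real_derivative 2 * (s - a)) (at s)"
    "((\<lambda>s. (s - a)^3) has_real_derivative 3 * (s - a)\<^sup>2) (at s)"
    by (auto intro!: derivative_eq_intros)
  from this[THEN has_vector_derivative_of_real]
  show "((\<lambda>s. complex_of_real (s - a)) has_vector_derivative 1) (at s)"
  "((\<lambda>s. (complex_of_real (s - a))\<^sup>2) has_vector_derivative 2 * of_real (s - a)) (at s)"
  "((\<lambda>s. (complex_of_real (s - a)) ^ 3) has_vector_derivative 3 * (of_real (s - a))\<^sup>2) (at s)"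
    by (simp_all only: of_real_1 of_real_power of_real_mult of_real_numeral)
qed

lemma moll_derivs:
  assumes a: "a > 0"
  shows "(moll1 k a has_vector_derivative moll2 k a s) (at s)"
    "(moll2 k a has_vector_derivative moll3 k a s) (at s)"
    "continuous_on UNIV (moll3 k a)"
    "(kern k a has_vector_derivative kern' k a s) (at s)"
    "s \<ge> a \<Longrightarrow> kern' k a s = 0"
proof -
  let ?A = "src1 k (of_real (sqrt a))" and ?B = "src2 k (of_real (sqrt a))" and ?C = "src3 k (of_real (sqrt a))"
  have d1: "((\<lambda>s. ?A + ?B * of_real (s - a) + ?C * (of_real (s - a))\<^sup>2 / 2) has_vector_derivative
      0 + ?B * 1 + ?C * (2 * of_real (s - a)) / 2) (at s)" for s
    by (intro has_vector_derivative_add has_vector_derivative_const has_vector_derivative_mult_right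
        has_vector_derivative_divide poly_derivs)
  have "((\<lambda>s. ?A + ?B * of_real (s - a) + ?C * (of_real (s - a))\<^sup>2 / 2) has_vector_derivative
      ?B + ?C * of_real (s - a)) (at s)" for s
  proof -
    have "0 + b * 1 + c * (2 * v) / 2 = b + c * v" for b c v :: complex by simp
    note this[of ?B ?C "of_real (s - a)"]
    with d1[of s] show ?thesis by (simp only:)
  qed
  then show "(moll1 k a has_vector_derivative moll2 k a s) (at s)"
    unfolding moll1_def[abs_def] moll2_def
    by (intro has_vector_derivative_piecewise src_radial_deriv) (use a in auto)
  have "((\<lambda>s. ?B + ?C * of_real (s - a)) has_vector_derivative 0 + ?C * 1) (at s)" for s
    by (intro has_vector_derivative_add has_vector_derivative_const has_vector_derivative_mult_right poly_derivs)
  then show "(moll2 k a has_vector_derivative moll3 k a s) (at s)"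
    unfolding moll2_def[abs_def] moll3_def
    by (intro has_vector_derivative_piecewise src_radial_deriv) (use a in auto)
  show "continuous_on UNIV (moll3 k a)"
    unfolding moll3_def[abs_def]
    by (rule continuous_on_cases_le)
       (use a in \<open>auto intro!: continuous_intros continuous_on_subset[OF continuous_src3]\<close>)
  have ode: "4 * of_real s * src3 k (of_real (sqrt s)) + 10 * src2 k (of_real (sqrt s)) + k\<^sup>2 * src1 k (of_real (sqrt s)) = 0"
    if "s > 0" for s :: real
  proof -
    have "(complex_of_real (sqrt s))\<^sup>2 = of_real s" using that by (metis of_real_power real_sqrt_pow2 less_imp_le)
    then show ?thesis using src_ode[of "of_real (sqrt s)" k] that by simp
  qed
  show z: "kern' k a s = 0" if "s \<ge> a" for s
    using ode[of s] that a by (cases "s = a") (auto simp: kern'_def moll1_def moll2_def moll3_def)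
  have k': "kern' k a s = (if s \<le> a then (7 * ?C + k\<^sup>2 * ?B / 2) * (2 * of_real (s - a)) + k\<^sup>2 * ?C / 6 * (3 * (of_real (s - a))\<^sup>2) else 0)" for s
  proof (cases "s \<le> a")
    case True
    define v where "v = complex_of_real (s - a)"
    have s: "complex_of_real s = of_real a + v" by (simp add: v_def)
    have "kern' k a s = (4 * of_real a * ?C + 10 * ?B + k\<^sup>2 * ?A) + ((7 * ?C + k\<^sup>2 * ?B / 2) * (2 * v) + k\<^sup>2 * ?C / 6 * (3 * v\<^sup>2))"
      using True unfolding kern'_def moll1_def moll2_def moll3_def v_def[symmetric] s by (simp add: algebra_simps)
    then show ?thesis using ode[OF a] True by (simp add: v_def)
  qed (use z in simp)
  have "((\<lambda>s. (7 * ?C + k\<^sup>2 * ?B / 2) * (of_real (s - a))\<^sup>2 + k\<^sup>2 * ?C / 6 * (of_real (s - a)) ^ 3) has_vector_derivative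
     (7 * ?C + k\<^sup>2 * ?B / 2) * (2 * of_real (s - a)) + k\<^sup>2 * ?C / 6 * (3 * (of_real (s - a))\<^sup>2)) (at s)" for s
    by (intro has_vector_derivative_add has_vector_derivative_mult_right poly_derivs)
  then show "(kern k a has_vector_derivative kern' k a s) (at s)"
    unfolding k' kern_def[abs_def]
    by (intro has_vector_derivative_piecewise) auto
qed

definition flux :: "(3 \<Rightarrow> real^3 \<Rightarrow> complex) \<Rightarrow> vfield \<Rightarrow> complex" where
  "flux D V = integral\<^sup>L lborel (\<lambda>x. \<Sum>i\<in>UNIV. D i x * V x $ i)"

text \<open>Replace the dipole by its modification inside the ball, where \<open>\<phi> = 1\<close>; this does not change the flux. Now all fields are \<open>C\<^sup>1\<close>,
  and the divergence of the flux density is \<open>(i/k) curl (kern p) \<bullet> H\<close>. Moving the curl to \<open>H\<close> and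
  using \<open>curl H = - i k E\<close> leaves \<open>kern (p \<bullet> E)\<close>.\<close>

lemma source_flux_kernel:
  assumes M: "maxwell_C1 k U E H" and k: "k \<noteq> 0" and a: "0 < a" "a < r\<^sup>2" "0 < r" and sub: "cball z r \<subseteq> U"
    and \<phi>: "test_fun U \<phi> D" and \<phi>1: "\<And>x. x \<in> ball z r \<Longrightarrow> \<phi> x = 1"
  shows "flux D (flux_field E H (dipole_E k z p) (dipole_H k z p)) =
    - integral\<^sup>L lborel (\<lambda>x. kern k a ((norm (x - z))\<^sup>2) * (cvec p \<bullet>\<^sub>c E x))"
    and "integrable lborel (\<lambda>x. \<Sum>i\<in>UNIV. D i x * flux_field E H (dipole_E k z p) (dipole_H k z p) x $ i)"
proof -
  obtain DE DH where 1: "open U" "\<And>i. has_grad U (\<lambda>x. E x $ i) (DE i)" "\<And>i. has_grad U (\<lambda>x. H x $ i) (DH i)"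
    "\<And>x. x \<in> U \<Longrightarrow> rot DE x = (\<i> * k) *s H x" "\<And>x. x \<in> U \<Longrightarrow> rot DH x = - (\<i> * k) *s E x"
    using maxwell_C1E[OF M] by metis
  let ?E = "radial_E k (moll1 k a) (moll2 k a) z p" and ?H = "radial_H (moll1 k a) z p"
  let ?s = "\<lambda>x. (norm (x - z))\<^sup>2"
  let ?V = "flux_field E H (dipole_E k z p) (dipole_H k z p)" and ?W = "flux_field E H ?E ?H"
  obtain DE' DH' where 2: "\<And>i. has_grad U (\<lambda>x. ?E x $ i) (DE' i)" "\<And>i. has_grad U (\<lambda>x. ?H x $ i) (DH' i)"
    "\<And>x. rot DH' x = - (\<i> * k) *s ?E x"
    "\<And>x. rot DE' x = (\<i> * k) *s ?H x - ((\<i> / k) * 2 * (4 * of_real (?s x) * moll3 k a (?s x) + 10 * moll2 k a (?s x)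
       + k\<^sup>2 * moll1 k a (?s x))) *s (cvec (x - z) \<times>\<^sub>c cvec p)"
    by (rule radial_fields[of UNIV "moll1 k a" "moll2 k a" "moll3 k a" U z k p, OF moll_derivs(1)[OF a(1)] moll_derivs(2)[OF a(1)] moll_derivs(3)[OF a(1)] UNIV_I k])
       (rule that; assumption)
  note rotE' = 2(4)[folded kern'_def]
  have D0: "D i x = 0" if "x \<in> ball z r" for i x
    by (rule has_grad_zero_deriv[of UNIV \<phi> D "ball z r" 1]) (use \<phi> \<phi>1 that in \<open>auto simp: test_fun_def\<close>)
  have "?V x = ?W x" if "x \<notin> ball z r" for x
  proof -
    have "norm (x - z) \<ge> r" using that by (auto simp: dist_norm norm_minus_commute)
    then have s: "?s x > a" using a by (smt (verit) power_mono)
    have "x \<noteq> z" using that a by auto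
    from dipole_radial[OF k this, of p] s show ?thesis
      by (simp add: flux_field_def radial_E_def radial_H_def moll1_def moll2_def)
  qed
  then have eqVW: "(\<lambda>x. \<Sum>i\<in>UNIV. D i x * ?V x $ i) = (\<lambda>x. \<Sum>i\<in>UNIV. D i x * ?W x $ i)"
    using D0 by (intro ext sum.cong refl) (metis mult_zero_left)
  obtain DW where DW: "\<And>i. has_grad U (\<lambda>x. ?W x $ i) (DW i)"
    "\<And>x. (\<Sum>i\<in>UNIV. DW i i x) = rot DE x \<bullet>\<^sub>c ?H x - E x \<bullet>\<^sub>c rot DH' x - rot DE' x \<bullet>\<^sub>c H x + ?E x \<bullet>\<^sub>c rot DH x"
    by (rule flux_field_grad[OF 1(2,3) 2(1,2)]) (rule that; assumption)
  let ?X = "\<lambda>x. (cvec (x - z) \<times>\<^sub>c cvec p) \<bullet>\<^sub>c H x"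
  have divW: "(\<Sum>i\<in>UNIV. DW i i x) = ((\<i> / k) * 2 * kern' k a (?s x)) * ?X x" if "x \<in> U" for x
  proof -
    define c where "c = (\<i> / k) * 2 * kern' k a (?s x)"
    show ?thesis unfolding DW(2) 1(4,5)[OF that] 2(3) rotE' c_def[symmetric]
      by (simp add: bilinear_dot_3 algebra_simps)
  qed
  show "integrable lborel (\<lambda>x. \<Sum>i\<in>UNIV. D i x * ?V x $ i)"
    unfolding eqVW by (rule integral_grad_dot(1)[OF \<phi> 1(1) DW(1)])
  have i1: "flux D ?V = - integral\<^sup>L lborel (\<lambda>x. \<phi> x * (\<Sum>i\<in>UNIV. DW i i x))"
    unfolding flux_def eqVW by (rule integral_grad_dot(2)[OF \<phi> 1(1) DW(1)])
  let ?m = "\<lambda>x. kern k a (?s x)" and ?Dm = "\<lambda>j x. of_real (2 * (x - z)$j) * kern' k a (?s x)"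
  have ck': "continuous_on UNIV (kern' k a)" unfolding kern'_def[abs_def]
    using moll_derivs(1,2)[OF a(1)] moll_derivs(3)[OF a(1)]
    by (intro continuous_intros) (meson continuous_at_imp_continuous_on has_vector_derivative_continuous)+
  have m: "test_fun U ?m ?Dm"
    unfolding test_fun_def
  proof (intro conjI exI[of _ "cball z r"] allI impI sub)
    show "has_grad UNIV ?m ?Dm"
      by (rule has_grad_radial[OF moll_derivs(4)[OF a(1)] ck']) simp
    fix x assume "x \<notin> cball z r"
    then have "norm (x - z) \<ge> r" by (auto simp: dist_norm norm_minus_commute)
    then have s: "?s x > a" using a by (smt (verit) power_mono)
    then show "?m x = 0" by (simp add: kern_def)
  qed simp
  define Y where "Y = flux_field (\<lambda>x. cvec p) (\<lambda>x. 0) (\<lambda>x. 0) H"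
  have c0: "has_grad U (\<lambda>x. (cvec p) $ i) (\<lambda>j x. 0)" "has_grad U (\<lambda>x. (0::complex^3) $ i) (\<lambda>j x. 0)" for i
    by (rule has_grad_const)+
  obtain DY where DY: "\<And>i. has_grad U (\<lambda>x. flux_field (\<lambda>x. cvec p) (\<lambda>x. 0) (\<lambda>x. 0) H x $ i) (DY i)"
    "\<And>x. (\<Sum>i\<in>UNIV. DY i i x) = rot (\<lambda>i j x. 0) x \<bullet>\<^sub>c H x - cvec p \<bullet>\<^sub>c rot DH x - rot (\<lambda>i j x. 0) x \<bullet>\<^sub>c 0 + 0 \<bullet>\<^sub>c rot (\<lambda>i j x. 0) x"
    by (rule flux_field_grad[OF c0(1) c0(2) c0(2) 1(3)]) (rule that; assumption)
  have divY: "(\<Sum>i\<in>UNIV. DY i i x) = (\<i> * k) * (cvec p \<bullet>\<^sub>c E x)" if "x \<in> U" for x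
    unfolding DY(2) 1(5)[OF that] by (simp add: bilinear_dot_3 algebra_simps)
  have i2: "integral\<^sup>L lborel (\<lambda>x. \<Sum>i\<in>UNIV. ?Dm i x * Y x $ i) = - integral\<^sup>L lborel (\<lambda>x. ?m x * (\<Sum>i\<in>UNIV. DY i i x))"
    by (rule integral_grad_dot(2)[OF m 1(1) DY(1)[folded Y_def]])
  have XY: "(\<Sum>i\<in>UNIV. ?Dm i x * Y x $ i) = 2 * kern' k a (?s x) * ?X x" for x
    unfolding Y_def flux_field_def by (simp add: sum_3 bilinear_dot_3 algebra_simps)
  have e1: "\<phi> x * (\<Sum>i\<in>UNIV. DW i i x) = (\<i> / k) * (\<Sum>i\<in>UNIV. ?Dm i x * Y x $ i)" for x
  proof (cases "x \<in> ball z r")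
    case True
    then have "x \<in> U" using sub by auto
    then show ?thesis unfolding XY using divW \<phi>1[OF True] by simp
  next
    case False
    have "norm (x - z) \<ge> r" using False by (auto simp: dist_norm norm_minus_commute)
    then have s: "?s x > a" using a by (smt (verit) power_mono)
    then have k0: "kern' k a (?s x) = 0" using moll_derivs(5)[OF a(1)] by simp
    show ?thesis
    proof (cases "x \<in> U")
      case True then show ?thesis unfolding XY divW[OF True] k0 by simp
    next
      case False then have "\<phi> x = 0" using \<phi> by (meson subsetD test_funE)
      then show ?thesis unfolding XY k0 by simp
    qed
  qed
  have e2: "?m x * (\<Sum>i\<in>UNIV. DY i i x) = (\<i> * k) * (?m x * (cvec p \<bullet>\<^sub>c E x))" for x
  proof (cases "x \<in> U")
    case True then show ?thesis unfolding divY[OF True] by simp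
  next
    case False then have "?m x = 0" using m by (meson subsetD test_funE)
    then show ?thesis by simp
  qed
  have "flux D ?V = - ((\<i> / k) * (- ((\<i> * k) * integral\<^sup>L lborel (\<lambda>x. ?m x * (cvec p \<bullet>\<^sub>c E x)))))"
    unfolding i1 e1 integral_mult_right_zero i2 e2 ..
  then show "flux D ?V = - integral\<^sup>L lborel (\<lambda>x. kern k a (?s x) * (cvec p \<bullet>\<^sub>c E x))"
    using k by simp
qed

lemma lborel_integral_scale:
  fixes f :: "real^3 \<Rightarrow> complex"
  assumes "f \<in> borel_measurable borel" "r > 0"
  shows "integral\<^sup>L lborel f = of_real (r ^ 3) * integral\<^sup>L lborel (\<lambda>y. f (z + r *\<^sub>R y))"
proof -
  have "integral\<^sup>L lborel f = integral\<^sup>L (density (distr lborel borel (\<lambda>x. z + r *\<^sub>R x)) (\<lambda>_. ennreal (r ^ 3))) f"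
    using lborel_affine[of r z] assms(2) by (simp add: ennreal_power)
  also have "\<dots> = integral\<^sup>L (distr lborel borel (\<lambda>x. z + r *\<^sub>R x)) (\<lambda>x. (r ^ 3) *\<^sub>R f x)"
    using assms by (intro integral_density) auto
  also have "\<dots> = (r ^ 3) *\<^sub>R integral\<^sup>L lborel (\<lambda>x. f (z + r *\<^sub>R x))"
    using assms by (simp, subst integral_distr) auto
  finally show ?thesis by (simp add: scaleR_conv_of_real)
qed

text \<open>The weight with which a dipole reads off the field at its position. It does not depend on the wave number; this lets
  it cancel between a dipole in one layer and a remote dipole in the other.\<close>

definition source_constant :: real where
  "source_constant = 105 / (32 * pi) * integral\<^sup>L lborel (\<lambda>y::real^3. indicator (cball 0 1) y * ((norm y)\<^sup>2 - 1)\<^sup>2)"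

lemma source_constant_pos: "source_constant > 0"
proof -
  let ?f = "\<lambda>y::real^3. indicator (cball 0 1) y * ((norm y)\<^sup>2 - 1)\<^sup>2 :: real"
  have i: "integrable lborel ?f"
    using borel_integrable_compact[of "cball 0 1" "\<lambda>y::real^3. ((norm y)\<^sup>2 - 1)\<^sup>2"] by (simp add: continuous_intros)
  have i2: "integrable lborel (\<lambda>y::real^3. indicator (cball 0 (1/2)) y * (1/4) :: real)"
    using borel_integrable_compact[of "cball 0 (1/2)" "\<lambda>y::real^3. 1/4 :: real"] by simp
  have le: "indicator (cball 0 (1/2)) y * (1/4) \<le> ?f y" for y
  proof (cases "norm y \<le> 1/2")
    case True
    have "(norm y)\<^sup>2 \<le> (1/2)\<^sup>2" using True by (intro power_mono) auto
    then have "1/2 \<le> 1 - (norm y)\<^sup>2" by (simp add: power2_eq_square)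
    then have "(1/2)\<^sup>2 \<le> (1 - (norm y)\<^sup>2)\<^sup>2" by (intro power_mono) auto
    also have "(1 - (norm y)\<^sup>2)\<^sup>2 = ((norm y)\<^sup>2 - 1)\<^sup>2" by (simp add: power2_commute)
    finally show ?thesis using True by (simp add: power2_eq_square)
  qed (simp add: indicator_def)
  have "0 < measure lborel (cball (0::real^3) (1/2)) * (1/4)" using content_cball_pos[of "1/2" "0::real^3"] by simp
  also have "\<dots> = integral\<^sup>L lborel (\<lambda>y::real^3. indicator (cball 0 (1/2)) y * (1/4) :: real)" by simp
  also have "\<dots> \<le> integral\<^sup>L lborel ?f" by (rule integral_mono[OF i2 i le])
  finally show ?thesis unfolding source_constant_def by simp
qed

text \<open>The coefficients of \<open>kern\<close> after the substitution \<open>x = z + r y\<close>; only the most singular term of \<open>src3\<close> survives, and it is independent of \<open>k\<close>.\<close>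

lemma src_scaled_limits:
  assumes r: "r \<longlonglongrightarrow> 0" "\<And>n. r n > (0::real)"
  shows "(\<lambda>n. of_real (r n ^ 7) * src3 k (of_real (r n))) \<longlonglongrightarrow> - 15 / (32 * of_real pi)"
    and "(\<lambda>n. of_real (r n ^ 7) * src2 k (of_real (r n))) \<longlonglongrightarrow> 0"
    and "(\<lambda>n. of_real (r n ^ 9) * src3 k (of_real (r n))) \<longlonglongrightarrow> 0"
proof -
  define w where "w n = complex_of_real (r n)" for n
  have w: "w \<longlonglongrightarrow> 0" "w n \<noteq> 0" for n
    using tendsto_of_real[OF r(1), where 'a=complex] r(2)[of n] by (auto simp: w_def[abs_def])
  define c where "c = \<i> * k"
  have u: "w n ^ (m + d) * inverse (w n) ^ m = w n ^ d" for n m d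
    using w(2)[of n] by (simp add: power_add power_inverse)
  have e3: "w n ^ 7 * src3 k (w n) = exp (c * w n) * (c ^ 3 * w n ^ 3 - 6 * c\<^sup>2 * w n ^ 2 + 15 * c * w n - 15) / (32 * of_real pi)" for n
  proof -
    have "w n ^ 7 * src3 k (w n) = exp (c * w n) * (c ^ 3 * (w n ^ (4 + 3) * inverse (w n) ^ 4) - 6 * c\<^sup>2 * (w n ^ (5 + 2) * inverse (w n) ^ 5)
      + 15 * c * (w n ^ (6 + 1) * inverse (w n) ^ 6) - 15 * (w n ^ (7 + 0) * inverse (w n) ^ 7)) / (32 * of_real pi)"
      unfolding src3_def c_def[symmetric] by (simp add: algebra_simps)
    then show ?thesis unfolding u by simp
  qed
  have e2: "w n ^ 7 * src2 k (w n) = exp (c * w n) * (c\<^sup>2 * w n ^ 4 - 3 * c * w n ^ 3 + 3 * w n ^ 2) / (16 * of_real pi)" for n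
  proof -
    have "w n ^ 7 * src2 k (w n) = exp (c * w n) * (c\<^sup>2 * (w n ^ (3 + 4) * inverse (w n) ^ 3) - 3 * c * (w n ^ (4 + 3) * inverse (w n) ^ 4)
      + 3 * (w n ^ (5 + 2) * inverse (w n) ^ 5)) / (16 * of_real pi)"
      unfolding src2_def c_def[symmetric] by (simp add: algebra_simps)
    then show ?thesis unfolding u by simp
  qed
  have l3: "(\<lambda>n. w n ^ 7 * src3 k (w n)) \<longlonglongrightarrow> exp (c * 0) * (c ^ 3 * 0 ^ 3 - 6 * c\<^sup>2 * 0 ^ 2 + 15 * c * 0 - 15) / (32 * of_real pi)"
    unfolding e3 by (intro tendsto_intros w) simp
  then show "(\<lambda>n. of_real (r n ^ 7) * src3 k (of_real (r n))) \<longlonglongrightarrow> - 15 / (32 * of_real pi)"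
    by (simp add: w_def)
  have "(\<lambda>n. w n ^ 7 * src2 k (w n)) \<longlonglongrightarrow> exp (c * 0) * (c\<^sup>2 * 0 ^ 4 - 3 * c * 0 ^ 3 + 3 * 0 ^ 2) / (16 * of_real pi)"
    unfolding e2 by (intro tendsto_intros w) simp
  then show "(\<lambda>n. of_real (r n ^ 7) * src2 k (of_real (r n))) \<longlonglongrightarrow> 0" by (simp add: w_def)
  have "(\<lambda>n. w n ^ 2 * (w n ^ 7 * src3 k (w n))) \<longlonglongrightarrow> 0 ^ 2 * (exp (c * 0) * (c ^ 3 * 0 ^ 3 - 6 * c\<^sup>2 * 0 ^ 2 + 15 * c * 0 - 15) / (32 * of_real pi))"
    by (intro tendsto_mult tendsto_power w l3)
  moreover have "w n ^ 2 * (w n ^ 7 * src3 k (w n)) = of_real (r n ^ 9) * src3 k (of_real (r n))" for n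
    by (simp add: w_def flip: mult.assoc power_add)
  ultimately show "(\<lambda>n. of_real (r n ^ 9) * src3 k (of_real (r n))) \<longlonglongrightarrow> 0" by simp
qed

lemma ball_average_limit:
  assumes g: "continuous_on (cball z R) (g :: real^3 \<Rightarrow> complex)" "0 < R"
    and r: "r \<longlonglongrightarrow> 0" "\<And>n. 0 < r n" "\<And>n. r n \<le> R"
    and h: "continuous_on (cball 0 1) (h :: real^3 \<Rightarrow> complex)"
  shows "(\<lambda>n. integral\<^sup>L lborel (\<lambda>y. indicator (cball 0 1) y *\<^sub>R (h y * g (z + r n *\<^sub>R y))))
     \<longlonglongrightarrow> g z * integral\<^sup>L lborel (\<lambda>y. indicator (cball 0 1) y *\<^sub>R h y)"
proof -
  have sub: "z + r n *\<^sub>R y \<in> cball z R" if "y \<in> cball 0 1" for n y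
  proof -
    have "r n * norm y \<le> R * 1" using that r(2,3)[of n] g(2) by (intro mult_mono) auto
    then show ?thesis using r(2)[of n] by (simp add: dist_norm)
  qed
  have "bounded (g ` cball z R)" "bounded (h ` cball 0 1)"
    using g(1) h by (auto intro!: compact_imp_bounded compact_continuous_image)
  then obtain bg bh where "\<forall>y\<in>g ` cball z R. norm y \<le> bg" "\<forall>y\<in>h ` cball 0 1. norm y \<le> bh"
    unfolding bounded_iff by blast
  then have b: "\<And>x. x \<in> cball z R \<Longrightarrow> norm (g x) \<le> bg" and b2: "\<And>x. x \<in> cball 0 1 \<Longrightarrow> norm (h x) \<le> bh"
    by blast+
  have int: "integrable lborel (\<lambda>y. indicator (cball 0 1) y *\<^sub>R (h y * g (z + r n *\<^sub>R y)))" for n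
    by (rule borel_integrable_compact)
       (use sub in \<open>auto intro!: continuous_intros h continuous_on_compose2[OF g(1)]\<close>)
  have inth: "integrable lborel (\<lambda>y. indicator (cball 0 1) y *\<^sub>R h y)"
    by (rule borel_integrable_compact) (use h in auto)
  have "(\<lambda>n. integral\<^sup>L lborel (\<lambda>y. indicator (cball 0 1) y *\<^sub>R (h y * g (z + r n *\<^sub>R y))))
     \<longlonglongrightarrow> integral\<^sup>L lborel (\<lambda>y. (indicator (cball 0 1) y *\<^sub>R h y) * g z)"
  proof (rule integral_dominated_convergence[where w="\<lambda>y. indicator (cball 0 1) y *\<^sub>R (bh * bg)"])
    show "(\<lambda>y. (indicator (cball 0 1) y *\<^sub>R h y) * g z) \<in> borel_measurable lborel"
      using inth by (intro borel_measurable_times) auto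
    show "(\<lambda>y. indicator (cball 0 1) y *\<^sub>R (h y * g (z + r n *\<^sub>R y))) \<in> borel_measurable lborel" for n
      using int by auto
    show "integrable lborel (\<lambda>y::real^3. indicator (cball 0 1) y *\<^sub>R (bh * bg))"
      by (rule borel_integrable_compact) auto
    show "AE y in lborel. (\<lambda>n. indicator (cball 0 1) y *\<^sub>R (h y * g (z + r n *\<^sub>R y))) \<longlonglongrightarrow> (indicator (cball 0 1) y *\<^sub>R h y) * g z"
    proof (rule AE_I2)
      fix y :: "real^3"
      show "(\<lambda>n. indicator (cball 0 1) y *\<^sub>R (h y * g (z + r n *\<^sub>R y))) \<longlonglongrightarrow> (indicator (cball 0 1) y *\<^sub>R h y) * g z"
      proof (cases "y \<in> cball 0 1")
        case True
        have "(\<lambda>n. z + r n *\<^sub>R y) \<longlonglongrightarrow> z + 0 *\<^sub>R y" by (intro tendsto_intros r)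
        then have "(\<lambda>n. g (z + r n *\<^sub>R y)) \<longlonglongrightarrow> g z"
          by (intro continuous_on_tendsto_compose[OF g(1)]) (use sub[OF True] g(2) in auto)
        then have "(\<lambda>n. h y * g (z + r n *\<^sub>R y)) \<longlonglongrightarrow> h y * g z" by (intro tendsto_intros)
        then show ?thesis using True by simp
      qed simp
    qed
    show "AE y in lborel. norm (indicator (cball 0 1) y *\<^sub>R (h y * g (z + r n *\<^sub>R y))) \<le> indicator (cball 0 1) y *\<^sub>R (bh * bg)" for n
    proof (rule AE_I2)
      fix y :: "real^3"
      show "norm (indicator (cball 0 1) y *\<^sub>R (h y * g (z + r n *\<^sub>R y))) \<le> indicator (cball 0 1) y *\<^sub>R (bh * bg)"
      proof (cases "y \<in> cball 0 1")
        case True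
        then show ?thesis using b[OF sub[OF True, of n]] b2[OF True]
          by (simp add: norm_mult mult_mono[of "norm (h y)" bh "norm (g (z + r n *\<^sub>R y))" bg] order_trans[OF norm_ge_zero, of "h y" bh])
      qed simp
    qed
  qed
  then show ?thesis unfolding integral_mult_left_zero by (simp only: mult.commute[of "g z"])
qed

lemma source_scaling_identity:
  fixes w q :: complex
  shows "w ^ 3 * (((7 * c + d * b / 2) * (w\<^sup>2 * q)\<^sup>2 + d * c / 6 * (w\<^sup>2 * q) ^ 3) * g) =
    (7 * (w ^ 7 * c) + d * (w ^ 7 * b) / 2) * (q\<^sup>2 * g) + d * (w ^ 9 * c) / 6 * (q ^ 3 * g)"
  by (simp add: field_simps eval_nat_numeral)

text \<open>The flux does not depend on the radius \<open>\<surd>a\<close> of the ball in which the dipole is modified; let it tend to zero.\<close>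

lemma source_flux:
  assumes M: "maxwell_C1 k U E H" and k: "k \<noteq> 0" and R: "0 < R" and sub: "cball z R \<subseteq> U"
    and \<phi>: "test_fun U \<phi> D" and \<phi>1: "\<And>x. x \<in> ball z R \<Longrightarrow> \<phi> x = 1"
  shows "flux D (flux_field E H (dipole_E k z p) (dipole_H k z p)) = of_real source_constant * (cvec p \<bullet>\<^sub>c E z)"
proof -
  define g where "g x = cvec p \<bullet>\<^sub>c E x" for x
  have cg: "continuous_on (cball z R) g"
    unfolding g_def bilinear_dot_def using maxwell_continuous(1)[OF M] sub
    by (intro continuous_intros) (auto intro: continuous_on_subset)
  define r where "r n = R * inverse (real (Suc (Suc n)))" for n
  have r: "0 < r n" "r n < R" for n using R by (auto simp: r_def field_simps add_pos_nonneg)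
  have "(\<lambda>n. R * inverse (real (Suc (Suc n)))) \<longlonglongrightarrow> R * 0"
    by (intro tendsto_intros LIMSEQ_Suc[OF LIMSEQ_inverse_real_of_nat])
  then have r0: "r \<longlonglongrightarrow> 0" by (simp add: r_def[abs_def])
  let ?q = "\<lambda>y::real^3. complex_of_real ((norm y)\<^sup>2 - 1)"
  define J where "J m n = integral\<^sup>L lborel (\<lambda>y. indicator (cball 0 1) y *\<^sub>R (?q y ^ m * g (z + r n *\<^sub>R y)))" for m n
  define J0 where "J0 m = integral\<^sup>L lborel (\<lambda>y. indicator (cball 0 1) y *\<^sub>R ?q y ^ m)" for m
  have J: "(\<lambda>n. J m n) \<longlonglongrightarrow> g z * J0 m" for m
    unfolding J_def J0_def
    by (rule ball_average_limit[OF cg R r0 r(1) less_imp_le[OF r(2)]]) (intro continuous_intros)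
  let ?A = "\<lambda>n. 7 * (of_real (r n ^ 7) * src3 k (of_real (r n))) + k\<^sup>2 * (of_real (r n ^ 7) * src2 k (of_real (r n))) / 2"
  let ?B = "\<lambda>n. k\<^sup>2 * (of_real (r n ^ 9) * src3 k (of_real (r n))) / 6"
  have fl: "flux D (flux_field E H (dipole_E k z p) (dipole_H k z p)) = - (?A n * J 2 n + ?B n * J 3 n)" for n
  proof -
    let ?a = "(r n)\<^sup>2"
    let ?f = "\<lambda>x. kern k ?a ((norm (x - z))\<^sup>2) * g x"
    have sq: "sqrt ?a = r n" using r(1)[of n] by simp
    have a: "0 < ?a" "?a < R\<^sup>2" using r[of n] by (auto intro!: power_strict_mono)
    have f1: "flux D (flux_field E H (dipole_E k z p) (dipole_H k z p)) = - integral\<^sup>L lborel ?f"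
      unfolding g_def by (rule source_flux_kernel(1)[OF M k a R sub \<phi> \<phi>1])
    have "continuous_on UNIV (kern k ?a)"
      using moll_derivs(4)[OF a(1)] by (meson continuous_at_imp_continuous_on has_vector_derivative_continuous)
    moreover have "continuous_on (cball z R) (\<lambda>x. (norm (x - z))\<^sup>2)" by (intro continuous_intros)
    ultimately have "continuous_on (cball z R) (\<lambda>x. kern k ?a ((norm (x - z))\<^sup>2))"
      by (rule continuous_on_compose2) simp
    from continuous_on_mult[OF this cg] have "continuous_on (cball z R) ?f" .
    then have "integrable lborel ?f"
    proof (rule integrable_compact_support)
      fix x assume "x \<notin> cball z R"
      then have "norm (x - z) \<ge> R" by (auto simp: dist_norm norm_minus_commute)
      then have "(norm (x - z))\<^sup>2 > ?a" using a R by (smt (verit) power_mono)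
      then show "?f x = 0" by (simp add: kern_def)
    qed simp
    then have "?f \<in> borel_measurable borel" by auto
    from lborel_integral_scale[OF this r(1), of n z]
    have "integral\<^sup>L lborel ?f = of_real (r n ^ 3) * integral\<^sup>L lborel (\<lambda>y. ?f (z + r n *\<^sub>R y))" .
    also have "\<dots> = integral\<^sup>L lborel (\<lambda>y. of_real (r n ^ 3) * ?f (z + r n *\<^sub>R y))" by simp
    also have "\<dots> = integral\<^sup>L lborel (\<lambda>y. ?A n * (indicator (cball 0 1) y *\<^sub>R (?q y ^ 2 * g (z + r n *\<^sub>R y)))
         + ?B n * (indicator (cball 0 1) y *\<^sub>R (?q y ^ 3 * g (z + r n *\<^sub>R y))))"
    proof (rule Bochner_Integration.integral_cong[OF refl])
      fix y :: "real^3"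
      have n: "(norm (z + r n *\<^sub>R y - z))\<^sup>2 = (r n)\<^sup>2 * (norm y)\<^sup>2" using r(1)[of n] by (simp add: power_mult_distrib)
      show "of_real (r n ^ 3) * ?f (z + r n *\<^sub>R y) = ?A n * (indicator (cball 0 1) y *\<^sub>R (?q y ^ 2 * g (z + r n *\<^sub>R y)))
         + ?B n * (indicator (cball 0 1) y *\<^sub>R (?q y ^ 3 * g (z + r n *\<^sub>R y)))"
      proof (cases "norm y \<le> 1")
        case True
        then have "(norm y)\<^sup>2 \<le> 1\<^sup>2" by (intro power_mono) auto
        then have le: "(r n)\<^sup>2 * (norm y)\<^sup>2 \<le> ?a" by (simp add: mult_left_le)
        have v: "complex_of_real ((r n)\<^sup>2 * (norm y)\<^sup>2 - ?a) = of_real (r n) ^ 2 * ?q y" by (simp add: algebra_simps)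
        show ?thesis using True le unfolding n kern_def v sq
          using source_scaling_identity[of "of_real (r n)" "src3 k (of_real (r n))" "k\<^sup>2" "src2 k (of_real (r n))" "?q y" "g (z + r n *\<^sub>R y)"]
          by simp
      next
        case False
        then have "1\<^sup>2 < (norm y)\<^sup>2" by (intro power_strict_mono) auto
        then have "\<not> (r n)\<^sup>2 * (norm y)\<^sup>2 \<le> ?a" using r(1)[of n] by simp
        then show ?thesis using False unfolding n kern_def by simp
      qed
    qed
    also have "\<dots> = ?A n * J 2 n + ?B n * J 3 n"
    proof -
      have "integrable lborel (\<lambda>y. indicator (cball 0 1) y *\<^sub>R (?q y ^ m * g (z + r n *\<^sub>R y)))" for m
      proof (rule borel_integrable_compact)
        have "z + r n *\<^sub>R y \<in> cball z R" if "y \<in> cball 0 1" for y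
        proof -
          have "r n * norm y \<le> R * 1" using that r[of n] R by (intro mult_mono) auto
          then show ?thesis using r(1)[of n] by (simp add: dist_norm)
        qed
        then show "continuous_on (cball 0 1) (\<lambda>y. ?q y ^ m * g (z + r n *\<^sub>R y))"
          by (intro continuous_intros continuous_on_compose2[OF cg]) auto
      qed simp
      then show ?thesis unfolding J_def integral_mult_right_zero[symmetric]
        by (intro Bochner_Integration.integral_add integrable_mult_right)
    qed
    finally show ?thesis using f1 by simp
  qed
  have "(\<lambda>n. - (?A n * J 2 n + ?B n * J 3 n)) \<longlonglongrightarrow>
     - ((7 * (- 15 / (32 * of_real pi)) + k\<^sup>2 * 0 / 2) * (g z * J0 2) + (k\<^sup>2 * 0 / 6) * (g z * J0 3))"
    by (intro tendsto_intros J src_scaled_limits r0 r) auto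
  moreover have "- ((7 * (- 15 / (32 * of_real pi)) + k\<^sup>2 * 0 / 2) * (g z * J0 2) + (k\<^sup>2 * 0 / 6) * (g z * J0 3))
     = of_real source_constant * g z"
  proof -
    have "J0 2 = of_real (integral\<^sup>L lborel (\<lambda>y::real^3. indicator (cball 0 1) y * ((norm y)\<^sup>2 - 1)\<^sup>2))"
    proof -
      have "J0 2 = integral\<^sup>L lborel (\<lambda>y::real^3. complex_of_real (indicator (cball 0 1) y * ((norm y)\<^sup>2 - 1)\<^sup>2))"
        unfolding J0_def by (rule Bochner_Integration.integral_cong) (auto simp: scaleR_conv_of_real)
      then show ?thesis by (simp only: integral_complex_of_real)
    qed
    then show ?thesis by (simp add: source_constant_def)
  qed
  ultimately have "(\<lambda>n. - (?A n * J 2 n + ?B n * J 3 n)) \<longlonglongrightarrow> of_real source_constant * g z" by simp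
  then have "(\<lambda>n::nat. flux D (flux_field E H (dipole_E k z p) (dipole_H k z p))) \<longlonglongrightarrow> of_real source_constant * g z"
    using fl by simp
  then show ?thesis unfolding g_def by (simp add: LIMSEQ_const_iff)
qed


section \<open>Radiating fields\<close>

lemma norm_smult: "norm (c *s v) = norm c * norm (v :: complex^3)"
  by (simp add: norm_vec_def L2_set_def norm_mult power_mult_distrib sum_distrib_left[symmetric] real_sqrt_mult)

lemma bilinear_dot_bound: "norm (a \<bullet>\<^sub>c b) \<le> 3 * (norm a * norm b)"
proof -
  have "norm (a \<bullet>\<^sub>c b) \<le> (\<Sum>i\<in>(UNIV::3 set). norm a * norm b)"
    unfolding bilinear_dot_def
    by (rule sum_norm_le) (auto simp: norm_mult Finite_Cartesian_Product.norm_nth_le intro!: mult_mono)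
  then show ?thesis by simp
qed

lemma flux_add:
  assumes "integrable lborel (\<lambda>x. \<Sum>i\<in>UNIV. D i x * V x $ i)" "integrable lborel (\<lambda>x. \<Sum>i\<in>UNIV. D i x * W x $ i)"
  shows "flux D (\<lambda>x. V x + W x) = flux D V + flux D W"
  using Bochner_Integration.integral_add[OF assms]
  by (simp add: flux_def algebra_simps sum.distrib)

text \<open>The gradient of a radial cutoff that falls from \<open>1\<close> at \<open>|x| = T\<close> to \<open>0\<close> at \<open>|x| = 2 T\<close>. Pairing a field with it gives
  minus the outward flux, averaged over the spheres in between.\<close>

definition shell :: "real \<Rightarrow> 3 \<Rightarrow> real^3 \<Rightarrow> complex" where
  "shell T = dbump 0 (T\<^sup>2) ((2 * T)\<^sup>2)"

text \<open>The density of \<open>- shell T\<close> with respect to the radial vector \<open>x\<close>.\<close>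

definition wt :: "real \<Rightarrow> real^3 \<Rightarrow> real" where
  "wt T x = - 2 * cut' (T\<^sup>2) ((2 * T)\<^sup>2) ((norm x)\<^sup>2)"

lemma sq_less: "0 < T \<Longrightarrow> T\<^sup>2 < (2 * T)\<^sup>2" for T :: real
  by (intro power_strict_mono) auto

lemma shell_wt: "shell T j x = - of_real (wt T x * x$j)"
  by (simp add: shell_def dbump_def wt_def)

lemma wt:
  assumes "0 < T"
  shows "0 \<le> wt T x" "norm x \<le> T \<Longrightarrow> wt T x = 0" "2 * T \<le> norm x \<Longrightarrow> wt T x = 0" "continuous_on S (wt T)"
proof -
  note c = cut_values[OF sq_less[OF assms]]
  show "0 \<le> wt T x" using c(6) by (simp add: wt_def)
  show "norm x \<le> T \<Longrightarrow> wt T x = 0" using c(5) assms by (simp add: wt_def power_mono)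
  show "2 * T \<le> norm x \<Longrightarrow> wt T x = 0" using c(5) assms power_mono[of "2 * T" "norm x" 2] by (simp add: wt_def)
  show "continuous_on S (wt T)" unfolding wt_def[abs_def]
    by (intro continuous_intros continuous_on_compose2[OF continuous_cut'[OF sq_less[OF assms], of UNIV]]) auto
qed

lemma wt_integrable_annulus:
  fixes f :: "real^3 \<Rightarrow> 'a::{banach, second_countable_topology}"
  assumes T: "0 < T" and f: "continuous_on {x. T \<le> norm x \<and> norm x \<le> 2 * T} f"
  shows "integrable lborel (\<lambda>x. wt T x *\<^sub>R f x)"
proof (rule integrable_compact_support)
  let ?K = "cball 0 (2 * T) - ball (0::real^3) T"
  show "compact ?K" by (intro compact_diff) auto
  show "continuous_on ?K (\<lambda>x. wt T x *\<^sub>R f x)"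
    using f by (intro continuous_intros wt(4)[OF T]) (auto intro: continuous_on_subset)
  show "wt T x *\<^sub>R f x = 0" if "x \<notin> ?K" for x
    using that wt(2,3)[OF T, of x] by auto
qed

lemma wt_integrable:
  fixes f :: "real^3 \<Rightarrow> 'a::{banach, second_countable_topology}"
  assumes "0 < T" "continuous_on {x. T \<le> norm x} f"
  shows "integrable lborel (\<lambda>x. wt T x *\<^sub>R f x)"
  by (rule wt_integrable_annulus[OF assms(1) continuous_on_subset[OF assms(2)]]) auto

lemma shell_sum: "(\<Sum>i\<in>UNIV. shell T i x * V $ i) = - of_real (wt T x) * (cvec x \<bullet>\<^sub>c V)"
  by (simp add: shell_wt bilinear_dot_def sum_negf sum_distrib_left mult.assoc)

lemma shell_integrable_annulus:
  assumes T: "0 < T" and V: "continuous_on {x. T \<le> norm x \<and> norm x \<le> 2 * T} V"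
  shows "integrable lborel (\<lambda>x. \<Sum>i\<in>UNIV. shell T i x * V x $ i)"
proof -
  have "continuous_on {x. T \<le> norm x \<and> norm x \<le> 2 * T} (\<lambda>x. - (cvec x \<bullet>\<^sub>c V x))"
    unfolding bilinear_dot_def cvec_nth using V by (intro continuous_intros)
  from wt_integrable_annulus[OF T this] show ?thesis by (simp add: shell_sum scaleR_conv_of_real)
qed

lemma shell_integrable:
  assumes "0 < T" "continuous_on {x. T \<le> norm x} V"
  shows "integrable lborel (\<lambda>x. \<Sum>i\<in>UNIV. shell T i x * V x $ i)"
  by (rule shell_integrable_annulus[OF assms(1) continuous_on_subset[OF assms(2)]]) auto

definition radiating :: "complex \<Rightarrow> real \<Rightarrow> vfield \<Rightarrow> vfield \<Rightarrow> bool" where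
  "radiating k R E H \<longleftrightarrow> maxwell_C1 k {x. norm x > R} E H \<and> silver_mueller E H"

lemma radiating_continuous:
  assumes "maxwell_C1 k {x. norm x > R} E H" "R < T"
  shows "continuous_on {x. T \<le> norm x} E" "continuous_on {x. T \<le> norm x} H"
  using maxwell_continuous[OF assms(1)] assms(2) by (auto elim!: continuous_on_subset)

lemma flux_shell_const:
  assumes V: "weak_div_free {x. norm x > R} V" and T: "0 < T" "R < T" and T': "0 < T'" "R < T'"
    and c: "continuous_on {x. R < norm x} V"
  shows "flux (shell T) V = flux (shell T') V"
proof -
  let ?b = "\<lambda>T. bump 0 (T\<^sup>2) ((2 * T)\<^sup>2)"
  define m M where "m = min T T'" and "M = 2 * max T T'"
  have g: "has_grad UNIV (?b T) (shell T)" if "0 < T" for T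
    unfolding shell_def by (rule has_grad_bump[OF sq_less[OF that]])
  have b1: "?b T x = 1" if "0 < T" "norm x \<le> T" for T x
    using cut_values(1)[OF sq_less[OF that(1)]] that by (simp add: bump_def power_mono)
  have b0: "?b T x = 0" if "0 < T" "2 * T \<le> norm x" for T x
    using cut_values(2)[OF sq_less[OF that(1)]] that power_mono[of "2 * T" "norm x" 2] by (simp add: bump_def)
  have "test_fun {x. norm x > R} (\<lambda>x. ?b T x - ?b T' x) (\<lambda>j x. shell T j x - shell T' j x)"
    unfolding test_fun_def
  proof (intro conjI exI[of _ "cball 0 M - ball 0 m"] allI impI)
    show "has_grad UNIV (\<lambda>x. ?b T x - ?b T' x) (\<lambda>j x. shell T j x - shell T' j x)"
      by (rule has_grad_diff[OF g[OF T(1)] g[OF T'(1)]])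
    show "compact (cball (0::real^3) M - ball 0 m)" by (intro compact_diff) auto
    show "cball 0 M - ball 0 m \<subseteq> {x. norm x > R}" using T T' by (auto simp: m_def)
    fix x :: "real^3" assume "x \<notin> cball 0 M - ball 0 m"
    then have "M < norm x \<or> norm x < m" by auto
    then show "?b T x - ?b T' x = 0"
    proof
      assume "M < norm x"
      then have "2 * T \<le> norm x" "2 * T' \<le> norm x" by (auto simp: M_def)
      then show ?thesis using b0 T T' by simp
    next
      assume "norm x < m"
      then have "norm x \<le> T" "norm x \<le> T'" by (auto simp: m_def)
      then show ?thesis using b1 T T' by simp
    qed
  qed
  then have "integral\<^sup>L lborel (\<lambda>x. \<Sum>i\<in>UNIV. (shell T i x - shell T' i x) * V x $ i) = 0"
    using V unfolding weak_div_free_def by blast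
  moreover have "integrable lborel (\<lambda>x. \<Sum>i\<in>UNIV. shell T i x * V x $ i)" "integrable lborel (\<lambda>x. \<Sum>i\<in>UNIV. shell T' i x * V x $ i)"
    using T T' by (auto intro!: shell_integrable continuous_on_subset[OF c])
  ultimately show ?thesis
    unfolding flux_def by (simp add: left_diff_distrib sum_subtractf)
qed

definition wt_mass :: real where
  "wt_mass = 3 * Re (integral\<^sup>L lborel (bump (0::real^3) 1 4))"

text \<open>The cutoff has the integral of its gradient against \<open>x\<close> equal to \<open>- 3\<close> times its own integral, and the latter scales like \<open>T\<^sup>3\<close>.\<close>

lemma wt_moment:
  assumes T: "0 < T"
  shows "integral\<^sup>L lborel (\<lambda>x. wt T x * (norm x)\<^sup>2) = T ^ 3 * wt_mass"
proof -
  let ?b = "bump (0::real^3) (T\<^sup>2) ((2 * T)\<^sup>2)"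
  have t: "test_fun UNIV ?b (shell T)" unfolding shell_def
    by (rule test_fun_bump[OF sq_less[OF T], of _ "2 * T"]) (use T in auto)
  have g: "has_grad UNIV (\<lambda>x. cvec x $ i) (\<lambda>j x. if j = i then 1 else 0)" for i
    using has_grad_offset[of UNIV 0 i] by simp
  have a1: "integral\<^sup>L lborel (\<lambda>x. \<Sum>i\<in>UNIV. shell T i x * cvec x $ i) = - integral\<^sup>L lborel (\<lambda>x. ?b x * 3)"
    using integral_grad_dot(2)[OF t open_UNIV g] by simp
  have a2: "(\<Sum>i\<in>UNIV. shell T i x * cvec x $ i) = - complex_of_real (wt T x * (norm x)\<^sup>2)" for x
    unfolding shell_sum norm_sq_sum by (simp add: bilinear_dot_def)
  have "integral\<^sup>L lborel (\<lambda>x. \<Sum>i\<in>UNIV. shell T i x * cvec x $ i) = - complex_of_real (integral\<^sup>L lborel (\<lambda>x. wt T x * (norm x)\<^sup>2))"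
    unfolding a2 integral_minus integral_complex_of_real ..
  then have 1: "complex_of_real (integral\<^sup>L lborel (\<lambda>x. wt T x * (norm x)\<^sup>2)) = integral\<^sup>L lborel ?b * 3"
    using a1 by simp
  have "integral\<^sup>L lborel ?b = of_real (T ^ 3) * integral\<^sup>L lborel (\<lambda>y. ?b (0 + T *\<^sub>R y))"
    by (rule lborel_integral_scale[OF _ T])
       (use has_grad_continuous[OF has_grad_bump[OF sq_less[OF T]]] in \<open>auto intro: borel_measurable_continuous_onI\<close>)
  also have "(\<lambda>y. ?b (0 + T *\<^sub>R y)) = bump 0 1 4"
  proof
    fix y :: "real^3"
    have m: "max 0 (T\<^sup>2 * a) = T\<^sup>2 * max 0 a" for a using T by (simp add: max_def mult_le_0_iff zero_le_mult_iff)
    have "cut (T\<^sup>2 * 1) (T\<^sup>2 * 4) (T\<^sup>2 * s) = cut 1 4 s" for s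
      unfolding cut_def right_diff_distrib[symmetric] m power_mult_distrib distrib_left[symmetric]
      using T by simp
    from this[of "(norm y)\<^sup>2"] show "?b (0 + T *\<^sub>R y) = bump 0 1 4 y"
      by (simp add: bump_def power_mult_distrib mult.commute)
  qed
  finally have "complex_of_real (integral\<^sup>L lborel (\<lambda>x. wt T x * (norm x)\<^sup>2)) = of_real (T ^ 3) * (3 * integral\<^sup>L lborel (bump (0::real^3) 1 4))"
    using 1 by simp
  then have "Re (complex_of_real (integral\<^sup>L lborel (\<lambda>x. wt T x * (norm x)\<^sup>2))) = Re (of_real (T ^ 3) * (3 * integral\<^sup>L lborel (bump (0::real^3) 1 4)))"
    by (simp only:)
  then show ?thesis by (simp add: wt_mass_def)
qed

lemma wt_inverse_bound:
  assumes T: "0 < T"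
  shows "integral\<^sup>L lborel (\<lambda>x. wt T x * (1 / norm x)) \<le> wt_mass"
    "integrable lborel (\<lambda>x. wt T x * (1 / norm x))"
proof -
  have c: "continuous_on {x::real^3. T \<le> norm x} (\<lambda>x. 1 / norm x)" using T by (intro continuous_intros) auto
  show i: "integrable lborel (\<lambda>x. wt T x * (1 / norm x))" using wt_integrable[OF T c] by simp
  have c2: "continuous_on {x::real^3. T \<le> norm x} (\<lambda>x. (norm x)\<^sup>2 / T ^ 3)" using T by (intro continuous_intros) auto
  have i2: "integrable lborel (\<lambda>x. wt T x * ((norm x)\<^sup>2 / T ^ 3))" using wt_integrable[OF T c2] by simp
  have "integral\<^sup>L lborel (\<lambda>x. wt T x * (1 / norm x)) \<le> integral\<^sup>L lborel (\<lambda>x. wt T x * ((norm x)\<^sup>2 / T ^ 3))"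
  proof (rule integral_mono[OF i i2])
    fix x :: "real^3"
    show "wt T x * (1 / norm x) \<le> wt T x * ((norm x)\<^sup>2 / T ^ 3)"
    proof (cases "norm x \<le> T")
      case False
      then have "T ^ 3 \<le> norm x ^ 3" using T by (intro power_mono) auto
      then have "1 / norm x \<le> (norm x)\<^sup>2 / T ^ 3" using T False
        by (simp add: divide_simps power2_eq_square power3_eq_cube)
      then show ?thesis by (rule mult_left_mono[OF _ wt(1)[OF T]])
    qed (simp add: wt(2)[OF T])
  qed
  also have "\<dots> = integral\<^sup>L lborel (\<lambda>x. wt T x * (norm x)\<^sup>2) / T ^ 3" by simp
  also have "\<dots> = wt_mass" using wt_moment[OF T] T by simp
  finally show "integral\<^sup>L lborel (\<lambda>x. wt T x * (1 / norm x)) \<le> wt_mass" .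
qed

definition cnjv :: "complex^3 \<Rightarrow> complex^3" where
  "cnjv v = (\<chi> i. cnj (v$i))"

lemma cnjv_nth [simp]: "cnjv v $ i = cnj (v $ i)" by (simp add: cnjv_def)

text \<open>For a real wave number complex conjugation gives another solution. Paired with the original one it yields the Poynting flux.\<close>

lemma maxwell_conjugate:
  assumes "maxwell_C1 k U E H" "Im k = 0"
  shows "maxwell_C1 k U (\<lambda>x. cnjv (E x)) (\<lambda>x. - cnjv (H x))"
proof -
  obtain DE DH where 1: "open U" "\<And>i. has_grad U (\<lambda>x. E x $ i) (DE i)" "\<And>i. has_grad U (\<lambda>x. H x $ i) (DH i)"
    "\<And>x. x \<in> U \<Longrightarrow> rot DE x = (\<i> * k) *s H x" "\<And>x. x \<in> U \<Longrightarrow> rot DH x = - (\<i> * k) *s E x"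
    using maxwell_C1E[OF assms(1)] by metis
  have k: "cnj k = k" using assms(2) by (simp add: complex_eq_iff)
  have bn: "bounded_linear (\<lambda>c. - cnj c)" by (rule bounded_linear_minus[OF bounded_linear_cnj])
  have r: "rot (\<lambda>i j x. cnj (D i j x)) x = cnjv (rot D x)" "rot (\<lambda>i j x. - cnj (D i j x)) x = - cnjv (rot D x)" for D x
    by (rule vec3_eqI; simp)+
  show ?thesis
  proof (rule maxwell_C1I[OF 1(1)])
    show "has_grad U (\<lambda>x. cnjv (E x) $ i) (\<lambda>j x. cnj (DE i j x))" for i
      using has_grad_linear[OF bounded_linear_cnj 1(2)] by simp
    show "has_grad U (\<lambda>x. (- cnjv (H x)) $ i) (\<lambda>j x. - cnj (DH i j x))" for i
      using has_grad_linear[OF bn 1(3)] by simp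
    fix x assume x: "x \<in> U"
    show "rot (\<lambda>i j x. cnj (DE i j x)) x = (\<i> * k) *s - cnjv (H x)"
      unfolding r 1(4)[OF x] by (simp add: vec_eq_iff k)
    show "rot (\<lambda>i j x. - cnj (DH i j x)) x = - (\<i> * k) *s cnjv (E x)"
      unfolding r 1(5)[OF x] by (simp add: vec_eq_iff k)
  qed
qed

definition sm_defect :: "vfield \<Rightarrow> vfield \<Rightarrow> vfield" where
  "sm_defect E H x = H x \<times>\<^sub>c cvec x - norm x *\<^sub>R E x"

lemma silver_mueller_eventually:
  assumes "silver_mueller E H" "e > 0"
  obtains T where "T > R" "T > 0" "\<And>x. norm x \<ge> T \<Longrightarrow> norm (sm_defect E H x) < e"
proof -
  have "\<forall>\<^sub>F x in at_infinity. norm (sm_defect E H x) < e"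
    using tendstoD[OF assms(1)[unfolded silver_mueller_def] assms(2)] by (simp add: sm_defect_def)
  then obtain b where b: "\<And>x. norm x \<ge> b \<Longrightarrow> norm (sm_defect E H x) < e" by (auto simp: eventually_at_infinity)
  show ?thesis by (rule that[of "max b (max (R + 1) 1)"]) (use b in auto)
qed

lemma norm_sq_cnjv: "cnjv v \<bullet>\<^sub>c v = of_real ((norm v)\<^sup>2)"
proof -
  have e: "(norm v)\<^sup>2 = (\<Sum>i\<in>UNIV. (norm (v$i))\<^sup>2)"
    by (simp add: norm_vec_def L2_set_def sum_nonneg)
  show ?thesis unfolding e bilinear_dot_def of_real_sum complex_norm_square by (simp add: mult.commute)
qed

lemma norm_cnjv: "norm (cnjv v) = norm v"
  by (simp add: norm_vec_def L2_set_def)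

text \<open>The Poynting flux through large shells does not depend on the radius. By the Silver-Mueller condition it dominates, up to a bounded error,
  the weighted integral of \<open>|x| |E|\<^sup>2\<close>, which is therefore bounded. This bound replaces
  the decay \<open>E = O(1/|x|)\<close>.\<close>

lemma radiating_energy:
  assumes rad: "radiating k R E H" and k: "Im k = 0"
  obtains C T0 where "T0 > R" "T0 > 0" "\<And>T. T \<ge> T0 \<Longrightarrow> integral\<^sup>L lborel (\<lambda>x. wt T x * (norm x * (norm (E x))\<^sup>2)) \<le> C"
    "\<And>T. T \<ge> T0 \<Longrightarrow> integrable lborel (\<lambda>x. wt T x * (norm x * (norm (E x))\<^sup>2))"
proof -
  let ?U = "{x. norm x > R}"
  have M: "maxwell_C1 k ?U E H" and SM: "silver_mueller E H" using rad by (auto simp: radiating_def)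
  let ?V = "flux_field E H (\<lambda>x. cnjv (E x)) (\<lambda>x. - cnjv (H x))"
  note M' = maxwell_conjugate[OF M k]
  have d: "weak_div_free ?U ?V" by (rule flux_field_div_free[OF M M'])
  have cV: "continuous_on ?U ?V"
    using maxwell_continuous[OF M] maxwell_continuous[OF M'] by (intro continuous_on_flux_field)
  obtain T0 where T0: "T0 > R" "T0 > 0" and sm: "\<And>x. norm x \<ge> T0 \<Longrightarrow> norm (sm_defect E H x) < 1"
    using silver_mueller_eventually[OF SM, of 1 R] by auto
  have int: "integrable lborel (\<lambda>x. wt T x * (norm x * (norm (E x))\<^sup>2))" if "T \<ge> T0" for T
  proof -
    have T: "0 < T" "R < T" using T0 that by auto
    have "continuous_on {x. T \<le> norm x} (\<lambda>x. norm x * (norm (E x))\<^sup>2)"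
      using radiating_continuous[OF M T(2)] by (intro continuous_intros)
    from wt_integrable[OF T(1) this] show ?thesis by simp
  qed
  have pt: "wt T x * (norm x * (norm (E x))\<^sup>2) \<le> Re (\<Sum>i\<in>UNIV. shell T i x * ?V x $ i) + 9 * (wt T x * (1 / norm x))"
    if "T \<ge> T0" for T x
  proof (cases "norm x \<le> T")
    case True
    then show ?thesis using wt(2)[of T x] T0 that by (simp add: shell_sum)
  next
    case False
    then have x: "norm x > 0" "norm x \<ge> T0" "0 < T" using T0 that by auto
    define \<delta> where "\<delta> = sm_defect E H x"
    have Hx: "H x \<times>\<^sub>c cvec x = of_real (norm x) *s E x + \<delta>"
      by (simp add: \<delta>_def sm_defect_def vec_eq_iff complex_eq_iff)
    have "cvec x \<bullet>\<^sub>c ?V x = - (E x \<bullet>\<^sub>c cnjv (H x \<times>\<^sub>c cvec x) + cnjv (E x) \<bullet>\<^sub>c (H x \<times>\<^sub>c cvec x))"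
      unfolding flux_field_def by (simp add: bilinear_dot_3 algebra_simps)
    also have "E x \<bullet>\<^sub>c cnjv (H x \<times>\<^sub>c cvec x) = cnj (cnjv (E x) \<bullet>\<^sub>c (H x \<times>\<^sub>c cvec x))"
      by (simp add: bilinear_dot_def)
    also have "cnjv (E x) \<bullet>\<^sub>c (H x \<times>\<^sub>c cvec x) = of_real (norm x * (norm (E x))\<^sup>2) + cnjv (E x) \<bullet>\<^sub>c \<delta>"
      unfolding Hx of_real_mult norm_sq_cnjv[symmetric] by (simp add: bilinear_dot_3 algebra_simps)
    finally have "Re (cvec x \<bullet>\<^sub>c ?V x) = - (2 * (norm x * (norm (E x))\<^sup>2) + 2 * Re (cnjv (E x) \<bullet>\<^sub>c \<delta>))"
      by simp
    moreover have "Re (\<Sum>i\<in>UNIV. shell T i x * ?V x $ i) = wt T x * (- Re (cvec x \<bullet>\<^sub>c ?V x))"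
      unfolding shell_sum by simp
    ultimately have Re_sum: "Re (\<Sum>i\<in>UNIV. shell T i x * ?V x $ i) = wt T x * (2 * (norm x * (norm (E x))\<^sup>2) + 2 * Re (cnjv (E x) \<bullet>\<^sub>c \<delta>))"
      by (simp only: minus_minus)
    have "2 * (norm x * (norm (E x))\<^sup>2) + 2 * Re (cnjv (E x) \<bullet>\<^sub>c \<delta>) \<ge> norm x * (norm (E x))\<^sup>2 - 9 * (1 / norm x)"
    proof -
      have "\<bar>Re (cnjv (E x) \<bullet>\<^sub>c \<delta>)\<bar> \<le> 3 * (norm (E x) * norm \<delta>)"
        using abs_Re_le_cmod[of "cnjv (E x) \<bullet>\<^sub>c \<delta>"] bilinear_dot_bound[of "cnjv (E x)" \<delta>] by (simp add: norm_cnjv)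
      also have "\<dots> \<le> 3 * (norm (E x) * 1)"
        using sm[OF x(2)] by (intro mult_left_mono) (auto simp: \<delta>_def)
      finally have b: "\<bar>Re (cnjv (E x) \<bullet>\<^sub>c \<delta>)\<bar> \<le> 3 * norm (E x)" by simp
      have "0 \<le> (norm x * norm (E x) - 3)\<^sup>2 / norm x" using x by simp
      also have "\<dots> = norm x * (norm (E x))\<^sup>2 - 6 * norm (E x) + 9 * (1 / norm x)"
        using x by (simp add: field_simps power2_eq_square)
      finally show ?thesis using b by linarith
    qed
    from mult_left_mono[OF this wt(1)[OF x(3), of x]]
    have "wt T x * (norm x * (norm (E x))\<^sup>2) - 9 * (wt T x * (1 / norm x))
        \<le> wt T x * (2 * (norm x * (norm (E x))\<^sup>2) + 2 * Re (cnjv (E x) \<bullet>\<^sub>c \<delta>))"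
      by (simp only: right_diff_distrib mult.left_commute)
    then show ?thesis using Re_sum by linarith
  qed
  define C where "C = Re (flux (shell T0) ?V) + 9 * wt_mass"
  show ?thesis
  proof (rule that[OF T0 _ int])
    fix T assume T: "T \<ge> T0"
    then have T': "0 < T" "R < T" using T0 by auto
    have iV: "integrable lborel (\<lambda>x. \<Sum>i\<in>UNIV. shell T i x * ?V x $ i)"
      using T' by (intro shell_integrable continuous_on_subset[OF cV]) auto
    have iR: "integrable lborel (\<lambda>x. Re (\<Sum>i\<in>UNIV. shell T i x * ?V x $ i))" using iV by (rule integrable_Re)
    have iW: "integrable lborel (\<lambda>x. 9 * (wt T x * (1 / norm x)))" using wt_inverse_bound(2)[OF T'(1)] by (rule integrable_mult_right)
    have "integral\<^sup>L lborel (\<lambda>x. wt T x * (norm x * (norm (E x))\<^sup>2)) \<le>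
      integral\<^sup>L lborel (\<lambda>x. Re (\<Sum>i\<in>UNIV. shell T i x * ?V x $ i) + 9 * (wt T x * (1 / norm x)))"
      by (rule integral_mono[OF int[OF T] Bochner_Integration.integrable_add[OF iR iW] pt[OF T]])
    also have "\<dots> = Re (flux (shell T) ?V) + 9 * integral\<^sup>L lborel (\<lambda>x. wt T x * (1 / norm x))"
      unfolding flux_def Bochner_Integration.integral_add[OF iR iW] integral_Re[OF iV] integral_mult_right_zero ..
    also have "flux (shell T) ?V = flux (shell T0) ?V"
      by (rule flux_shell_const[OF d T' T0(2,1) cV])
    also have "Re (flux (shell T0) ?V) + 9 * integral\<^sup>L lborel (\<lambda>x. wt T x * (1 / norm x)) \<le> C"
      unfolding C_def using wt_inverse_bound(1)[OF T'(1)] by simp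
    finally show "integral\<^sup>L lborel (\<lambda>x. wt T x * (norm x * (norm (E x))\<^sup>2)) \<le> C" .
  qed
qed

text \<open>With \<open>H \<times> x = |x| E + \<delta>\<close> for both pairs the products \<open>|x| (E \<bullet> E')\<close> cancel, and \<open>E \<bullet> \<delta>' - E' \<bullet> \<delta>\<close> remains. Since \<open>\<delta>\<close>
  tends to zero and the weighted integrals of \<open>|x| |E|\<^sup>2\<close> and \<open>1/|x|\<close> are bounded, so does its integral.\<close>

lemma radiating_flux_vanishes:
  assumes r1: "radiating k R E H" and r2: "radiating k R E' H'" and k: "Im k = 0"
  shows "((\<lambda>T. flux (shell T) (flux_field E H E' H')) \<longlongrightarrow> 0) at_top"
proof (rule tendstoI)
  fix e :: real assume e: "e > 0"
  have M: "maxwell_C1 k {x. norm x > R} E H" "silver_mueller E H" "maxwell_C1 k {x. norm x > R} E' H'" "silver_mueller E' H'"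
    using r1 r2 by (auto simp: radiating_def)
  obtain C T0 where C: "T0 > R" "T0 > 0" "\<And>T. T \<ge> T0 \<Longrightarrow> integral\<^sup>L lborel (\<lambda>x. wt T x * (norm x * (norm (E x))\<^sup>2)) \<le> C"
    "\<And>T. T \<ge> T0 \<Longrightarrow> integrable lborel (\<lambda>x. wt T x * (norm x * (norm (E x))\<^sup>2))"
    by (rule radiating_energy[OF r1 k]) (rule that; assumption)
  obtain C' T0' where C': "T0' > R" "T0' > 0" "\<And>T. T \<ge> T0' \<Longrightarrow> integral\<^sup>L lborel (\<lambda>x. wt T x * (norm x * (norm (E' x))\<^sup>2)) \<le> C'"
    "\<And>T. T \<ge> T0' \<Longrightarrow> integrable lborel (\<lambda>x. wt T x * (norm x * (norm (E' x))\<^sup>2))"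
    by (rule radiating_energy[OF r2 k]) (rule that; assumption)
  define B where "B = \<bar>C\<bar> + \<bar>C'\<bar> + 2 * \<bar>wt_mass\<bar> + 1"
  have B: "B > 0" by (simp add: B_def add_nonneg_pos)
  define \<eta> where "\<eta> = e / (6 * B)"
  have \<eta>: "\<eta> > 0" using e B by (simp add: \<eta>_def)
  obtain T1 where T1: "\<And>x. norm x \<ge> T1 \<Longrightarrow> norm (sm_defect E H x) < \<eta>"
    using silver_mueller_eventually[OF M(2) \<eta>] by metis
  obtain T2 where T2: "\<And>x. norm x \<ge> T2 \<Longrightarrow> norm (sm_defect E' H' x) < \<eta>"
    using silver_mueller_eventually[OF M(4) \<eta>] by metis
  have "norm (flux (shell T) (flux_field E H E' H')) < e" if T: "T \<ge> max (max T0 T0') (max T1 T2)" for T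
  proof -
    have Tp: "0 < T" "R < T" "T \<ge> T0" "T \<ge> T0'" "T \<ge> T1" "T \<ge> T2" using T C C' by auto
    let ?V = "flux_field E H E' H'"
    let ?f = "\<lambda>x. wt T x * (norm x * (norm (E x))\<^sup>2)" and ?f' = "\<lambda>x. wt T x * (norm x * (norm (E' x))\<^sup>2)"
    let ?h = "\<lambda>x. wt T x * (1 / norm x)"
    have iV: "integrable lborel (\<lambda>x. \<Sum>i\<in>UNIV. shell T i x * ?V x $ i)"
      using radiating_continuous[OF M(1) Tp(2)] radiating_continuous[OF M(3) Tp(2)]
      by (intro shell_integrable[OF Tp(1)] continuous_on_flux_field)
    note i = C(4)[OF Tp(3)] C'(4)[OF Tp(4)] wt_inverse_bound(2)[OF Tp(1)]
    have pt: "norm (\<Sum>i\<in>UNIV. shell T i x * ?V x $ i) \<le> (3 * \<eta>) * (?f x + ?f' x + 2 * ?h x)" for x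
    proof (cases "norm x \<le> T")
      case True
      then show ?thesis using wt(2)[OF Tp(1), of x] by (simp add: shell_sum)
    next
      case False
      then have x: "norm x > 0" "norm x \<ge> T1" "norm x \<ge> T2" using Tp by auto
      define \<delta> where "\<delta> = sm_defect E H x"
      define \<delta>' where "\<delta>' = sm_defect E' H' x"
      have Hx: "H x \<times>\<^sub>c cvec x = of_real (norm x) *s E x + \<delta>"
        by (simp add: \<delta>_def sm_defect_def vec_eq_iff complex_eq_iff)
      have Hx': "H' x \<times>\<^sub>c cvec x = of_real (norm x) *s E' x + \<delta>'"
        by (simp add: \<delta>'_def sm_defect_def vec_eq_iff complex_eq_iff)
      have "cvec x \<bullet>\<^sub>c ?V x = E x \<bullet>\<^sub>c (H' x \<times>\<^sub>c cvec x) - E' x \<bullet>\<^sub>c (H x \<times>\<^sub>c cvec x)"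
        unfolding flux_field_def by (simp add: bilinear_dot_3 algebra_simps)
      also have "\<dots> = E x \<bullet>\<^sub>c \<delta>' - E' x \<bullet>\<^sub>c \<delta>" unfolding Hx Hx' by (simp add: bilinear_dot_3 algebra_simps)
      finally have "norm (cvec x \<bullet>\<^sub>c ?V x) \<le> norm (E x \<bullet>\<^sub>c \<delta>') + norm (E' x \<bullet>\<^sub>c \<delta>)" by (simp add: norm_triangle_ineq4)
      also have "\<dots> \<le> 3 * (norm (E x) * \<eta>) + 3 * (norm (E' x) * \<eta>)"
        using T1[OF x(2)] T2[OF x(3)]
        by (intro add_mono order_trans[OF bilinear_dot_bound] mult_left_mono) (auto simp: \<delta>_def \<delta>'_def)
      also have "\<dots> = (3 * \<eta>) * (norm (E x) + norm (E' x))" by (simp add: algebra_simps)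
      also have "\<dots> \<le> (3 * \<eta>) * ((norm x * (norm (E x))\<^sup>2 + 1 / norm x) + (norm x * (norm (E' x))\<^sup>2 + 1 / norm x))"
      proof -
        have am: "a \<le> norm x * a\<^sup>2 + 1 / norm x" if "a \<ge> 0" for a
        proof -
          have "0 \<le> (norm x * a - 1)\<^sup>2 / norm x" using x by simp
          also have "\<dots> = norm x * a\<^sup>2 - 2 * a + 1 / norm x" using x by (simp add: field_simps power2_eq_square)
          finally show ?thesis using that by linarith
        qed
        show ?thesis using \<eta> by (intro mult_left_mono add_mono am) auto
      qed
      finally have "wt T x * norm (cvec x \<bullet>\<^sub>c ?V x) \<le> wt T x * ((3 * \<eta>) * ((norm x * (norm (E x))\<^sup>2 + 1 / norm x) + (norm x * (norm (E' x))\<^sup>2 + 1 / norm x)))"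
        by (rule mult_left_mono[OF _ wt(1)[OF Tp(1)]])
      also have "\<dots> = (3 * \<eta>) * (?f x + ?f' x + 2 * ?h x)" by (simp add: algebra_simps)
      finally show ?thesis unfolding shell_sum by (simp add: norm_mult wt(1)[OF Tp(1)])
    qed
    have iS: "integrable lborel (\<lambda>x. ?f x + ?f' x + 2 * ?h x)"
      using i by (intro Bochner_Integration.integrable_add integrable_mult_right)
    have "norm (flux (shell T) ?V) \<le> integral\<^sup>L lborel (\<lambda>x. (3 * \<eta>) * (?f x + ?f' x + 2 * ?h x))"
      unfolding flux_def
      by (rule Bochner_Integration.integral_norm_bound_integral[OF iV integrable_mult_right[OF iS] pt])
    also have "\<dots> = (3 * \<eta>) * (integral\<^sup>L lborel ?f + integral\<^sup>L lborel ?f' + 2 * integral\<^sup>L lborel ?h)"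
      unfolding integral_mult_right_zero Bochner_Integration.integral_add[OF i(1,2)]
        Bochner_Integration.integral_add[OF Bochner_Integration.integrable_add[OF i(1,2)] integrable_mult_right[OF i(3), of 2]] ..
    also have "\<dots> \<le> (3 * \<eta>) * B"
      using C(3)[OF Tp(3)] C'(3)[OF Tp(4)] wt_inverse_bound(1)[OF Tp(1)] \<eta>
      by (intro mult_left_mono) (auto simp: B_def)
    also have "\<dots> < e" using e B by (simp add: \<eta>_def)
    finally show ?thesis .
  qed
  then show "\<forall>\<^sub>F T in at_top. dist (flux (shell T) (flux_field E H E' H')) 0 < e"
    unfolding eventually_at_top_linorder dist_norm diff_0_right by blast
qed


section \<open>Dipoles and plane waves at large distances\<close>

text \<open>The amplitudes of the dipole fields relative to \<open>e\<^bsup>ikR\<^esup> / (4 \<pi> R)\<close>, as functions of \<open>c = i k\<close>, the unit direction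
  \<open>N\<close> and \<open>u = 1/R\<close>. At \<open>u = 0\<close> they are the amplitudes of a plane wave in direction \<open>N\<close>.\<close>

definition amp_H :: "complex \<Rightarrow> complex^3 \<Rightarrow> complex^3 \<Rightarrow> complex \<Rightarrow> complex^3" where
  "amp_H c P N u = (c - u) *s (N \<times>\<^sub>c P)"

definition amp_E :: "complex \<Rightarrow> complex^3 \<Rightarrow> complex^3 \<Rightarrow> complex \<Rightarrow> complex^3" where
  "amp_E c P N u = (- (c - 3 * u + 3 * u\<^sup>2 / c) * (N \<bullet>\<^sub>c P)) *s N + (c - u + u\<^sup>2 / c) *s P"

definition dir :: "real^3 \<Rightarrow> real^3 \<Rightarrow> complex^3" where
  "dir z x = cvec ((1 / norm (x - z)) *\<^sub>R (x - z))"

lemma cvec_dir: "x \<noteq> z \<Longrightarrow> cvec (x - z) = of_real (norm (x - z)) *s dir z x"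
  by (simp add: vec_eq_iff dir_def)

lemma dipole_amplitude:
  assumes k: "k \<noteq> 0" and x: "x \<noteq> z"
  shows "dipole_H k z p x = (exp (\<i> * k * of_real (norm (x - z))) / (4 * of_real pi * of_real (norm (x - z)))) *s
      amp_H (\<i> * k) (cvec p) (dir z x) (inverse (of_real (norm (x - z))))" (is ?H)
    and "dipole_E k z p x = (exp (\<i> * k * of_real (norm (x - z))) / (4 * of_real pi * of_real (norm (x - z)))) *s
      amp_E (\<i> * k) (cvec p) (dir z x) (inverse (of_real (norm (x - z))))" (is ?E)
proof -
  define c where "c = \<i> * k"
  define R where "R = complex_of_real (norm (x - z))"
  define u where "u = inverse R"
  define e where "e = exp (c * R)"
  define N where "N = dir z x"
  have c: "c \<noteq> 0" and R: "R \<noteq> 0" using k x by (auto simp: c_def R_def)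
  have uR: "u * R = 1" "R * u = 1" using R by (auto simp: u_def)
  have X: "cvec (x - z) = R *s N" using cvec_dir[OF x] by (simp add: R_def N_def)
  have sq: "complex_of_real (sqrt ((norm (x - z))\<^sup>2)) = R" "complex_of_real ((norm (x - z))\<^sup>2) = R\<^sup>2"
    by (simp_all add: R_def)
  have ik: "\<i> / k = - inverse c" using k by (simp add: c_def field_simps)
  have eR: "e / (4 * of_real pi * R) = e * u / (4 * of_real pi)" by (simp add: u_def field_simps)
  have s1: "src1 k R = e * (c * u ^ 2 - u ^ 3) / (8 * of_real pi)"
    by (simp add: src1_def c_def e_def u_def)
  have s2: "src2 k R = e * (c\<^sup>2 * u ^ 3 - 3 * c * u ^ 4 + 3 * u ^ 5) / (16 * of_real pi)"
    by (simp add: src2_def c_def e_def u_def)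
  have cross: "(a *s A) \<times>\<^sub>c B = a *s (A \<times>\<^sub>c B)" and dot: "(a *s A) \<bullet>\<^sub>c B = a * (A \<bullet>\<^sub>c B)" for a A B
    by (rule vec3_eqI; simp add: algebra_simps) (simp add: bilinear_dot_3 algebra_simps)
  have "dipole_H k z p x = (2 * src1 k R * R) *s (N \<times>\<^sub>c cvec p)"
    unfolding dipole_radial(1)[OF k x] radial_H_def sq X cross vector_smult_assoc by simp
  also have "2 * src1 k R * R = e / (4 * of_real pi * R) * (c - u)"
  proof -
    have "2 * src1 k R * R = e * (c * u * (u * R) - u ^ 2 * (u * R)) / (4 * of_real pi)"
      unfolding s1 by (simp add: power2_eq_square power3_eq_cube field_simps)
    then show ?thesis unfolding uR eR by (simp add: power2_eq_square algebra_simps)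
  qed
  finally show ?H unfolding amp_H_def vector_smult_assoc c_def e_def R_def u_def N_def .
  have "dipole_E k z p x = (- inverse c) *s ((4 * src2 k R * R\<^sup>2 * (N \<bullet>\<^sub>c cvec p)) *s N - (4 * R\<^sup>2 * src2 k R + 4 * src1 k R) *s cvec p)"
    unfolding dipole_radial(2)[OF k x] radial_E_def sq X dot vector_smult_assoc ik
    by (simp add: mult_ac power2_eq_square)
  also have f2: "4 * src2 k R * R\<^sup>2 = e * u / (4 * of_real pi) * (c\<^sup>2 - 3 * c * u + 3 * u\<^sup>2)"
  proof -
    have "4 * src2 k R * R\<^sup>2 = e * (c\<^sup>2 * u * (u * R)\<^sup>2 - 3 * c * u\<^sup>2 * (u * R)\<^sup>2 + 3 * u ^ 3 * (u * R)\<^sup>2) / (4 * of_real pi)"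
      unfolding s2 by (simp add: eval_nat_numeral field_simps)
    then show ?thesis unfolding uR by (simp add: power2_eq_square power3_eq_cube field_simps)
  qed
  also have "4 * R\<^sup>2 * src2 k R + 4 * src1 k R = e * u / (4 * of_real pi) * (c\<^sup>2 - c * u + u\<^sup>2)"
  proof -
    define f where "f = e / (4 * of_real pi)"
    have "4 * src1 k R = f * (2 * (c * u ^ 2 - u ^ 3))" unfolding s1 f_def by (simp add: field_simps)
    moreover have "4 * R\<^sup>2 * src2 k R = f * u * (c\<^sup>2 - 3 * c * u + 3 * u\<^sup>2)"
      using f2 by (simp add: f_def mult_ac)
    ultimately have "4 * R\<^sup>2 * src2 k R + 4 * src1 k R = f * u * (c\<^sup>2 - 3 * c * u + 3 * u\<^sup>2) + f * (2 * (c * u ^ 2 - u ^ 3))"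
      by (simp only:)
    also have "\<dots> = f * u * (c\<^sup>2 - c * u + u\<^sup>2)" by (simp add: power2_eq_square power3_eq_cube algebra_simps)
    also have "f * u = e * u / (4 * of_real pi)" by (simp add: f_def)
    finally show ?thesis .
  qed
  also have "(- inverse c) *s ((e * u / (4 * of_real pi) * (c\<^sup>2 - 3 * c * u + 3 * u\<^sup>2) * (N \<bullet>\<^sub>c cvec p)) *s N
       - (e * u / (4 * of_real pi) * (c\<^sup>2 - c * u + u\<^sup>2)) *s cvec p)
     = (e * u / (4 * of_real pi)) *s amp_E c (cvec p) N u"
  proof -
    have i: "inverse c * (c\<^sup>2 - 3 * c * u + 3 * u\<^sup>2) = c - 3 * u + 3 * u\<^sup>2 / c" "inverse c * (c\<^sup>2 - c * u + u\<^sup>2) = c - u + u\<^sup>2 / c"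
      using c by (simp_all add: field_simps power2_eq_square)
    define f where "f = e * u / (4 * of_real pi)"
    show ?thesis unfolding amp_E_def i[symmetric] f_def[symmetric]
      by (simp add: vec_eq_iff algebra_simps)
  qed
  finally show ?E unfolding eR[symmetric] unfolding c_def e_def R_def u_def N_def .
qed

lemma norm_le_sum3: "norm (v :: complex^3) \<le> norm (v$1) + norm (v$2) + norm (v$3)"
  using L2_set_le_sum[of UNIV "\<lambda>i. norm (v$i)"] by (simp add: norm_vec_def sum_3)

lemma norm_cross_bound: "norm (a \<times>\<^sub>c b) \<le> 6 * (norm a * norm b)"
proof -
  have c: "norm (a$i * b$j - a$l * b$m) \<le> 2 * (norm a * norm b)" for i j l m
  proof -
    have "norm (a$i * b$j - a$l * b$m) \<le> norm (a$i) * norm (b$j) + norm (a$l) * norm (b$m)"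
      by (rule order_trans[OF norm_triangle_ineq4]) (simp add: norm_mult)
    also have "\<dots> \<le> norm a * norm b + norm a * norm b"
      by (intro add_mono mult_mono Finite_Cartesian_Product.norm_nth_le) auto
    finally show ?thesis by simp
  qed
  have "norm (a \<times>\<^sub>c b) \<le> norm ((a \<times>\<^sub>c b)$1) + norm ((a \<times>\<^sub>c b)$2) + norm ((a \<times>\<^sub>c b)$3)" by (rule norm_le_sum3)
  also have "\<dots> \<le> 2 * (norm a * norm b) + 2 * (norm a * norm b) + 2 * (norm a * norm b)"
    unfolding cross_nth by (intro add_mono c)
  finally show ?thesis by simp
qed

lemma scaleR_eq_smult: "r *\<^sub>R (v :: complex^3) = complex_of_real r *s v"
  by (simp add: vec_eq_iff complex_eq_iff)

lemma norm_cvec: "norm (cvec v) = norm v"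
  by (simp add: norm_vec_def L2_set_def)

lemma norm_dir: "x \<noteq> z \<Longrightarrow> norm (dir z x) = 1"
  by (simp add: dir_def norm_cvec)

lemma dir_dot: "x \<noteq> z \<Longrightarrow> dir z x \<bullet>\<^sub>c dir z x = 1"
proof -
  assume x: "x \<noteq> z"
  have "dir z x \<bullet>\<^sub>c dir z x = cnjv (dir z x) \<bullet>\<^sub>c dir z x" by (simp add: bilinear_dot_def dir_def)
  then show ?thesis unfolding norm_sq_cnjv norm_dir[OF x] by simp
qed

lemma amp_bounds:
  assumes N: "norm N = 1" and u: "norm u \<le> 1"
  shows "norm (amp_H c P N u) \<le> 6 * (norm c + 1) * norm P"
    and "norm (amp_E c P N u) \<le> 3 * (norm c + 3 + 3 / norm c) * norm P + (norm c + 1 + 1 / norm c) * norm P"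
proof -
  have u2: "norm (u\<^sup>2) \<le> 1" using u by (simp add: norm_power power_le_one)
  have a: "norm (c - u) \<le> norm c + 1" using norm_triangle_ineq4[of c u] u by simp
  have "norm (amp_H c P N u) = norm (c - u) * norm (N \<times>\<^sub>c P)" unfolding amp_H_def norm_smult ..
  also have "\<dots> \<le> (norm c + 1) * (6 * (norm N * norm P))"
    by (intro mult_mono a norm_cross_bound) auto
  finally show "norm (amp_H c P N u) \<le> 6 * (norm c + 1) * norm P"
    unfolding N by (simp only: mult_1_left mult.assoc mult.commute mult.left_commute)
  have q: "norm (u\<^sup>2 / c) \<le> 1 / norm c" using u2 by (simp add: norm_divide divide_right_mono)
  have q3: "norm (3 * u\<^sup>2 / c) \<le> 3 / norm c" using u2 by (simp add: norm_divide norm_mult divide_right_mono)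
  have "norm (c - 3 * u + 3 * u\<^sup>2 / c) \<le> norm (c - 3 * u) + norm (3 * u\<^sup>2 / c)" by (rule norm_triangle_ineq)
  also have "norm (c - 3 * u) \<le> norm c + norm (3 * u)" by (rule norm_triangle_ineq4)
  finally have b: "norm (c - 3 * u + 3 * u\<^sup>2 / c) \<le> norm c + 3 + 3 / norm c" using q3 u by (simp add: norm_mult)
  have "norm (c - u + u\<^sup>2 / c) \<le> norm (c - u) + norm (u\<^sup>2 / c)" by (rule norm_triangle_ineq)
  then have b': "norm (c - u + u\<^sup>2 / c) \<le> norm c + 1 + 1 / norm c" using a q by linarith
  have "norm (amp_E c P N u) \<le> norm (c - 3 * u + 3 * u\<^sup>2 / c) * norm (N \<bullet>\<^sub>c P) * norm N + norm (c - u + u\<^sup>2 / c) * norm P"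
    unfolding amp_E_def by (rule order_trans[OF norm_triangle_ineq]) (simp only: norm_smult norm_mult norm_minus_cancel order_refl)
  also have "\<dots> \<le> (norm c + 3 + 3 / norm c) * (3 * (norm N * norm P)) * norm N + (norm c + 1 + 1 / norm c) * norm P"
    by (intro add_mono mult_mono b b' bilinear_dot_bound mult_nonneg_nonneg) auto
  finally show "norm (amp_E c P N u) \<le> 3 * (norm c + 3 + 3 / norm c) * norm P + (norm c + 1 + 1 / norm c) * norm P"
    using N by (simp add: mult_ac)
qed

lemma norm_exp_imaginary: "Im k = 0 \<Longrightarrow> norm (exp (\<i> * k * of_real r)) = 1"
  by (simp add: norm_exp_eq_Re)

text \<open>In terms of amplitudes the leading parts of \<open>H \<times> x\<close> and \<open>|x| E\<close> agree. What is left,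
  including the effect of a source away from the origin, carries a factor \<open>u = 1 / |x - z|\<close>.\<close>

lemma dipole_silver_mueller:
  assumes k: "k \<noteq> 0" "Im k = 0"
  shows "silver_mueller (dipole_E k z p) (dipole_H k z p)"
proof -
  define c where "c = \<i> * k"
  have c: "c \<noteq> 0" "norm c > 0" using k by (auto simp: c_def)
  define P where "P = cvec p"
  define KH where "KH = 6 * (norm c + 1) * norm P"
  define KE where "KE = 3 * (norm c + 3 + 3 / norm c) * norm P + (norm c + 1 + 1 / norm c) * norm P"
  define K where "K = 1 / norm c * norm P + (2 + 3 / norm c) * (3 * norm P) + 6 * (KH * norm z) + norm z * KE"
  have main: "norm (dipole_H k z p x \<times>\<^sub>c cvec x - norm x *\<^sub>R dipole_E k z p x) \<le> K * inverse (norm (x - z))"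
    if x: "norm (x - z) \<ge> 1" for x
  proof -
    have xz: "x \<noteq> z" using x by auto
    define R where "R = norm (x - z)"
    define u where "u = inverse R"
    define U where "U = complex_of_real u"
    define N where "N = dir z x"
    define e where "e = exp (c * of_real R) / (4 * of_real pi)"
    have R: "R \<ge> 1" using x by (simp add: R_def)
    have u: "0 < u" "u \<le> 1" "u * R = 1" using R by (auto simp: u_def inverse_le_1_iff)
    have NN: "N \<bullet>\<^sub>c N = 1" "norm N = 1" using dir_dot[OF xz] norm_dir[OF xz] by (auto simp: N_def)
    have X: "cvec x = of_real R *s N + cvec z"
    proof -
      have "cvec x = cvec (x - z) + cvec z" by (simp add: vec_eq_iff)
      then show ?thesis using cvec_dir[OF xz] by (simp add: R_def N_def)
    qed
    have inv: "inverse (complex_of_real (norm (x - z))) = U" by (simp add: U_def u_def R_def)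
    have H: "dipole_H k z p x = (e * U) *s amp_H c P N U" and E: "dipole_E k z p x = (e * U) *s amp_E c P N U"
      unfolding dipole_amplitude[OF k(1) xz] inv
      by (simp_all add: e_def U_def u_def R_def c_def P_def N_def field_simps)
    define aH where "aH = amp_H c P N U"
    define aE where "aE = amp_E c P N U"
    let ?T = "(- (U\<^sup>2 / c)) *s P - ((2 * U - 3 * U\<^sup>2 / c) * (N \<bullet>\<^sub>c P)) *s N + U *s (aH \<times>\<^sub>c cvec z) + (1 - of_real (norm x) * U) *s aE"
    have UR: "U * of_real R = 1" using u(3) by (metis U_def of_real_1 of_real_mult)
    have aHN: "aH \<times>\<^sub>c N = (c - U) *s (P - (N \<bullet>\<^sub>c P) *s N)"
    proof -
      have "(N \<times>\<^sub>c P) \<times>\<^sub>c N = (N \<bullet>\<^sub>c N) *s P - (N \<bullet>\<^sub>c P) *s N"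
        by (rule vec3_eqI) (simp_all add: bilinear_dot_3 algebra_simps)
      moreover have "aH \<times>\<^sub>c N = (c - U) *s ((N \<times>\<^sub>c P) \<times>\<^sub>c N)"
        unfolding aH_def amp_H_def by (rule vec3_eqI) (simp_all add: algebra_simps)
      ultimately show ?thesis unfolding NN by simp
    qed
    have "dipole_H k z p x \<times>\<^sub>c cvec x - norm x *\<^sub>R dipole_E k z p x =
      e *s ((U * of_real R) *s (aH \<times>\<^sub>c N) + U *s (aH \<times>\<^sub>c cvec z) - (of_real (norm x) * U) *s aE)"
      unfolding H E X aH_def[symmetric] aE_def[symmetric] scaleR_eq_smult
      by (rule vec3_eqI) (simp_all add: algebra_simps)
    also have "(U * of_real R) *s (aH \<times>\<^sub>c N) + U *s (aH \<times>\<^sub>c cvec z) - (of_real (norm x) * U) *s aE = ?T"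
    proof -
      have "(c - U) *s (P - (N \<bullet>\<^sub>c P) *s N) - aE = (- (U\<^sup>2 / c)) *s P - ((2 * U - 3 * U\<^sup>2 / c) * (N \<bullet>\<^sub>c P)) *s N"
        unfolding aE_def amp_E_def by (simp add: vec_eq_iff algebra_simps)
      then show ?thesis unfolding UR aHN
        by (simp add: vec_eq_iff algebra_simps)
    qed
    finally have eq: "norm (dipole_H k z p x \<times>\<^sub>c cvec x - norm x *\<^sub>R dipole_E k z p x) = norm e * norm ?T"
      by (simp only: norm_smult)
    have e: "norm e \<le> 1"
    proof -
      have "norm e = 1 / (4 * pi)" using norm_exp_imaginary[OF k(2), of R]
        by (simp add: e_def c_def norm_divide norm_mult)
      also have "\<dots> \<le> 1" using pi_gt3 by simp
      finally show ?thesis .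
    qed
    have nU: "norm U = u" "norm U \<le> 1" using u by (auto simp: U_def)
    have uu: "u\<^sup>2 \<le> u" using u by (simp add: power2_eq_square mult_left_le)
    note b = amp_bounds[OF NN(2) nU(2), of c P, folded aH_def aE_def KH_def KE_def]
    have t1: "norm ((- (U\<^sup>2 / c)) *s P) \<le> (1 / norm c * norm P) * u"
    proof -
      have "norm ((- (U\<^sup>2 / c)) *s P) = u\<^sup>2 * (1 / norm c * norm P)"
        by (simp add: norm_smult norm_divide norm_power nU(1))
      also have "\<dots> \<le> u * (1 / norm c * norm P)" using uu by (intro mult_right_mono) auto
      finally show ?thesis by (simp add: mult_ac)
    qed
    have t2: "norm (((2 * U - 3 * U\<^sup>2 / c) * (N \<bullet>\<^sub>c P)) *s N) \<le> ((2 + 3 / norm c) * (3 * norm P)) * u"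
    proof -
      have "norm (2 * U - 3 * U\<^sup>2 / c) \<le> norm (2 * U) + norm (3 * U\<^sup>2 / c)" by (rule norm_triangle_ineq4)
      also have "\<dots> = 2 * u + 3 / norm c * u\<^sup>2" by (simp add: norm_divide norm_mult norm_power nU(1))
      also have "\<dots> \<le> 2 * u + 3 / norm c * u" using uu c by (intro add_left_mono mult_left_mono) auto
      also have "\<dots> = (2 + 3 / norm c) * u" by (simp add: algebra_simps)
      finally have "norm (2 * U - 3 * U\<^sup>2 / c) * norm (N \<bullet>\<^sub>c P) \<le> ((2 + 3 / norm c) * u) * (3 * (norm N * norm P))"
        by (intro mult_mono bilinear_dot_bound) (use u c in auto)
      then show ?thesis by (simp add: norm_smult norm_mult NN(2) mult_ac)
    qed
    have t3: "norm (U *s (aH \<times>\<^sub>c cvec z)) \<le> (6 * (KH * norm z)) * u"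
    proof -
      have "norm (aH \<times>\<^sub>c cvec z) \<le> 6 * (norm aH * norm z)" using norm_cross_bound[of aH "cvec z"] by (simp add: norm_cvec)
      also have "\<dots> \<le> 6 * (KH * norm z)" using b(1) by (intro mult_left_mono mult_right_mono) auto
      finally have "u * norm (aH \<times>\<^sub>c cvec z) \<le> u * (6 * (KH * norm z))" using u by (intro mult_left_mono) auto
      then show ?thesis by (simp add: norm_smult nU(1) mult_ac)
    qed
    have t4: "norm ((1 - of_real (norm x) * U) *s aE) \<le> (norm z * KE) * u"
    proof -
      have "1 - of_real (norm x) * U = complex_of_real (u * (R - norm x))"
        using u(3) by (simp add: U_def algebra_simps flip: of_real_mult)
      then have "norm (1 - of_real (norm x) * U) = u * \<bar>R - norm x\<bar>"
        using u(1) by (simp only: norm_of_real abs_mult abs_of_pos)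
      also have "\<dots> \<le> u * norm z"
        using norm_triangle_ineq3[of "x - z" x] u(1) by (intro mult_left_mono) (auto simp: R_def norm_minus_commute)
      finally have "norm (1 - of_real (norm x) * U) * norm aE \<le> (u * norm z) * KE"
        using b(2) u by (intro mult_mono) auto
      then show ?thesis unfolding norm_smult by (simp add: mult_ac)
    qed
    have "norm ?T \<le> norm ((- (U\<^sup>2 / c)) *s P) + norm (((2 * U - 3 * U\<^sup>2 / c) * (N \<bullet>\<^sub>c P)) *s N)
       + norm (U *s (aH \<times>\<^sub>c cvec z)) + norm ((1 - of_real (norm x) * U) *s aE)"
      by (intro order_trans[OF norm_triangle_ineq] add_mono norm_triangle_ineq4 order_refl)
    also have "\<dots> \<le> K * u" unfolding K_def using t1 t2 t3 t4 by (simp only: distrib_right)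
    finally have "norm ?T \<le> K * u" .
    moreover have "norm e * norm ?T \<le> 1 * norm ?T" using e by (intro mult_right_mono) auto
    ultimately show ?thesis unfolding eq by (simp add: u_def R_def)
  qed
  have top: "filterlim (\<lambda>x. norm (x - z)) at_top at_infinity"
  proof (rule filterlim_at_top_mono[of "\<lambda>x. - norm z + norm x"])
    show "filterlim (\<lambda>x. - norm z + norm x) at_top at_infinity"
      by (rule filterlim_tendsto_add_at_top[OF tendsto_const filterlim_norm_at_top])
    show "\<forall>\<^sub>F x in at_infinity. - norm z + norm x \<le> norm (x - z)"
    proof (intro always_eventually allI)
      fix x show "- norm z + norm x \<le> norm (x - z)" using norm_triangle_ineq2[of x z] by linarith
    qed
  qed
  have "((\<lambda>x. K * inverse (norm (x - z))) \<longlongrightarrow> K * 0) at_infinity"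
    by (intro tendsto_intros tendsto_inverse_0_at_top[OF top])
  then have lim0: "((\<lambda>x. K * inverse (norm (x - z))) \<longlongrightarrow> 0) at_infinity" by simp
  have "\<forall>\<^sub>F x in at_infinity. norm (x - z) \<ge> 1"
    using top unfolding filterlim_at_top by blast
  then have ev: "\<forall>\<^sub>F x in at_infinity. norm (dipole_H k z p x \<times>\<^sub>c cvec x - norm x *\<^sub>R dipole_E k z p x) \<le> K * inverse (norm (x - z))"
    by eventually_elim (rule main)
  show ?thesis unfolding silver_mueller_def by (rule Lim_null_comparison[OF ev lim0])
qed

lemma plane_wave_explicit:
  assumes k: "k \<noteq> 0" and d: "norm d = 1"
  shows "plane_wave_H k d q x = exp (\<i> * k * of_real (x \<bullet> d)) *s ((\<i> * k) *s (cvec d \<times>\<^sub>c cvec q))" (is ?H)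
    and "plane_wave_E k d q x = exp (\<i> * k * of_real (x \<bullet> d)) *s ((\<i> * k) *s ((cvec d \<times>\<^sub>c cvec q) \<times>\<^sub>c cvec d))" (is ?E)
    and "maxwell_C1 k UNIV (plane_wave_E k d q) (plane_wave_H k d q)" (is ?M)
proof -
  define c where "c = \<i> * k"
  define g where "g x = exp (c * complex_of_real (x \<bullet> d))" for x
  have lin: "has_grad UNIV (\<lambda>x. x \<bullet> d) (\<lambda>j x. d$j)"
    by (rule has_gradI, rule bounded_linear_imp_has_derivative[OF bounded_linear_inner_left])
       (auto simp: inner_vec_def)
  have ex: "((\<lambda>s. exp (c * complex_of_real s)) has_vector_derivative c * exp (c * of_real s)) (at s)" for s
  proof -
    have "((\<lambda>w. exp (c * w)) has_field_derivative exp (c * of_real s) * c) (at (of_real s))"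
      by (auto intro!: derivative_eq_intros)
    from has_vector_derivative_real_field[OF this] show ?thesis by (simp add: mult.commute)
  qed
  have g: "has_grad UNIV g (\<lambda>j x. c * of_real (d$j) * g x)"
  proof -
    have "has_grad UNIV (\<lambda>x. exp (c * complex_of_real (x \<bullet> d))) (\<lambda>j x. d$j *\<^sub>R (c * exp (c * of_real (x \<bullet> d))))"
      by (rule has_grad_compose[OF lin, of UNIV]) (auto intro!: ex continuous_intros)
    then show ?thesis unfolding g_def[abs_def] by (simp add: scaleR_conv_of_real mult_ac)
  qed
  have comp: "has_grad UNIV (\<lambda>x. (g x *s v) $ i) (\<lambda>j x. c * of_real (d$j) * g x * v $ i)" for v :: "complex^3" and i
    using has_grad_mult[OF g has_grad_const[of _ "v $ i"]] by simp
  have rot: "rot (\<lambda>i j x. c * of_real (d$j) * g x * v $ i) x = g x *s (c *s (cvec d \<times>\<^sub>c v))" for v :: "complex^3" and x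
    by (rule vec3_eqI) (simp_all add: algebra_simps)
  have curl: "curl (\<lambda>x. g x *s v) x = g x *s (c *s (cvec d \<times>\<^sub>c v))" for v x
    using curl_eq_rot[OF comp, of x v] rot by simp
  define w where "w = cvec d \<times>\<^sub>c cvec q"
  have H: "plane_wave_H k d q = (\<lambda>x. g x *s (c *s w))"
    unfolding plane_wave_H_def c_def[symmetric] g_def[symmetric] w_def by (intro ext curl)
  then show ?H by (simp add: g_def c_def w_def)
  have cc: "(\<i> / k) * (c * c) = - c" using k by (simp add: c_def)
  have ww: "(\<i> / k) *s (g x *s (c *s (cvec d \<times>\<^sub>c (c *s w)))) = g x *s (c *s (w \<times>\<^sub>c cvec d))" for x
  proof -
    have "cvec d \<times>\<^sub>c (c *s w) = (- c) *s (w \<times>\<^sub>c cvec d)" by (rule vec3_eqI) (simp_all add: algebra_simps)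
    moreover have "\<i> / k * (g x * (c * - c)) = g x * c"
    proof -
      have "\<i> / k * (g x * (c * - c)) = - ((\<i> / k) * (c * c)) * g x" by (simp add: algebra_simps)
      then show ?thesis unfolding cc by simp
    qed
    ultimately show ?thesis by (simp only: vector_smult_assoc)
  qed
  have E: "plane_wave_E k d q = (\<lambda>x. g x *s (c *s (w \<times>\<^sub>c cvec d)))"
  proof
    fix x
    have "plane_wave_E k d q x = (\<i> / k) *s curl (plane_wave_H k d q) x"
      unfolding plane_wave_E_def plane_wave_H_def ..
    then show "plane_wave_E k d q x = g x *s (c *s (w \<times>\<^sub>c cvec d))"
      unfolding H curl ww .
  qed
  then show ?E by (simp add: g_def c_def w_def)
  have dd: "cvec d \<bullet>\<^sub>c cvec d = 1"
  proof -
    have "cvec d \<bullet>\<^sub>c cvec d = cnjv (cvec d) \<bullet>\<^sub>c cvec d" by (simp add: bilinear_dot_def)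
    then show ?thesis unfolding norm_sq_cnjv norm_cvec d by simp
  qed
  show ?M unfolding H E
  proof (rule maxwell_C1I[OF open_UNIV comp comp])
    fix x
    have "cvec d \<times>\<^sub>c (c *s (w \<times>\<^sub>c cvec d)) = c *s ((cvec d \<bullet>\<^sub>c cvec d) *s w)"
      unfolding w_def by (rule vec3_eqI) (simp_all add: bilinear_dot_3 algebra_simps)
    then show "rot (\<lambda>i j x. c * of_real (d$j) * g x * (c *s (w \<times>\<^sub>c cvec d)) $ i) x = (\<i> * k) *s (g x *s (c *s w))"
      unfolding rot dd c_def[symmetric] by (simp add: mult_ac)
    have "cvec d \<times>\<^sub>c (c *s w) = (- c) *s (w \<times>\<^sub>c cvec d)" by (rule vec3_eqI) (simp_all add: algebra_simps)
    then show "rot (\<lambda>i j x. c * of_real (d$j) * g x * (c *s w) $ i) x = - (\<i> * k) *s (g x *s (c *s (w \<times>\<^sub>c cvec d)))"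
      unfolding rot c_def[symmetric] by (simp add: mult_ac)
  qed
qed


section \<open>The far field pattern as a flux\<close>

lemma tendsto_smult:
  fixes v :: "'a \<Rightarrow> complex^3"
  assumes "(f \<longlongrightarrow> c) F" "(v \<longlongrightarrow> w) F"
  shows "((\<lambda>x. f x *s v x) \<longlongrightarrow> c *s w) F"
  by (rule vec_tendstoI) (use assms in \<open>auto intro!: tendsto_intros\<close>)

lemma tendsto_cross:
  assumes "(f \<longlongrightarrow> v) F" "(g \<longlongrightarrow> w) F"
  shows "((\<lambda>x. f x \<times>\<^sub>c g x) \<longlongrightarrow> v \<times>\<^sub>c w) F"
proof (rule vec_tendstoI)
  fix i :: 3
  consider "i = 1" | "i = 2" | "i = 3" using exhaust_3 by blast
  then show "((\<lambda>x. (f x \<times>\<^sub>c g x) $ i) \<longlongrightarrow> (v \<times>\<^sub>c w) $ i) F"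
    by cases (use assms in \<open>auto intro!: tendsto_intros\<close>)
qed

lemma tendsto_bilinear_dot:
  assumes "(f \<longlongrightarrow> v) F" "(g \<longlongrightarrow> w) F"
  shows "((\<lambda>x. f x \<bullet>\<^sub>c g x) \<longlongrightarrow> v \<bullet>\<^sub>c w) F"
  unfolding bilinear_dot_def using assms by (intro tendsto_intros)

lemma tendsto_cvec:
  assumes "(f \<longlongrightarrow> v) F" shows "((\<lambda>x. cvec (f x)) \<longlongrightarrow> cvec v) F"
  by (rule vec_tendstoI) (use assms in \<open>auto intro!: tendsto_intros\<close>)

text \<open>This factor compensates the decay and the phase of a dipole at distance \<open>t\<close>.\<close>

definition dip_scale :: "complex \<Rightarrow> real \<Rightarrow> complex" where
  "dip_scale k t = 4 * of_real pi * of_real t * exp (- (\<i> * k * of_real t))"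

lemma far_dipole:
  assumes k: "k \<noteq> 0" and x: "x \<noteq> y" and t: "t > 0"
  shows "dip_scale k t *s dipole_H k y q x = (exp (\<i> * k * of_real (norm (x - y) - t)) * of_real (t / norm (x - y))) *s
      amp_H (\<i> * k) (cvec q) (dir y x) (inverse (of_real (norm (x - y))))"
    and "dip_scale k t *s dipole_E k y q x = (exp (\<i> * k * of_real (norm (x - y) - t)) * of_real (t / norm (x - y))) *s
      amp_E (\<i> * k) (cvec q) (dir y x) (inverse (of_real (norm (x - y))))"
proof -
  have "dip_scale k t * (exp (\<i> * k * of_real (norm (x - y))) / (4 * of_real pi * of_real (norm (x - y))))
     = exp (\<i> * k * of_real (norm (x - y) - t)) * of_real (t / norm (x - y))"
    unfolding dip_scale_def using x by (simp add: right_diff_distrib exp_diff exp_minus field_simps)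
  then show "dip_scale k t *s dipole_H k y q x = (exp (\<i> * k * of_real (norm (x - y) - t)) * of_real (t / norm (x - y))) *s
      amp_H (\<i> * k) (cvec q) (dir y x) (inverse (of_real (norm (x - y))))"
    "dip_scale k t *s dipole_E k y q x = (exp (\<i> * k * of_real (norm (x - y) - t)) * of_real (t / norm (x - y))) *s
      amp_E (\<i> * k) (cvec q) (dir y x) (inverse (of_real (norm (x - y))))"
    unfolding dipole_amplitude[OF k x] vector_smult_assoc by simp_all
qed

text \<open>A rescaled dipole at \<open>- t d\<close> looks like a plane wave in direction \<open>d\<close>: its distance \<open>R\<close> to \<open>x\<close> satisfies \<open>R - t \<longlongrightarrow> x \<bullet> d\<close>, and
  the direction from the dipole to \<open>x\<close> tends to \<open>d\<close>.\<close>

lemma far_dipole_limit: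
  assumes k: "k \<noteq> 0" and d: "norm d = 1" and t: "filterlim t at_top sequentially"
  shows "(\<lambda>n. dip_scale k (t n) *s dipole_H k (- (t n *\<^sub>R d)) q x) \<longlonglongrightarrow> plane_wave_H k d q x"
    and "(\<lambda>n. dip_scale k (t n) *s dipole_E k (- (t n *\<^sub>R d)) q x) \<longlonglongrightarrow> plane_wave_E k d q x"
proof -
  define R where "R n = norm (x + t n *\<^sub>R d)" for n
  have it: "(\<lambda>n. inverse (t n)) \<longlonglongrightarrow> 0" by (rule tendsto_inverse_0_at_top[OF t])
  have tpos: "\<forall>\<^sub>F n in sequentially. t n > norm x" using t unfolding filterlim_at_top_dense by blast
  have ev: "\<forall>\<^sub>F n in sequentially. t n > 0 \<and> x \<noteq> - (t n *\<^sub>R d) \<and> R n > 0"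
    using tpos
  proof eventually_elim
    case (elim n)
    have "t n > 0" using elim norm_ge_zero[of x] by linarith
    moreover have "R n > 0"
    proof -
      have "norm (t n *\<^sub>R d) - norm (- x) \<le> norm (t n *\<^sub>R d - (- x))" by (rule norm_triangle_ineq2)
      then have "t n - norm x \<le> R n" using d \<open>t n > 0\<close> by (simp add: R_def add.commute)
      then show ?thesis using elim by linarith
    qed
    ultimately show ?case by (auto simp: R_def)
  qed
  have Rt: "(\<lambda>n. norm (inverse (t n) *\<^sub>R x + d)) \<longlonglongrightarrow> norm (0 *\<^sub>R x + d)"
    by (intro tendsto_intros it)
  then have Rt1: "(\<lambda>n. R n / t n) \<longlonglongrightarrow> 1"
  proof (rule Lim_transform_eventually[THEN tendsto_eq_rhs])
    show "norm (0 *\<^sub>R x + d) = 1" using d by simp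
    show "\<forall>\<^sub>F n in sequentially. norm (inverse (t n) *\<^sub>R x + d) = R n / t n"
      using ev
    proof eventually_elim
      case (elim n)
      have "x + t n *\<^sub>R d = t n *\<^sub>R (inverse (t n) *\<^sub>R x + d)" using elim by (simp add: scaleR_add_right)
      then show ?case using elim by (simp add: R_def)
    qed
  qed
  then have "(\<lambda>n. inverse (R n / t n)) \<longlonglongrightarrow> inverse 1" by (intro tendsto_intros) auto
  then have tR: "(\<lambda>n. t n / R n) \<longlonglongrightarrow> 1" by (simp add: divide_inverse mult.commute)
  have "(\<lambda>n. inverse (t n) * (t n / R n)) \<longlonglongrightarrow> 0 * 1" by (intro tendsto_intros it tR)
  then have iR: "(\<lambda>n. inverse (R n)) \<longlonglongrightarrow> 0"
  proof (rule Lim_transform_eventually[THEN tendsto_eq_rhs])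
    show "\<forall>\<^sub>F n in sequentially. inverse (t n) * (t n / R n) = inverse (R n)"
      using ev by eventually_elim (simp add: field_simps)
  qed simp
  have N: "(\<lambda>n. dir (- (t n *\<^sub>R d)) x) \<longlonglongrightarrow> cvec d"
  proof -
    have "(\<lambda>n. cvec (inverse (R n) *\<^sub>R x + (t n / R n) *\<^sub>R d)) \<longlonglongrightarrow> cvec (0 *\<^sub>R x + 1 *\<^sub>R d)"
      by (intro tendsto_cvec tendsto_intros iR tR)
    moreover have "cvec (inverse (R n) *\<^sub>R x + (t n / R n) *\<^sub>R d) = dir (- (t n *\<^sub>R d)) x" for n
      by (simp add: dir_def R_def scaleR_add_right divide_inverse mult.commute)
    ultimately show ?thesis by simp
  qed
  have RD: "(\<lambda>n. R n - t n) \<longlonglongrightarrow> x \<bullet> d"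
  proof -
    have "(\<lambda>n. ((norm x)\<^sup>2 * inverse (t n) + 2 * (x \<bullet> d)) / (R n / t n + 1)) \<longlonglongrightarrow> ((norm x)\<^sup>2 * 0 + 2 * (x \<bullet> d)) / (1 + 1)"
      by (intro tendsto_intros it Rt1) auto
    then show ?thesis
    proof (rule Lim_transform_eventually[THEN tendsto_eq_rhs])
      show "\<forall>\<^sub>F n in sequentially. ((norm x)\<^sup>2 * inverse (t n) + 2 * (x \<bullet> d)) / (R n / t n + 1) = R n - t n"
        using ev
      proof eventually_elim
        case (elim n)
        have "(R n)\<^sup>2 = (norm x)\<^sup>2 + 2 * t n * (x \<bullet> d) + (t n)\<^sup>2"
        proof -
          have "d \<bullet> d = 1" using d by (simp add: norm_eq_1)
          then show ?thesis unfolding R_def power2_norm_eq_inner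
            by (simp add: inner_add_left inner_add_right inner_commute power2_eq_square)
        qed
        then have a: "(R n - t n) * (R n + t n) = (norm x)\<^sup>2 + 2 * t n * (x \<bullet> d)"
          by (simp add: power2_eq_square algebra_simps)
        have b: "R n / t n + 1 = (R n + t n) / t n" "(norm x)\<^sup>2 * inverse (t n) + 2 * (x \<bullet> d) = ((norm x)\<^sup>2 + 2 * t n * (x \<bullet> d)) / t n"
          using elim by (simp_all add: field_simps)
        have "R n + t n \<noteq> 0" "t n \<noteq> 0" using elim by linarith+
        then show ?case unfolding b a[symmetric] by simp
      qed
    qed simp
  qed
  have pre: "(\<lambda>n. exp (\<i> * k * of_real (R n - t n)) * of_real (t n / R n)) \<longlonglongrightarrow> exp (\<i> * k * of_real (x \<bullet> d)) * of_real 1"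
    by (intro tendsto_intros RD tR)
  have u: "(\<lambda>n. inverse (complex_of_real (R n))) \<longlonglongrightarrow> 0"
    using tendsto_of_real[OF iR, where 'a=complex] by simp
  have c: "\<i> * k \<noteq> 0" using k by simp
  have aH: "(\<lambda>n. amp_H (\<i> * k) (cvec q) (dir (- (t n *\<^sub>R d)) x) (inverse (complex_of_real (R n)))) \<longlonglongrightarrow> amp_H (\<i> * k) (cvec q) (cvec d) 0"
    unfolding amp_H_def by (intro tendsto_smult tendsto_cross tendsto_intros u N)
  have aE: "(\<lambda>n. amp_E (\<i> * k) (cvec q) (dir (- (t n *\<^sub>R d)) x) (inverse (complex_of_real (R n)))) \<longlonglongrightarrow> amp_E (\<i> * k) (cvec q) (cvec d) 0"
    unfolding amp_E_def using c by (intro tendsto_smult tendsto_bilinear_dot tendsto_intros u N)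
  have dd: "cvec d \<bullet>\<^sub>c cvec d = 1"
  proof -
    have "cvec d \<bullet>\<^sub>c cvec d = cnjv (cvec d) \<bullet>\<^sub>c cvec d" by (simp add: bilinear_dot_def)
    then show ?thesis unfolding norm_sq_cnjv norm_cvec d by simp
  qed
  have aH0: "amp_H (\<i> * k) (cvec q) (cvec d) 0 = (\<i> * k) *s (cvec d \<times>\<^sub>c cvec q)"
    by (simp add: amp_H_def)
  have aE0: "amp_E (\<i> * k) (cvec q) (cvec d) 0 = (\<i> * k) *s ((cvec d \<times>\<^sub>c cvec q) \<times>\<^sub>c cvec d)"
  proof -
    have e: "(cvec d \<times>\<^sub>c cvec q) \<times>\<^sub>c cvec d = (cvec d \<bullet>\<^sub>c cvec d) *s cvec q - (cvec d \<bullet>\<^sub>c cvec q) *s cvec d"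
      by (rule vec3_eqI) (simp_all add: bilinear_dot_3 algebra_simps)
    show ?thesis unfolding e dd by (simp add: amp_E_def vec_eq_iff algebra_simps)
  qed
  have sub: "x - - (t n *\<^sub>R d) = x + t n *\<^sub>R d" for n by simp
  show "(\<lambda>n. dip_scale k (t n) *s dipole_H k (- (t n *\<^sub>R d)) q x) \<longlonglongrightarrow> plane_wave_H k d q x"
    using tendsto_smult[OF pre aH]
  proof (rule Lim_transform_eventually[THEN tendsto_eq_rhs])
    show "\<forall>\<^sub>F n in sequentially. (exp (\<i> * k * of_real (R n - t n)) * of_real (t n / R n)) *s
       amp_H (\<i> * k) (cvec q) (dir (- (t n *\<^sub>R d)) x) (inverse (complex_of_real (R n))) = dip_scale k (t n) *s dipole_H k (- (t n *\<^sub>R d)) q x"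
      using ev
    proof eventually_elim
      case (elim n)
      then have "x \<noteq> - (t n *\<^sub>R d)" "t n > 0" by auto
      from far_dipole(1)[OF k this, of q] show ?case by (simp only: R_def sub)
    qed
    show "(exp (\<i> * k * of_real (x \<bullet> d)) * of_real 1) *s amp_H (\<i> * k) (cvec q) (cvec d) 0 = plane_wave_H k d q x"
      unfolding plane_wave_explicit(1)[OF k d] aH0 by simp
  qed
  show "(\<lambda>n. dip_scale k (t n) *s dipole_E k (- (t n *\<^sub>R d)) q x) \<longlonglongrightarrow> plane_wave_E k d q x"
    using tendsto_smult[OF pre aE]
  proof (rule Lim_transform_eventually[THEN tendsto_eq_rhs])
    show "\<forall>\<^sub>F n in sequentially. (exp (\<i> * k * of_real (R n - t n)) * of_real (t n / R n)) *s
       amp_E (\<i> * k) (cvec q) (dir (- (t n *\<^sub>R d)) x) (inverse (complex_of_real (R n))) = dip_scale k (t n) *s dipole_E k (- (t n *\<^sub>R d)) q x"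
      using ev
    proof eventually_elim
      case (elim n)
      then have "x \<noteq> - (t n *\<^sub>R d)" "t n > 0" by auto
      from far_dipole(2)[OF k this, of q] show ?case by (simp only: R_def sub)
    qed
    show "(exp (\<i> * k * of_real (x \<bullet> d)) * of_real 1) *s amp_E (\<i> * k) (cvec q) (cvec d) 0 = plane_wave_E k d q x"
      unfolding plane_wave_explicit(2)[OF k d] aE0 by simp
  qed
qed

lemma far_dipole_bound:
  assumes k: "k \<noteq> 0" "Im k = 0"
  obtains B where "\<And>x y t. norm x \<le> t / 2 \<Longrightarrow> norm y = t \<Longrightarrow> 2 \<le> t \<Longrightarrow>
    norm (dip_scale k t *s dipole_H k y q x) \<le> B \<and> norm (dip_scale k t *s dipole_E k y q x) \<le> B"
proof -
  define c where "c = \<i> * k"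
  define KH where "KH = 6 * (norm c + 1) * norm (cvec q)"
  define KE where "KE = 3 * (norm c + 3 + 3 / norm c) * norm (cvec q) + (norm c + 1 + 1 / norm c) * norm (cvec q)"
  show ?thesis
  proof (rule that[of "2 * max KH KE"])
    fix x y :: "real^3" and t :: real assume h: "norm x \<le> t / 2" "norm y = t" "2 \<le> t"
    define R where "R = norm (x - y)"
    have R: "R \<ge> t / 2" using norm_triangle_ineq3[of y x] h by (simp add: R_def norm_minus_commute)
    then have xy: "x \<noteq> y" "R \<ge> 1" using h by (auto simp: R_def)
    have f: "norm (exp (\<i> * k * of_real (R - t)) * complex_of_real (t / R)) \<le> 2"
    proof -
      have "t / R \<le> 2" using R xy(2) h by (simp add: field_simps)
      moreover have "norm (exp (\<i> * k * of_real (R - t)) * complex_of_real (t / R)) = t / R"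
        unfolding norm_mult norm_exp_imaginary[OF k(2)] norm_of_real using xy(2) h by simp
      ultimately show ?thesis by simp
    qed
    have u: "norm (inverse (complex_of_real R)) \<le> 1" using xy(2) by (simp add: norm_inverse inverse_le_1_iff)
    note b = amp_bounds[OF norm_dir[OF xy(1)] u, of c "cvec q", folded KH_def KE_def]
    have "norm (dip_scale k t *s dipole_H k y q x) \<le> 2 * KH"
      unfolding far_dipole(1)[OF k(1) xy(1) less_le_trans[OF zero_less_numeral h(3)]] norm_smult c_def[symmetric] R_def[symmetric]
      using f b(1) by (intro mult_mono) (auto simp: c_def)
    moreover have "norm (dip_scale k t *s dipole_E k y q x) \<le> 2 * KE"
      unfolding far_dipole(2)[OF k(1) xy(1) less_le_trans[OF zero_less_numeral h(3)]] norm_smult c_def[symmetric] R_def[symmetric]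
      using f b(2) by (intro mult_mono) (auto simp: c_def)
    ultimately show "norm (dip_scale k t *s dipole_H k y q x) \<le> 2 * max KH KE \<and> norm (dip_scale k t *s dipole_E k y q x) \<le> 2 * max KH KE"
      by (auto simp: le_max_iff_disj)
  qed
qed

lemma radiating_mono: "radiating k R E H \<Longrightarrow> R \<le> R' \<Longrightarrow> radiating k R' E H"
  unfolding radiating_def
  by (auto intro: maxwell_C1_subset simp: open_Collect_less continuous_intros)

lemma dipole_radiating:
  assumes "k \<noteq> 0" "Im k = 0" "norm z \<le> R"
  shows "radiating k R (dipole_E k z p) (dipole_H k z p)"
  unfolding radiating_def
proof (intro conjI dipole_silver_mueller[OF assms(1,2)])
  show "maxwell_C1 k {x. norm x > R} (dipole_E k z p) (dipole_H k z p)"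
    by (rule maxwell_C1_subset[OF dipole_maxwell[OF assms(1)]])
       (use assms(3) in \<open>auto simp: open_Collect_less continuous_intros\<close>)
qed

lemma ball_cutoff:
  assumes "0 < T"
  shows "has_grad UNIV (bump 0 (T\<^sup>2) ((2 * T)\<^sup>2)) (shell T)"
    "norm x \<le> T \<Longrightarrow> bump 0 (T\<^sup>2) ((2 * T)\<^sup>2) x = 1"
    "2 * T \<le> norm x \<Longrightarrow> bump 0 (T\<^sup>2) ((2 * T)\<^sup>2) x = 0"
proof -
  note c = cut_values[OF sq_less[OF assms]]
  show "has_grad UNIV (bump 0 (T\<^sup>2) ((2 * T)\<^sup>2)) (shell T)"
    unfolding shell_def by (rule has_grad_bump[OF sq_less[OF assms]])
  show "norm x \<le> T \<Longrightarrow> bump 0 (T\<^sup>2) ((2 * T)\<^sup>2) x = 1"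
    using c(1) by (simp add: bump_def power_mono)
  show "2 * T \<le> norm x \<Longrightarrow> bump 0 (T\<^sup>2) ((2 * T)\<^sup>2) x = 0"
    using c(2) assms power_mono[of "2 * T" "norm x" 2] by (simp add: bump_def)
qed

text \<open>The gradient of a cutoff around the position of a source, the analogue of \<open>shell\<close> at a small radius.\<close>

definition spike :: "real^3 \<Rightarrow> real \<Rightarrow> 3 \<Rightarrow> real^3 \<Rightarrow> complex" where
  "spike z r = dbump z ((r / 2)\<^sup>2) (r\<^sup>2)"

lemma spike_cutoff:
  assumes "0 < r"
  shows "has_grad UNIV (bump z ((r / 2)\<^sup>2) (r\<^sup>2)) (spike z r)"
    "x \<in> ball z (r / 2) \<Longrightarrow> bump z ((r / 2)\<^sup>2) (r\<^sup>2) x = 1"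
    "x \<notin> cball z r \<Longrightarrow> bump z ((r / 2)\<^sup>2) (r\<^sup>2) x = 0"
    "x \<notin> cball z r \<Longrightarrow> spike z r j x = 0"
    "cball z r \<subseteq> A \<Longrightarrow> test_fun A (bump z ((r / 2)\<^sup>2) (r\<^sup>2)) (spike z r)"
proof -
  have lt: "(r / 2)\<^sup>2 < r\<^sup>2" using assms by (intro power_strict_mono) auto
  note c = cut_values[OF lt]
  show "has_grad UNIV (bump z ((r / 2)\<^sup>2) (r\<^sup>2)) (spike z r)"
    unfolding spike_def by (rule has_grad_bump[OF lt])
  show "x \<in> ball z (r / 2) \<Longrightarrow> bump z ((r / 2)\<^sup>2) (r\<^sup>2) x = 1"
    using c(1) assms power_mono[of "norm (x - z)" "r / 2" 2] by (simp add: bump_def dist_norm norm_minus_commute)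
  have "r\<^sup>2 \<le> (norm (x - z))\<^sup>2" if "x \<notin> cball z r"
    using that assms by (intro power_mono) (auto simp: dist_norm norm_minus_commute)
  then show "x \<notin> cball z r \<Longrightarrow> bump z ((r / 2)\<^sup>2) (r\<^sup>2) x = 0" "x \<notin> cball z r \<Longrightarrow> spike z r j x = 0"
    using c(2,5) by (auto simp: bump_def spike_def dbump_def)
  show "cball z r \<subseteq> A \<Longrightarrow> test_fun A (bump z ((r / 2)\<^sup>2) (r\<^sup>2)) (spike z r)"
    unfolding spike_def by (rule test_fun_bump[OF lt]) (use assms in auto)
qed

lemma source_flux_spike:
  assumes M: "maxwell_C1 k U E H" and k: "k \<noteq> 0" and r: "0 < r" "cball z r \<subseteq> U"
  shows "flux (spike z r) (flux_field E H (dipole_E k z p) (dipole_H k z p)) = of_real source_constant * (cvec p \<bullet>\<^sub>c E z)"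
    "integrable lborel (\<lambda>x. \<Sum>i\<in>UNIV. spike z r i x * flux_field E H (dipole_E k z p) (dipole_H k z p) x $ i)"
proof -
  have s: "cball z (r / 2) \<subseteq> U" "0 < r / 2" "0 < (r / 4)\<^sup>2" "(r / 4)\<^sup>2 < (r / 2)\<^sup>2"
    using r by (auto intro!: power_strict_mono)
  note c = spike_cutoff(5)[OF r(1,2)] spike_cutoff(2)[OF r(1)]
  show "flux (spike z r) (flux_field E H (dipole_E k z p) (dipole_H k z p)) = of_real source_constant * (cvec p \<bullet>\<^sub>c E z)"
    by (rule source_flux[OF M k s(2,1) c])
  show "integrable lborel (\<lambda>x. \<Sum>i\<in>UNIV. spike z r i x * flux_field E H (dipole_E k z p) (dipole_H k z p) x $ i)"
    by (rule source_flux_kernel(2)[OF M k s(3,4,2,1) c])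
qed

text \<open>The difference of the two cutoffs vanishes near \<open>z\<close>, so it is an admissible test function.\<close>

lemma shell_flux_eq_spike_flux:
  assumes V: "weak_div_free (- {z}) V" and c: "continuous_on {x. T \<le> norm x} V"
    and r: "0 < r" "norm z + r < T"
  shows "flux (shell T) V = flux (spike z r) V"
proof -
  have T: "0 < T" using r norm_ge_zero[of z] by linarith
  let ?b = "bump 0 (T\<^sup>2) ((2 * T)\<^sup>2)" and ?s = "bump z ((r / 2)\<^sup>2) (r\<^sup>2)"
  note b = ball_cutoff[OF T] and s = spike_cutoff[OF r(1)]
  have inball: "norm x < T" if "x \<in> cball z r" for x
  proof -
    have "norm (x - z) \<le> r" using that by (simp add: dist_norm norm_minus_commute)
    then show ?thesis using norm_triangle_sub[of x z] r by linarith
  qed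
  have tf: "test_fun (- {z}) (\<lambda>x. ?b x - ?s x) (\<lambda>j x. shell T j x - spike z r j x)"
    unfolding test_fun_def
  proof (intro conjI exI[of _ "cball 0 (2 * T) - ball z (r / 2)"] allI impI)
    show "has_grad UNIV (\<lambda>x. ?b x - ?s x) (\<lambda>j x. shell T j x - spike z r j x)"
      by (rule has_grad_diff[OF b(1) s(1)])
    show "compact (cball 0 (2 * T) - ball z (r / 2))" by (intro compact_diff) auto
    show "cball 0 (2 * T) - ball z (r / 2) \<subseteq> - {z}" using r by auto
    fix x assume "x \<notin> cball 0 (2 * T) - ball z (r / 2)"
    then consider "norm x > 2 * T" | "x \<in> ball z (r / 2)" by auto
    then show "?b x - ?s x = 0"
    proof cases
      case 1
      then have "x \<notin> cball z r" using inball[of x] T by auto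
      then show ?thesis using b(3)[of x] s(3)[of x] 1 by simp
    next
      case 2
      then have "norm x \<le> T" using inball[of x] r by auto
      then show ?thesis using b(2)[of x] s(2)[OF 2] by simp
    qed
  qed
  have i1: "integrable lborel (\<lambda>x. \<Sum>i\<in>UNIV. shell T i x * V x $ i)" by (rule shell_integrable[OF T c])
  have i2: "integrable lborel (\<lambda>x. \<Sum>i\<in>UNIV. (shell T i x - spike z r i x) * V x $ i)"
    and z: "integral\<^sup>L lborel (\<lambda>x. \<Sum>i\<in>UNIV. (shell T i x - spike z r i x) * V x $ i) = 0"
    using V tf unfolding weak_div_free_def by blast+
  have eq: "(\<lambda>x. \<Sum>i\<in>UNIV. spike z r i x * V x $ i) =
     (\<lambda>x. (\<Sum>i\<in>UNIV. shell T i x * V x $ i) - (\<Sum>i\<in>UNIV. (shell T i x - spike z r i x) * V x $ i))"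
    by (simp add: left_diff_distrib sum_subtractf)
  show ?thesis unfolding flux_def eq Bochner_Integration.integral_diff[OF i1 i2] z by simp
qed

text \<open>Between a shell around the origin and a shell of radius \<open>T'\<close> beyond \<open>y\<close> the flux density is divergence free except at \<open>y\<close>, where
  the dipole reads off \<open>E\<close>. The outer flux vanishes as \<open>T'\<close> grows, as it pairs two radiating fields.\<close>

lemma representation:
  assumes rad: "radiating k R E H" and k: "k \<noteq> 0" "Im k = 0" and T: "0 < T" "R < T" and y: "2 * T < norm y"
  shows "flux (shell T) (flux_field E H (dipole_E k y q) (dipole_H k y q)) = - of_real source_constant * (cvec q \<bullet>\<^sub>c E y)"
proof -
  let ?V = "flux_field E H (dipole_E k y q) (dipole_H k y q)"
  let ?U = "{x. norm x > R}"
  have M: "maxwell_C1 k ?U E H" using rad by (simp add: radiating_def)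
  have oU: "open ?U" by (simp add: open_Collect_less continuous_intros)
  define r where "r = (norm y - 2 * T) / 2"
  have r: "r > 0" using y by (simp add: r_def)
  have far: "norm x > 2 * T \<and> norm x \<le> norm y + r" if "x \<in> cball y r" for x
  proof -
    have "norm (y - x) \<le> r" using that by (simp add: dist_norm)
    moreover have "norm y - 2 * T = 2 * r" by (simp add: r_def)
    moreover have "norm y - norm x \<le> norm (y - x)" "norm x - norm y \<le> norm (y - x)"
      using norm_triangle_ineq2[of y x] norm_triangle_ineq2[of x y] by (simp_all add: norm_minus_commute)
    ultimately show ?thesis using r by linarith
  qed
  have sub: "cball y r \<subseteq> ?U" using far T by force
  have V: "weak_div_free (?U - {y}) ?V"
    by (rule flux_field_div_free[OF maxwell_C1_subset[OF M] maxwell_C1_subset[OF dipole_maxwell[OF k(1)]]])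
       (use oU in auto)
  have cV: "continuous_on A ?V" if "A \<subseteq> ?U - {y}" for A
    using maxwell_continuous[OF M] maxwell_continuous[OF dipole_maxwell[OF k(1)], of y q] that
    by (intro continuous_on_flux_field) (auto elim!: continuous_on_subset)
  note src = source_flux_spike[OF M k(1) r sub, of q]
  let ?b = "\<lambda>T. bump 0 (T\<^sup>2) ((2 * T)\<^sup>2)" and ?s = "bump y ((r / 2)\<^sup>2) (r\<^sup>2)"
  note s = spike_cutoff[OF r] and b = ball_cutoff
  have step: "flux (shell T') ?V = flux (shell T) ?V + of_real source_constant * (cvec q \<bullet>\<^sub>c E y)"
    if T': "T' > norm y + r" for T'
  proof -
    have T'0: "0 < T'" "R < T'" "2 * T < T'" using that r y T norm_ge_zero[of y] by auto
    have tf: "test_fun (?U - {y}) (\<lambda>x. ?b T' x - ?b T x - ?s x) (\<lambda>j x. shell T' j x - shell T j x - spike y r j x)"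
      unfolding test_fun_def
    proof (intro conjI exI[of _ "cball 0 (2 * T') - ball 0 T - ball y (r / 2)"] allI impI)
      show "has_grad UNIV (\<lambda>x. ?b T' x - ?b T x - ?s x) (\<lambda>j x. shell T' j x - shell T j x - spike y r j x)"
        by (intro has_grad_diff b(1) s(1) T T'0)
      show "compact (cball 0 (2 * T') - ball 0 T - ball y (r / 2))" by (intro compact_diff) auto
      show "cball 0 (2 * T') - ball 0 T - ball y (r / 2) \<subseteq> ?U - {y}" using r T by auto
      fix x assume "x \<notin> cball 0 (2 * T') - ball 0 T - ball y (r / 2)"
      then consider "norm x > 2 * T'" | "norm x < T" | "x \<in> ball y (r / 2)" by force
      then show "?b T' x - ?b T x - ?s x = 0"
      proof cases
        case 1
        then have "x \<notin> cball y r" using far[of x] T' T'0 by force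
        then show ?thesis using b(3)[OF T'0(1), of x] b(3)[OF T(1), of x] s(3)[of x] 1 T'0 by simp
      next
        case 2
        then have "x \<notin> cball y r" using far[of x] T by force
        then show ?thesis using b(2)[OF T'0(1), of x] b(2)[OF T(1), of x] s(3)[of x] 2 T T'0 by simp
      next
        case 3
        then have "2 * T < norm x \<and> norm x \<le> norm y + r" using far[of x] r by force
        then show ?thesis using b(2)[OF T'0(1), of x] b(3)[OF T(1), of x] s(2)[OF 3] T' by simp
      qed
    qed
    have z: "integral\<^sup>L lborel (\<lambda>x. \<Sum>i\<in>UNIV. (shell T' i x - shell T i x - spike y r i x) * ?V x $ i) = 0"
      using V tf unfolding weak_div_free_def by blast
    have i1: "integrable lborel (\<lambda>x. \<Sum>i\<in>UNIV. shell T' i x * ?V x $ i)"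
      by (intro shell_integrable_annulus T'0 cV) (use T' T'0 r in auto)
    have i2: "integrable lborel (\<lambda>x. \<Sum>i\<in>UNIV. shell T i x * ?V x $ i)"
      by (intro shell_integrable_annulus T cV) (use y T in auto)
    have eq: "(\<lambda>x. \<Sum>i\<in>UNIV. (shell T' i x - shell T i x - spike y r i x) * ?V x $ i) =
       (\<lambda>x. (\<Sum>i\<in>UNIV. shell T' i x * ?V x $ i) - (\<Sum>i\<in>UNIV. shell T i x * ?V x $ i) - (\<Sum>i\<in>UNIV. spike y r i x * ?V x $ i))"
      by (simp add: left_diff_distrib sum_subtractf)
    have "flux (shell T') ?V - flux (shell T) ?V - flux (spike y r) ?V = 0"
      using z unfolding eq Bochner_Integration.integral_diff[OF Bochner_Integration.integrable_diff[OF i1 i2] src(2)]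
        Bochner_Integration.integral_diff[OF i1 i2] flux_def .
    then show ?thesis using src(1) by (simp add: algebra_simps)
  qed
  have "((\<lambda>T. flux (shell T) ?V) \<longlongrightarrow> 0) at_top"
    by (rule radiating_flux_vanishes[OF radiating_mono[OF rad] dipole_radiating[OF k] k(2), of "max R (norm y)"]) auto
  moreover have "\<forall>\<^sub>F T' in at_top. flux (shell T') ?V = flux (shell T) ?V + of_real source_constant * (cvec q \<bullet>\<^sub>c E y)"
    using eventually_gt_at_top[of "norm y + r"] by eventually_elim (rule step)
  then have "((\<lambda>T. flux (shell T) ?V) \<longlongrightarrow> flux (shell T) ?V + of_real source_constant * (cvec q \<bullet>\<^sub>c E y)) at_top"
    by (rule tendsto_eventually)
  ultimately have "0 = flux (shell T) ?V + of_real source_constant * (cvec q \<bullet>\<^sub>c E y)"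
    by (rule tendsto_unique[OF trivial_limit_at_top_linorder])
  then show ?thesis by (simp add: eq_neg_iff_add_eq_0)
qed

text \<open>Evaluate the representation at \<open>y = - t d\<close> and multiply by \<open>4 \<pi> t e\<^bsup>-ikt\<^esup>\<close>. As \<open>t\<close> grows the dipole becomes the plane wave,
  and the value \<open>E(y)\<close> becomes \<open>4 \<pi>\<close> times the far field pattern in direction \<open>- d\<close>.\<close>

lemma far_field_flux:
  assumes rad: "radiating k R E H" and k: "k \<noteq> 0" "Im k = 0" and T: "0 < T" "R < T"
    and ff: "far_field_pattern k E Einf" and d: "norm d = 1"
  shows "flux (shell T) (flux_field E H (plane_wave_E k d q) (plane_wave_H k d q)) =
    - of_real source_constant * (4 * of_real pi * (cvec q \<bullet>\<^sub>c Einf (- d)))"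
proof -
  have M: "maxwell_C1 k {x. norm x > R} E H" using rad by (simp add: radiating_def)
  define t where "t n = (4 * T + 2) + real n" for n
  define y where "y n = - (t n *\<^sub>R d)" for n
  have t: "filterlim t at_top sequentially"
    unfolding t_def by (rule filterlim_tendsto_add_at_top[OF tendsto_const filterlim_real_sequentially])
  have tn: "t n \<ge> 4 * T + 2" "t n > 0" for n using T by (auto simp: t_def)
  have ny: "norm (y n) = t n" for n using d tn(2)[of n] by (simp add: y_def)
  let ?dE = "\<lambda>n. dipole_E k (y n) q" and ?dH = "\<lambda>n. dipole_H k (y n) q" and ?s = "\<lambda>n. dip_scale k (t n)"
  let ?W = "\<lambda>n. flux_field E H (?dE n) (?dH n)"
  let ?P = "flux_field E H (plane_wave_E k d q) (plane_wave_H k d q)"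
  obtain B where B: "\<And>x y t. norm x \<le> t / 2 \<Longrightarrow> norm y = t \<Longrightarrow> 2 \<le> t \<Longrightarrow>
    norm (dip_scale k t *s dipole_H k y q x) \<le> B \<and> norm (dip_scale k t *s dipole_E k y q x) \<le> B"
    by (rule far_dipole_bound[OF k]) (rule that; assumption)
  note cE = radiating_continuous[OF M T(2)]
  have sW: "?s n *s ?W n x = E x \<times>\<^sub>c (?s n *s ?dH n x) - (?s n *s ?dE n x) \<times>\<^sub>c H x" for n x
    by (rule vec3_eqI) (simp_all add: flux_field_def algebra_simps)
  have iW: "integrable lborel (\<lambda>x. \<Sum>i\<in>UNIV. shell T i x * ?W n x $ i)" for n
  proof (rule shell_integrable_annulus[OF T(1)])
    have "{x. T \<le> norm x \<and> norm x \<le> 2 * T} \<subseteq> - {y n}" using ny[of n] tn[of n] T by auto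
    then show "continuous_on {x. T \<le> norm x \<and> norm x \<le> 2 * T} (?W n)"
      using cE maxwell_continuous[OF dipole_maxwell[OF k(1)], of "y n" q]
      by (intro continuous_on_flux_field) (auto elim: continuous_on_subset)
  qed
  have pt: "(\<lambda>n. ?s n *s ?W n x) \<longlonglongrightarrow> ?P x" for x
    unfolding sW flux_field_def[of E H "plane_wave_E k d q"]
    using far_dipole_limit[OF k(1) d t, of q x] unfolding y_def
    by (intro tendsto_diff tendsto_cross tendsto_const)
  have lim1: "(\<lambda>n. integral\<^sup>L lborel (\<lambda>x. ?s n * (\<Sum>i\<in>UNIV. shell T i x * ?W n x $ i))) \<longlonglongrightarrow> flux (shell T) ?P"
    unfolding flux_def
  proof (rule integral_dominated_convergence[where w="\<lambda>x. wt T x *\<^sub>R (3 * (norm x * (6 * (norm (E x) * B) + 6 * (B * norm (H x)))))"])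
    show "(\<lambda>x. \<Sum>i\<in>UNIV. shell T i x * ?P x $ i) \<in> borel_measurable lborel"
    proof (rule borel_measurable_integrable, rule shell_integrable[OF T(1)])
      show "continuous_on {x. T \<le> norm x} ?P"
        using cE maxwell_continuous[OF plane_wave_explicit(3)[OF k(1) d], of q]
        by (intro continuous_on_flux_field) (auto elim: continuous_on_subset)
    qed
    show "(\<lambda>x. ?s n * (\<Sum>i\<in>UNIV. shell T i x * ?W n x $ i)) \<in> borel_measurable lborel" for n
      using iW[of n] by (intro borel_measurable_times) auto
    show "integrable lborel (\<lambda>x. wt T x *\<^sub>R (3 * (norm x * (6 * (norm (E x) * B) + 6 * (B * norm (H x))))))"
      by (rule wt_integrable[OF T(1)]) (intro continuous_intros cE)
    show "AE x in lborel. (\<lambda>n. ?s n * (\<Sum>i\<in>UNIV. shell T i x * ?W n x $ i)) \<longlonglongrightarrow> (\<Sum>i\<in>UNIV. shell T i x * ?P x $ i)"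
    proof (rule AE_I2)
      fix x
      have "(\<lambda>n. \<Sum>i\<in>UNIV. shell T i x * (?s n *s ?W n x) $ i) \<longlonglongrightarrow> (\<Sum>i\<in>UNIV. shell T i x * ?P x $ i)"
        by (intro tendsto_intros pt)
      then show "(\<lambda>n. ?s n * (\<Sum>i\<in>UNIV. shell T i x * ?W n x $ i)) \<longlonglongrightarrow> (\<Sum>i\<in>UNIV. shell T i x * ?P x $ i)"
        by (simp add: sum_distrib_left mult.left_commute)
    qed
    show "AE x in lborel. norm (?s n * (\<Sum>i\<in>UNIV. shell T i x * ?W n x $ i))
       \<le> wt T x *\<^sub>R (3 * (norm x * (6 * (norm (E x) * B) + 6 * (B * norm (H x)))))" for n
    proof (rule AE_I2)
      fix x :: "real^3"
      show "norm (?s n * (\<Sum>i\<in>UNIV. shell T i x * ?W n x $ i))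
       \<le> wt T x *\<^sub>R (3 * (norm x * (6 * (norm (E x) * B) + 6 * (B * norm (H x)))))"
      proof (cases "norm x \<le> 2 * T")
        case True
        have b: "norm (?s n *s ?dH n x) \<le> B" "norm (?s n *s ?dE n x) \<le> B"
          using B[of x "t n" "y n"] ny[of n] tn(1)[of n] True T by auto
        have "norm (?s n *s ?W n x) \<le> norm (E x \<times>\<^sub>c (?s n *s ?dH n x)) + norm ((?s n *s ?dE n x) \<times>\<^sub>c H x)"
          unfolding sW by (rule norm_triangle_ineq4)
        also have "\<dots> \<le> 6 * (norm (E x) * B) + 6 * (B * norm (H x))"
          by (intro add_mono order_trans[OF norm_cross_bound] mult_left_mono mult_right_mono b) auto
        finally have n: "norm (?s n *s ?W n x) \<le> 6 * (norm (E x) * B) + 6 * (B * norm (H x))" .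
        have "norm (cvec x \<bullet>\<^sub>c (?s n *s ?W n x)) \<le> 3 * (norm x * norm (?s n *s ?W n x))"
          using bilinear_dot_bound[of "cvec x"] by (simp only: norm_cvec)
        also have "\<dots> \<le> 3 * (norm x * (6 * (norm (E x) * B) + 6 * (B * norm (H x))))"
          by (intro mult_left_mono n) auto
        finally have "wt T x * norm (cvec x \<bullet>\<^sub>c (?s n *s ?W n x)) \<le> wt T x * (3 * (norm x * (6 * (norm (E x) * B) + 6 * (B * norm (H x)))))"
          by (rule mult_left_mono[OF _ wt(1)[OF T(1)]])
        moreover have "?s n * (\<Sum>i\<in>UNIV. shell T i x * ?W n x $ i) = - of_real (wt T x) * (cvec x \<bullet>\<^sub>c (?s n *s ?W n x))"
          unfolding shell_sum by (simp add: bilinear_dot_3 algebra_simps)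
        then have "norm (?s n * (\<Sum>i\<in>UNIV. shell T i x * ?W n x $ i)) = wt T x * norm (cvec x \<bullet>\<^sub>c (?s n *s ?W n x))"
          using wt(1)[OF T(1), of x] by (simp only: norm_mult norm_minus_cancel norm_of_real abs_of_nonneg)
        ultimately show ?thesis by simp
      next
        case False
        then have "wt T x = 0" using wt(3)[OF T(1), of x] by simp
        then show ?thesis by (simp add: shell_sum)
      qed
    qed
  qed
  have val: "integral\<^sup>L lborel (\<lambda>x. ?s n * (\<Sum>i\<in>UNIV. shell T i x * ?W n x $ i)) = - of_real source_constant * (?s n * (cvec q \<bullet>\<^sub>c E (y n)))" for n
  proof -
    have "flux (shell T) (?W n) = - of_real source_constant * (cvec q \<bullet>\<^sub>c E (y n))"
      by (rule representation[OF rad k T]) (use ny[of n] tn[of n] T in auto)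
    then show ?thesis unfolding integral_mult_right_zero flux_def by simp
  qed
  obtain r where r: "\<forall>\<^sub>F x in at_infinity. E x = (exp (\<i> * k * of_real (norm x)) / of_real (norm x)) *s (Einf (x /\<^sub>R norm x) + r x)"
    and rO: "(\<lambda>x. norm (r x)) \<in> O[at_infinity](\<lambda>x. 1 / norm x)"
    using ff unfolding far_field_pattern_def by blast
  have yinf: "filterlim y at_infinity sequentially"
    unfolding filterlim_at_infinity_conv_norm_at_top using t by (simp add: ny)
  have r0: "(\<lambda>n. r (y n)) \<longlonglongrightarrow> 0"
  proof -
    obtain C where "\<forall>\<^sub>F x in at_infinity. norm (norm (r x)) \<le> C * norm (1 / norm x)"
      using landau_o.bigE[OF rO] by blast
    then have "\<forall>\<^sub>F n in sequentially. norm (norm (r (y n))) \<le> C * norm (1 / norm (y n))"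
      using yinf by (rule eventually_compose_filterlim)
    then have ev: "\<forall>\<^sub>F n in sequentially. norm (r (y n)) \<le> C * inverse (t n)"
      by eventually_elim (use ny tn(2) in \<open>simp add: divide_inverse abs_of_pos\<close>)
    have "(\<lambda>n. C * inverse (t n)) \<longlonglongrightarrow> C * 0" by (intro tendsto_intros tendsto_inverse_0_at_top t)
    then show ?thesis using Lim_null_comparison[OF ev] by simp
  qed
  have "\<forall>\<^sub>F n in sequentially. E (y n) = (exp (\<i> * k * of_real (norm (y n))) / of_real (norm (y n))) *s (Einf (y n /\<^sub>R norm (y n)) + r (y n))"
    using r yinf by (rule eventually_compose_filterlim)
  then have ev: "\<forall>\<^sub>F n in sequentially. - of_real source_constant * (4 * of_real pi * (cvec q \<bullet>\<^sub>c (Einf (- d) + r (y n))))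
     = - of_real source_constant * (?s n * (cvec q \<bullet>\<^sub>c E (y n)))"
  proof eventually_elim
    case (elim n)
    have yd: "y n /\<^sub>R norm (y n) = - d" using ny[of n] tn(2)[of n] by (simp add: y_def)
    have one: "?s n * (exp (\<i> * k * of_real (t n)) / of_real (t n)) = 4 * of_real pi"
      using tn(2)[of n] by (simp add: dip_scale_def exp_minus field_simps)
    have "cvec q \<bullet>\<^sub>c E (y n) = (exp (\<i> * k * of_real (t n)) / of_real (t n)) * (cvec q \<bullet>\<^sub>c (Einf (- d) + r (y n)))"
      unfolding elim yd unfolding ny by (simp add: bilinear_dot_3 algebra_simps)
    then have "?s n * (cvec q \<bullet>\<^sub>c E (y n)) = (?s n * (exp (\<i> * k * of_real (t n)) / of_real (t n))) * (cvec q \<bullet>\<^sub>c (Einf (- d) + r (y n)))"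
      by (simp only: mult.assoc)
    then show ?case unfolding one by (simp only:)
  qed
  have "(\<lambda>n. - of_real source_constant * (4 * of_real pi * (cvec q \<bullet>\<^sub>c (Einf (- d) + r (y n))))) \<longlonglongrightarrow>
     - of_real source_constant * (4 * of_real pi * (cvec q \<bullet>\<^sub>c (Einf (- d) + 0)))"
    by (intro tendsto_intros tendsto_bilinear_dot r0)
  from Lim_transform_eventually[OF this ev] lim1 show ?thesis
    unfolding val using LIMSEQ_unique by fastforce
qed


section \<open>Mixed reciprocity\<close>

lemma k0_real:
  assumes "admissible_medium \<alpha> M"
  shows "k\<^sub>0 M \<noteq> 0" "Im (k\<^sub>0 M) = 0"
proof -
  have p: "\<omega> M > 0" "\<epsilon>\<^sub>0 M > 0" "\<mu>\<^sub>0 M > 0" using assms by (auto simp: admissible_medium_def)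
  note w = wavenumber_characterization[OF p order_refl]
  show "k\<^sub>0 M \<noteq> 0" using w(2) by (auto simp: k\<^sub>0_def)
  have "(k\<^sub>0 M)\<^sup>2 = of_real (\<epsilon>\<^sub>0 M * \<mu>\<^sub>0 M * (\<omega> M)\<^sup>2)" using w(1) by (simp add: k\<^sub>0_def)
  then have "Im ((k\<^sub>0 M)\<^sup>2) = 0" by (simp only: Im_complex_of_real)
  then show "Im (k\<^sub>0 M) = 0" using w(2) by (simp add: power2_eq_square k\<^sub>0_def)
qed

lemma k1_nonzero:
  assumes "admissible_medium \<alpha> M"
  shows "k\<^sub>1 M \<noteq> 0"
proof -
  have p: "\<omega> M > 0" "\<epsilon>\<^sub>1 M > 0" "\<mu>\<^sub>1 M > 0" "\<sigma>\<^sub>1 M \<ge> 0" using assms by (auto simp: admissible_medium_def)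
  show ?thesis using wavenumber_characterization(2)[OF p] by (auto simp: k\<^sub>1_def)
qed

lemma exterior_contains_far_points:
  assumes "admissible_medium \<alpha> M"
  obtains R where "R > 0" "{x. norm x > R} \<subseteq> \<Omega>\<^sub>0 M"
proof -
  have b: "bounded (\<Omega>\<^sub>2 M)" "bounded (\<Omega>\<^sub>1 M)" "compact (S\<^sub>0 M)"
    and un: "\<Omega>\<^sub>0 M \<union> S\<^sub>0 M \<union> \<Omega>\<^sub>1 M = UNIV - closure (\<Omega>\<^sub>2 M)"
    using assms by (auto simp: admissible_medium_def closed_C2_holder_surface_def)
  have "bounded (S\<^sub>0 M \<union> \<Omega>\<^sub>1 M \<union> closure (\<Omega>\<^sub>2 M))"
    using b by (simp add: compact_imp_bounded)
  then obtain R where R: "\<And>x. x \<in> S\<^sub>0 M \<union> \<Omega>\<^sub>1 M \<union> closure (\<Omega>\<^sub>2 M) \<Longrightarrow> norm x \<le> R"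
    by (auto simp: bounded_iff)
  have "{x. norm x > max R 1} \<subseteq> \<Omega>\<^sub>0 M"
  proof
    fix x :: "real^3" assume "x \<in> {x. norm x > max R 1}"
    then have "x \<notin> S\<^sub>0 M \<union> \<Omega>\<^sub>1 M \<union> closure (\<Omega>\<^sub>2 M)" using R[of x] by auto
    then show "x \<in> \<Omega>\<^sub>0 M" using un by blast
  qed
  then show ?thesis by (intro that[of "max R 1"]) auto
qed

lemma source_off_interfaces:
  assumes adm: "admissible_medium \<alpha> M" and z: "z \<in> \<Omega>\<^sub>0 M \<union> \<Omega>\<^sub>1 M"
  shows "z \<notin> S\<^sub>0 M" "z \<notin> S\<^sub>1 M"
proof -
  have o: "open (\<Omega>\<^sub>0 M)" "open (\<Omega>\<^sub>1 M)" and fr: "frontier (\<Omega>\<^sub>0 M) = S\<^sub>0 M" "frontier (\<Omega>\<^sub>1 M) = S\<^sub>0 M \<union> S\<^sub>1 M" "frontier (\<Omega>\<^sub>2 M) = S\<^sub>1 M"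
    and un: "\<Omega>\<^sub>0 M \<union> S\<^sub>0 M \<union> \<Omega>\<^sub>1 M = UNIV - closure (\<Omega>\<^sub>2 M)"
    using adm by (auto simp: admissible_medium_def)
  have "\<Omega>\<^sub>0 M \<inter> S\<^sub>0 M = {}" "\<Omega>\<^sub>1 M \<inter> (S\<^sub>0 M \<union> S\<^sub>1 M) = {}" "S\<^sub>1 M \<subseteq> closure (\<Omega>\<^sub>2 M)"
    using o fr by (auto simp: frontier_def interior_open)
  then show "z \<notin> S\<^sub>0 M" "z \<notin> S\<^sub>1 M" using z un by blast+
qed

lemma tangential_trace_add:
  "tangential_trace M (\<lambda>x. A x + B x) x = tangential_trace M A x + tangential_trace M B x"
  unfolding tangential_trace_def by (rule vec3_eqI) (simp_all add: algebra_simps)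

lemma impedance_trace_add:
  "impedance_trace M (\<lambda>x. A x + B x) (\<lambda>x. C x + D x) x = impedance_trace M A C x + impedance_trace M B D x"
  unfolding impedance_trace_def tangential_trace_add by (rule vec3_eqI) (simp_all add: algebra_simps)

lemma flux_field_add:
  "flux_field (\<lambda>x. A x + B x) (\<lambda>x. C x + D x) E H = (\<lambda>x. flux_field A C E H x + flux_field B D E H x)"
  "flux_field E H (\<lambda>x. A x + B x) (\<lambda>x. C x + D x) = (\<lambda>x. flux_field E H A C x + flux_field E H B D x)"
  unfolding flux_field_def by (auto intro!: ext vec3_eqI simp: algebra_simps)

lemma flux_field_swap: "flux_field E H A C = (\<lambda>x. - flux_field A C E H x)"
  by (simp add: flux_field_def fun_eq_iff)

lemma radiating_add:
  assumes "radiating k R E H" "radiating k R A C"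
  shows "radiating k R (\<lambda>x. E x + A x) (\<lambda>x. H x + C x)"
proof -
  have m: "maxwell_C1 k {x. norm x > R} E H" "maxwell_C1 k {x. norm x > R} A C"
    and s: "silver_mueller E H" "silver_mueller A C"
    using assms by (auto simp: radiating_def)
  have "(\<lambda>x. (H x + C x) \<times>\<^sub>c cvec x - norm x *\<^sub>R (E x + A x)) =
    (\<lambda>x. (H x \<times>\<^sub>c cvec x - norm x *\<^sub>R E x) + (C x \<times>\<^sub>c cvec x - norm x *\<^sub>R A x))"
    by (auto intro!: ext vec3_eqI simp: algebra_simps)
  with tendsto_add[OF s[unfolded silver_mueller_def]] maxwell_C1_add[OF m] show ?thesis
    unfolding radiating_def silver_mueller_def by simp
qed

lemma flux_cong:
  assumes "\<And>x. V x = W x \<or> (\<forall>j. D j x = 0)"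
  shows "flux D V = flux D W"
  unfolding flux_def using assms
  by (intro Bochner_Integration.integral_cong refl sum.cong) (metis mult_zero_left)

lemma flux_smult: "flux D (\<lambda>x. c *s V x) = c * flux D V"
proof -
  have "(\<lambda>x. \<Sum>i\<in>UNIV. D i x * (c *s V x) $ i) = (\<lambda>x. c * (\<Sum>i\<in>UNIV. D i x * V x $ i))"
    by (simp add: sum_distrib_left mult.left_commute)
  then show ?thesis unfolding flux_def by simp
qed

lemma flux_uminus: "flux D (\<lambda>x. - V x) = - flux D V"
  unfolding flux_def by (simp add: sum_negf)

lemma weak_div_free_smult:
  assumes "weak_div_free A V" shows "weak_div_free A (\<lambda>x. c *s V x)"
proof -
  have "(\<lambda>x. \<Sum>i\<in>UNIV. D i x * (c *s V x) $ i) = (\<lambda>x. c * (\<Sum>i\<in>UNIV. D i x * V x $ i))" for D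
    by (simp add: sum_distrib_left mult.left_commute)
  with assms show ?thesis unfolding weak_div_free_def by simp
qed

text \<open>Total fields: solutions in \<open>\<Omega>\<^sub>0\<close> and \<open>\<Omega>\<^sub>1\<close>, up to the singular set \<open>Z\<close>, that satisfy the transmission and boundary
  conditions in homogeneous form. Adding the incident wave or dipole in its own layer turns a
  solution of the boundary value problem into such fields.\<close>

definition total_fields :: "layered_medium \<Rightarrow> (real^3) set \<Rightarrow> vfield \<Rightarrow> vfield \<Rightarrow> vfield \<Rightarrow> vfield \<Rightarrow> bool" where
  "total_fields M Z E H F G \<longleftrightarrow>
     maxwell_C1 (k\<^sub>0 M) (\<Omega>\<^sub>0 M - Z) E H \<and> maxwell_C1 (k\<^sub>1 M) (\<Omega>\<^sub>1 M - Z) F G \<and>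
     continuous_on (closure (\<Omega>\<^sub>0 M) - Z) E \<and> continuous_on (closure (\<Omega>\<^sub>0 M) - Z) H \<and>
     continuous_on (closure (\<Omega>\<^sub>1 M) - Z) F \<and> continuous_on (closure (\<Omega>\<^sub>1 M) - Z) G \<and>
     (\<forall>x\<in>S\<^sub>0 M. tangential_trace M E x = lambda_E M *s tangential_trace M F x \<and>
                tangential_trace M H x = lambda_H M *s tangential_trace M G x) \<and>
     (\<forall>x\<in>\<Gamma>\<^sub>1 M. tangential_trace M F x = 0) \<and>
     (\<forall>x\<in>\<Gamma>\<^sub>2 M. impedance_trace M F G x = 0)"

lemma total_fields_div_free:
  assumes adm: "admissible_medium \<alpha> M" and z: "z \<in> \<Omega>\<^sub>0 M \<union> \<Omega>\<^sub>1 M"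
    and t1: "total_fields M {} E1 H1 F1 G1" and t2: "total_fields M {z} E2 H2 F2 G2"
  shows "weak_div_free (- {z}) (\<lambda>x. if x \<in> \<Omega>\<^sub>0 M then flux_field E1 H1 E2 H2 x
     else if x \<in> \<Omega>\<^sub>1 M then (lambda_E M * lambda_H M) *s flux_field F1 G1 F2 G2 x else 0)"
proof (rule transmission_div_free[OF adm source_off_interfaces[OF adm z]])
  have o: "open (\<Omega>\<^sub>0 M - {z})" "open (\<Omega>\<^sub>1 M - {z})" using adm by (auto simp: admissible_medium_def)
  note t1' = t1[unfolded total_fields_def Diff_empty] and t2' = t2[unfolded total_fields_def]
  have m1: "maxwell_C1 (k\<^sub>0 M) (\<Omega>\<^sub>0 M) E1 H1" "maxwell_C1 (k\<^sub>1 M) (\<Omega>\<^sub>1 M) F1 G1" using t1' by blast+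
  have m2: "maxwell_C1 (k\<^sub>0 M) (\<Omega>\<^sub>0 M - {z}) E2 H2" "maxwell_C1 (k\<^sub>1 M) (\<Omega>\<^sub>1 M - {z}) F2 G2" using t2' by blast+
  have c1: "continuous_on (closure (\<Omega>\<^sub>0 M) - {z}) E1" "continuous_on (closure (\<Omega>\<^sub>0 M) - {z}) H1"
    "continuous_on (closure (\<Omega>\<^sub>1 M) - {z}) F1" "continuous_on (closure (\<Omega>\<^sub>1 M) - {z}) G1"
    using t1' by (auto intro: continuous_on_subset)
  have c2: "continuous_on (closure (\<Omega>\<^sub>0 M) - {z}) E2" "continuous_on (closure (\<Omega>\<^sub>0 M) - {z}) H2"
    "continuous_on (closure (\<Omega>\<^sub>1 M) - {z}) F2" "continuous_on (closure (\<Omega>\<^sub>1 M) - {z}) G2"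
    using t2' by auto
  show "continuous_on (closure (\<Omega>\<^sub>0 M) - {z}) (flux_field E1 H1 E2 H2)"
    by (intro continuous_on_flux_field c1 c2)
  have "continuous_on (closure (\<Omega>\<^sub>1 M) - {z}) (flux_field F1 G1 F2 G2)"
    by (intro continuous_on_flux_field c1 c2)
  then have "continuous_on (closure (\<Omega>\<^sub>1 M) - {z}) (\<lambda>x. \<chi> i. (lambda_E M * lambda_H M) * flux_field F1 G1 F2 G2 x $ i)"
    by (intro continuous_on_vec_lambda continuous_intros)
  then show "continuous_on (closure (\<Omega>\<^sub>1 M) - {z}) (\<lambda>x. (lambda_E M * lambda_H M) *s flux_field F1 G1 F2 G2 x)"
    by (simp add: vector_scalar_mult_def)
  show "weak_div_free (\<Omega>\<^sub>0 M - {z}) (flux_field E1 H1 E2 H2)"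
    by (rule flux_field_div_free[OF maxwell_C1_subset[OF m1(1) o(1)] m2(1)]) auto
  show "weak_div_free (\<Omega>\<^sub>1 M - {z}) (\<lambda>x. (lambda_E M * lambda_H M) *s flux_field F1 G1 F2 G2 x)"
    by (rule weak_div_free_smult[OF flux_field_div_free[OF maxwell_C1_subset[OF m1(2) o(2)] m2(2)]]) auto
  show "cvec (\<nu> M x) \<bullet>\<^sub>c flux_field E1 H1 E2 H2 x = cvec (\<nu> M x) \<bullet>\<^sub>c ((lambda_E M * lambda_H M) *s flux_field F1 G1 F2 G2 x)"
    if "x \<in> S\<^sub>0 M" for x
    unfolding flux_field_def
    by (rule transmission_normal) (use t1' t2' that in \<open>auto simp: tangential_trace_def\<close>)
  have s: "n \<bullet>\<^sub>c (c *s v) = c * (n \<bullet>\<^sub>c v)" for n v c by (simp add: bilinear_dot_3 algebra_simps)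
  show "cvec (\<nu> M x) \<bullet>\<^sub>c ((lambda_E M * lambda_H M) *s flux_field F1 G1 F2 G2 x) = 0" if "x \<in> \<Gamma>\<^sub>1 M \<union> \<Gamma>\<^sub>2 M" for x
    using that
  proof
    assume "x \<in> \<Gamma>\<^sub>1 M"
    then have "cvec (\<nu> M x) \<bullet>\<^sub>c flux_field F1 G1 F2 G2 x = 0"
      unfolding flux_field_def
      by (intro conductor_normal) (use t1' t2' in \<open>auto simp: tangential_trace_def\<close>)
    then show ?thesis by (simp add: s)
  next
    assume x: "x \<in> \<Gamma>\<^sub>2 M"
    then have "impedance_trace M F1 G1 x = 0" "impedance_trace M F2 G2 x = 0" using t1' t2' by blast+
    then have "cvec (\<nu> M x) \<bullet>\<^sub>c flux_field F1 G1 F2 G2 x = 0"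
      unfolding flux_field_def
      by (intro impedance_normal[where c="of_real (impedance M) / k\<^sub>1 M"]) (simp_all add: impedance_trace_def tangential_trace_def)
    then show ?thesis by (simp add: s)
  qed
qed

lemma flux_spike_regular_part:
  assumes "maxwell_C1 k U E H" "maxwell_C1 k U A C" "k \<noteq> 0" "0 < r" "cball z r \<subseteq> U"
  shows "flux (spike z r) (flux_field E H (\<lambda>x. A x + dipole_E k z p x) (\<lambda>x. C x + dipole_H k z p x)) =
    of_real source_constant * (cvec p \<bullet>\<^sub>c E z)"
proof -
  note src = source_flux_spike[OF assms(1,3,4,5), of p]
  have "weak_div_free U (flux_field E H A C)" by (rule flux_field_div_free[OF assms(1,2)])
  then have z: "integrable lborel (\<lambda>x. \<Sum>i\<in>UNIV. spike z r i x * flux_field E H A C x $ i)" "flux (spike z r) (flux_field E H A C) = 0"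
    using spike_cutoff(5)[OF assms(4,5)] unfolding weak_div_free_def flux_def by blast+
  show ?thesis unfolding flux_field_add(2) flux_add[OF z(1) src(2)] z(2) src(1) by simp
qed

text \<open>The flux density, weighted by \<open>\<lambda>\<^sub>E \<lambda>\<^sub>H\<close> inside and continued by zero into the obstacle, is divergence free away from the source; so its
  flux through a large shell is its flux around the source.\<close>

lemma total_flux_relation:
  assumes adm: "admissible_medium \<alpha> M" and z: "z \<in> \<Omega>\<^sub>0 M \<union> \<Omega>\<^sub>1 M"
    and t1: "total_fields M {} E1 H1 F1 G1" and t2: "total_fields M {z} E2 H2 F2 G2"
    and far: "{x. norm x \<ge> T} \<subseteq> \<Omega>\<^sub>0 M" and r: "0 < r" "norm z + r < T"
  shows "flux (shell T) (flux_field E1 H1 E2 H2) =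
    flux (spike z r) (\<lambda>x. if x \<in> \<Omega>\<^sub>0 M then flux_field E1 H1 E2 H2 x
     else if x \<in> \<Omega>\<^sub>1 M then (lambda_E M * lambda_H M) *s flux_field F1 G1 F2 G2 x else 0)"
    (is "_ = flux (spike z r) ?V")
proof -
  have T: "0 < T" using r norm_ge_zero[of z] by linarith
  have V: "weak_div_free (- {z}) ?V" by (rule total_fields_div_free[OF adm z t1 t2])
  have sub: "{x. T \<le> norm x} \<subseteq> \<Omega>\<^sub>0 M - {z}" using far r by auto
  have m: "maxwell_C1 (k\<^sub>0 M) (\<Omega>\<^sub>0 M) E1 H1" "maxwell_C1 (k\<^sub>0 M) (\<Omega>\<^sub>0 M - {z}) E2 H2"
    using t1 t2 by (auto simp: total_fields_def)
  have "continuous_on {x. T \<le> norm x} (flux_field E1 H1 E2 H2)"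
    using maxwell_continuous[OF m(1)] maxwell_continuous[OF m(2)] sub
    by (intro continuous_on_flux_field) (auto elim!: continuous_on_subset)
  moreover have Veq: "flux_field E1 H1 E2 H2 x = ?V x" if "T \<le> norm x" for x using far that by auto
  ultimately have "continuous_on {x. T \<le> norm x} ?V"
    by (rule continuous_on_eq) (simp add: Veq)
  from shell_flux_eq_spike_flux[OF V this r]
  have "flux (shell T) ?V = flux (spike z r) ?V" .
  moreover have "flux (shell T) ?V = flux (shell T) (flux_field E1 H1 E2 H2)"
  proof (rule flux_cong)
    fix x show "?V x = flux_field E1 H1 E2 H2 x \<or> (\<forall>j. shell T j x = 0)"
    proof (cases "T \<le> norm x")
      case True
      then show ?thesis using far by auto
    next
      case False
      then show ?thesis using wt(2)[OF T, of x] by (simp add: shell_wt)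
    qed
  qed
  ultimately show ?thesis by simp
qed

lemma bvp_solutionD:
  assumes "bvp_solution M (T1, T2, T3, T4) E H F G" and "admissible_medium \<alpha> M"
  shows "maxwell_C1 (k\<^sub>0 M) (\<Omega>\<^sub>0 M) E H" "maxwell_C1 (k\<^sub>1 M) (\<Omega>\<^sub>1 M) F G" "silver_mueller E H"
    "continuous_on (closure (\<Omega>\<^sub>0 M)) E" "continuous_on (closure (\<Omega>\<^sub>0 M)) H"
    "continuous_on (closure (\<Omega>\<^sub>1 M)) F" "continuous_on (closure (\<Omega>\<^sub>1 M)) G"
    "\<And>x. x \<in> S\<^sub>0 M \<Longrightarrow> tangential_trace M E x - lambda_E M *s tangential_trace M F x = T1 x"
    "\<And>x. x \<in> S\<^sub>0 M \<Longrightarrow> tangential_trace M H x - lambda_H M *s tangential_trace M G x = T2 x"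
    "\<And>x. x \<in> \<Gamma>\<^sub>1 M \<Longrightarrow> tangential_trace M F x = T3 x"
    "\<And>x. x \<in> \<Gamma>\<^sub>2 M \<Longrightarrow> impedance_trace M F G x = T4 x"
proof -
  have o: "open (\<Omega>\<^sub>0 M)" "open (\<Omega>\<^sub>1 M)" using assms(2) by (auto simp: admissible_medium_def)
  have m: "maxwell_in (k\<^sub>0 M) (\<Omega>\<^sub>0 M) E H" "maxwell_in (k\<^sub>1 M) (\<Omega>\<^sub>1 M) F G" using assms(1) by auto
  show "maxwell_C1 (k\<^sub>0 M) (\<Omega>\<^sub>0 M) E H" "maxwell_C1 (k\<^sub>1 M) (\<Omega>\<^sub>1 M) F G"
    using maxwell_in_C1 m o by auto
  show "continuous_on (closure (\<Omega>\<^sub>0 M)) E" "continuous_on (closure (\<Omega>\<^sub>0 M)) H"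
    "continuous_on (closure (\<Omega>\<^sub>1 M)) F" "continuous_on (closure (\<Omega>\<^sub>1 M)) G"
    using m unfolding maxwell_in_def by blast+
qed (use assms(1) in auto)

lemma plane_wave_total:
  assumes adm: "admissible_medium \<alpha> M" and d: "norm d = 1"
    and b: "bvp_solution M (plane_wave_data M d q) E H F G"
  shows "total_fields M {} (\<lambda>x. E x + plane_wave_E (k\<^sub>0 M) d q x) (\<lambda>x. H x + plane_wave_H (k\<^sub>0 M) d q x) F G"
proof -
  note b' = bvp_solutionD[OF b[unfolded plane_wave_data_def] adm]
  note pw = plane_wave_explicit(3)[OF k0_real(1)[OF adm] d, of q]
  note cpw = maxwell_continuous[OF pw]
  have o: "open (\<Omega>\<^sub>0 M)" using adm by (simp add: admissible_medium_def)
  show ?thesis unfolding total_fields_def Diff_empty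
  proof (intro conjI ballI)
    show "maxwell_C1 (k\<^sub>0 M) (\<Omega>\<^sub>0 M) (\<lambda>x. E x + plane_wave_E (k\<^sub>0 M) d q x) (\<lambda>x. H x + plane_wave_H (k\<^sub>0 M) d q x)"
      by (rule maxwell_C1_add[OF b'(1) maxwell_C1_subset[OF pw o]]) simp
    show "continuous_on (closure (\<Omega>\<^sub>0 M)) (\<lambda>x. E x + plane_wave_E (k\<^sub>0 M) d q x)"
      "continuous_on (closure (\<Omega>\<^sub>0 M)) (\<lambda>x. H x + plane_wave_H (k\<^sub>0 M) d q x)"
      using b'(4,5) cpw by (auto intro!: continuous_on_add intro: continuous_on_subset)
    fix x assume x: "x \<in> S\<^sub>0 M"
    show "tangential_trace M (\<lambda>x. E x + plane_wave_E (k\<^sub>0 M) d q x) x = lambda_E M *s tangential_trace M F x"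
      "tangential_trace M (\<lambda>x. H x + plane_wave_H (k\<^sub>0 M) d q x) x = lambda_H M *s tangential_trace M G x"
      unfolding tangential_trace_add using b'(8,9)[OF x] by (simp_all add: algebra_simps)
  qed (use b' in auto)
qed

lemma dipole_total_0:
  assumes adm: "admissible_medium \<alpha> M" and z: "z \<in> \<Omega>\<^sub>0 M"
    and b: "bvp_solution M (dipole_data_0 M z p) E H F G"
  shows "total_fields M {z} (\<lambda>x. E x + dipole_E (k\<^sub>0 M) z p x) (\<lambda>x. H x + dipole_H (k\<^sub>0 M) z p x) F G"
proof -
  note b' = bvp_solutionD[OF b[unfolded dipole_data_0_def] adm]
  note dp = dipole_maxwell[OF k0_real(1)[OF adm], of z p]
  note cdp = maxwell_continuous[OF dp]
  have o: "open (\<Omega>\<^sub>0 M - {z})" "open (\<Omega>\<^sub>1 M - {z})" using adm by (auto simp: admissible_medium_def)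
  show ?thesis unfolding total_fields_def
  proof (intro conjI ballI)
    show "maxwell_C1 (k\<^sub>0 M) (\<Omega>\<^sub>0 M - {z}) (\<lambda>x. E x + dipole_E (k\<^sub>0 M) z p x) (\<lambda>x. H x + dipole_H (k\<^sub>0 M) z p x)"
      by (rule maxwell_C1_add[OF maxwell_C1_subset[OF b'(1) o(1)] maxwell_C1_subset[OF dp o(1)]]) auto
    show "maxwell_C1 (k\<^sub>1 M) (\<Omega>\<^sub>1 M - {z}) F G" by (rule maxwell_C1_subset[OF b'(2) o(2)]) auto
    show "continuous_on (closure (\<Omega>\<^sub>0 M) - {z}) (\<lambda>x. E x + dipole_E (k\<^sub>0 M) z p x)"
      "continuous_on (closure (\<Omega>\<^sub>0 M) - {z}) (\<lambda>x. H x + dipole_H (k\<^sub>0 M) z p x)"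
      using b'(4,5) cdp by (auto intro!: continuous_on_add intro: continuous_on_subset)
    show "continuous_on (closure (\<Omega>\<^sub>1 M) - {z}) F" "continuous_on (closure (\<Omega>\<^sub>1 M) - {z}) G"
      using b'(6,7) by (auto intro: continuous_on_subset)
    fix x assume x: "x \<in> S\<^sub>0 M"
    show "tangential_trace M (\<lambda>x. E x + dipole_E (k\<^sub>0 M) z p x) x = lambda_E M *s tangential_trace M F x"
      "tangential_trace M (\<lambda>x. H x + dipole_H (k\<^sub>0 M) z p x) x = lambda_H M *s tangential_trace M G x"
      unfolding tangential_trace_add using b'(8,9)[OF x] by (simp_all add: algebra_simps)
  qed (use b' in auto)
qed

lemma dipole_total_1:
  assumes adm: "admissible_medium \<alpha> M" and z: "z \<in> \<Omega>\<^sub>1 M"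
    and b: "bvp_solution M (dipole_data_1 M z p) E H F G"
  shows "total_fields M {z} E H (\<lambda>x. F x + dipole_E (k\<^sub>1 M) z p x) (\<lambda>x. G x + dipole_H (k\<^sub>1 M) z p x)"
proof -
  note b' = bvp_solutionD[OF b[unfolded dipole_data_1_def] adm]
  note dp = dipole_maxwell[OF k1_nonzero[OF adm], of z p]
  note cdp = maxwell_continuous[OF dp]
  have o: "open (\<Omega>\<^sub>0 M - {z})" "open (\<Omega>\<^sub>1 M - {z})" using adm by (auto simp: admissible_medium_def)
  show ?thesis unfolding total_fields_def
  proof (intro conjI ballI)
    show "maxwell_C1 (k\<^sub>1 M) (\<Omega>\<^sub>1 M - {z}) (\<lambda>x. F x + dipole_E (k\<^sub>1 M) z p x) (\<lambda>x. G x + dipole_H (k\<^sub>1 M) z p x)"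
      by (rule maxwell_C1_add[OF maxwell_C1_subset[OF b'(2) o(2)] maxwell_C1_subset[OF dp o(2)]]) auto
    show "maxwell_C1 (k\<^sub>0 M) (\<Omega>\<^sub>0 M - {z}) E H" by (rule maxwell_C1_subset[OF b'(1) o(1)]) auto
    show "continuous_on (closure (\<Omega>\<^sub>1 M) - {z}) (\<lambda>x. F x + dipole_E (k\<^sub>1 M) z p x)"
      "continuous_on (closure (\<Omega>\<^sub>1 M) - {z}) (\<lambda>x. G x + dipole_H (k\<^sub>1 M) z p x)"
      using b'(6,7) cdp by (auto intro!: continuous_on_add intro: continuous_on_subset)
    show "continuous_on (closure (\<Omega>\<^sub>0 M) - {z}) E" "continuous_on (closure (\<Omega>\<^sub>0 M) - {z}) H"
      using b'(4,5) by (auto intro: continuous_on_subset)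
    show "tangential_trace M E x = lambda_E M *s tangential_trace M (\<lambda>x. F x + dipole_E (k\<^sub>1 M) z p x) x"
      "tangential_trace M H x = lambda_H M *s tangential_trace M (\<lambda>x. G x + dipole_H (k\<^sub>1 M) z p x) x"
      if x: "x \<in> S\<^sub>0 M" for x
      unfolding tangential_trace_add using b'(8,9)[OF x] by (simp_all add: vector_add_ldistrib algebra_simps)
    show "tangential_trace M (\<lambda>x. F x + dipole_E (k\<^sub>1 M) z p x) x = 0" if "x \<in> \<Gamma>\<^sub>1 M" for x
      unfolding tangential_trace_add using b'(10)[OF that] by simp
    show "impedance_trace M (\<lambda>x. F x + dipole_E (k\<^sub>1 M) z p x) (\<lambda>x. G x + dipole_H (k\<^sub>1 M) z p x) x = 0" if "x \<in> \<Gamma>\<^sub>2 M" for x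
      unfolding impedance_trace_add b'(11)[OF that] by (simp add: impedance_trace_def)
  qed
qed

lemma far_flux_plane_wave:
  assumes rad: "radiating k R E H" and k: "k \<noteq> 0" "Im k = 0" and T: "0 < T" "R < T"
    and ff: "far_field_pattern k E Einf" and d: "norm d = 1"
  shows "flux (shell T) (flux_field (plane_wave_E k d q) (plane_wave_H k d q) E H) =
    of_real source_constant * (4 * of_real pi * (cvec q \<bullet>\<^sub>c Einf (- d)))"
  unfolding flux_field_swap[of "plane_wave_E k d q"] flux_uminus far_field_flux[OF assms] by simp

text \<open>The first summand pairs two radiating fields and vanishes in the limit of large shells.\<close>

lemma flux_decomposition:
  assumes es: "radiating k R Es Hs" and e: "radiating k R E H" and k: "k \<noteq> 0" "Im k = 0" and d: "norm d = 1"
    and T: "0 < T" "R < T"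
  shows "flux (shell T) (flux_field (\<lambda>x. Es x + plane_wave_E k d q x) (\<lambda>x. Hs x + plane_wave_H k d q x) E H) =
     flux (shell T) (flux_field Es Hs E H) + flux (shell T) (flux_field (plane_wave_E k d q) (plane_wave_H k d q) E H)"
proof -
  have m: "maxwell_C1 k {x. norm x > R} Es Hs" "maxwell_C1 k {x. norm x > R} E H" using es e by (auto simp: radiating_def)
  have cp: "continuous_on {x. T \<le> norm x} (plane_wave_E k d q)" "continuous_on {x. T \<le> norm x} (plane_wave_H k d q)"
    using maxwell_continuous[OF plane_wave_explicit(3)[OF k(1) d], of q] by (auto intro: continuous_on_subset)
  note c = radiating_continuous[OF m(1) T(2)] radiating_continuous[OF m(2) T(2)] cp
  show ?thesis unfolding flux_field_add(1)
    by (intro flux_add shell_integrable[OF T(1)] continuous_on_flux_field c)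
qed

theorem lemma2p4:
  fixes \<alpha> :: real and M :: layered_medium
  assumes "0 < \<alpha>" "\<alpha> < 1"
    and "admissible_medium \<alpha> M"
    and "\<forall>d\<in>sphere 0 1. \<forall>q. uniquely_solvable M (plane_wave_data M d q)"
    and "\<forall>z\<in>\<Omega>\<^sub>0 M. \<forall>p. uniquely_solvable M (dipole_data_0 M z p)"
    and "\<forall>z\<in>\<Omega>\<^sub>1 M. \<forall>p. uniquely_solvable M (dipole_data_1 M z p)"
  shows "\<forall>d\<in>sphere 0 1. \<forall>p q. \<forall>Es Hs F G.
      bvp_solution M (plane_wave_data M d q) Es Hs F G \<longrightarrow>
      (\<forall>z\<^sub>0\<in>\<Omega>\<^sub>0 M. \<forall>E H F' G' Einf.
         bvp_solution M (dipole_data_0 M z\<^sub>0 p) E H F' G' \<and> far_field_pattern (k\<^sub>0 M) E Einf \<longrightarrow>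
         4 * of_real pi * (cvec q \<bullet>\<^sub>c Einf (- d)) = cvec p \<bullet>\<^sub>c Es z\<^sub>0) \<and>
      (\<forall>z\<^sub>1\<in>\<Omega>\<^sub>1 M. \<forall>E H F' G' Einf.
         bvp_solution M (dipole_data_1 M z\<^sub>1 p) E H F' G' \<and> far_field_pattern (k\<^sub>0 M) E Einf \<longrightarrow>
         4 * of_real pi * (cvec q \<bullet>\<^sub>c Einf (- d)) =
           lambda_E M * lambda_H M * (cvec p \<bullet>\<^sub>c F z\<^sub>1))"
proof (intro ballI allI impI conjI)
  note adm = assms(3)
  fix d :: "real^3" and p q Es Hs F G
  assume "d \<in> sphere 0 1" and pw: "bvp_solution M (plane_wave_data M d q) Es Hs F G"
  then have d: "norm d = 1" by simp
  let ?k = "k\<^sub>0 M"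
  note k = k0_real[OF adm]
  let ?C = "complex_of_real source_constant"
  have C: "?C \<noteq> 0" using source_constant_pos by simp
  let ?Ei = "plane_wave_E ?k d q" and ?Hi = "plane_wave_H ?k d q"
  let ?E1 = "\<lambda>x. Es x + ?Ei x" and ?H1 = "\<lambda>x. Hs x + ?Hi x"
  note pw' = bvp_solutionD[OF pw[unfolded plane_wave_data_def] adm]
  note t1 = plane_wave_total[OF adm d pw]
  obtain R where R: "R > 0" "{x. norm x > R} \<subseteq> \<Omega>\<^sub>0 M" using exterior_contains_far_points[OF adm] .
  have o: "open (\<Omega>\<^sub>0 M)" "open (\<Omega>\<^sub>1 M)" using adm by (auto simp: admissible_medium_def)
  have oR: "open {x::real^3. norm x > R'}" for R' by (simp add: open_Collect_less continuous_intros)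
  have es: "radiating ?k R Es Hs"
    unfolding radiating_def using maxwell_C1_subset[OF pw'(1) oR R(2)] pw'(3) by blast
  have m1: "maxwell_C1 ?k (\<Omega>\<^sub>0 M) ?E1 ?H1" "maxwell_C1 (k\<^sub>1 M) (\<Omega>\<^sub>1 M) F G"
    using t1 by (auto simp: total_fields_def)
  note pM = plane_wave_explicit(3)[OF k(1) d, of q]
  {
    fix z E H F' G' Einf
    assume z: "z \<in> \<Omega>\<^sub>0 M"
      and "bvp_solution M (dipole_data_0 M z p) E H F' G' \<and> far_field_pattern ?k E Einf"
    then have dp: "bvp_solution M (dipole_data_0 M z p) E H F' G'" and ff: "far_field_pattern ?k E Einf" by auto
    note dp' = bvp_solutionD[OF dp[unfolded dipole_data_0_def] adm]
    note t2 = dipole_total_0[OF adm z dp]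
    let ?Ed = "dipole_E ?k z p" and ?Hd = "dipole_H ?k z p"
    let ?E2 = "\<lambda>x. E x + ?Ed x" and ?H2 = "\<lambda>x. H x + ?Hd x"
    obtain r where r: "r > 0" "cball z r \<subseteq> \<Omega>\<^sub>0 M" using open_contains_cball o(1) z by blast
    define R' where "R' = max R (norm z + r)"
    have R': "R' > 0" "R \<le> R'" "norm z \<le> R'" using R(1) r(1) by (auto simp: R'_def)
    have es': "radiating ?k R' Es Hs" by (rule radiating_mono[OF es R'(2)])
    have e: "radiating ?k R' E H"
      by (rule radiating_mono[OF _ R'(2)]) (use maxwell_C1_subset[OF dp'(1) oR R(2)] dp'(3) in \<open>auto simp: radiating_def\<close>)
    have ed: "radiating ?k R' ?Ed ?Hd" by (rule dipole_radiating[OF k R'(3)])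
    have e2: "radiating ?k R' ?E2 ?H2" by (rule radiating_add[OF e ed])
    have val: "flux (shell T) (flux_field Es Hs ?E2 ?H2) = ?C * (cvec p \<bullet>\<^sub>c Es z) - ?C * (4 * of_real pi * (cvec q \<bullet>\<^sub>c Einf (- d)))"
      if T: "T > R'" for T
    proof -
      have T0: "0 < T" "R' < T" "norm z + r < T" using T R' by (auto simp: R'_def)
      have far: "{x. norm x \<ge> T} \<subseteq> \<Omega>\<^sub>0 M" using R(2) T R'(2) by force
      let ?V0 = "\<lambda>x. if x \<in> \<Omega>\<^sub>0 M then flux_field ?E1 ?H1 ?E2 ?H2 x
        else if x \<in> \<Omega>\<^sub>1 M then (lambda_E M * lambda_H M) *s flux_field F G F' G' x else 0"
      have "flux (shell T) (flux_field ?E1 ?H1 ?E2 ?H2) = flux (spike z r) (flux_field ?E1 ?H1 ?E2 ?H2)"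
        unfolding total_flux_relation[OF adm UnI1[OF z] t1 t2 far r(1) T0(3)]
      proof (rule flux_cong)
        fix x show "?V0 x = flux_field ?E1 ?H1 ?E2 ?H2 x \<or> (\<forall>j. spike z r j x = 0)"
          using r(2) spike_cutoff(4)[OF r(1), of x z] by (cases "x \<in> cball z r") auto
      qed
      also have "\<dots> = ?C * (cvec p \<bullet>\<^sub>c ?E1 z)"
        by (rule flux_spike_regular_part[OF m1(1) dp'(1) k(1) r])
      finally have a: "flux (shell T) (flux_field ?E1 ?H1 ?E2 ?H2) = ?C * (cvec p \<bullet>\<^sub>c ?E1 z)" .
      have b: "flux (shell T) (flux_field ?E1 ?H1 ?E2 ?H2) = flux (shell T) (flux_field Es Hs ?E2 ?H2) + flux (shell T) (flux_field ?Ei ?Hi ?E2 ?H2)"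
        by (rule flux_decomposition[OF es' e2 k d T0(1,2)])
      have i: "integrable lborel (\<lambda>x. \<Sum>i\<in>UNIV. shell T i x * flux_field ?Ei ?Hi A B x $ i)" if "radiating ?k R' A B" for A B
      proof -
        have "maxwell_C1 ?k {x. norm x > R'} A B" using that by (simp add: radiating_def)
        from radiating_continuous[OF this T0(2)] maxwell_continuous[OF pM] show ?thesis
          by (intro shell_integrable[OF T0(1)] continuous_on_flux_field) (auto intro: continuous_on_subset)
      qed
      have c: "flux (shell T) (flux_field ?Ei ?Hi ?E2 ?H2) = flux (shell T) (flux_field ?Ei ?Hi E H) + flux (shell T) (flux_field ?Ei ?Hi ?Ed ?Hd)"
        unfolding flux_field_add(2) by (rule flux_add[OF i[OF e] i[OF ed]])
      have f: "flux (shell T) (flux_field ?Ei ?Hi ?Ed ?Hd) = ?C * (cvec p \<bullet>\<^sub>c ?Ei z)"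
      proof -
        have "weak_div_free (- {z}) (flux_field ?Ei ?Hi ?Ed ?Hd)"
          by (rule flux_field_div_free[OF maxwell_C1_subset[OF pM] dipole_maxwell[OF k(1)]]) auto
        moreover have "continuous_on {x. T \<le> norm x} (flux_field ?Ei ?Hi ?Ed ?Hd)"
          using maxwell_continuous[OF pM] maxwell_continuous[OF dipole_maxwell[OF k(1)], of z p] T0 r
          by (intro continuous_on_flux_field) (auto elim!: continuous_on_subset)
        ultimately have "flux (shell T) (flux_field ?Ei ?Hi ?Ed ?Hd) = flux (spike z r) (flux_field ?Ei ?Hi ?Ed ?Hd)"
          by (rule shell_flux_eq_spike_flux[OF _ _ r(1) T0(3)])
        also have "\<dots> = ?C * (cvec p \<bullet>\<^sub>c ?Ei z)" by (rule source_flux_spike(1)[OF pM k(1) r(1)]) simp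
        finally show ?thesis .
      qed
      have g: "flux (shell T) (flux_field ?Ei ?Hi E H) = ?C * (4 * of_real pi * (cvec q \<bullet>\<^sub>c Einf (- d)))"
        by (rule far_flux_plane_wave[OF e k T0(1,2) ff d])
      have "cvec p \<bullet>\<^sub>c ?E1 z = cvec p \<bullet>\<^sub>c Es z + cvec p \<bullet>\<^sub>c ?Ei z" by (simp add: bilinear_dot_3 algebra_simps)
      then show ?thesis using a b c f g by (simp add: algebra_simps)
    qed
    have "((\<lambda>T. flux (shell T) (flux_field Es Hs ?E2 ?H2)) \<longlongrightarrow> 0) at_top"
      by (rule radiating_flux_vanishes[OF es' e2 k(2)])
    moreover have "((\<lambda>T. flux (shell T) (flux_field Es Hs ?E2 ?H2)) \<longlongrightarrow> ?C * (cvec p \<bullet>\<^sub>c Es z) - ?C * (4 * of_real pi * (cvec q \<bullet>\<^sub>c Einf (- d)))) at_top"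
      by (rule tendsto_eventually, rule eventually_mono[OF eventually_gt_at_top[of R']], rule val)
    ultimately have "?C * (cvec p \<bullet>\<^sub>c Es z) - ?C * (4 * of_real pi * (cvec q \<bullet>\<^sub>c Einf (- d))) = 0"
      by (rule tendsto_unique[OF trivial_limit_at_top_linorder, rotated])
    then show "4 * of_real pi * (cvec q \<bullet>\<^sub>c Einf (- d)) = cvec p \<bullet>\<^sub>c Es z"
      using C by (simp flip: right_diff_distrib)
  next
    fix z E H F' G' Einf
    assume z: "z \<in> \<Omega>\<^sub>1 M"
      and "bvp_solution M (dipole_data_1 M z p) E H F' G' \<and> far_field_pattern ?k E Einf"
    then have dp: "bvp_solution M (dipole_data_1 M z p) E H F' G'" and ff: "far_field_pattern ?k E Einf" by auto
    note dp' = bvp_solutionD[OF dp[unfolded dipole_data_1_def] adm]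
    note t2 = dipole_total_1[OF adm z dp]
    let ?l = "lambda_E M * lambda_H M"
    let ?F2 = "\<lambda>x. F' x + dipole_E (k\<^sub>1 M) z p x" and ?G2 = "\<lambda>x. G' x + dipole_H (k\<^sub>1 M) z p x"
    obtain r where r: "r > 0" "cball z r \<subseteq> \<Omega>\<^sub>1 M" using open_contains_cball o(2) z by blast
    define R' where "R' = max R (norm z + r)"
    have R': "R' > 0" "R \<le> R'" using R(1) by (auto simp: R'_def)
    have es': "radiating ?k R' Es Hs" by (rule radiating_mono[OF es R'(2)])
    have e: "radiating ?k R' E H"
      by (rule radiating_mono[OF _ R'(2)]) (use maxwell_C1_subset[OF dp'(1) oR R(2)] dp'(3) in \<open>auto simp: radiating_def\<close>)
    have val: "flux (shell T) (flux_field Es Hs E H) = ?l * (?C * (cvec p \<bullet>\<^sub>c F z)) - ?C * (4 * of_real pi * (cvec q \<bullet>\<^sub>c Einf (- d)))"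
      if T: "T > R'" for T
    proof -
      have T0: "0 < T" "R' < T" "norm z + r < T" using T R' by (auto simp: R'_def)
      have far: "{x. norm x \<ge> T} \<subseteq> \<Omega>\<^sub>0 M" using R(2) T R'(2) by force
      have dj: "\<Omega>\<^sub>0 M \<inter> \<Omega>\<^sub>1 M = {}" using adm by (simp add: admissible_medium_def)
      let ?V1 = "\<lambda>x. if x \<in> \<Omega>\<^sub>0 M then flux_field ?E1 ?H1 E H x
        else if x \<in> \<Omega>\<^sub>1 M then ?l *s flux_field F G ?F2 ?G2 x else 0"
      have "flux (shell T) (flux_field ?E1 ?H1 E H) = flux (spike z r) (\<lambda>x. ?l *s flux_field F G ?F2 ?G2 x)"
        unfolding total_flux_relation[OF adm UnI2[OF z] t1 t2 far r(1) T0(3)]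
      proof (rule flux_cong)
        fix x show "?V1 x = ?l *s flux_field F G ?F2 ?G2 x \<or> (\<forall>j. spike z r j x = 0)"
          using r(2) dj spike_cutoff(4)[OF r(1), of x z] by (cases "x \<in> cball z r") auto
      qed
      also have "\<dots> = ?l * (?C * (cvec p \<bullet>\<^sub>c F z))"
        unfolding flux_smult flux_spike_regular_part[OF m1(2) dp'(2) k1_nonzero[OF adm] r] ..
      finally show ?thesis
        unfolding flux_decomposition[OF es' e k d T0(1,2)] far_flux_plane_wave[OF e k T0(1,2) ff d]
        by (simp add: algebra_simps)
    qed
    have "((\<lambda>T. flux (shell T) (flux_field Es Hs E H)) \<longlongrightarrow> 0) at_top"
      by (rule radiating_flux_vanishes[OF es' e k(2)])
    moreover have "((\<lambda>T. flux (shell T) (flux_field Es Hs E H)) \<longlongrightarrow> ?l * (?C * (cvec p \<bullet>\<^sub>c F z)) - ?C * (4 * of_real pi * (cvec q \<bullet>\<^sub>c Einf (- d)))) at_top"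
      by (rule tendsto_eventually, rule eventually_mono[OF eventually_gt_at_top[of R']], rule val)
    ultimately have "?l * (?C * (cvec p \<bullet>\<^sub>c F z)) - ?C * (4 * of_real pi * (cvec q \<bullet>\<^sub>c Einf (- d))) = 0"
      by (rule tendsto_unique[OF trivial_limit_at_top_linorder, rotated])
    then have "?C * (?l * (cvec p \<bullet>\<^sub>c F z)) = ?C * (4 * of_real pi * (cvec q \<bullet>\<^sub>c Einf (- d)))"
      by (simp add: mult.left_commute)
    then show "4 * of_real pi * (cvec q \<bullet>\<^sub>c Einf (- d)) = lambda_E M * lambda_H M * (cvec p \<bullet>\<^sub>c F z)"
      using C by simp
  }
qed

end
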